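(* Let $h=h^*\in C^\infty(\mathbb{T}_\theta^4)$ and let $N(\lambda)$ be the number of eigenvalues (counted with multiplicity) of $\triangle_\varphi=\sum_{i=1}^4e^h\delta_ie^{-h}\delta_ie^h$ (acting in $\mathcal{H}_0$) that are $\le\lambda$. Then $$N(\lambda)\sim\frac{\pi^2\,\varphi_0(e^{-2h})}{2}\,\lambda^2\qquad(\lambda\to\infty).$$
   Context: Noncommutative 4-torus: $\theta$ a real skew-symmetric $4\times4$ matrix; $C(\mathbb{T}_\theta^4)$ the universal unital $C^*$-algebra generated by unitaries $U_1,\dots,U_4$ with $U_kU_l=e^{2\pi i\theta_{kl}}U_lU_k$; $C^\infty(\mathbb{T}_\theta^4)$ the $*$-subalgebra of $\sum_{\ell\in\mathbb{Z}^4}a_\ell U_1^{\ell_1}\cdots U_4^{\ell_4}$ with rapidly decreasing $(a_\ell)$; $\varphi_0$ the faithful tracial state $\varphi_0(\sum a_\ell U^\ell)=a_0$; $\delta_j$ the commuting derivations with $\delta_j(U_k)=\delta_{jk}U_k$; $\mathcal{H}_0$ the completion of $C(\mathbb{T}_\theta^4)$ for $(a,b)=\varphi_0(b^*a)$. Elements of the algebra act by left multiplication; $\triangle_\varphi$ denotes the closure of the operator on $C^\infty(\mathbb{T}_\theta^4)$, a nonnegative selfadjoint operator with compact resolvent (the conformally perturbed Laplacian). *)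

theory Defs
  imports "HOL-Analysis.Analysis" "HOL-Library.Landau_Symbols" "HOL-Library.Function_Algebras"
begin

text \<open>Concrete Fourier model of the noncommutative 4-torus.  Lattice points of Z^4 are
  functions nat to int supported on the indices 1..4.  An element sum a_m U_1^m1 ... U_4^m4
  is represented by its coefficient function a (vanishing off the lattice); H_0 is
  identified with l^2(Z^4) via the orthonormal basis U^m (GNS for the trace phi_0), and
  left multiplication becomes twisted convolution.\<close>

definition lat :: "(nat \<Rightarrow> int) set" where
  "lat = {m. \<forall>i. i \<notin> {1..4} \<longrightarrow> m i = 0}"

definition skew4 :: "(nat \<Rightarrow> nat \<Rightarrow> real) \<Rightarrow> bool" where
  "skew4 \<theta> \<longleftrightarrow> (\<forall>k\<in>{1..4}. \<forall>l\<in>{1..4}. \<theta> k l = - \<theta> l k)"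

text \<open>U^m U^n = phase m n U^(m+n).\<close>
definition phase :: "(nat \<Rightarrow> nat \<Rightarrow> real) \<Rightarrow> (nat \<Rightarrow> int) \<Rightarrow> (nat \<Rightarrow> int) \<Rightarrow> complex" where
  "phase \<theta> m n = cis (2 * pi * (\<Sum>k\<in>{1..4}. \<Sum>j\<in>{1..<k}. \<theta> k j * of_int (m k) * of_int (n j)))"

definition tmult :: "(nat \<Rightarrow> nat \<Rightarrow> real) \<Rightarrow> ((nat \<Rightarrow> int) \<Rightarrow> complex) \<Rightarrow> ((nat \<Rightarrow> int) \<Rightarrow> complex) \<Rightarrow> ((nat \<Rightarrow> int) \<Rightarrow> complex)" where
  "tmult \<theta> a b = (\<lambda>n. if n \<in> lat then infsum (\<lambda>m. a m * b (\<lambda>i. n i - m i) * phase \<theta> m (\<lambda>i. n i - m i)) lat else 0)"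

text \<open>(U^m)^* = cis(2 pi sum_{j<k} theta_kj m_k m_j) U^(-m).\<close>
definition tstar :: "(nat \<Rightarrow> nat \<Rightarrow> real) \<Rightarrow> ((nat \<Rightarrow> int) \<Rightarrow> complex) \<Rightarrow> ((nat \<Rightarrow> int) \<Rightarrow> complex)" where
  "tstar \<theta> a = (\<lambda>n. if n \<in> lat then cnj (a (\<lambda>i. - n i)) *
      cis (2 * pi * (\<Sum>k\<in>{1..4}. \<Sum>j\<in>{1..<k}. \<theta> k j * of_int (n k) * of_int (n j))) else 0)"

definition tunit :: "(nat \<Rightarrow> int) \<Rightarrow> complex" where
  "tunit = (\<lambda>n. if n = (\<lambda>i. 0) then 1 else 0)"

fun tpow :: "(nat \<Rightarrow> nat \<Rightarrow> real) \<Rightarrow> ((nat \<Rightarrow> int) \<Rightarrow> complex) \<Rightarrow> nat \<Rightarrow> ((nat \<Rightarrow> int) \<Rightarrow> complex)" where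
  "tpow \<theta> a 0 = tunit"
| "tpow \<theta> a (Suc k) = tmult \<theta> a (tpow \<theta> a k)"

text \<open>Exponential e^a = sum a^k/k!, computed coefficientwise (absolutely convergent in l^1
  for smooth a, hence agrees with the C*-algebraic exponential).\<close>
definition texp :: "(nat \<Rightarrow> nat \<Rightarrow> real) \<Rightarrow> ((nat \<Rightarrow> int) \<Rightarrow> complex) \<Rightarrow> ((nat \<Rightarrow> int) \<Rightarrow> complex)" where
  "texp \<theta> a = (\<lambda>n. \<Sum>k. tpow \<theta> a k n / of_nat (fact k))"

definition smooth :: "((nat \<Rightarrow> int) \<Rightarrow> complex) set" where
  "smooth = {a. (\<forall>m. m \<notin> lat \<longrightarrow> a m = 0) \<and>
     (\<forall>p::nat. \<exists>C. \<forall>m\<in>lat. (1 + real (\<Sum>i\<in>{1..4}. nat \<bar>m i\<bar>)) ^ p * cmod (a m) \<le> C)}"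

definition phi0 :: "((nat \<Rightarrow> int) \<Rightarrow> complex) \<Rightarrow> complex" where
  "phi0 a = a (\<lambda>i. 0)"

definition delta :: "nat \<Rightarrow> ((nat \<Rightarrow> int) \<Rightarrow> complex) \<Rightarrow> ((nat \<Rightarrow> int) \<Rightarrow> complex)" where
  "delta j a = (\<lambda>m. of_int (m j) * a m)"

definition lap :: "(nat \<Rightarrow> nat \<Rightarrow> real) \<Rightarrow> ((nat \<Rightarrow> int) \<Rightarrow> complex) \<Rightarrow> ((nat \<Rightarrow> int) \<Rightarrow> complex) \<Rightarrow> ((nat \<Rightarrow> int) \<Rightarrow> complex)" where
  "lap \<theta> h x = (\<lambda>m. \<Sum>i\<in>{1..4}.
     tmult \<theta> (texp \<theta> h) (delta i (tmult \<theta> (texp \<theta> (\<lambda>n. - h n)) (delta i (tmult \<theta> (texp \<theta> h) x)))) m)"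

definition H0 :: "((nat \<Rightarrow> int) \<Rightarrow> complex) set" where
  "H0 = {x. (\<forall>m. m \<notin> lat \<longrightarrow> x m = 0) \<and> (\<lambda>m. (cmod (x m))\<^sup>2) summable_on lat}"

definition l2dist2 :: "((nat \<Rightarrow> int) \<Rightarrow> complex) \<Rightarrow> ((nat \<Rightarrow> int) \<Rightarrow> complex) \<Rightarrow> real" where
  "l2dist2 x y = infsum (\<lambda>m. (cmod (x m - y m))\<^sup>2) lat"

definition lap_closure :: "(nat \<Rightarrow> nat \<Rightarrow> real) \<Rightarrow> ((nat \<Rightarrow> int) \<Rightarrow> complex) \<Rightarrow>
    (((nat \<Rightarrow> int) \<Rightarrow> complex) \<times> ((nat \<Rightarrow> int) \<Rightarrow> complex)) set" where
  "lap_closure \<theta> h = {(x, y). x \<in> H0 \<and> y \<in> H0 \<and>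
     (\<exists>s. (\<forall>n. s n \<in> smooth) \<and> (\<lambda>n. l2dist2 (s n) x) \<longlonglongrightarrow> 0
          \<and> (\<lambda>n. l2dist2 (lap \<theta> h (s n)) y) \<longlonglongrightarrow> 0)}"

definition eigvecs_le :: "(nat \<Rightarrow> nat \<Rightarrow> real) \<Rightarrow> ((nat \<Rightarrow> int) \<Rightarrow> complex) \<Rightarrow> real \<Rightarrow>
    ((nat \<Rightarrow> int) \<Rightarrow> complex) set" where
  "eigvecs_le \<theta> h lam = {x. \<exists>\<mu>::real. \<mu> \<le> lam \<and> (x, (\<lambda>m. complex_of_real \<mu> * x m)) \<in> lap_closure \<theta> h}"

text \<open>N(lam): number of eigenvalues <= lam counted with multiplicity = complex dimension of
  the span of all eigenspaces with eigenvalue <= lam.\<close>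
definition Ncount :: "(nat \<Rightarrow> nat \<Rightarrow> real) \<Rightarrow> ((nat \<Rightarrow> int) \<Rightarrow> complex) \<Rightarrow> real \<Rightarrow> nat" where
  "Ncount \<theta> h lam = vector_space.dim (\<lambda>(c::complex) x. (\<lambda>m. c * x m)) (eigvecs_le \<theta> h lam)"

end

theory Submission
  imports Defs "HOL-Computational_Algebra.Fundamental_Theorem_Algebra"
begin

text \<open>Write \<open>k = e\<^sup>h\<close>, \<open>X\<close> for left multiplication by \<open>k\<close>, \<open>\<bar>n\<bar>\<close> for the Euclidean norm
  on the lattice and \<open>\<Lambda>\<close> for multiplication by \<open>\<bar>n\<bar>\<close>.  Since commutators of left multiplications with
  Lipschitz functions of \<open>n\<close> are bounded, the form of the Laplacian \<open>P\<close> is that of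
  \<open>\<Lambda> X \<Lambda>\<close> up to first order terms.  Instead of resolvent or heat expansions, the proof estimates the
  Riesz mean \<open>S(\<lambda>) = \<Sum>(\<lambda> - \<mu>)\<close> over the eigenvalues \<open>\<mu> \<le> \<lambda>\<close>.  A partition of unity
  cuts the lattice into finitely many thin shells \<open>\<bar>n\<bar> \<approx> r \<surd>\<lambda>\<close>; on each of them \<open>P\<close> is close to
  \<open>\<lambda> r\<^sup>2 X\<close>, and the variational upper and lower bounds for \<open>S(\<lambda>)\<close> reduce to traces of
  \<open>\<chi> g(X) \<chi>\<close> with \<open>g\<close> a polynomial approximating \<open>s \<mapsto> (1 - r\<^sup>2 s)\<^sub>+\<close>.  Right
  translations commute with \<open>X\<close>, so such a trace is the number of lattice points in the shell times the
  vacuum expectation of \<open>g(X)\<close>.  Summing over the shells and counting lattice points gives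
  \<open>S(\<lambda>) \<sim> \<pi>\<^sup>2/6 \<phi>\<^sub>0(e\<^sup>-\<^sup>2\<^sup>h) \<lambda>\<^sup>3\<close>, and comparing \<open>S\<close>
  at \<open>\<lambda>\<close> and \<open>(1 \<plusminus> d) \<lambda>\<close> yields the counting function.\<close>

section \<open>The Hilbert space and its operators\<close>

text \<open>The leading symbol \<open>|n|^2 X\<close> is operator valued and does not commute with
  functions of \<open>n\<close>. Cutoffs at scale \<open>sqrt lam\<close> have Lipschitz constant of
  order \<open>1 / sqrt lam\<close>, hence commutators with \<open>X\<close> of that size, so inside
  a shell cutoff and \<open>X\<close> may be interchanged at vanishing relative cost. The positive
  part of \<open>1 - r^2 s\<close> is continuous in \<open>s\<close>, unlike the step function
  behind an eigenvalue count. It is therefore a uniform limit of polynomials on the spectral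
  interval of \<open>X\<close>, and positivity of polynomials in \<open>X\<close> is all of the
  spectral theorem that is required. The Riesz mean is also a maximum over trial operators between 0
  and 1, which is what makes upper and lower bounds accessible. The exponent -2 is a matter of
  scaling: for a scalar value \<open>s\<close> of \<open>X\<close> the lattice sum of the positive
  parts of \<open>1 - |n|^2 s / lam\<close> is about \<open>pi^2/6 (lam/s)^2\<close>, and
  \<open>s^-2\<close> becomes \<open>e^(-2h)\<close>. Here \<open>pi^2/6\<close> is a third of the
  volume \<open>pi^2/2\<close> of the unit ball in dimension 4; differentiating \<open>lam^3\<close>
  restores the factor 3.\<close>

typedef hil = H0 morphisms co Hil
proof
  show "(\<lambda>_. 0) \<in> H0" by (simp add: H0_def)
qed

lemma co_off: "n \<notin> lat \<Longrightarrow> co x n = 0"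
  using co[of x] by (auto simp: H0_def)

lemma co_sq_summable: "(\<lambda>n. (cmod (co x n))\<^sup>2) summable_on lat"
  using co[of x] by (auto simp: H0_def)

lemma hil_eqI: "(\<And>n. n \<in> lat \<Longrightarrow> co x n = co y n) \<Longrightarrow> x = y"
  by (metis co_inject co_off ext)

lemma H0_boundedI:
  assumes "\<And>n. n \<notin> lat \<Longrightarrow> f n = 0"
    and "\<And>F. finite F \<Longrightarrow> F \<subseteq> lat \<Longrightarrow> (\<Sum>n\<in>F. (cmod (f n))\<^sup>2) \<le> B"
  shows "f \<in> H0"
proof -
  have "(\<lambda>n. (cmod (f n))\<^sup>2) summable_on lat"
    by (rule nonneg_bdd_above_summable_on) (use assms(2) in \<open>auto simp: bdd_above_def\<close>)
  thus ?thesis using assms(1) by (auto simp: H0_def)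
qed

lemma H0_comparison:
  assumes "g \<in> H0" "\<And>n. n \<notin> lat \<Longrightarrow> f n = 0" "\<And>n. n \<in> lat \<Longrightarrow> cmod (f n) \<le> C * cmod (g n)"
  shows "f \<in> H0"
proof (rule H0_boundedI)
  fix F assume F: "finite F" "F \<subseteq> lat"
  have "(\<Sum>n\<in>F. (cmod (f n))\<^sup>2) \<le> (\<Sum>n\<in>F. C\<^sup>2 * (cmod (g n))\<^sup>2)"
    using assms(3) F by (intro sum_mono) (metis norm_ge_zero power_mono power_mult_distrib subsetD)
  also have "\<dots> = C\<^sup>2 * (\<Sum>n\<in>F. (cmod (g n))\<^sup>2)" by (simp add: sum_distrib_left)
  also have "\<dots> \<le> C\<^sup>2 * infsum (\<lambda>n. (cmod (g n))\<^sup>2) lat"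
    using assms(1) F by (intro mult_left_mono finite_sum_le_infsum) (auto simp: H0_def)
  finally show "(\<Sum>n\<in>F. (cmod (f n))\<^sup>2) \<le> C\<^sup>2 * infsum (\<lambda>n. (cmod (g n))\<^sup>2) lat" .
qed (use assms in auto)

lemma H0_add:
  assumes "f \<in> H0" "g \<in> H0"
  shows "(\<lambda>n. f n + g n) \<in> H0"
proof -
  have "(\<lambda>n. 2 * (cmod (f n))\<^sup>2 + 2 * (cmod (g n))\<^sup>2) summable_on lat"
    using assms by (intro summable_on_add summable_on_cmult_right) (auto simp: H0_def)
  moreover have "(cmod (f n + g n))\<^sup>2 \<le> 2 * (cmod (f n))\<^sup>2 + 2 * (cmod (g n))\<^sup>2" for n
  proof -
    have "(cmod (f n + g n))\<^sup>2 \<le> (cmod (f n) + cmod (g n))\<^sup>2"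
      by (intro power_mono norm_triangle_ineq) auto
    also have "\<dots> \<le> 2 * (cmod (f n))\<^sup>2 + 2 * (cmod (g n))\<^sup>2"
      using zero_le_power2[of "cmod (f n) - cmod (g n)"] by (simp add: power2_eq_square algebra_simps)
    finally show ?thesis .
  qed
  ultimately have "(\<lambda>n. (cmod (f n + g n))\<^sup>2) summable_on lat"
    by (rule summable_on_comparison_test) auto
  thus ?thesis using assms by (auto simp: H0_def)
qed

lemma H0_scale: "f \<in> H0 \<Longrightarrow> (\<lambda>n. c * f n) \<in> H0"
  by (rule H0_comparison[where C = "cmod c"]) (auto simp: norm_mult H0_def)

lemma l2_product_summable:
  fixes f g :: "'a \<Rightarrow> complex"
  assumes "(\<lambda>n. (cmod (f n))\<^sup>2) summable_on A" "(\<lambda>n. (cmod (g n))\<^sup>2) summable_on A"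
  shows "(\<lambda>n. f n * g n) summable_on A" "(\<lambda>n. norm (f n * g n)) summable_on A"
proof -
  have "(\<lambda>n. (cmod (f n))\<^sup>2 + (cmod (g n))\<^sup>2) summable_on A"
    using assms by (rule summable_on_add)
  moreover have "norm (f n * g n) \<le> (cmod (f n))\<^sup>2 + (cmod (g n))\<^sup>2" for n
  proof -
    have "2 * (cmod (f n) * cmod (g n)) \<le> (cmod (f n))\<^sup>2 + (cmod (g n))\<^sup>2"
      using zero_le_power2[of "cmod (f n) - cmod (g n)"] by (simp add: power2_eq_square algebra_simps)
    moreover have "0 \<le> cmod (f n) * cmod (g n)" by simp
    ultimately show ?thesis unfolding norm_mult by linarith
  qed
  ultimately show *: "(\<lambda>n. norm (f n * g n)) summable_on A"
    by (rule summable_on_comparison_test) auto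
  show "(\<lambda>n. f n * g n) summable_on A" by (rule abs_summable_summable[OF *])
qed

definition cip :: "hil \<Rightarrow> hil \<Rightarrow> complex" where
  "cip x y = infsum (\<lambda>n. co x n * cnj (co y n)) lat"

lemma cip_summable: "(\<lambda>n. co x n * cnj (co y n)) summable_on lat"
  by (rule l2_product_summable) (auto simp: co_sq_summable)

instantiation hil :: real_vector
begin
definition "0 = Hil (\<lambda>_. 0)"
definition "x + y = Hil (\<lambda>n. co x n + co y n)"
definition "x - y = Hil (\<lambda>n. co x n - co y n)"
definition "- x = Hil (\<lambda>n. - co x n)"
definition "scaleR r x = Hil (\<lambda>n. of_real r * co x n)"

lemma co_zero [simp]: "co 0 n = 0"
  unfolding zero_hil_def by (subst Hil_inverse) (auto simp: H0_def)
lemma co_add [simp]: "co (x + y) n = co x n + co y n"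
  unfolding plus_hil_def by (subst Hil_inverse) (auto intro: H0_add co)
lemma co_minus [simp]: "co (- x) n = - co x n"
  unfolding uminus_hil_def using H0_scale[OF co, of "-1" x] by (subst Hil_inverse) auto
lemma co_diff [simp]: "co (x - y) n = co x n - co y n"
  unfolding minus_hil_def using H0_add[OF co[of x] H0_scale[OF co, of "-1" y]]
  by (subst Hil_inverse) auto
lemma co_scaleR [simp]: "co (scaleR r x) n = of_real r * co x n"
  unfolding scaleR_hil_def by (subst Hil_inverse) (auto intro: H0_scale co)
instance by standard (auto intro!: hil_eqI simp: algebra_simps)
end

text \<open>The class \<open>real_inner\<close> only provides real scalars; \<open>cs\<close> is the complex scalar multiplication.\<close>

definition cs :: "complex \<Rightarrow> hil \<Rightarrow> hil" where "cs c x = Hil (\<lambda>n. c * co x n)"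

lemma co_cs [simp]: "co (cs c x) n = c * co x n"
  unfolding cs_def by (subst Hil_inverse) (auto intro: H0_scale co)

lemma cip_add_left: "cip (x + y) z = cip x z + cip y z"
  unfolding cip_def by (simp add: distrib_right infsum_add cip_summable)
lemma cip_cs_left: "cip (cs c x) y = c * cip x y"
  unfolding cip_def by (simp add: mult.assoc infsum_cmult_right')
lemma cip_cnj: "cnj (cip x y) = cip y x"
  unfolding cip_def by (simp flip: infsum_cnj add: mult.commute)
lemma cip_add_right: "cip x (y + z) = cip x y + cip x z"
  by (metis cip_add_left cip_cnj complex_cnj_add)
lemma cip_cs_right: "cip x (cs c y) = cnj c * cip x y"
  by (metis cip_cs_left cip_cnj complex_cnj_mult)
lemma scaleR_cs: "scaleR r x = cs (of_real r) x"
  by (rule hil_eqI) simp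
lemma minus_cs: "- x = cs (-1) x"
  by (rule hil_eqI) simp
lemma cip_scaleR_left: "cip (scaleR r x) y = of_real r * cip x y"
  by (simp add: scaleR_cs cip_cs_left)
lemma cip_scaleR_right: "cip x (scaleR r y) = of_real r * cip x y"
  by (simp add: scaleR_cs cip_cs_right)
lemma cip_minus_left: "cip (- x) y = - cip x y"
  by (simp add: minus_cs cip_cs_left)
lemma cip_minus_right: "cip x (- y) = - cip x y"
  by (simp add: minus_cs cip_cs_right)
lemma cip_diff_left: "cip (x - y) z = cip x z - cip y z"
  using cip_add_left[of x "- y" z] by (simp add: cip_minus_left)
lemma cip_diff_right: "cip x (y - z) = cip x y - cip x z"
  using cip_add_right[of x y "- z"] by (simp add: cip_minus_right)
lemma cip_zero [simp]: "cip 0 x = 0" "cip x 0 = 0"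
  by (simp_all add: cip_def)

lemma cip_self: "cip x x = of_real (infsum (\<lambda>n. (cmod (co x n))\<^sup>2) lat)"
proof -
  have "((\<lambda>n. complex_of_real ((cmod (co x n))\<^sup>2)) has_sum of_real (infsum (\<lambda>n. (cmod (co x n))\<^sup>2) lat)) lat"
    by (intro has_sum_of_real has_sum_infsum co_sq_summable)
  thus ?thesis unfolding cip_def complex_norm_square[symmetric] by (rule infsumI)
qed

instantiation hil :: real_inner
begin
text \<open>The real part of \<open>cip\<close> induces the same norm, so topology, Cauchy-Schwarz
  and bounded linear maps come from the type classes, while orthogonality and adjoints are expressed
  with the complex \<open>cip\<close>.\<close>

definition "inner x y = Re (cip x y)"
definition "norm x = sqrt (inner x x)" for x :: hil
definition "dist x y = norm (x - y)" for x y :: hil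
definition "sgn x = x /\<^sub>R norm x" for x :: hil
definition "uniformity = (INF e\<in>{0<..}. principal {(x::hil, y). dist x y < e})"
definition "open U = (\<forall>x\<in>U. eventually (\<lambda>(x', y). x' = x \<longrightarrow> y \<in> U) (uniformity :: (hil \<times> hil) filter))"

lemma inner_self_hil: "inner x x = infsum (\<lambda>n. (cmod (co x n))\<^sup>2) lat" for x :: hil
  unfolding inner_hil_def cip_self by simp

instance
proof
  fix x y z :: hil and r :: real
  show "inner x y = inner y x"
    unfolding inner_hil_def by (metis cip_cnj complex_cnj(1) complex.sel(1) cnj.sel(1))
  show "inner (x + y) z = inner x z + inner y z"
    by (simp add: inner_hil_def cip_add_left)
  show "inner (scaleR r x) y = r * inner x y"
    by (simp add: inner_hil_def cip_scaleR_left)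
  show "0 \<le> inner x x" unfolding inner_self_hil by (intro infsum_nonneg) auto
  show "(inner x x = 0) = (x = 0)"
  proof
    assume *: "inner x x = 0"
    show "x = 0"
    proof (rule hil_eqI)
      fix n assume n: "n \<in> lat"
      have "(cmod (co x n))\<^sup>2 = 0"
        using nonneg_infsum_le_0D[of "\<lambda>n. (cmod (co x n))\<^sup>2" lat, OF _ co_sq_summable _ n] * inner_self_hil
        by simp
      thus "co x n = co 0 n" by simp
    qed
  qed (simp add: inner_self_hil)
qed (fact norm_hil_def dist_hil_def sgn_hil_def uniformity_hil_def open_hil_def)+
end

lemma norm_sq_hil: "(norm x)\<^sup>2 = infsum (\<lambda>n. (cmod (co x n))\<^sup>2) lat" for x :: hil
  by (metis inner_self_hil power2_norm_eq_inner)

lemma norm_sq_has_sum: "((\<lambda>n. (cmod (co x n))\<^sup>2) has_sum (norm x)\<^sup>2) lat" for x :: hil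
  unfolding norm_sq_hil by (rule has_sum_infsum[OF co_sq_summable])

lemma cip_self_norm: "cip x x = of_real ((norm x)\<^sup>2)"
  unfolding cip_self norm_sq_hil ..

lemma finite_sum_le_norm:
  assumes "finite F"
  shows "(\<Sum>n\<in>F. (cmod (co x n))\<^sup>2) \<le> (norm x)\<^sup>2"
proof -
  have "(\<Sum>n\<in>F. (cmod (co x n))\<^sup>2) = (\<Sum>n\<in>F \<inter> lat. (cmod (co x n))\<^sup>2)"
    using assms by (intro sum.mono_neutral_right) (auto simp: co_off)
  also have "\<dots> \<le> (norm x)\<^sup>2" unfolding norm_sq_hil
    using assms by (intro finite_sum_le_infsum co_sq_summable) auto
  finally show ?thesis .
qed

lemma norm_boundI:
  fixes x :: hil
  assumes "\<And>F. finite F \<Longrightarrow> F \<subseteq> lat \<Longrightarrow> (\<Sum>n\<in>F. (cmod (co x n))\<^sup>2) \<le> B\<^sup>2" "B \<ge> 0"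
  shows "norm x \<le> B"
proof -
  have "(norm x)\<^sup>2 \<le> B\<^sup>2" unfolding norm_sq_hil
    using assms by (intro infsum_le_finite_sums co_sq_summable) auto
  thus ?thesis using assms(2) power2_le_imp_le by blast
qed

lemma norm_comparison:
  fixes x y :: hil
  assumes "\<And>n. n \<in> lat \<Longrightarrow> cmod (co x n) \<le> C * cmod (co y n)" "C \<ge> 0"
  shows "norm x \<le> C * norm y"
proof (rule norm_boundI)
  fix F assume F: "finite F" "F \<subseteq> lat"
  have "(\<Sum>n\<in>F. (cmod (co x n))\<^sup>2) \<le> (\<Sum>n\<in>F. C\<^sup>2 * (cmod (co y n))\<^sup>2)"
    using assms F by (intro sum_mono) (metis norm_ge_zero power_mono power_mult_distrib subsetD)
  also have "\<dots> \<le> C\<^sup>2 * (norm y)\<^sup>2"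
    unfolding sum_distrib_left[symmetric] by (intro mult_left_mono finite_sum_le_norm F) auto
  finally show "(\<Sum>n\<in>F. (cmod (co x n))\<^sup>2) \<le> (C * norm y)\<^sup>2" by (simp add: power_mult_distrib)
qed (use assms in auto)

lemma cmod_co_le: "cmod (co x n) \<le> norm x"
  using finite_sum_le_norm[of "{n}" x] power2_le_imp_le[of "cmod (co x n)" "norm x"] by auto

lemma norm_cs [simp]: "norm (cs c x) = cmod c * norm x"
proof -
  have "(norm (cs c x))\<^sup>2 = (cmod c * norm x)\<^sup>2"
    by (simp add: norm_sq_hil norm_mult power_mult_distrib infsum_cmult_right')
  thus ?thesis by (simp add: power2_eq_iff_nonneg)
qed

lemma cs_add: "cs c (x + y) = cs c x + cs c y" by (rule hil_eqI) (simp add: algebra_simps)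
lemma cs_diff: "cs c (x - y) = cs c x - cs c y" by (rule hil_eqI) (simp add: algebra_simps)
lemma cs_add_left: "cs (c + d) x = cs c x + cs d x" by (rule hil_eqI) (simp add: algebra_simps)
lemma cs_cs [simp]: "cs c (cs d x) = cs (c * d) x" by (rule hil_eqI) (simp add: algebra_simps)
lemma cs_one [simp]: "cs 1 x = x" by (rule hil_eqI) simp
lemma cs_zero [simp]: "cs 0 x = 0" "cs c 0 = 0" by (rule hil_eqI, simp)+
lemma bounded_linear_cs: "bounded_linear (cs c)"
  by (rule bounded_linear_intro[where K = "cmod c"])
     (auto simp: cs_add intro!: hil_eqI)
lemma co_sum: "co (\<Sum>i\<in>A. f i) n = (\<Sum>i\<in>A. co (f i) n)"
  by (induction A rule: infinite_finite_induct) auto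
lemma cs_sum: "cs c (\<Sum>i\<in>A. f i) = (\<Sum>i\<in>A. cs c (f i))"
  by (rule hil_eqI) (simp add: co_sum sum_distrib_left)
lemma bounded_linear_co: "bounded_linear (\<lambda>x. co x n)"
  by (rule bounded_linear_intro[where K = 1]) (auto simp: cmod_co_le scaleR_conv_of_real)

text \<open>A unimodular factor on \<open>x\<close> makes the product real and nonnegative, after
  which the real Cauchy-Schwarz inequality applies.\<close>

lemma cmod_cip_le: "cmod (cip x y) \<le> norm x * norm y"
proof (cases "cip x y = 0")
  case False
  define c where "c = cnj (sgn (cip x y))"
  have 1: "cmod c = 1" using False by (simp add: c_def norm_sgn)
  have "cip (cs c x) y = of_real (cmod (cip x y))"
    using False by (simp add: cip_cs_left c_def sgn_eq complex_norm_square[symmetric] field_simps power2_eq_square)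
  hence "cmod (cip x y) = inner (cs c x) y" by (simp add: inner_hil_def)
  also have "\<dots> \<le> norm (cs c x) * norm y" by (rule norm_cauchy_schwarz)
  finally show ?thesis using 1 by simp
qed auto

lemma bounded_linear_cip_left: "bounded_linear (\<lambda>x. cip x y)"
  by (rule bounded_linear_intro[where K = "norm y"])
     (auto simp: cip_add_left cip_scaleR_left scaleR_conv_of_real cmod_cip_le)
lemma bounded_linear_cip_right: "bounded_linear (\<lambda>y. cip x y)"
  by (rule bounded_linear_intro[where K = "norm x"])
     (simp_all add: cip_add_right cip_scaleR_right scaleR_conv_of_real, metis cmod_cip_le mult.commute)

lemma cip_sum_left: "cip (\<Sum>i\<in>A. f i) y = (\<Sum>i\<in>A. cip (f i) y)"
  by (induction A rule: infinite_finite_induct) (auto simp: cip_add_left)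
lemma cip_sum_right: "cip y (\<Sum>i\<in>A. f i) = (\<Sum>i\<in>A. cip y (f i))"
  by (induction A rule: infinite_finite_induct) (auto simp: cip_add_right)

text \<open>The limit is taken coordinatewise. Norm bounds are tested on finite sets of coordinates,
  where they survive the limit.\<close>

instance hil :: complete_space
proof
  fix X :: "nat \<Rightarrow> hil"
  assume C: "Cauchy X"
  have "Cauchy (\<lambda>k. co (X k) n)" for n
    by (rule bounded_linear.Cauchy[OF bounded_linear_co C])
  hence "\<exists>l. (\<lambda>k. co (X k) n) \<longlonglongrightarrow> l" for n
    using Cauchy_convergent_iff convergent_def by blast
  then obtain L where L: "\<And>n. (\<lambda>k. co (X k) n) \<longlonglongrightarrow> L n" by metis
  have L0: "L n = 0" if "n \<notin> lat" for n
    using L[of n] that by (simp add: co_off LIMSEQ_const_iff)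
  obtain B where B: "\<And>k. norm (X k) \<le> B"
    using Cauchy_Bseq[OF C] by (auto simp: Bseq_def)
  have "L \<in> H0"
  proof (rule H0_boundedI[OF L0])
    fix F :: "(nat \<Rightarrow> int) set" assume F: "finite F" "F \<subseteq> lat"
    have lim: "(\<lambda>k. \<Sum>n\<in>F. (cmod (co (X k) n))\<^sup>2) \<longlonglongrightarrow> (\<Sum>n\<in>F. (cmod (L n))\<^sup>2)"
      by (intro tendsto_intros L)
    show "(\<Sum>n\<in>F. (cmod (L n))\<^sup>2) \<le> B\<^sup>2"
    proof (rule LIMSEQ_le_const2[OF lim], intro exI allI impI)
      fix k :: nat
      have "(\<Sum>n\<in>F. (cmod (co (X k) n))\<^sup>2) \<le> (norm (X k))\<^sup>2" by (rule finite_sum_le_norm[OF F(1)])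
      also have "\<dots> \<le> B\<^sup>2" by (intro power_mono B) auto
      finally show "(\<Sum>n\<in>F. (cmod (co (X k) n))\<^sup>2) \<le> B\<^sup>2" .
    qed
  qed auto
  hence co_L: "co (Hil L) = L" by (rule Hil_inverse)
  have "X \<longlonglongrightarrow> Hil L"
  proof (rule LIMSEQ_I)
    fix e :: real assume e: "e > 0"
    obtain N where N: "\<And>k l. k \<ge> N \<Longrightarrow> l \<ge> N \<Longrightarrow> norm (X k - X l) < e / 2"
      using CauchyD[OF C, of "e/2"] e by auto
    have "norm (X k - Hil L) \<le> e / 2" if k: "k \<ge> N" for k
    proof (rule norm_boundI)
      fix F :: "(nat \<Rightarrow> int) set" assume F: "finite F" "F \<subseteq> lat"
      have lim: "(\<lambda>l. \<Sum>n\<in>F. (cmod (co (X k) n - co (X l) n))\<^sup>2) \<longlonglongrightarrow> (\<Sum>n\<in>F. (cmod (co (X k) n - L n))\<^sup>2)"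
        by (intro tendsto_intros L)
      have "(\<Sum>n\<in>F. (cmod (co (X k) n - L n))\<^sup>2) \<le> (e/2)\<^sup>2"
      proof (rule LIMSEQ_le_const2[OF lim], intro exI allI impI)
        fix l assume l: "N \<le> l"
        have "(\<Sum>n\<in>F. (cmod (co (X k - X l) n))\<^sup>2) \<le> (norm (X k - X l))\<^sup>2"
          by (rule finite_sum_le_norm[OF F(1)])
        also have "\<dots> \<le> (e/2)\<^sup>2" using N[OF k l] by (intro power_mono) auto
        finally show "(\<Sum>n\<in>F. (cmod (co (X k) n - co (X l) n))\<^sup>2) \<le> (e/2)\<^sup>2" by simp
      qed
      thus "(\<Sum>n\<in>F. (cmod (co (X k - Hil L) n))\<^sup>2) \<le> (e/2)\<^sup>2" by (simp add: co_L)
    qed (use e in auto)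
    thus "\<exists>N. \<forall>k\<ge>N. norm (X k - Hil L) < e" using e by (intro exI[of _ N]) force
  qed
  thus "convergent X" by (auto simp: convergent_def)
qed

instance hil :: banach ..

section \<open>Euclidean length on the lattice and multiplication operators\<close>

definition nn :: "(nat \<Rightarrow> int) \<Rightarrow> real" where
  "nn n = L2_set (\<lambda>i. of_int (n i)) {1..4}"

lemma nn_ge0 [simp]: "nn n \<ge> 0" by (simp add: nn_def)
lemma nn_sq: "(nn n)\<^sup>2 = (\<Sum>i\<in>{1..4}. (of_int (n i))\<^sup>2)"
  unfolding nn_def L2_set_def by (simp add: sum_nonneg)
lemma nn_triangle: "nn (\<lambda>i. m i + n i) \<le> nn m + nn n"
  unfolding nn_def using L2_set_triangle_ineq[of "\<lambda>i. of_int (m i)" "\<lambda>i. of_int (n i)" "{1..4}"] by simp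
lemma nn_coord: "i \<in> {1..4} \<Longrightarrow> \<bar>of_int (n i)\<bar> \<le> nn n"
  unfolding nn_def using member_le_L2_set[of "{1..4}" i "\<lambda>i. \<bar>of_int (n i)\<bar>"] by (auto simp: L2_set_def)

lemma finite_nn_ball: "finite {n \<in> lat. nn n \<le> r}"
proof -
  let ?B = "{-\<lceil>r\<rceil>..\<lceil>r\<rceil>}"
  have "{n \<in> lat. nn n \<le> r} \<subseteq> (\<lambda>f i. if i \<in> {1..4} then f i else 0) ` (PiE {1..4} (\<lambda>_. ?B))"
  proof
    fix n assume n: "n \<in> {n \<in> lat. nn n \<le> r}"
    have "n i \<in> ?B" if "i \<in> {1..4}" for i
    proof -
      have "\<bar>of_int (n i)\<bar> \<le> r" using nn_coord[OF that, of n] n by auto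
      hence "of_int \<bar>n i\<bar> \<le> (of_int \<lceil>r\<rceil> :: real)" using le_of_int_ceiling[of r] by linarith
      thus ?thesis unfolding of_int_le_iff by auto
    qed
    hence "restrict n {1..4} \<in> PiE {1..4} (\<lambda>_. ?B)" by auto
    moreover have "n = (\<lambda>i. if i \<in> {1..4} then restrict n {1..4} i else 0)"
      using n by (auto simp: lat_def fun_eq_iff)
    ultimately show "n \<in> (\<lambda>f i. if i \<in> {1..4} then f i else 0) ` (PiE {1..4} (\<lambda>_. ?B))" by blast
  qed
  moreover have "finite (PiE {1..4::nat} (\<lambda>_. ?B))" by (intro finite_PiE) auto
  ultimately show ?thesis by (meson finite_imageI finite_subset)
qed

definition mdom :: "((nat \<Rightarrow> int) \<Rightarrow> real) \<Rightarrow> hil set" where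
  "mdom g = {x. (\<lambda>n. of_real (g n) * co x n) \<in> H0}"

text \<open>Off \<open>mdom g\<close> the value is an unspecified vector, because \<open>Hil\<close>
  is then applied outside \<open>H0\<close>; this is the origin of the domain hypotheses in the
  rules for \<open>mlt\<close>.\<close>

definition mlt :: "((nat \<Rightarrow> int) \<Rightarrow> real) \<Rightarrow> hil \<Rightarrow> hil" where
  "mlt g x = Hil (\<lambda>n. of_real (g n) * co x n)"

lemma co_mlt: "x \<in> mdom g \<Longrightarrow> co (mlt g x) n = of_real (g n) * co x n"
  by (simp add: mlt_def mdom_def Hil_inverse)

text \<open>The summand 1 next to \<open>\<bar>g n\<bar>\<close> admits multipliers of lower order
  and bounded ones. The dominating sequence is \<open>cmod (co x n) + cmod (g n * co x n)\<close>,
  whose summands are square summable separately.\<close>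

lemma mdom_comparison:
  assumes "x \<in> mdom g" "\<And>n. n \<in> lat \<Longrightarrow> \<bar>f n\<bar> \<le> C * (1 + \<bar>g n\<bar>)"
  shows "x \<in> mdom f"
proof -
  have C: "C \<ge> 0"
  proof -
    have "(0::nat \<Rightarrow> int) \<in> lat" by (simp add: lat_def)
    from assms(2)[OF this] have "0 \<le> C * (1 + \<bar>g 0\<bar>)" by linarith
    thus ?thesis by (simp add: zero_le_mult_iff) linarith
  qed
  have H: "(\<lambda>n. of_real (cmod (co x n)) + of_real (cmod (of_real (g n) * co x n))) \<in> H0"
  proof (rule H0_add)
    show "(\<lambda>n. complex_of_real (cmod (co x n))) \<in> H0"
      by (rule H0_comparison[where C = 1, OF co[of x]]) (auto simp: co_off)
    show "(\<lambda>n. complex_of_real (cmod (complex_of_real (g n) * co x n))) \<in> H0"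
      by (rule H0_comparison[where C = 1 and g = "\<lambda>n. complex_of_real (g n) * co x n"])
         (use assms(1) in \<open>auto simp: co_off mdom_def\<close>)
  qed
  have "(\<lambda>n. of_real (f n) * co x n) \<in> H0"
  proof (rule H0_comparison[where C = C, OF H])
    fix n assume n: "n \<in> lat"
    have "cmod (of_real (f n) * co x n) \<le> C * (1 + \<bar>g n\<bar>) * cmod (co x n)"
      using assms(2)[OF n] by (simp add: norm_mult mult_right_mono)
    also have "\<dots> = C * (cmod (co x n) + cmod (of_real (g n) * co x n))"
      by (simp add: norm_mult algebra_simps)
    also have "cmod (co x n) + cmod (of_real (g n) * co x n) = cmod (of_real (cmod (co x n)) + of_real (cmod (of_real (g n) * co x n)))"
      by (metis abs_of_nonneg add_nonneg_nonneg norm_ge_zero norm_of_real of_real_add)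
    finally show "cmod (of_real (f n) * co x n) \<le> C * cmod (of_real (cmod (co x n)) + of_real (cmod (of_real (g n) * co x n)))" .
  qed (auto simp: co_off)
  thus ?thesis by (simp add: mdom_def)
qed

lemma mdom_bounded:
  assumes "\<And>n. n \<in> lat \<Longrightarrow> \<bar>g n\<bar> \<le> C"
  shows "x \<in> mdom g"
proof -
  have "x \<in> mdom (\<lambda>_. 0)" using co[of 0] by (simp add: mdom_def zero_hil_def Hil_inverse H0_def)
  thus ?thesis by (rule mdom_comparison[where C = C]) (use assms in auto)
qed

lemma mdom_add: "x \<in> mdom g \<Longrightarrow> y \<in> mdom g \<Longrightarrow> x + y \<in> mdom g"
  using H0_add by (auto simp: mdom_def algebra_simps)
lemma mdom_cs: "x \<in> mdom g \<Longrightarrow> cs c x \<in> mdom g"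
  using H0_scale[of "\<lambda>n. of_real (g n) * co x n" c] by (auto simp: mdom_def algebra_simps)
lemma mdom_diff: "x \<in> mdom g \<Longrightarrow> y \<in> mdom g \<Longrightarrow> x - y \<in> mdom g"
  using mdom_add[of x g "cs (-1) y"] mdom_cs[of y g "-1"] by (simp flip: minus_cs)
lemma mdom_zero [simp]: "0 \<in> mdom g" by (simp add: mdom_def H0_def)
lemma mdom_sum: "(\<And>i. i \<in> A \<Longrightarrow> f i \<in> mdom g) \<Longrightarrow> (\<Sum>i\<in>A. f i) \<in> mdom g"
  by (induction A rule: infinite_finite_induct) (auto intro: mdom_add)

lemma mlt_add: "x \<in> mdom g \<Longrightarrow> y \<in> mdom g \<Longrightarrow> mlt g (x + y) = mlt g x + mlt g y"
  by (rule hil_eqI) (simp add: co_mlt mdom_add algebra_simps)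
lemma mlt_diff: "x \<in> mdom g \<Longrightarrow> y \<in> mdom g \<Longrightarrow> mlt g (x - y) = mlt g x - mlt g y"
  by (rule hil_eqI) (simp add: co_mlt mdom_diff algebra_simps)
lemma mlt_cs: "x \<in> mdom g \<Longrightarrow> mlt g (cs c x) = cs c (mlt g x)"
  by (rule hil_eqI) (simp add: co_mlt mdom_cs algebra_simps)
lemma mlt_mlt:
  "x \<in> mdom g \<Longrightarrow> x \<in> mdom (\<lambda>n. f n * g n) \<Longrightarrow> mlt g x \<in> mdom f \<and> mlt f (mlt g x) = mlt (\<lambda>n. f n * g n) x"
proof -
  assume *: "x \<in> mdom g" "x \<in> mdom (\<lambda>n. f n * g n)"
  hence 1: "mlt g x \<in> mdom f" by (simp add: mdom_def co_mlt mult.assoc)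
  thus ?thesis using * by (auto intro!: hil_eqI simp: co_mlt)
qed

lemma mlt_norm_le:
  assumes "\<And>n. n \<in> lat \<Longrightarrow> \<bar>g n\<bar> \<le> C"
  shows "norm (mlt g x) \<le> C * norm x"
proof (rule norm_comparison)
  fix n assume n: "n \<in> lat"
  show "cmod (co (mlt g x) n) \<le> C * cmod (co x n)"
    by (simp add: co_mlt[OF mdom_bounded[OF assms]] norm_mult mult_right_mono assms n)
next
  have "(0::nat \<Rightarrow> int) \<in> lat" by (simp add: lat_def)
  from assms[OF this] show "0 \<le> C" by linarith
qed

lemma mlt_symmetric: "x \<in> mdom g \<Longrightarrow> y \<in> mdom g \<Longrightarrow> cip (mlt g x) y = cip x (mlt g y)"
  unfolding cip_def by (intro infsum_cong) (simp add: co_mlt)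

definition bas :: "(nat \<Rightarrow> int) \<Rightarrow> hil" where
  "bas n = Hil (\<lambda>m. if m = n then 1 else 0)"

lemma finite_support_H0:
  assumes "finite S" "\<And>n. n \<notin> lat \<Longrightarrow> f n = 0" "\<And>n. n \<notin> S \<Longrightarrow> f n = 0"
  shows "f \<in> H0"
proof -
  have "(\<lambda>n. (cmod (f n))\<^sup>2) summable_on lat"
    by (rule finite_nonzero_values_imp_summable_on) (rule finite_subset[OF _ assms(1)], use assms(3) in auto)
  thus ?thesis using assms(2) by (auto simp: H0_def)
qed

lemma co_bas [simp]: "n \<in> lat \<Longrightarrow> co (bas n) m = (if m = n then 1 else 0)"
  unfolding bas_def by (subst Hil_inverse) (auto intro!: finite_support_H0[of "{n}"] split: if_splits)

lemma cip_bas: "n \<in> lat \<Longrightarrow> cip x (bas n) = co x n"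
  unfolding cip_def by (subst infsum_cong_neutral[where T = "{n}" and g = "\<lambda>m. co x n"]) auto

lemma norm_bas [simp]: "n \<in> lat \<Longrightarrow> norm (bas n) = 1"
  using cip_self_norm[of "bas n"] cip_bas[of n "bas n"]
  by (simp add: power2_eq_1_iff) (metis norm_ge_zero of_real_eq_1_iff power2_eq_1_iff not_one_le_zero
      neg_0_le_iff_le of_real_power)

definition trunc :: "real \<Rightarrow> hil \<Rightarrow> hil" where
  "trunc r = mlt (\<lambda>n. if nn n \<le> r then 1 else 0)"

lemma co_trunc: "co (trunc r x) n = (if nn n \<le> r then co x n else 0)"
  unfolding trunc_def by (subst co_mlt) (auto intro!: mdom_bounded[where C = 1])

lemma trunc_tendsto: "(\<lambda>k. trunc (real k) x) \<longlonglongrightarrow> x"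
proof (rule LIMSEQ_I)
  fix e :: real assume e: "e > 0"
  obtain F where F: "finite F" "F \<subseteq> lat" and
    *: "dist (\<Sum>n\<in>F. (cmod (co x n))\<^sup>2) ((norm x)\<^sup>2) \<le> e\<^sup>2 / 2"
    using has_sum_finite_approximation[OF norm_sq_has_sum, of "e\<^sup>2/2" x] e by auto
  obtain N :: nat where N: "\<And>n. n \<in> F \<Longrightarrow> nn n \<le> real N"
    using F(1) by (metis Max_ge finite_imageI image_eqI le_trans nat_le_real_less real_arch_simple order.trans)
  have "norm (trunc (real k) x - x) < e" if k: "k \<ge> N" for k
  proof -
    have "norm (x - trunc (real k) x) \<le> sqrt (e\<^sup>2 / 2)"
    proof (rule norm_boundI)
      fix G :: "(nat \<Rightarrow> int) set" assume G: "finite G" "G \<subseteq> lat"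
      have "(\<Sum>n\<in>G. (cmod (co (x - trunc (real k) x) n))\<^sup>2) \<le> (\<Sum>n\<in>G - F. (cmod (co x n))\<^sup>2)"
      proof -
        have "(\<Sum>n\<in>G. (cmod (co (x - trunc (real k) x) n))\<^sup>2) = (\<Sum>n\<in>G - F. (cmod (co (x - trunc (real k) x) n))\<^sup>2)"
          using G N k by (intro sum.mono_neutral_right) (auto simp: co_trunc, force)
        also have "\<dots> \<le> (\<Sum>n\<in>G - F. (cmod (co x n))\<^sup>2)"
          by (intro sum_mono) (auto simp: co_trunc)
        finally show ?thesis .
      qed
      also have "\<dots> = (\<Sum>n\<in>G \<union> F. (cmod (co x n))\<^sup>2) - (\<Sum>n\<in>F. (cmod (co x n))\<^sup>2)"
        using G F by (subst sum_diff[symmetric]) (auto simp: Un_Diff)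
      also have "\<dots> \<le> (norm x)\<^sup>2 - (\<Sum>n\<in>F. (cmod (co x n))\<^sup>2)"
        using finite_sum_le_norm[of "G \<union> F" x] G F by auto
      also have "\<dots> \<le> e\<^sup>2 / 2" using * unfolding dist_real_def by linarith
      finally show "(\<Sum>n\<in>G. (cmod (co (x - trunc (real k) x) n))\<^sup>2) \<le> (sqrt (e\<^sup>2 / 2))\<^sup>2"
        by simp
    qed auto
    also have "\<dots> < sqrt (e\<^sup>2)" using e by (intro real_sqrt_less_mono) auto
    also have "\<dots> = e" using e by simp
    finally show ?thesis by (simp add: norm_minus_commute)
  qed
  thus "\<exists>N. \<forall>k\<ge>N. norm (trunc (real k) x - x) < e" by blast
qed

lemma trunc_sum: "trunc r x = (\<Sum>n\<in>{n\<in>lat. nn n \<le> r}. cs (co x n) (bas n))"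
proof (rule hil_eqI)
  fix m assume m: "m \<in> lat"
  have "co (\<Sum>n\<in>{n\<in>lat. nn n \<le> r}. cs (co x n) (bas n)) m = (\<Sum>n\<in>{n\<in>lat. nn n \<le> r}. if m = n then co x n else 0)"
    unfolding co_sum by (intro sum.cong) auto
  also have "\<dots> = co (trunc r x) m"
    using m by (simp add: sum.delta finite_nn_ball co_trunc)
  finally show "co (trunc r x) m = co (\<Sum>n\<in>{n\<in>lat. nn n \<le> r}. cs (co x n) (bas n)) m" ..
qed

text \<open>Truncations are finite combinations of basis vectors and converge in norm. Complex
  homogeneity is a separate hypothesis because \<open>bounded_linear\<close> speaks of real scalars
  only.\<close>

lemma bounded_clinear_eqI:
  assumes "bounded_linear A" "bounded_linear B"
    and "\<And>c x. A (cs c x) = cs c (A x)" "\<And>c x. B (cs c x) = cs c (B x)"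
    and eq: "\<And>n. n \<in> lat \<Longrightarrow> A (bas n) = B (bas n)"
  shows "A x = B x"
proof -
  interpret A: bounded_linear A by fact
  interpret B: bounded_linear B by fact
  have *: "A (trunc r x) = B (trunc r x)" for r
    unfolding trunc_sum A.sum B.sum by (intro sum.cong) (auto simp: assms)
  have "(\<lambda>k. A (trunc (real k) x)) \<longlonglongrightarrow> A x" by (rule A.tendsto[OF trunc_tendsto])
  moreover have "(\<lambda>k. A (trunc (real k) x)) \<longlonglongrightarrow> B x" unfolding * by (rule B.tendsto[OF trunc_tendsto])
  ultimately show ?thesis by (rule LIMSEQ_unique)
qed

text \<open>A copy of the bounded operators carrying an algebra structure, so that the exponential of Banach
  algebras becomes available.\<close>

typedef bop = "UNIV :: (hil \<Rightarrow>\<^sub>L hil) set" morphisms bl Op ..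

lemma bl_Op [simp]: "bl (Op f) = f" by (simp add: Op_inverse)
lemma bop_eqI: "bl A = bl B \<Longrightarrow> A = B" by (simp add: bl_inject)

instantiation bop :: real_vector
begin
definition "0 = Op 0"
definition "A + B = Op (bl A + bl B)"
definition "A - B = Op (bl A - bl B)"
definition "- A = Op (- bl A)"
definition "scaleR r A = Op (scaleR r (bl A))" for A :: bop
instance
  by standard (simp_all add: zero_bop_def plus_bop_def minus_bop_def uminus_bop_def scaleR_bop_def
      algebra_simps bl_inverse)
end

instantiation bop :: real_normed_algebra_1
begin
definition "1 = Op id_blinfun"
definition "A * B = Op (bl A o\<^sub>L bl B)"
definition "norm A = norm (bl A)" for A :: bop
definition "dist A B = norm (A - B)" for A B :: bop
definition "sgn A = A /\<^sub>R norm A" for A :: bop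
definition "uniformity = (INF e\<in>{0<..}. principal {(x::bop, y). dist x y < e})"
definition "open U = (\<forall>x\<in>U. eventually (\<lambda>(x', y). x' = x \<longrightarrow> y \<in> U) (uniformity :: (bop \<times> bop) filter))"

instance
proof
  fix A B C :: bop and r s :: real
  note defs = zero_bop_def one_bop_def plus_bop_def minus_bop_def uminus_bop_def times_bop_def
    scaleR_bop_def norm_bop_def
  show "norm (1::bop) = 1"
  proof -
    have "bas 0 = blinfun_apply id_blinfun (bas 0)" by simp
    hence "norm (bas 0) \<le> norm (id_blinfun :: hil \<Rightarrow>\<^sub>L hil) * norm (bas 0)"
      by (metis norm_blinfun)
    moreover have "(0::nat \<Rightarrow> int) \<in> lat" by (simp add: lat_def)
    ultimately have "norm (id_blinfun :: hil \<Rightarrow>\<^sub>L hil) \<ge> 1" by simp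
    thus ?thesis using norm_blinfun_id_le[where 'a = hil] by (simp add: defs)
  qed
  show "(0::bop) \<noteq> 1"
  proof
    assume "(0::bop) = 1"
    hence "blinfun_apply (bl 0) (bas 0) = blinfun_apply (bl 1) (bas 0)" by simp
    hence "bas 0 = 0" by (simp add: defs)
    moreover have "(0::nat \<Rightarrow> int) \<in> lat" by (simp add: lat_def)
    ultimately show False using norm_bas[of 0] by simp
  qed
  show "norm (A * B) \<le> norm A * norm B" by (simp add: defs norm_blinfun_compose)
  show "norm (A + B) \<le> norm A + norm B" by (simp add: defs norm_triangle_ineq)
  show "norm A = 0 \<longleftrightarrow> A = 0" by (auto simp: defs intro!: bop_eqI)
  show "norm (scaleR r A) = \<bar>r\<bar> * norm A" by (simp add: defs)
  show "A * B * C = A * (B * C)" by (auto simp: defs intro!: bop_eqI blinfun_eqI)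
  show "(A + B) * C = A * C + B * C" "C * (A + B) = C * A + C * B"
    by (auto simp: defs intro!: bop_eqI blinfun_eqI simp: blinfun.add_left blinfun.add_right)
  show "scaleR r A * B = scaleR r (A * B)" "A * scaleR r B = scaleR r (A * B)"
    by (auto simp: defs intro!: bop_eqI blinfun_eqI simp: blinfun.scaleR_left blinfun.scaleR_right)
  show "1 * A = A" "A * 1 = A"
    by (auto simp: defs intro!: bop_eqI blinfun_eqI)
qed (fact dist_bop_def sgn_bop_def uniformity_bop_def open_bop_def)+
end

instance bop :: complete_space
proof
  fix X :: "nat \<Rightarrow> bop" assume C: "Cauchy X"
  have d: "dist (bl A) (bl B) = dist A B" for A B
    by (simp add: dist_norm norm_bop_def minus_bop_def)
  have "Cauchy (\<lambda>k. bl (X k))" using C unfolding Cauchy_def d .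
  then obtain L where "(\<lambda>k. bl (X k)) \<longlonglongrightarrow> L"
    using Cauchy_convergent_iff convergent_def by blast
  hence "X \<longlonglongrightarrow> Op L" unfolding lim_sequentially d[symmetric] by simp
  thus "convergent X" by (auto simp: convergent_def)
qed

instance bop :: banach ..

definition ap :: "bop \<Rightarrow> hil \<Rightarrow> hil" where "ap A = blinfun_apply (bl A)"
definition mkop :: "(hil \<Rightarrow> hil) \<Rightarrow> bop" where "mkop f = Op (Blinfun f)"

lemma ap_mkop: "bounded_linear f \<Longrightarrow> ap (mkop f) = f"
  by (simp add: ap_def mkop_def bounded_linear_Blinfun_apply)
lemma bop_eq_apI: "(\<And>x. ap A x = ap B x) \<Longrightarrow> A = B"
  unfolding ap_def by (intro bop_eqI blinfun_eqI)
lemma ap_mult [simp]: "ap (A * B) x = ap A (ap B x)" by (simp add: ap_def times_bop_def)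
lemma ap_one [simp]: "ap 1 x = x" by (simp add: ap_def one_bop_def)
lemma ap_scaleR_op: "ap (scaleR r A) x = scaleR r (ap A x)"
  by (simp add: ap_def scaleR_bop_def blinfun.scaleR_left)
lemma bounded_linear_ap: "bounded_linear (ap A)" unfolding ap_def by (rule blinfun.bounded_linear_right)
lemma bounded_linear_ap_left: "bounded_linear (\<lambda>A. ap A x)"
proof (rule bounded_linear_intro[where K = "norm x"])
  show "norm (ap A x) \<le> norm A * norm x" for A by (simp add: ap_def norm_bop_def norm_blinfun)
qed (simp_all add: ap_def plus_bop_def scaleR_bop_def blinfun.add_left blinfun.scaleR_left)
lemma norm_ap: "norm (ap A x) \<le> norm A * norm x" by (simp add: ap_def norm_bop_def norm_blinfun)

lemma exp_sums_ap: "(\<lambda>j. ap (A ^ j) x /\<^sub>R fact j) sums ap (exp A) x"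
  using bounded_linear.sums[OF bounded_linear_ap_left exp_converges, of A x]
  by (simp add: ap_scaleR_op)

lemma exp_commute_op:
  fixes A B :: bop
  assumes "A * B = B * A"
  shows "exp A * B = B * exp A"
proof -
  have *: "A ^ n * B = B * A ^ n" for n
    by (metis assms power_commuting_commutes)
  have "(\<lambda>n. (A ^ n /\<^sub>R fact n) * B) sums (exp A * B)"
    by (rule sums_mult2[OF exp_converges])
  moreover have "(\<lambda>n. B * (A ^ n /\<^sub>R fact n)) sums (B * exp A)"
    by (rule sums_mult[OF exp_converges])
  moreover have "(A ^ n /\<^sub>R fact n) * B = B * (A ^ n /\<^sub>R fact n)" for n by (simp add: *)
  ultimately show ?thesis using sums_unique2 by fastforce
qed

lemma exp_selfadjoint:
  assumes "\<And>x y. cip (ap A x) y = cip x (ap A y)"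
  shows "cip (ap (exp A) x) y = cip x (ap (exp A) y)"
proof -
  have pow: "cip (ap (A ^ n) x) y = cip x (ap (A ^ n) y)" for n x y
    by (induction n arbitrary: x y) (simp_all add: assms, metis ap_mult power_commutes assms)
  have "(\<lambda>j. cip (ap (A ^ j) x /\<^sub>R fact j) y) sums cip (ap (exp A) x) y"
    by (rule bounded_linear.sums[OF bounded_linear_cip_left exp_sums_ap])
  moreover have "(\<lambda>j. cip x (ap (A ^ j) y /\<^sub>R fact j)) sums cip x (ap (exp A) y)"
    by (rule bounded_linear.sums[OF bounded_linear_cip_right exp_sums_ap])
  moreover have "cip (ap (A ^ j) x /\<^sub>R fact j) y = cip x (ap (A ^ j) y /\<^sub>R fact j)" for j
    by (simp add: cip_scaleR_left cip_scaleR_right pow)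
  ultimately show ?thesis using sums_unique2 by fastforce
qed

section \<open>Twisted translations and left multiplication\<close>

lemma lat_add [simp]: "m \<in> lat \<Longrightarrow> n \<in> lat \<Longrightarrow> m + n \<in> lat" by (simp add: lat_def)
lemma lat_diff [simp]: "m \<in> lat \<Longrightarrow> n \<in> lat \<Longrightarrow> n - m \<in> lat" by (simp add: lat_def)
lemma lat_uminus [simp]: "m \<in> lat \<Longrightarrow> - m \<in> lat" by (simp add: lat_def)
lemma lat_zero [simp]: "0 \<in> lat" by (simp add: lat_def)
lemma lat_diff_iff: "m \<in> lat \<Longrightarrow> n - m \<in> lat \<longleftrightarrow> n \<in> lat"
  by (metis lat_add lat_diff diff_add_cancel)
lemma bij_lat_shift: "m \<in> lat \<Longrightarrow> bij_betw (\<lambda>n. n - m) lat lat"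
  by (rule bij_betw_byWitness[where f' = "\<lambda>n. n + m"]) auto
lemma bij_lat_uminus: "bij_betw uminus lat lat"
  by (rule bij_betw_byWitness[where f' = uminus]) auto

text \<open>The exponent of \<open>phase\<close> is bilinear, so \<open>phase\<close> is a
  bicharacter; the cocycle identities below all reduce to these rules.\<close>

lemma phase_add_left: "phase \<theta> (m + m') n = phase \<theta> m n * phase \<theta> m' n"
  unfolding phase_def cis_mult by (simp add: algebra_simps sum.distrib)
lemma phase_add_right: "phase \<theta> n (m + m') = phase \<theta> n m * phase \<theta> n m'"
  unfolding phase_def cis_mult by (simp add: algebra_simps sum.distrib)
lemma phase_uminus_left: "phase \<theta> (- m) n = cnj (phase \<theta> m n)"
  unfolding phase_def cis_cnj by (simp add: sum_negf)
lemma phase_uminus_right: "phase \<theta> n (- m) = cnj (phase \<theta> n m)"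
  unfolding phase_def cis_cnj by (simp add: sum_negf)
lemma norm_phase [simp]: "cmod (phase \<theta> m n) = 1" by (simp add: phase_def)
lemma phase_diff_right: "phase \<theta> n (m - m') = phase \<theta> n m * cnj (phase \<theta> n m')"
  using phase_add_right[of \<theta> n m "- m'"] by (simp add: phase_uminus_right)
lemma phase_diff_left: "phase \<theta> (m - m') n = phase \<theta> m n * cnj (phase \<theta> m' n)"
  using phase_add_left[of \<theta> m "- m'" n] by (simp add: phase_uminus_left)
lemma phase_cnj [simp]: "phase \<theta> m n * cnj (phase \<theta> m n) = 1"
  by (simp add: complex_norm_square[symmetric])
lemma phase_zero [simp]: "phase \<theta> 0 n = 1" "phase \<theta> n 0 = 1"
  by (simp_all add: phase_def)

text \<open>Common form of left and right multiplication by \<open>U^m\<close>: a shift followed by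
  a unimodular multiplier. Isometry and linearity are thus proved once for both.\<close>

definition tsh :: "((nat \<Rightarrow> int) \<Rightarrow> complex) \<Rightarrow> (nat \<Rightarrow> int) \<Rightarrow> hil \<Rightarrow> hil" where
  "tsh c m x = Hil (\<lambda>n. c n * co x (n - m))"

lemma co_tsh:
  assumes "m \<in> lat" "\<And>n. cmod (c n) = 1"
  shows "co (tsh c m x) n = c n * co x (n - m)"
proof -
  have "(\<lambda>n. (cmod (co x (n - m)))\<^sup>2) summable_on lat"
    using summable_on_reindex_bij_betw[OF bij_lat_shift[OF assms(1)], of "\<lambda>n. (cmod (co x n))\<^sup>2"]
    by (simp add: co_sq_summable)
  hence "(\<lambda>n. c n * co x (n - m)) \<in> H0"
    using assms by (auto simp: H0_def norm_mult co_off lat_diff_iff)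
  thus ?thesis unfolding tsh_def by (simp add: Hil_inverse)
qed

lemma norm_tsh:
  assumes "m \<in> lat" "\<And>n. cmod (c n) = 1"
  shows "norm (tsh c m x) = norm x"
proof -
  have "(norm (tsh c m x))\<^sup>2 = (norm x)\<^sup>2"
    using infsum_reindex_bij_betw[OF bij_lat_shift[OF assms(1)], of "\<lambda>n. (cmod (co x n))\<^sup>2"]
    by (simp add: norm_sq_hil co_tsh[OF assms] norm_mult assms(2))
  thus ?thesis by (simp add: power2_eq_iff_nonneg)
qed

lemma bounded_linear_tsh:
  assumes "m \<in> lat" "\<And>n. cmod (c n) = 1"
  shows "bounded_linear (tsh c m)"
  by (rule bounded_linear_intro[where K = 1])
     (auto intro!: hil_eqI simp: co_tsh[OF assms] norm_tsh[OF assms] algebra_simps)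

text \<open>Left and right multiplication by \<open>U\<^sup>m\<close>.\<close>

definition V where "V \<theta> m = tsh (\<lambda>n. phase \<theta> m (n - m)) m"
definition R where "R \<theta> m = tsh (\<lambda>n. phase \<theta> (n - m) m) m"

lemma co_V: "m \<in> lat \<Longrightarrow> co (V \<theta> m x) n = phase \<theta> m (n - m) * co x (n - m)"
  unfolding V_def by (rule co_tsh) auto
lemma co_R: "m \<in> lat \<Longrightarrow> co (R \<theta> m x) n = phase \<theta> (n - m) m * co x (n - m)"
  unfolding R_def by (rule co_tsh) auto
lemma norm_V [simp]: "m \<in> lat \<Longrightarrow> norm (V \<theta> m x) = norm x"
  unfolding V_def by (rule norm_tsh) auto
lemma norm_R [simp]: "m \<in> lat \<Longrightarrow> norm (R \<theta> m x) = norm x"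
  unfolding R_def by (rule norm_tsh) auto
lemma bl_V: "m \<in> lat \<Longrightarrow> bounded_linear (V \<theta> m)"
  unfolding V_def by (rule bounded_linear_tsh) auto
lemma bl_R: "m \<in> lat \<Longrightarrow> bounded_linear (R \<theta> m)"
  unfolding R_def by (rule bounded_linear_tsh) auto
lemma V_cs: "m \<in> lat \<Longrightarrow> V \<theta> m (cs c x) = cs c (V \<theta> m x)"
  by (rule hil_eqI) (simp add: co_V)
lemma R_cs: "m \<in> lat \<Longrightarrow> R \<theta> m (cs c x) = cs c (R \<theta> m x)"
  by (rule hil_eqI) (simp add: co_R)
lemma R_bas: "n \<in> lat \<Longrightarrow> R \<theta> n (bas 0) = bas n"
  by (rule hil_eqI) (simp add: co_R)

text \<open>This is associativity \<open>U^m (x U^n) = (U^m x) U^n\<close>, which for the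
  coefficients is the cocycle identity of \<open>phase\<close>.\<close>

lemma V_R: "m \<in> lat \<Longrightarrow> n \<in> lat \<Longrightarrow> V \<theta> m (R \<theta> n x) = R \<theta> n (V \<theta> m x)"
proof (rule hil_eqI)
  fix k assume m: "m \<in> lat" and n: "n \<in> lat" and "k \<in> lat"
  have e: "k - m - n = k - n - m" by simp
  have "phase \<theta> m (k - m) * phase \<theta> (k - m - n) n = phase \<theta> m (k - n - m + n) * phase \<theta> (k - m - n) n"
    by simp
  also have "\<dots> = phase \<theta> (k - n) n * phase \<theta> m (k - n - m)"
    by (simp only: phase_add_right phase_diff_left phase_diff_right) (simp add: algebra_simps)
  finally show "co (V \<theta> m (R \<theta> n x)) k = co (R \<theta> n (V \<theta> m x)) k"
    using m n by (simp add: co_V co_R e)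
qed

text \<open>The adjoint of the unitary \<open>U^m\<close> is its inverse. Since
  \<open>U^m U^(-m)\<close> is the scalar
  \<open>phase \<theta> m (- m) = cnj (phase \<theta> m m)\<close>, the inverse is
  \<open>U^(-m)\<close> only up to this phase.\<close>

lemma cip_tsh_reindex:
  assumes "m \<in> lat"
  shows "cip (V \<theta> m x) y = cnj (phase \<theta> m m) * cip x (V \<theta> (- m) y)"
proof -
  have "cip (V \<theta> m x) y = infsum (\<lambda>n. phase \<theta> m (n - m) * co x (n - m) * cnj (co y n)) lat"
    unfolding cip_def by (simp add: co_V assms)
  also have "\<dots> = infsum (\<lambda>n. phase \<theta> m n * co x n * cnj (co y (n + m))) lat"
    using infsum_reindex_bij_betw[OF bij_lat_shift[OF assms], of "\<lambda>n. phase \<theta> m n * co x n * cnj (co y (n + m))"]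
    by simp
  also have "\<dots> = infsum (\<lambda>n. cnj (phase \<theta> m m) * (co x n * cnj (co (V \<theta> (- m) y) n))) lat"
  proof (rule infsum_cong)
    fix n
    have "cnj (phase \<theta> m m) * (phase \<theta> m n * phase \<theta> m m) = phase \<theta> m n"
      using phase_cnj[of \<theta> m m] by (simp add: mult.commute mult.left_commute)
    thus "phase \<theta> m n * co x n * cnj (co y (n + m)) = cnj (phase \<theta> m m) * (co x n * cnj (co (V \<theta> (- m) y) n))"
      using assms by (simp add: co_V phase_uminus_left phase_add_right algebra_simps)
  qed
  also have "\<dots> = cnj (phase \<theta> m m) * cip x (V \<theta> (- m) y)"
    unfolding cip_def by (rule infsum_cmult_right')
  finally show ?thesis .
qed

text \<open>Left multiplication by \<open>sum a_m U^m\<close>, as a sum of isometries that converges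
  in norm for summable \<open>a\<close>; \<open>tmult_co\<close> identifies it with twisted
  convolution.\<close>

definition T :: "(nat \<Rightarrow> nat \<Rightarrow> real) \<Rightarrow> ((nat \<Rightarrow> int) \<Rightarrow> complex) \<Rightarrow> hil \<Rightarrow> hil" where
  "T \<theta> a x = infsum (\<lambda>m. cs (a m) (V \<theta> m x)) lat"

abbreviation l1 :: "((nat \<Rightarrow> int) \<Rightarrow> complex) \<Rightarrow> bool" where
  "l1 a \<equiv> (\<lambda>m. cmod (a m)) summable_on lat"

lemma T_abs_summable:
  assumes "l1 a"
  shows "(\<lambda>m. norm (cs (a m) (V \<theta> m x))) summable_on lat"
proof -
  have "(\<lambda>m. cmod (a m) * norm x) summable_on lat" using assms by (rule summable_on_cmult_left)
  thus ?thesis by (rule summable_on_cong[THEN iffD1, rotated]) simp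
qed

lemma T_has_sum: "l1 a \<Longrightarrow> ((\<lambda>m. cs (a m) (V \<theta> m x)) has_sum T \<theta> a x) lat"
  unfolding T_def by (rule has_sum_infsum[OF abs_summable_summable[OF T_abs_summable]])

lemma T_norm:
  assumes "l1 a"
  shows "norm (T \<theta> a x) \<le> infsum (\<lambda>m. cmod (a m)) lat * norm x"
proof -
  have "norm (T \<theta> a x) \<le> infsum (\<lambda>m. norm (cs (a m) (V \<theta> m x))) lat"
    unfolding T_def by (rule norm_infsum_bound[OF T_abs_summable[OF assms]])
  also have "\<dots> = infsum (\<lambda>m. cmod (a m) * norm x) lat" by (rule infsum_cong) simp
  also have "\<dots> = infsum (\<lambda>m. cmod (a m)) lat * norm x" by (rule infsum_cmult_left')
  finally show ?thesis .
qed

lemma bl_T: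
  assumes "l1 a"
  shows "bounded_linear (T \<theta> a)"
proof (rule bounded_linear_intro[where K = "infsum (\<lambda>m. cmod (a m)) lat"])
  fix x y :: hil and r :: real
  have "((\<lambda>m. cs (a m) (V \<theta> m x) + cs (a m) (V \<theta> m y)) has_sum T \<theta> a x + T \<theta> a y) lat"
    by (intro has_sum_add T_has_sum assms)
  hence "((\<lambda>m. cs (a m) (V \<theta> m (x + y))) has_sum T \<theta> a x + T \<theta> a y) lat"
    by (rule has_sum_cong[THEN iffD1, rotated]) (simp add: cs_add linear_add[OF bounded_linear.linear[OF bl_V]])
  thus "T \<theta> a (x + y) = T \<theta> a x + T \<theta> a y" unfolding T_def by (rule infsumI)
  have "((\<lambda>m. scaleR r (cs (a m) (V \<theta> m x))) has_sum scaleR r (T \<theta> a x)) lat"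
    by (rule has_sum_bounded_linear[OF bounded_linear_scaleR_right T_has_sum[OF assms]])
  hence "((\<lambda>m. cs (a m) (V \<theta> m (scaleR r x))) has_sum scaleR r (T \<theta> a x)) lat"
    by (rule has_sum_cong[THEN iffD1, rotated]) (simp add: scaleR_cs V_cs mult.commute)
  thus "T \<theta> a (scaleR r x) = scaleR r (T \<theta> a x)" unfolding T_def by (rule infsumI)
  show "norm (T \<theta> a x) \<le> norm x * infsum (\<lambda>m. cmod (a m)) lat"
    using T_norm[OF assms, of \<theta> x] by (simp add: mult.commute)
qed

lemma T_cs:
  assumes "l1 a"
  shows "T \<theta> a (cs c x) = cs c (T \<theta> a x)"
proof -
  have "((\<lambda>m. cs c (cs (a m) (V \<theta> m x))) has_sum cs c (T \<theta> a x)) lat"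
    by (rule has_sum_bounded_linear[OF bounded_linear_cs T_has_sum[OF assms]])
  hence "((\<lambda>m. cs (a m) (V \<theta> m (cs c x))) has_sum cs c (T \<theta> a x)) lat"
    by (rule has_sum_cong[THEN iffD1, rotated]) (simp add: V_cs mult.commute)
  thus ?thesis unfolding T_def by (rule infsumI)
qed

lemma T_scale:
  assumes "l1 a"
  shows "T \<theta> (\<lambda>m. c * a m) x = cs c (T \<theta> a x)"
proof -
  have "((\<lambda>m. cs c (cs (a m) (V \<theta> m x))) has_sum cs c (T \<theta> a x)) lat"
    by (rule has_sum_bounded_linear[OF bounded_linear_cs T_has_sum[OF assms]])
  thus ?thesis unfolding T_def[of \<theta> "\<lambda>m. c * a m"] by (intro infsumI) simp
qed

lemma T_R:
  assumes "l1 a" "n \<in> lat"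
  shows "T \<theta> a (R \<theta> n x) = R \<theta> n (T \<theta> a x)"
proof -
  have "((\<lambda>m. R \<theta> n (cs (a m) (V \<theta> m x))) has_sum R \<theta> n (T \<theta> a x)) lat"
    by (rule has_sum_bounded_linear[OF bl_R[OF assms(2)] T_has_sum[OF assms(1)]])
  hence "((\<lambda>m. cs (a m) (V \<theta> m (R \<theta> n x))) has_sum R \<theta> n (T \<theta> a x)) lat"
    by (rule has_sum_cong[THEN iffD1, rotated]) (simp add: V_R R_cs assms)
  thus ?thesis unfolding T_def[of \<theta> a "R \<theta> n x"] by (rule infsumI)
qed

lemma co_T_has_sum:
  assumes "l1 a"
  shows "((\<lambda>m. a m * (phase \<theta> m (n - m) * co x (n - m))) has_sum co (T \<theta> a x) n) lat"
proof -
  have "((\<lambda>m. co (cs (a m) (V \<theta> m x)) n) has_sum co (T \<theta> a x) n) lat"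
    by (rule has_sum_bounded_linear[OF bounded_linear_co T_has_sum[OF assms]])
  thus ?thesis by (rule has_sum_cong[THEN iffD1, rotated]) (simp add: co_V)
qed

lemma tmult_co:
  assumes "l1 a"
  shows "tmult \<theta> a (co x) = co (T \<theta> a x)"
proof
  fix n
  show "tmult \<theta> a (co x) n = co (T \<theta> a x) n"
  proof (cases "n \<in> lat")
    case True
    have "co (T \<theta> a x) n = infsum (\<lambda>m. a m * (phase \<theta> m (n - m) * co x (n - m))) lat"
      by (rule infsumI[OF co_T_has_sum[OF assms], symmetric])
    thus ?thesis using True by (simp add: tmult_def fun_diff_def mult_ac)
  qed (simp add: tmult_def co_off)
qed

lemma T_selfadjoint:
  assumes "l1 h" "tstar \<theta> h = h"
  shows "cip (T \<theta> h x) y = cip x (T \<theta> h y)"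
proof -
  \<comment> \<open>Coefficient form of \<open>tstar \<theta> h = h\<close>. After the substitution
    of \<open>- m\<close> for \<open>m\<close> its phase cancels the one produced by
    \<open>cip_tsh_reindex\<close>.\<close>
  have hm: "cnj (h m) = h (- m) * cnj (phase \<theta> m m)" if "m \<in> lat" for m
  proof -
    have "h m = tstar \<theta> h m" by (simp add: assms(2))
    also have "\<dots> = cnj (h (- m)) * phase \<theta> m m"
      using that by (simp add: tstar_def phase_def fun_Compl_def)
    finally show ?thesis by simp
  qed
  have "((\<lambda>m. cip (cs (h m) (V \<theta> m x)) y) has_sum cip (T \<theta> h x) y) lat"
    by (rule has_sum_bounded_linear[OF bounded_linear_cip_left T_has_sum[OF assms(1)]])
  hence "((\<lambda>m. h m * (cnj (phase \<theta> m m) * cip x (V \<theta> (- m) y))) has_sum cip (T \<theta> h x) y) lat"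
    by (rule has_sum_cong[THEN iffD1, rotated]) (simp add: cip_cs_left cip_tsh_reindex)
  hence "((\<lambda>m. h (- m) * (cnj (phase \<theta> (- m) (- m)) * cip x (V \<theta> (- (- m)) y))) has_sum cip (T \<theta> h x) y) lat"
    using has_sum_reindex_bij_betw[OF bij_lat_uminus, of "\<lambda>m. h m * (cnj (phase \<theta> m m) * cip x (V \<theta> (- m) y))"]
    by blast
  hence 1: "((\<lambda>m. cnj (h m) * cip x (V \<theta> m y)) has_sum cip (T \<theta> h x) y) lat"
    by (rule has_sum_cong[THEN iffD1, rotated]) (simp add: hm phase_uminus_left phase_uminus_right)
  have "((\<lambda>m. cip x (cs (h m) (V \<theta> m y))) has_sum cip x (T \<theta> h y)) lat"
    by (rule has_sum_bounded_linear[OF bounded_linear_cip_right T_has_sum[OF assms(1)]])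
  hence "((\<lambda>m. cnj (h m) * cip x (V \<theta> m y)) has_sum cip x (T \<theta> h y)) lat"
    by (simp add: cip_cs_right)
  with 1 show ?thesis by (rule has_sum_unique)
qed

section \<open>Weighted summable coefficients and the exponential\<close>

lemma has_sum_finite_sum:
  fixes f :: "'a \<Rightarrow> 'b \<Rightarrow> 'c :: real_normed_vector"
  assumes "\<And>i. i \<in> I \<Longrightarrow> (f i has_sum s i) A"
  shows "((\<lambda>x. \<Sum>i\<in>I. f i x) has_sum (\<Sum>i\<in>I. s i)) A"
  using assms by (induction I rule: infinite_finite_induct) (auto intro!: has_sum_add)

definition wt :: "(nat \<Rightarrow> int) \<Rightarrow> real" where
  "wt m = 1 + real (\<Sum>i\<in>{1..4}. nat \<bar>m i\<bar>)"

lemma wt_ge1: "wt m \<ge> 1" by (simp add: wt_def)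
lemma wt_alt: "wt m = 1 + (\<Sum>i\<in>{1..4}. \<bar>of_int (m i)\<bar>)"
  by (simp add: wt_def)
lemma wt_add: "wt (m + n) \<le> wt m * wt n"
proof -
  let ?s = "\<lambda>m. \<Sum>i\<in>{1..4}. \<bar>real_of_int (m i)\<bar>"
  have "?s (m + n) \<le> ?s m + ?s n"
    unfolding sum.distrib[symmetric] by (intro sum_mono) simp
  moreover have "0 \<le> ?s m * ?s n" by (intro mult_nonneg_nonneg sum_nonneg) auto
  ultimately have "1 + ?s (m + n) \<le> 1 + ?s m + ?s n + ?s m * ?s n" by linarith
  also have "\<dots> = (1 + ?s m) * (1 + ?s n)" unfolding distrib_right distrib_left by linarith
  finally show ?thesis unfolding wt_alt .
qed
lemma nn_le_wt: "nn m \<le> wt m"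
  unfolding wt_alt nn_def using L2_set_le_sum_abs[of "\<lambda>i. of_int (m i)" "{1..4}"] by linarith

text \<open>Summability with the weight \<open>wt\<^sup>2\<close> is inherited by exponentials, and it
  suffices for two derivatives.\<close>

definition lw :: "((nat \<Rightarrow> int) \<Rightarrow> complex) \<Rightarrow> bool" where
  "lw a \<longleftrightarrow> (\<lambda>m. (wt m)\<^sup>2 * cmod (a m)) summable_on lat"

lemma lw_comparison:
  assumes "lw a" "\<And>m. m \<in> lat \<Longrightarrow> cmod (b m) \<le> C * ((wt m)\<^sup>2 * cmod (a m))"
  shows "l1 b"
proof -
  have "(\<lambda>m. C * ((wt m)\<^sup>2 * cmod (a m))) summable_on lat"
    using assms(1) unfolding lw_def by (rule summable_on_cmult_right)
  thus ?thesis by (rule summable_on_comparison_test) (use assms(2) in auto)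
qed

lemma lw_l1: "lw a \<Longrightarrow> l1 a"
  by (rule lw_comparison[where C = 1]) (auto simp: wt_ge1 mult_le_cancel_right1 one_le_power)

text \<open>The unit of the algebra is the vector \<open>bas 0\<close>, so an element is recovered
  by letting its left multiplication act on \<open>bas 0\<close>. Powers and exponentials of
  coefficient functions thereby become powers and exponentials of operators.\<close>

lemma tpow_co:
  assumes "l1 h"
  shows "tpow \<theta> h j = co (ap (mkop (T \<theta> h) ^ j) (bas 0))"
proof (induction j)
  case 0
  show ?case by (rule ext) (simp add: tunit_def zero_fun_def[symmetric])
next
  case (Suc j)
  thus ?case by (simp add: tmult_co[OF assms] ap_mkop[OF bl_T[OF assms]])
qed

lemma texp_sums:
  assumes "l1 h"
  shows "(\<lambda>j. tpow \<theta> h j n / of_nat (fact j)) sums co (ap (exp (mkop (T \<theta> h))) (bas 0)) n"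
proof -
  have "(\<lambda>j. co (ap (mkop (T \<theta> h) ^ j) (bas 0) /\<^sub>R fact j) n) sums co (ap (exp (mkop (T \<theta> h))) (bas 0)) n"
    by (rule bounded_linear.sums[OF bounded_linear_co exp_sums_ap])
  thus ?thesis by (simp add: tpow_co[OF assms] field_simps)
qed

lemma texp_co: "l1 h \<Longrightarrow> texp \<theta> h = co (ap (exp (mkop (T \<theta> h))) (bas 0))"
  unfolding texp_def by (rule ext) (rule sums_unique[OF texp_sums, symmetric])

text \<open>Submultiplicativity of \<open>wt\<close> makes the weighted \<open>l^1\<close> space a
  Banach algebra under twisted convolution. The bound is stated on finite sets, since summability of
  the powers is a consequence rather than a premise.\<close>

lemma tpow_weight:
  assumes "lw h" "finite F" "F \<subseteq> lat"
  shows "(\<Sum>n\<in>F. (wt n)\<^sup>2 * cmod (tpow \<theta> h j n)) \<le> (infsum (\<lambda>m. (wt m)\<^sup>2 * cmod (h m)) lat) ^ j"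
  using assms(2,3)
proof (induction j arbitrary: F)
  case 0
  have "(\<Sum>n\<in>F. (wt n)\<^sup>2 * cmod (tpow \<theta> h 0 n)) = (\<Sum>n\<in>F. if n = 0 then 1 else 0)"
    by (intro sum.cong) (auto simp: tunit_def wt_def zero_fun_def)
  also have "\<dots> \<le> 1" using 0 by (simp add: sum.delta)
  finally show ?case by simp
next
  case (Suc j)
  let ?K = "infsum (\<lambda>m. (wt m)\<^sup>2 * cmod (h m)) lat"
  let ?b = "tpow \<theta> h j"
  note l1 = lw_l1[OF assms(1)]
  have K0: "?K \<ge> 0" by (intro infsum_nonneg) auto
  \<comment> \<open>One coefficient is a sum over a singleton, so the induction hypothesis bounds
    it; this suffices for the convolution series to converge.\<close>
  have b1: "(wt m)\<^sup>2 * cmod (?b m) \<le> ?K ^ j" for m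
    using Suc.IH[of "{m}"] K0 by (cases "m \<in> lat") (auto simp: tpow_co[OF l1] co_off)
  have S: "(\<lambda>m. ((wt m)\<^sup>2 * cmod (h m)) * ((wt (n - m))\<^sup>2 * cmod (?b (n - m)))) summable_on lat" for n
  proof (rule summable_on_comparison_test)
    show "(\<lambda>m. ((wt m)\<^sup>2 * cmod (h m)) * ?K ^ j) summable_on lat"
      using assms(1) unfolding lw_def by (rule summable_on_cmult_left)
  qed (auto intro!: mult_left_mono b1)
  have step: "(wt n)\<^sup>2 * cmod (tpow \<theta> h (Suc j) n) \<le>
      infsum (\<lambda>m. ((wt m)\<^sup>2 * cmod (h m)) * ((wt (n - m))\<^sup>2 * cmod (?b (n - m)))) lat" if n: "n \<in> lat" for n
  proof -
    let ?t = "\<lambda>m. h m * ?b (n - m) * phase \<theta> m (n - m)"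
    have w: "(wt n)\<^sup>2 * cmod (?t m) \<le> ((wt m)\<^sup>2 * cmod (h m)) * ((wt (n - m))\<^sup>2 * cmod (?b (n - m)))" for m
    proof -
      have "(wt n)\<^sup>2 \<le> (wt m * wt (n - m))\<^sup>2"
        using wt_add[of m "n - m"] wt_ge1[of n] by (intro power_mono) auto
      hence "(wt n)\<^sup>2 * (cmod (h m) * cmod (?b (n - m))) \<le> (wt m * wt (n - m))\<^sup>2 * (cmod (h m) * cmod (?b (n - m)))"
        by (intro mult_right_mono) auto
      thus ?thesis by (simp add: norm_mult power_mult_distrib mult_ac)
    qed
    have sm: "(\<lambda>m. (wt n)\<^sup>2 * cmod (?t m)) summable_on lat"
      by (rule summable_on_comparison_test[OF S]) (auto intro: w)
    hence "(\<lambda>m. inverse ((wt n)\<^sup>2) * ((wt n)\<^sup>2 * cmod (?t m))) summable_on lat"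
      by (rule summable_on_cmult_right)
    moreover have "wt n \<noteq> 0" using wt_ge1[of n] by auto
    ultimately have st: "(\<lambda>m. norm (?t m)) summable_on lat" by (simp add: field_simps)
    have "tpow \<theta> h (Suc j) n = infsum ?t lat"
      using n by (simp add: tmult_def fun_diff_def)
    hence "cmod (tpow \<theta> h (Suc j) n) \<le> infsum (\<lambda>m. cmod (?t m)) lat"
      using norm_infsum_bound[OF st] by simp
    hence "(wt n)\<^sup>2 * cmod (tpow \<theta> h (Suc j) n) \<le> (wt n)\<^sup>2 * infsum (\<lambda>m. cmod (?t m)) lat"
      by (intro mult_left_mono) auto
    also have "\<dots> = infsum (\<lambda>m. (wt n)\<^sup>2 * cmod (?t m)) lat" by (rule infsum_cmult_right'[symmetric])
    also have "\<dots> \<le> infsum (\<lambda>m. ((wt m)\<^sup>2 * cmod (h m)) * ((wt (n - m))\<^sup>2 * cmod (?b (n - m)))) lat"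
      by (rule infsum_mono[OF sm S w])
    finally show ?thesis .
  qed
  have "(\<Sum>n\<in>F. (wt n)\<^sup>2 * cmod (tpow \<theta> h (Suc j) n)) \<le>
    (\<Sum>n\<in>F. infsum (\<lambda>m. ((wt m)\<^sup>2 * cmod (h m)) * ((wt (n - m))\<^sup>2 * cmod (?b (n - m)))) lat)"
    using Suc.prems by (intro sum_mono step) auto
  also have "\<dots> = infsum (\<lambda>m. \<Sum>n\<in>F. ((wt m)\<^sup>2 * cmod (h m)) * ((wt (n - m))\<^sup>2 * cmod (?b (n - m)))) lat"
    by (rule infsumI[symmetric]) (intro has_sum_finite_sum has_sum_infsum S)
  also have "\<dots> \<le> infsum (\<lambda>m. ((wt m)\<^sup>2 * cmod (h m)) * ?K ^ j) lat"
  proof (rule infsum_mono)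
    show "(\<lambda>m. \<Sum>n\<in>F. ((wt m)\<^sup>2 * cmod (h m)) * ((wt (n - m))\<^sup>2 * cmod (?b (n - m)))) summable_on lat"
      unfolding summable_on_def by (rule exI, rule has_sum_finite_sum, rule has_sum_infsum, rule S)
    show "(\<lambda>m. ((wt m)\<^sup>2 * cmod (h m)) * ?K ^ j) summable_on lat"
      using assms(1) unfolding lw_def by (rule summable_on_cmult_left)
    fix m assume m: "m \<in> lat"
    have inj: "inj_on (\<lambda>n. n - m) F" by (auto simp: inj_on_def)
    have "(\<Sum>n\<in>F. (wt (n - m))\<^sup>2 * cmod (?b (n - m))) = (\<Sum>n\<in>(\<lambda>n. n - m) ` F. (wt n)\<^sup>2 * cmod (?b n))"
      by (simp add: sum.reindex[OF inj])
    also have "\<dots> \<le> ?K ^ j" using Suc.prems m by (intro Suc.IH) auto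
    finally show "(\<Sum>n\<in>F. ((wt m)\<^sup>2 * cmod (h m)) * ((wt (n - m))\<^sup>2 * cmod (?b (n - m)))) \<le> ((wt m)\<^sup>2 * cmod (h m)) * ?K ^ j"
      unfolding sum_distrib_left[symmetric] by (intro mult_left_mono) auto
  qed
  also have "\<dots> = ?K ^ Suc j" by (simp add: infsum_cmult_left')
  finally show ?case .
qed

lemma lw_texp:
  assumes "lw h"
  shows "lw (texp \<theta> h)"
  unfolding lw_def
proof (rule nonneg_bdd_above_summable_on)
  let ?K = "infsum (\<lambda>m. (wt m)\<^sup>2 * cmod (h m)) lat"
  note l1 = lw_l1[OF assms]
  have "(\<Sum>n\<in>F. (wt n)\<^sup>2 * cmod (texp \<theta> h n)) \<le> exp ?K" if F: "finite F" "F \<subseteq> lat" for F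
  proof -
    have b: "(wt n)\<^sup>2 * cmod (tpow \<theta> h j n) \<le> ?K ^ j" if "n \<in> F" for n j
      using tpow_weight[OF assms, of "{n}"] F that by auto
    have eK: "(\<lambda>j. ?K ^ j / fact j) sums exp ?K"
      using exp_converges[of ?K] by (simp add: field_simps)
    have sj: "summable (\<lambda>j. (wt n)\<^sup>2 * cmod (tpow \<theta> h j n) / fact j)" if n: "n \<in> F" for n
      by (rule summable_comparison_test'[OF sums_summable[OF eK], of 0])
         (use b[OF n] in \<open>auto simp: norm_mult intro!: divide_right_mono\<close>)
    have sj': "summable (\<lambda>j. cmod (tpow \<theta> h j n / of_nat (fact j)))" if n: "n \<in> F" for n
    proof -
      have "summable (\<lambda>j. inverse ((wt n)\<^sup>2) * ((wt n)\<^sup>2 * cmod (tpow \<theta> h j n) / fact j))"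
        by (rule summable_mult[OF sj[OF n]])
      moreover have "wt n \<noteq> 0" using wt_ge1[of n] by auto
      ultimately show ?thesis by (simp add: norm_divide field_simps)
    qed
    have "(\<Sum>n\<in>F. (wt n)\<^sup>2 * cmod (texp \<theta> h n)) \<le> (\<Sum>n\<in>F. \<Sum>j. (wt n)\<^sup>2 * cmod (tpow \<theta> h j n) / fact j)"
    proof (rule sum_mono)
      fix n assume n: "n \<in> F"
      have "cmod (texp \<theta> h n) \<le> (\<Sum>j. cmod (tpow \<theta> h j n / of_nat (fact j)))"
        unfolding texp_def by (rule summable_norm[OF sj'[OF n]])
      hence "(wt n)\<^sup>2 * cmod (texp \<theta> h n) \<le> (wt n)\<^sup>2 * (\<Sum>j. cmod (tpow \<theta> h j n / of_nat (fact j)))"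
        by (intro mult_left_mono) auto
      also have "\<dots> = (\<Sum>j. (wt n)\<^sup>2 * cmod (tpow \<theta> h j n / of_nat (fact j)))"
        by (rule suminf_mult[OF sj'[OF n], symmetric])
      finally show "(wt n)\<^sup>2 * cmod (texp \<theta> h n) \<le> (\<Sum>j. (wt n)\<^sup>2 * cmod (tpow \<theta> h j n) / fact j)"
        by (simp add: norm_divide)
    qed
    also have "\<dots> = (\<Sum>j. \<Sum>n\<in>F. (wt n)\<^sup>2 * cmod (tpow \<theta> h j n) / fact j)"
      by (rule suminf_sum[symmetric]) (rule sj)
    also have "\<dots> \<le> (\<Sum>j. ?K ^ j / fact j)"
    proof (rule suminf_le)
      show "(\<Sum>n\<in>F. (wt n)\<^sup>2 * cmod (tpow \<theta> h j n) / fact j) \<le> ?K ^ j / fact j" for j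
        unfolding sum_divide_distrib[symmetric]
        by (intro divide_right_mono tpow_weight assms F) auto
    qed (auto intro!: summable_sum sj sums_summable[OF eK])
    also have "\<dots> = exp ?K" using eK by (rule sums_unique[symmetric])
    finally show ?thesis .
  qed
  thus "bdd_above (sum (\<lambda>m. (wt m)\<^sup>2 * cmod (texp \<theta> h m)) ` {F. F \<subseteq> lat \<and> finite F})"
    by (auto simp: bdd_above_def)
qed auto

text \<open>Both operators commute with complex scalars and with all right translations, and both
  send \<open>bas 0\<close> to the coefficient vector of the exponential. Right translation carries
  \<open>bas 0\<close> to every basis vector, so they agree everywhere.\<close>

lemma T_texp:
  assumes "lw h"
  shows "ap (exp (mkop (T \<theta> h))) = T \<theta> (texp \<theta> h)"
proof
  fix x
  note l1 = lw_l1[OF assms] and l1k = lw_l1[OF lw_texp[OF assms]]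
  let ?A = "mkop (T \<theta> h)"
  have A: "ap ?A = T \<theta> h" by (rule ap_mkop[OF bl_T[OF l1]])
  have comm_cs: "ap (exp ?A) (cs c x) = cs c (ap (exp ?A) x)" for c x
  proof -
    have "?A * mkop (cs c) = mkop (cs c) * ?A"
      by (rule bop_eq_apI) (simp add: A ap_mkop[OF bounded_linear_cs] T_cs[OF l1])
    from exp_commute_op[OF this] have "ap (exp ?A * mkop (cs c)) x = ap (mkop (cs c) * exp ?A) x" by simp
    thus ?thesis by (simp add: ap_mkop[OF bounded_linear_cs])
  qed
  have comm_R: "ap (exp ?A) (R \<theta> n x) = R \<theta> n (ap (exp ?A) x)" if n: "n \<in> lat" for n x
  proof -
    have "?A * mkop (R \<theta> n) = mkop (R \<theta> n) * ?A"
      by (rule bop_eq_apI) (simp add: A ap_mkop[OF bl_R[OF n]] T_R[OF l1 n])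
    from exp_commute_op[OF this] have "ap (exp ?A * mkop (R \<theta> n)) x = ap (mkop (R \<theta> n) * exp ?A) x" by simp
    thus ?thesis by (simp add: ap_mkop[OF bl_R[OF n]])
  qed
  have 0: "T \<theta> (texp \<theta> h) (bas 0) = ap (exp ?A) (bas 0)"
  proof (rule hil_eqI)
    fix n :: "nat \<Rightarrow> int" assume n: "n \<in> lat"
    have "((\<lambda>m. texp \<theta> h m * (phase \<theta> m (n - m) * co (bas 0) (n - m))) has_sum texp \<theta> h n) lat"
      by (rule has_sum_finite_neutralI[where B = "{n}"]) (use n in auto)
    hence "co (T \<theta> (texp \<theta> h) (bas 0)) n = texp \<theta> h n"
      using co_T_has_sum[OF l1k, where \<theta> = \<theta> and n = n and x = "bas 0"] has_sum_unique by blast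
    thus "co (T \<theta> (texp \<theta> h) (bas 0)) n = co (ap (exp ?A) (bas 0)) n"
      by (simp add: texp_co[OF l1])
  qed
  show "ap (exp ?A) x = T \<theta> (texp \<theta> h) x"
  proof (rule bounded_clinear_eqI[OF bounded_linear_ap bl_T[OF l1k] comm_cs T_cs[OF l1k]])
    fix n :: "nat \<Rightarrow> int" assume n: "n \<in> lat"
    have "ap (exp ?A) (bas n) = ap (exp ?A) (R \<theta> n (bas 0))" by (simp add: R_bas n)
    also have "\<dots> = T \<theta> (texp \<theta> h) (R \<theta> n (bas 0))" by (simp add: comm_R n 0 T_R[OF l1k])
    finally show "ap (exp ?A) (bas n) = T \<theta> (texp \<theta> h) (bas n)" by (simp add: R_bas n)
  qed
qed

lemma inverse_square_int_sum_bounded: "\<exists>G. \<forall>S. finite S \<longrightarrow> (\<Sum>z\<in>S. 1 / (1 + \<bar>real_of_int z\<bar>)\<^sup>2) \<le> G"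
proof -
  have "summable (\<lambda>k. 1 / (real (Suc k))\<^sup>2)"
    using inverse_power_summable[of 2, where 'a = real] by (subst summable_Suc_iff) (simp add: divide_inverse)
  hence sm: "summable (\<lambda>k. 1 / (1 + real k)\<^sup>2)" by (simp add: add.commute)
  let ?G = "\<Sum>k. 1 / (1 + real k)\<^sup>2"
  have half: "(\<Sum>z\<in>S. 1 / (1 + \<bar>real_of_int z\<bar>)\<^sup>2) \<le> ?G" if "finite S" "inj_on (\<lambda>z. nat \<bar>z\<bar>) S" for S
  proof -
    have "(\<Sum>z\<in>S. 1 / (1 + \<bar>real_of_int z\<bar>)\<^sup>2) = (\<Sum>k\<in>(\<lambda>z. nat \<bar>z\<bar>) ` S. 1 / (1 + real k)\<^sup>2)"
      by (simp add: sum.reindex[OF that(2)])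
    also have "\<dots> \<le> ?G" by (intro sum_le_suminf sm) (use that in auto)
    finally show ?thesis .
  qed
  have "(\<Sum>z\<in>S. 1 / (1 + \<bar>real_of_int z\<bar>)\<^sup>2) \<le> ?G + ?G" if S: "finite S" for S
  proof -
    have "(\<Sum>z\<in>S. 1 / (1 + \<bar>real_of_int z\<bar>)\<^sup>2) = (\<Sum>z\<in>{z\<in>S. z \<ge> 0} \<union> {z\<in>S. z < 0}. 1 / (1 + \<bar>real_of_int z\<bar>)\<^sup>2)"
      by (intro sum.cong) auto
    also have "\<dots> = (\<Sum>z\<in>{z\<in>S. z \<ge> 0}. 1 / (1 + \<bar>real_of_int z\<bar>)\<^sup>2) + (\<Sum>z\<in>{z\<in>S. z < 0}. 1 / (1 + \<bar>real_of_int z\<bar>)\<^sup>2)"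
      using S by (intro sum.union_disjoint) auto
    also have "\<dots> \<le> ?G + ?G" using S by (intro add_mono half) (auto simp: inj_on_def)
    finally show ?thesis .
  qed
  thus ?thesis by blast
qed

lemma smooth_lw:
  assumes "h \<in> smooth"
  shows "lw h"
proof -
  \<comment> \<open>The exponent 10 splits as 2 for the weight in \<open>lw\<close> and 8 for four
    factors \<open>(1 + \<bar>m i\<bar>)^(-2)\<close>, one in each coordinate.\<close>
  obtain C where C: "\<And>m. m \<in> lat \<Longrightarrow> wt m ^ 10 * cmod (h m) \<le> C"
    using assms unfolding smooth_def wt_def by blast
  obtain G where G: "\<And>S. finite S \<Longrightarrow> (\<Sum>z\<in>S. 1 / (1 + \<bar>real_of_int z\<bar>)\<^sup>2) \<le> G"
    using inverse_square_int_sum_bounded by blast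
  have C0: "C \<ge> 0"
    using C[of 0] wt_ge1[of 0] by (meson lat_zero mult_nonneg_nonneg norm_ge_zero order_trans zero_le_one zero_le_power)
  let ?g = "\<lambda>z. 1 / (1 + \<bar>real_of_int z\<bar>)\<^sup>2"
  have pt: "(wt m)\<^sup>2 * cmod (h m) \<le> C * (\<Prod>i\<in>{1..4}. ?g (m i))" if m: "m \<in> lat" for m
  proof -
    have w: "wt m > 0" using wt_ge1[of m] by linarith
    have "(\<Prod>i\<in>{1..4::nat}. (1 + \<bar>real_of_int (m i)\<bar>)\<^sup>2) \<le> (\<Prod>i\<in>{1..4::nat}. (wt m)\<^sup>2)"
    proof (rule prod_mono, intro conjI power_mono)
      fix i :: nat assume i: "i \<in> {1..4}"
      show "1 + \<bar>real_of_int (m i)\<bar> \<le> wt m"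
        unfolding wt_alt using member_le_sum[OF i, of "\<lambda>i. \<bar>real_of_int (m i)\<bar>"] by simp
    qed auto
    also have "\<dots> = wt m ^ 8" by (simp flip: power_mult)
    finally have le: "(\<Prod>i\<in>{1..4::nat}. (1 + \<bar>real_of_int (m i)\<bar>)\<^sup>2) \<le> wt m ^ 8" .
    have pos: "(\<Prod>i\<in>{1..4::nat}. (1 + \<bar>real_of_int (m i)\<bar>)\<^sup>2) > 0" by (intro prod_pos) (auto intro!: zero_less_power)
    have "(wt m)\<^sup>2 * cmod (h m) * wt m ^ 8 \<le> C"
      using C[OF m] by (simp add: mult_ac power_add[symmetric] flip: power_add)
    hence "(wt m)\<^sup>2 * cmod (h m) * (\<Prod>i\<in>{1..4::nat}. (1 + \<bar>real_of_int (m i)\<bar>)\<^sup>2) \<le> C"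
      using mult_left_mono[OF le, of "(wt m)\<^sup>2 * cmod (h m)"] by simp
    hence "(wt m)\<^sup>2 * cmod (h m) \<le> C / (\<Prod>i\<in>{1..4::nat}. (1 + \<bar>real_of_int (m i)\<bar>)\<^sup>2)"
      using pos by (simp add: field_simps)
    thus ?thesis by (simp add: prod_dividef)
  qed
  show ?thesis unfolding lw_def
  proof (rule nonneg_bdd_above_summable_on)
    have "(\<Sum>m\<in>F. (wt m)\<^sup>2 * cmod (h m)) \<le> C * G ^ 4" if F: "finite F" "F \<subseteq> lat" for F
    proof -
      \<comment> \<open>All coordinates that occur in \<open>F\<close>. Restriction embeds
        \<open>F\<close> into the box over \<open>S\<close>, where the sum of products factors into
        one-dimensional sums.\<close>
      define S where "S = (\<Union>m\<in>F. m ` {1..4::nat})"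
      have fS: "finite S" using F by (auto simp: S_def)
      have inj: "inj_on (\<lambda>m. restrict m {1..4::nat}) F"
      proof (rule inj_onI)
        fix m n assume mn: "m \<in> F" "n \<in> F" "restrict m {1..4} = restrict n {1..4}"
        show "m = n"
        proof
          fix i show "m i = n i"
          proof (cases "i \<in> {1..4}")
            case True
            thus ?thesis using fun_cong[OF mn(3), of i] by (simp only: restrict_def if_True)
          next
            case False
            moreover have "m \<in> lat" "n \<in> lat" using mn F by auto
            ultimately show ?thesis unfolding lat_def by simp
          qed
        qed
      qed
      have "(\<Sum>m\<in>F. (wt m)\<^sup>2 * cmod (h m)) \<le> (\<Sum>m\<in>F. C * (\<Prod>i\<in>{1..4}. ?g (m i)))"
        using F by (intro sum_mono pt) auto
      also have "\<dots> = C * (\<Sum>m\<in>F. \<Prod>i\<in>{1..4}. ?g (restrict m {1..4} i))"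
        by (simp add: sum_distrib_left)
      also have "(\<Sum>m\<in>F. \<Prod>i\<in>{1..4}. ?g (restrict m {1..4} i)) =
          (\<Sum>f\<in>(\<lambda>m. restrict m {1..4}) ` F. \<Prod>i\<in>{1..4}. ?g (f i))"
        by (simp only: sum.reindex[OF inj] o_def)
      also have "\<dots> \<le> (\<Sum>f\<in>PiE {1..4::nat} (\<lambda>_. S). \<Prod>i\<in>{1..4}. ?g (f i))"
        by (rule sum_mono2) (auto simp: S_def F intro!: finite_PiE prod_nonneg)
      also have "\<dots> = (\<Prod>i\<in>{1..4::nat}. \<Sum>z\<in>S. ?g z)"
        by (rule prod_sum_PiE[symmetric]) (use fS in auto)
      also have "\<dots> \<le> (\<Prod>i\<in>{1..4::nat}. G)"
        by (intro prod_mono conjI G fS sum_nonneg) auto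
      finally show ?thesis using C0 by (simp add: mult_left_mono)
    qed
    thus "bdd_above (sum (\<lambda>m. (wt m)\<^sup>2 * cmod (h m)) ` {F. F \<subseteq> lat \<and> finite F})"
      by (auto simp: bdd_above_def)
  qed auto
qed

section \<open>Leibniz rule, commutators and the Sobolev domain\<close>

lemma wt_le_sq: "wt m \<le> (wt m)\<^sup>2"
  using mult_left_mono[OF wt_ge1[of m], of "wt m"] wt_ge1[of m] by (simp add: power2_eq_square)

lemma mdomI:
  assumes "\<And>n. n \<in> lat \<Longrightarrow> of_real (g n) * co x n = co y n"
  shows "x \<in> mdom g" "mlt g x = y"
proof -
  have e: "(\<lambda>n. of_real (g n) * co x n) = co y"
    by (rule ext) (metis assms co_off mult_zero_right)
  show "x \<in> mdom g" using co[of y] by (simp only: mdom_def mem_Collect_eq e)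
  show "mlt g x = y" unfolding mlt_def e by (simp add: co_inverse)
qed

abbreviation D :: "nat \<Rightarrow> hil \<Rightarrow> hil" where "D i \<equiv> mlt (\<lambda>n. of_int (n i))"
abbreviation Ddom :: "nat \<Rightarrow> hil set" where "Ddom i \<equiv> mdom (\<lambda>n. of_int (n i))"

text \<open>Coefficientwise this is the splitting of the coordinate \<open>n i\<close> into
  \<open>m i\<close> and \<open>(n - m) i\<close> inside the convolution sum.\<close>

lemma T_deriv:
  assumes "l1 a" "l1 (delta i a)" "x \<in> Ddom i"
  shows "T \<theta> a x \<in> Ddom i" "D i (T \<theta> a x) = T \<theta> a (D i x) + T \<theta> (delta i a) x"
proof -
  have *: "of_real (of_int (n i)) * co (T \<theta> a x) n = co (T \<theta> a (D i x) + T \<theta> (delta i a) x) n" for n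
  proof -
    have "((\<lambda>m. of_int (n i) * (a m * (phase \<theta> m (n - m) * co x (n - m)))) has_sum
        of_int (n i) * co (T \<theta> a x) n) lat"
      by (rule has_sum_cmult_right[OF co_T_has_sum[OF assms(1)]])
    moreover have "((\<lambda>m. a m * (phase \<theta> m (n - m) * co (D i x) (n - m)) +
        delta i a m * (phase \<theta> m (n - m) * co x (n - m))) has_sum
        co (T \<theta> a (D i x)) n + co (T \<theta> (delta i a) x) n) lat"
      by (rule has_sum_add[OF co_T_has_sum[OF assms(1)] co_T_has_sum[OF assms(2)]])
    moreover have "a m * (phase \<theta> m (n - m) * co (D i x) (n - m)) +
        delta i a m * (phase \<theta> m (n - m) * co x (n - m)) =
        of_int (n i) * (a m * (phase \<theta> m (n - m) * co x (n - m)))" for m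
      by (simp add: co_mlt[OF assms(3)] delta_def algebra_simps)
    ultimately show ?thesis using has_sum_unique by fastforce
  qed
  show "T \<theta> a x \<in> Ddom i" "D i (T \<theta> a x) = T \<theta> a (D i x) + T \<theta> (delta i a) x"
    using mdomI[of "\<lambda>n. of_int (n i)", OF *] by auto
qed

text \<open>The commutator of multiplication by \<open>g\<close> with \<open>U^m\<close> is
  \<open>U^m\<close> weighted by the difference \<open>g n - g (n - m)\<close>, of size at most
  \<open>l * nn m\<close>. The factor \<open>nn m\<close> is absorbed by the weight, and the sum
  over \<open>m\<close> converges in norm although \<open>g\<close> may be unbounded.\<close>

lemma T_commutator:
  assumes "lw a" "x \<in> mdom g" and lip: "\<And>m n. m \<in> lat \<Longrightarrow> n \<in> lat \<Longrightarrow> \<bar>g n - g m\<bar> \<le> l * nn (n - m)"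
    and l: "l \<ge> 0"
  shows "T \<theta> a x \<in> mdom g"
    "norm (mlt g (T \<theta> a x) - T \<theta> a (mlt g x)) \<le> l * infsum (\<lambda>m. (wt m)\<^sup>2 * cmod (a m)) lat * norm x"
proof -
  note l1 = lw_l1[OF assms(1)]
  \<comment> \<open>The case distinction makes the multiplier bounded on all indices, since the
    Lipschitz condition is available on the lattice only.\<close>
  define w where "w m = mlt (\<lambda>n. if n \<in> lat then g n - g (n - m) else 0) (V \<theta> m x)" for m
  have wb: "\<bar>if n \<in> lat then g n - g (n - m) else 0\<bar> \<le> l * nn m" if "m \<in> lat" for n m
  proof (cases "n \<in> lat")
    case True
    thus ?thesis using lip[of "n - m" n] that by simp
  qed (use l in simp)
  have co_w: "co (w m) n = of_real (g n - g (n - m)) * (phase \<theta> m (n - m) * co x (n - m))" if "m \<in> lat" for m n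
  proof (cases "n \<in> lat")
    case True
    thus ?thesis unfolding w_def using mdom_bounded[OF wb[OF that]] that by (simp add: co_mlt co_V)
  next
    case False
    thus ?thesis using that by (simp add: co_off lat_diff_iff)
  qed
  have nw: "norm (w m) \<le> l * nn m * norm x" if "m \<in> lat" for m
    using mlt_norm_le[OF wb[OF that], where x = "V \<theta> m x"] that unfolding w_def by simp
  have nw': "norm (cs (a m) (w m)) \<le> l * norm x * ((wt m)\<^sup>2 * cmod (a m))" if "m \<in> lat" for m
  proof -
    have "nn m \<le> (wt m)\<^sup>2" using nn_le_wt[of m] wt_le_sq[of m] by linarith
    hence "l * nn m * norm x \<le> l * (wt m)\<^sup>2 * norm x" by (intro mult_right_mono mult_left_mono l) auto
    hence "cmod (a m) * norm (w m) \<le> cmod (a m) * (l * (wt m)\<^sup>2 * norm x)"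
      using nw[OF that] by (intro mult_left_mono) auto
    thus ?thesis by (simp add: mult_ac)
  qed
  have sb: "(\<lambda>m. l * norm x * ((wt m)\<^sup>2 * cmod (a m))) summable_on lat"
    using assms(1) unfolding lw_def by (rule summable_on_cmult_right)
  have sw: "(\<lambda>m. norm (cs (a m) (w m))) summable_on lat"
    by (rule summable_on_comparison_test[OF sb]) (use nw' in auto)
  define y where "y = infsum (\<lambda>m. cs (a m) (w m)) lat"
  have hy: "((\<lambda>m. cs (a m) (w m)) has_sum y) lat"
    unfolding y_def by (rule has_sum_infsum[OF abs_summable_summable[OF sw]])
  have "norm y \<le> infsum (\<lambda>m. norm (cs (a m) (w m))) lat"
    unfolding y_def by (rule norm_infsum_bound[OF sw])
  also have "\<dots> \<le> infsum (\<lambda>m. l * norm x * ((wt m)\<^sup>2 * cmod (a m))) lat"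
    by (rule infsum_mono[OF sw sb nw'])
  also have "\<dots> = l * infsum (\<lambda>m. (wt m)\<^sup>2 * cmod (a m)) lat * norm x"
    by (subst infsum_cmult_right') simp
  finally have ny: "norm y \<le> l * infsum (\<lambda>m. (wt m)\<^sup>2 * cmod (a m)) lat * norm x" .
  have *: "of_real (g n) * co (T \<theta> a x) n = co (T \<theta> a (mlt g x) + y) n" for n
  proof -
    have "((\<lambda>m. co (cs (a m) (w m)) n) has_sum co y n) lat"
      by (rule has_sum_bounded_linear[OF bounded_linear_co hy])
    hence "((\<lambda>m. a m * (of_real (g n - g (n - m)) * (phase \<theta> m (n - m) * co x (n - m)))) has_sum co y n) lat"
      by (rule has_sum_cong[THEN iffD1, rotated]) (simp add: co_w)
    hence "((\<lambda>m. a m * (phase \<theta> m (n - m) * co (mlt g x) (n - m)) +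
        a m * (of_real (g n - g (n - m)) * (phase \<theta> m (n - m) * co x (n - m)))) has_sum
        co (T \<theta> a (mlt g x)) n + co y n) lat"
      by (rule has_sum_add[OF co_T_has_sum[OF l1]])
    moreover have "((\<lambda>m. of_real (g n) * (a m * (phase \<theta> m (n - m) * co x (n - m)))) has_sum
        of_real (g n) * co (T \<theta> a x) n) lat"
      by (rule has_sum_cmult_right[OF co_T_has_sum[OF l1]])
    moreover have "a m * (phase \<theta> m (n - m) * co (mlt g x) (n - m)) +
        a m * (of_real (g n - g (n - m)) * (phase \<theta> m (n - m) * co x (n - m))) =
        of_real (g n) * (a m * (phase \<theta> m (n - m) * co x (n - m)))" for m
      by (simp add: co_mlt[OF assms(2)] algebra_simps)
    ultimately show ?thesis using has_sum_unique by fastforce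
  qed
  have m: "T \<theta> a x \<in> mdom g" "mlt g (T \<theta> a x) = T \<theta> a (mlt g x) + y"
    using mdomI[of g, OF *] by auto
  show "T \<theta> a x \<in> mdom g" by fact
  show "norm (mlt g (T \<theta> a x) - T \<theta> a (mlt g x)) \<le> l * infsum (\<lambda>m. (wt m)\<^sup>2 * cmod (a m)) lat * norm x"
    using ny by (simp add: m(2))
qed

text \<open>The Sobolev space of order 2. It will turn out to be exactly the domain of the closed
  Laplacian.\<close>

definition H2 :: "hil set" where "H2 = mdom (\<lambda>n. (nn n)\<^sup>2)"
abbreviation Lm :: "hil \<Rightarrow> hil" where "Lm \<equiv> mlt nn"
abbreviation Lm2 :: "hil \<Rightarrow> hil" where "Lm2 \<equiv> mlt (\<lambda>n. (nn n)\<^sup>2)"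

lemma one_plus_sq: "x \<le> 1 + (x::real)\<^sup>2"
proof -
  have "(x - 1/2)\<^sup>2 = x\<^sup>2 - x + 1/4" by (simp add: power2_eq_square field_simps)
  thus ?thesis using zero_le_power2[of "x - 1/2"] by linarith
qed

lemma H2_nn: "x \<in> H2 \<Longrightarrow> x \<in> mdom nn"
  unfolding H2_def by (rule mdom_comparison[where C = 1]) (auto simp: one_plus_sq)
lemma H2_Lm: "x \<in> H2 \<Longrightarrow> Lm x \<in> mdom nn" "x \<in> H2 \<Longrightarrow> Lm (Lm x) = Lm2 x"
  using mlt_mlt[of x nn nn] H2_nn by (auto simp: H2_def power2_eq_square)
lemma nn_Ddom: "x \<in> mdom nn \<Longrightarrow> i \<in> {1..4} \<Longrightarrow> x \<in> Ddom i"
proof (rule mdom_comparison[where C = 1 and g = nn])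
  assume i: "i \<in> {1..4}"
  show "\<bar>real_of_int (n i)\<bar> \<le> 1 * (1 + \<bar>nn n\<bar>)" for n
  proof -
    have "\<bar>real_of_int (n i)\<bar> \<le> 1 + nn n" using nn_coord[OF i, of n] by linarith
    thus ?thesis by simp
  qed
qed
lemma H2_Ddom: "x \<in> H2 \<Longrightarrow> i \<in> {1..4} \<Longrightarrow> x \<in> Ddom i"
  by (intro nn_Ddom H2_nn)
lemma coord_sq_le: "i \<in> {1..4} \<Longrightarrow> (of_int (n i))\<^sup>2 \<le> (nn n)\<^sup>2"
  using power_mono[OF nn_coord[of i n] abs_ge_zero, of 2] by simp
lemma H2_D:
  assumes "x \<in> H2" "i \<in> {1..4}"
  shows "D i x \<in> Ddom i" "D i (D i x) = mlt (\<lambda>n. (of_int (n i))\<^sup>2) x"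
proof -
  have "x \<in> mdom (\<lambda>n. of_int (n i) * of_int (n i))"
  proof (rule mdom_comparison[where C = 1 and g = "\<lambda>n. (nn n)\<^sup>2"])
    show "x \<in> mdom (\<lambda>n. (nn n)\<^sup>2)" using assms(1) by (simp add: H2_def)
    show "\<bar>real_of_int (n i) * real_of_int (n i)\<bar> \<le> 1 * (1 + \<bar>(nn n)\<^sup>2\<bar>)" for n
    proof -
      have "\<bar>real_of_int (n i) * real_of_int (n i)\<bar> = (real_of_int (n i))\<^sup>2"
        unfolding power2_eq_square by (rule abs_of_nonneg) simp
      hence "\<bar>real_of_int (n i) * real_of_int (n i)\<bar> \<le> 1 + (nn n)\<^sup>2"
        using coord_sq_le[OF assms(2), of n] by linarith
      thus ?thesis by simp
    qed
  qed
  from mlt_mlt[OF H2_Ddom[OF assms] this]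
  show "D i x \<in> Ddom i" "D i (D i x) = mlt (\<lambda>n. (of_int (n i))\<^sup>2) x" by (auto simp: power2_eq_square)
qed

lemma H2_D_sum: "x \<in> H2 \<Longrightarrow> (\<Sum>i\<in>{1..4}. D i (D i x)) = Lm2 x"
proof (rule hil_eqI)
  fix n :: "nat \<Rightarrow> int" assume x: "x \<in> H2"
  have "co (\<Sum>i\<in>{1..4}. D i (D i x)) n = (\<Sum>i\<in>{1..4}. of_int (n i) * (of_int (n i) * co x n))"
    unfolding co_sum
  proof (rule sum.cong)
    fix i :: nat assume i: "i \<in> {1..4}"
    show "co (D i (D i x)) n = of_int (n i) * (of_int (n i) * co x n)"
      using H2_D(1)[OF x i] H2_Ddom[OF x i] by (simp add: co_mlt)
  qed simp
  also have "\<dots> = of_real ((nn n)\<^sup>2) * co x n"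
    unfolding nn_sq by (simp add: sum_distrib_right power2_eq_square mult.assoc)
  finally show "co (\<Sum>i\<in>{1..4}. D i (D i x)) n = co (Lm2 x) n"
    using x by (simp add: co_mlt H2_def)
qed

lemma D_norm_le: "x \<in> mdom nn \<Longrightarrow> i \<in> {1..4} \<Longrightarrow> norm (D i x) \<le> norm (Lm x)"
proof -
  assume x: "x \<in> mdom nn" and i: "i \<in> {1..4}"
  have "norm (D i x) \<le> 1 * norm (Lm x)"
  proof (rule norm_comparison)
    fix n
    have "\<bar>real_of_int (n i)\<bar> * cmod (co x n) \<le> nn n * cmod (co x n)"
      by (intro mult_right_mono nn_coord i) auto
    thus "cmod (co (D i x) n) \<le> 1 * cmod (co (Lm x) n)"
      by (simp add: co_mlt[OF x] co_mlt[OF nn_Ddom[OF x i]] norm_mult)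
  qed simp
  thus ?thesis by simp
qed

lemma nn_lipschitz: "\<bar>nn n - nn m\<bar> \<le> nn (n - m)"
proof -
  have u: "nn (- n) = nn n" for n by (simp add: nn_def L2_set_def)
  have "nn n \<le> nn (n - m) + nn m" using nn_triangle[of "n - m" m] by (simp add: fun_diff_def)
  moreover have "nn m \<le> nn (m - n) + nn n" using nn_triangle[of "m - n" n] by (simp add: fun_diff_def)
  moreover have "nn (m - n) = nn (n - m)" using u[of "n - m"] by simp
  ultimately show ?thesis by linarith
qed

lemma H2_add: "x \<in> H2 \<Longrightarrow> y \<in> H2 \<Longrightarrow> x + y \<in> H2" unfolding H2_def by (rule mdom_add)
lemma H2_diff: "x \<in> H2 \<Longrightarrow> y \<in> H2 \<Longrightarrow> x - y \<in> H2" unfolding H2_def by (rule mdom_diff)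
lemma H2_cs: "x \<in> H2 \<Longrightarrow> cs c x \<in> H2" unfolding H2_def by (rule mdom_cs)
lemma H2_sum: "(\<And>i. i \<in> A \<Longrightarrow> f i \<in> H2) \<Longrightarrow> (\<Sum>i\<in>A. f i) \<in> H2" unfolding H2_def by (rule mdom_sum)

lemma mdom_finite_support:
  assumes "\<And>n. n \<in> lat \<Longrightarrow> nn n > r \<Longrightarrow> co x n = 0"
  shows "x \<in> mdom g"
  unfolding mdom_def mem_Collect_eq
proof (rule finite_support_H0[OF finite_nn_ball[of r]])
  fix n assume "n \<notin> {n \<in> lat. nn n \<le> r}"
  hence "co x n = 0" using assms[of n] by (cases "n \<in> lat") (auto simp: co_off)
  thus "complex_of_real (g n) * co x n = 0" by simp
qed (simp add: co_off)

lemma trunc_H2: "trunc r x \<in> H2"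
  unfolding H2_def by (rule mdom_finite_support[where r = r]) (simp add: co_trunc)

section \<open>The perturbed Laplacian\<close>

locale nct =
  fixes \<theta> :: "nat \<Rightarrow> nat \<Rightarrow> real" and h :: "(nat \<Rightarrow> int) \<Rightarrow> complex"
  assumes h_smooth: "h \<in> smooth" and h_star: "tstar \<theta> h = h"
begin

definition "A = mkop (T \<theta> h)"
definition "X = T \<theta> (texp \<theta> h)"
definition "X' = T \<theta> (texp \<theta> (\<lambda>n. - h n))"

lemma lw_h: "lw h" by (rule smooth_lw[OF h_smooth])
lemma l1_h: "l1 h" by (rule lw_l1[OF lw_h])
lemma ap_A: "ap A = T \<theta> h" unfolding A_def by (rule ap_mkop[OF bl_T[OF l1_h]])

lemma mkop_scale: "mkop (T \<theta> (\<lambda>n. of_real r * h n)) = scaleR r A"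
proof (rule bop_eq_apI)
  fix x
  have "l1 (\<lambda>n. of_real r * h n)"
    using summable_on_cmult_right[OF l1_h, of "\<bar>r\<bar>"] by (simp add: norm_mult)
  thus "ap (mkop (T \<theta> (\<lambda>n. of_real r * h n))) x = ap (scaleR r A) x"
    by (simp add: ap_mkop bl_T T_scale l1_h ap_scaleR_op ap_A scaleR_cs)
qed

lemma lw_scale: "lw (\<lambda>n. of_real r * h n)"
  using summable_on_cmult_right[OF lw_h[unfolded lw_def], of "\<bar>r\<bar>"]
  by (simp add: lw_def norm_mult mult_ac)

lemma lw_minus: "lw (\<lambda>n. - h n)" using lw_scale[of "-1"] by simp
lemma mkop_minus: "mkop (T \<theta> (\<lambda>n. - h n)) = - A" using mkop_scale[of "-1"] by simp

lemma X_exp: "X = ap (exp A)" unfolding X_def A_def by (rule T_texp[OF lw_h, symmetric])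
lemma X'_exp: "X' = ap (exp (- A))"
  unfolding X'_def mkop_minus[symmetric] by (rule T_texp[OF lw_minus, symmetric])

lemma lw_k: "lw (texp \<theta> h)" by (rule lw_texp[OF lw_h])
lemma lw_k': "lw (texp \<theta> (\<lambda>n. - h n))" by (rule lw_texp[OF lw_minus])

lemma X_X' [simp]: "X (X' x) = x" "X' (X x) = x"
  unfolding X_exp X'_exp ap_mult[symmetric] by (simp_all add: exp_minus_inverse) (metis exp_minus_inverse minus_minus ap_mult ap_one)

lemma bl_X: "bounded_linear X" unfolding X_exp by (rule bounded_linear_ap)
lemma bl_X': "bounded_linear X'" unfolding X'_exp by (rule bounded_linear_ap)

sublocale X: bounded_linear X by (rule bl_X)
sublocale X': bounded_linear X' by (rule bl_X')

lemma X_cs: "X (cs c x) = cs c (X x)" unfolding X_def by (rule T_cs[OF lw_l1[OF lw_k]])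
lemma X'_cs: "X' (cs c x) = cs c (X' x)" unfolding X'_def by (rule T_cs[OF lw_l1[OF lw_k']])

lemma A_selfadjoint: "cip (ap A x) y = cip x (ap A y)"
  unfolding ap_A by (rule T_selfadjoint[OF l1_h h_star])

lemma scaled_exp_selfadjoint: "cip (ap (exp (scaleR r A)) x) y = cip x (ap (exp (scaleR r A)) y)"
  by (rule exp_selfadjoint) (simp add: ap_scaleR_op cip_scaleR_left cip_scaleR_right A_selfadjoint)

lemma X_selfadjoint: "cip (X x) y = cip x (X y)"
  using scaled_exp_selfadjoint[of 1] by (simp add: X_exp)
lemma X'_selfadjoint: "cip (X' x) y = cip x (X' y)"
  using scaled_exp_selfadjoint[of "-1"] by (simp add: X'_exp)

lemma exp_half: "exp (scaleR (1/2) A) * exp (scaleR (1/2) A) = exp A"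
  by (subst exp_add_commuting[symmetric]) (simp_all flip: scaleR_add_left)

text \<open>Positivity comes from the square root \<open>exp (A / 2)\<close>: the form of
  \<open>X\<close> at \<open>x\<close> is the squared norm of \<open>exp (A / 2) x\<close>, and the
  inverse \<open>exp (- A / 2)\<close> bounds this from below.\<close>

lemma X_bounds: "\<exists>a b. 0 < a \<and> a \<le> b \<and> (\<forall>x. a * (norm x)\<^sup>2 \<le> Re (cip (X x) x) \<and> norm (X x) \<le> b * norm x)"
proof -
  let ?E = "exp (scaleR (1/2) A)" and ?E' = "exp (- scaleR (1/2) A)"
  define c where "c = norm ?E'"
  have c: "c > 0" unfolding c_def by (simp add: exp_not_eq_zero)
  have "(1 / c\<^sup>2) * (norm x)\<^sup>2 \<le> Re (cip (X x) x)" for x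
  proof -
    have "x = ap (?E' * ?E) x"
      using exp_minus_inverse[of "- scaleR (1/2) A"] by simp
    hence "norm x \<le> c * norm (ap ?E x)" using norm_ap[of ?E' "ap ?E x"] by (simp add: c_def)
    hence "(norm x)\<^sup>2 \<le> (c * norm (ap ?E x))\<^sup>2" by (intro power_mono) auto
    moreover have "cip (X x) x = cip (ap ?E x) (ap ?E x)"
      unfolding X_exp exp_half[symmetric] by (simp add: scaled_exp_selfadjoint)
    ultimately show ?thesis using c by (simp add: cip_self_norm power_mult_distrib field_simps)
  qed
  \<comment> \<open>The summand \<open>1 / c\<^sup>2\<close> enlarges the upper constant just to
    make it at least the lower one.\<close>
  moreover have "norm (X x) \<le> (norm (exp A) + 1 / c\<^sup>2) * norm x" for x
  proof -
    have "norm (X x) \<le> norm (exp A) * norm x" unfolding X_exp by (rule norm_ap)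
    also have "\<dots> \<le> (norm (exp A) + 1 / c\<^sup>2) * norm x" by (intro mult_right_mono) auto
    finally show ?thesis .
  qed
  ultimately show ?thesis using c by (intro exI[of _ "1/c\<^sup>2"] exI[of _ "norm (exp A) + 1 / c\<^sup>2"]) auto
qed

text \<open>The vector \<open>e^(-h)\<close>. Its squared norm is the constant
  \<open>phi0 (e^(-2h))\<close> of the theorem, by selfadjointness of \<open>X'\<close>.\<close>

definition "v = X' (bas 0)"
lemma X_v: "X v = bas 0" by (simp add: v_def)

lemma norm_v: "phi0 (texp \<theta> (\<lambda>m. - 2 * h m)) = of_real ((norm v)\<^sup>2)"
proof -
  have lw2: "lw (\<lambda>m. - 2 * h m)" using lw_scale[of "-2"] by simp
  have m2: "mkop (T \<theta> (\<lambda>m. - 2 * h m)) = - A + - A"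
    using mkop_scale[of "-2"] by (simp add: scaleR_2[symmetric])
  have "texp \<theta> (\<lambda>m. - 2 * h m) = co (ap (exp (- A + - A)) (bas 0))"
    by (simp only: texp_co[OF lw_l1[OF lw2]] m2)
  also have "exp (- A + - A) = exp (- A) * exp (- A)" by (rule exp_add_commuting) simp
  finally have "phi0 (texp \<theta> (\<lambda>m. - 2 * h m)) = co (X' v) 0"
    by (simp add: phi0_def v_def X'_exp zero_fun_def)
  also have "\<dots> = cip (X' v) (bas 0)" by (simp add: cip_bas)
  also have "\<dots> = cip v v" by (simp add: X'_selfadjoint v_def)
  finally show ?thesis by (simp add: cip_self_norm)
qed

lemma v_pos: "norm v > 0"
proof -
  have "bas 0 \<noteq> 0" using norm_bas[of 0] by (metis lat_zero norm_zero zero_neq_one)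
  hence "v \<noteq> 0" using X_v X.zero by auto
  thus ?thesis by simp
qed

lemma X_R: "n \<in> lat \<Longrightarrow> X (R \<theta> n x) = R \<theta> n (X x)"
  unfolding X_def by (rule T_R[OF lw_l1[OF lw_k]])

text \<open>One constant serves all multipliers and all Lipschitz constants, so the bound can be
  used for cutoffs at every scale \<open>sqrt lam\<close>.\<close>

lemma X_commutator: "\<exists>K\<ge>0. \<forall>g l x. (\<forall>m\<in>lat. \<forall>n\<in>lat. \<bar>g n - g m\<bar> \<le> l * nn (n - m)) \<longrightarrow> l \<ge> 0 \<longrightarrow> x \<in> mdom g \<longrightarrow>
   X x \<in> mdom g \<and> norm (mlt g (X x) - X (mlt g x)) \<le> K * l * norm x"
proof (intro exI[of _ "infsum (\<lambda>m. (wt m)\<^sup>2 * cmod (texp \<theta> h m)) lat"] conjI allI impI)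
  show "0 \<le> infsum (\<lambda>m. (wt m)\<^sup>2 * cmod (texp \<theta> h m)) lat" by (intro infsum_nonneg) auto
  fix g l x assume *: "\<forall>m\<in>lat. \<forall>n\<in>lat. \<bar>g n - g m\<bar> \<le> l * nn (n - m)" "0 \<le> l" "x \<in> mdom g"
  show "X x \<in> mdom g" unfolding X_def by (rule T_commutator(1)[OF lw_k]) (use * in auto)
  have "norm (mlt g (X x) - X (mlt g x)) \<le> l * infsum (\<lambda>m. (wt m)\<^sup>2 * cmod (texp \<theta> h m)) lat * norm x"
    unfolding X_def by (rule T_commutator(2)[OF lw_k]) (use * in auto)
  thus "norm (mlt g (X x) - X (mlt g x)) \<le> infsum (\<lambda>m. (wt m)\<^sup>2 * cmod (texp \<theta> h m)) lat * l * norm x"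
    by (simp add: mult_ac)
qed

definition P :: "hil \<Rightarrow> hil" where
  "P x = (\<Sum>i\<in>{1..4}. X (D i (X' (D i (X x)))))"

abbreviation "k \<equiv> texp \<theta> h"
abbreviation "k' \<equiv> texp \<theta> (\<lambda>n. - h n)"

lemma coord_wt: "i \<in> {1..4} \<Longrightarrow> \<bar>real_of_int (n i)\<bar> \<le> wt n"
  using nn_coord[of i n] nn_le_wt[of n] by linarith

lemma l1_delta: "lw a \<Longrightarrow> i \<in> {1..4} \<Longrightarrow> l1 (delta i a)"
proof (rule lw_comparison[where C = 1])
  fix m assume "lw a" and i: "i \<in> {1..4}"
  have "\<bar>real_of_int (m i)\<bar> \<le> (wt m)\<^sup>2"
    using coord_wt[OF i, of m] wt_le_sq[of m] by linarith
  thus "cmod (delta i a m) \<le> 1 * ((wt m)\<^sup>2 * cmod (a m))"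
    by (auto simp: delta_def norm_mult intro!: mult_right_mono)
qed auto

lemma l1_delta2: "lw a \<Longrightarrow> i \<in> {1..4} \<Longrightarrow> l1 (delta i (delta i a))"
proof (rule lw_comparison[where C = 1])
  fix m assume "lw a" and i: "i \<in> {1..4}"
  have "\<bar>real_of_int (m i)\<bar> * \<bar>real_of_int (m i)\<bar> \<le> (wt m)\<^sup>2"
    unfolding power2_eq_square using coord_wt[OF i, of m] wt_ge1[of m] by (intro mult_mono) auto
  hence "\<bar>real_of_int (m i)\<bar> * \<bar>real_of_int (m i)\<bar> * cmod (a m) \<le> (wt m)\<^sup>2 * cmod (a m)"
    by (rule mult_right_mono) auto
  thus "cmod (delta i (delta i a) m) \<le> 1 * ((wt m)\<^sup>2 * cmod (a m))"
    by (simp add: delta_def norm_mult mult.assoc)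
qed auto

lemma D_X:
  assumes "i \<in> {1..4}" "x \<in> Ddom i"
  shows "X x \<in> Ddom i" "D i (X x) = X (D i x) + T \<theta> (delta i k) x"
  unfolding X_def using T_deriv[OF lw_l1[OF lw_k] l1_delta[OF lw_k assms(1)] assms(2)] by auto
lemma D_X':
  assumes "i \<in> {1..4}" "x \<in> Ddom i"
  shows "X' x \<in> Ddom i" "D i (X' x) = X' (D i x) + T \<theta> (delta i k') x"
  unfolding X'_def using T_deriv[OF lw_l1[OF lw_k'] l1_delta[OF lw_k' assms(1)] assms(2)] by auto
lemma D_Tk:
  assumes "i \<in> {1..4}" "x \<in> Ddom i"
  shows "T \<theta> (delta i k) x \<in> Ddom i"
    "D i (T \<theta> (delta i k) x) = T \<theta> (delta i k) (D i x) + T \<theta> (delta i (delta i k)) x"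
  using T_deriv[OF l1_delta[OF lw_k assms(1)] l1_delta2[OF lw_k assms(1)] assms(2)] by auto

text \<open>At top order \<open>e^(-h)\<close> cancels \<open>e^h\<close>, so
  \<open>X' (D i (X x))\<close> is \<open>D i x\<close> plus a bounded operator applied to
  \<open>x\<close>. One more derivative is then covered by \<open>x \<in> H2\<close>, and at most
  two derivatives fall on the coefficients of \<open>k\<close>.\<close>

lemma P_domains:
  assumes i: "i \<in> {1..4}" and x: "x \<in> H2"
  shows "X x \<in> Ddom i" "X' (D i (X x)) = D i x + X' (T \<theta> (delta i k) x)" "X' (D i (X x)) \<in> Ddom i"
    "D i (X' (D i (X x))) = D i (D i x) + (X' (T \<theta> (delta i k) (D i x)) + X' (T \<theta> (delta i (delta i k)) x)
       + T \<theta> (delta i k') (T \<theta> (delta i k) x))"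
proof -
  note xD = H2_Ddom[OF x i]
  show "X x \<in> Ddom i" by (rule D_X(1)[OF i xD])
  show e: "X' (D i (X x)) = D i x + X' (T \<theta> (delta i k) x)"
    by (simp add: D_X(2)[OF i xD] X'.add)
  have d: "X' (T \<theta> (delta i k) x) \<in> Ddom i" by (rule D_X'(1)[OF i D_Tk(1)[OF i xD]])
  show "X' (D i (X x)) \<in> Ddom i" unfolding e by (rule mdom_add[OF H2_D(1)[OF x i] d])
  show "D i (X' (D i (X x))) = D i (D i x) + (X' (T \<theta> (delta i k) (D i x)) + X' (T \<theta> (delta i (delta i k)) x)
       + T \<theta> (delta i k') (T \<theta> (delta i k) x))"
    unfolding e mlt_add[OF H2_D(1)[OF x i] d] D_X'(2)[OF i D_Tk(1)[OF i xD]] D_Tk(2)[OF i xD]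
    by (simp add: X'.add)
qed

lemma lap_co:
  assumes "x \<in> H2"
  shows "lap \<theta> h (co x) = co (P x)"
proof
  fix m
  have dd: "delta i (co y) = co (D i y)" if "y \<in> Ddom i" for i y
    using that by (auto simp: delta_def co_mlt)
  note tm = tmult_co[OF lw_l1[OF lw_k], of \<theta>, folded X_def] tmult_co[OF lw_l1[OF lw_k'], of \<theta>, folded X'_def]
  have "tmult \<theta> k (delta i (tmult \<theta> k' (delta i (tmult \<theta> k (co x))))) = co (X (D i (X' (D i (X x)))))"
    if "i \<in> {1..4}" for i
    by (simp only: tm dd[OF P_domains(1)[OF that assms]] dd[OF P_domains(3)[OF that assms]])
  thus "lap \<theta> h (co x) m = co (P x) m" by (simp add: lap_def P_def co_sum)
qed

lemma P_linear:
  assumes "x \<in> H2" "y \<in> H2"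
  shows "P (x + y) = P x + P y" "P (x - y) = P x - P y"
proof -
  have "X (D i (X' (D i (X (x + y))))) = X (D i (X' (D i (X x)))) + X (D i (X' (D i (X y))))"
    "X (D i (X' (D i (X (x - y))))) = X (D i (X' (D i (X x)))) - X (D i (X' (D i (X y))))"
    if i: "i \<in> {1..4}" for i
    using P_domains(1,3)[OF i assms(1)] P_domains(1,3)[OF i assms(2)]
    by (simp_all only: X.add X'.add mlt_add X.diff X'.diff mlt_diff)
  thus "P (x + y) = P x + P y" "P (x - y) = P x - P y"
    unfolding P_def by (simp_all add: sum.distrib sum_subtractf)
qed

lemma P_cs:
  assumes "x \<in> H2"
  shows "P (cs c x) = cs c (P x)"
proof -
  have "X (D i (X' (D i (X (cs c x))))) = cs c (X (D i (X' (D i (X x)))))"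
    if i: "i \<in> {1..4}" for i
    using P_domains(1,3)[OF i assms(1)] by (simp only: X_cs X'_cs mlt_cs)
  thus ?thesis unfolding P_def by (simp add: cs_sum)
qed

lemma P_symmetric:
  assumes "x \<in> H2" "y \<in> H2"
  shows "cip (P x) y = cip x (P y)"
proof -
  have "cip (X (D i (X' (D i (X x))))) y = cip x (X (D i (X' (D i (X y)))))" if i: "i \<in> {1..4}" for i
  proof -
    have "cip (X (D i (X' (D i (X x))))) y = cip (X' (D i (X x))) (D i (X y))"
      unfolding X_selfadjoint using P_domains[OF i] assms by (intro mlt_symmetric) auto
    also have "\<dots> = cip (X x) (D i (X' (D i (X y))))"
      unfolding X'_selfadjoint using P_domains[OF i] assms by (intro mlt_symmetric) auto
    finally show ?thesis by (simp add: X_selfadjoint)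
  qed
  thus ?thesis unfolding P_def cip_sum_left cip_sum_right by (intro sum.cong) auto
qed

text \<open>By the Leibniz expansion, every term beyond \<open>X (D i (D i x))\<close> has at most
  one derivative on \<open>x\<close>: \<open>B i\<close> below multiplies that derivative and
  \<open>E i\<close> is of order zero.\<close>

lemma P_principal_part: "\<exists>C\<ge>0. \<forall>x\<in>H2. norm (P x - X (Lm2 x)) \<le> C * (norm (Lm x) + norm x)"
proof -
  define B where "B i = (\<lambda>x. X (X' (T \<theta> (delta i k) x)))" for i
  define E where "E i = (\<lambda>x. X (X' (T \<theta> (delta i (delta i k)) x) + T \<theta> (delta i k') (T \<theta> (delta i k) x)))" for i
  have blB: "bounded_linear (B i)" if i: "i \<in> {1..4}" for i
    unfolding B_def by (intro bounded_linear_compose[OF bl_X] bounded_linear_compose[OF bl_X'] bl_T l1_delta[OF lw_k i])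
  have blE: "bounded_linear (E i)" if i: "i \<in> {1..4}" for i
    unfolding E_def
    by (intro bounded_linear_compose[OF bl_X] bounded_linear_add bounded_linear_compose[OF bl_X']
       bounded_linear_compose[OF bl_T[OF l1_delta[OF lw_k' i]]] bl_T l1_delta2[OF lw_k i] l1_delta[OF lw_k i])
  have "\<exists>K. \<forall>x. norm (B i x) \<le> norm x * K" "\<exists>K. \<forall>x. norm (E i x) \<le> norm x * K" if "i \<in> {1..4}" for i
    using bounded_linear.bounded[OF blB[OF that]] bounded_linear.bounded[OF blE[OF that]] by auto
  then obtain KB KE where KB: "\<And>i x. i \<in> {1..4} \<Longrightarrow> norm (B i x) \<le> norm x * KB i"
    and KE: "\<And>i x. i \<in> {1..4} \<Longrightarrow> norm (E i x) \<le> norm x * KE i" by metis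
  define C where "C = (\<Sum>i\<in>{1..4}. \<bar>KB i\<bar> + \<bar>KE i\<bar>)"
  have "norm (P x - X (Lm2 x)) \<le> C * (norm (Lm x) + norm x)" if x: "x \<in> H2" for x
  proof -
    have "P x = (\<Sum>i\<in>{1..4}. X (D i (D i x)) + (B i (D i x) + E i x))"
      unfolding P_def by (intro sum.cong) (simp_all add: P_domains(4)[OF _ x] X.add B_def E_def del: X_X')
    also have "\<dots> = X (Lm2 x) + (\<Sum>i\<in>{1..4}. B i (D i x) + E i x)"
      unfolding sum.distrib H2_D_sum[OF x, symmetric] X.sum by simp
    finally have "norm (P x - X (Lm2 x)) = norm (\<Sum>i\<in>{1..4}. B i (D i x) + E i x)" by simp
    also have "\<dots> \<le> (\<Sum>i\<in>{1..4}. (\<bar>KB i\<bar> + \<bar>KE i\<bar>) * (norm (Lm x) + norm x))"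
    proof (rule sum_norm_le)
      fix i :: nat assume i: "i \<in> {1..4}"
      have "norm (B i (D i x)) \<le> norm (Lm x) * \<bar>KB i\<bar>"
      proof -
        have "norm (B i (D i x)) \<le> norm (D i x) * KB i" by (rule KB[OF i])
        also have "\<dots> \<le> norm (D i x) * \<bar>KB i\<bar>" by (intro mult_left_mono) auto
        also have "\<dots> \<le> norm (Lm x) * \<bar>KB i\<bar>" by (intro mult_right_mono D_norm_le H2_nn x i) auto
        finally show ?thesis .
      qed
      moreover have "norm (E i x) \<le> norm x * \<bar>KE i\<bar>"
        using KE[OF i, of x] mult_left_mono[OF abs_ge_self[of "KE i"], of "norm x"] by auto
      moreover have "0 \<le> norm (Lm x) * \<bar>KE i\<bar>" "0 \<le> norm x * \<bar>KB i\<bar>" by auto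
      moreover have "(\<bar>KB i\<bar> + \<bar>KE i\<bar>) * (norm (Lm x) + norm x) = norm (Lm x) * \<bar>KB i\<bar> + norm x * \<bar>KB i\<bar>
          + (norm (Lm x) * \<bar>KE i\<bar> + norm x * \<bar>KE i\<bar>)" by (simp add: algebra_simps)
      ultimately have "norm (B i (D i x)) + norm (E i x) \<le> (\<bar>KB i\<bar> + \<bar>KE i\<bar>) * (norm (Lm x) + norm x)"
        by linarith
      thus "norm (B i (D i x) + E i x) \<le> (\<bar>KB i\<bar> + \<bar>KE i\<bar>) * (norm (Lm x) + norm x)"
        using norm_triangle_ineq order_trans by blast
    qed
    also have "\<dots> = C * (norm (Lm x) + norm x)" unfolding C_def by (simp add: sum_distrib_right)
    finally show ?thesis .
  qed
  moreover have "C \<ge> 0" unfolding C_def by (intro sum_nonneg) auto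
  ultimately show ?thesis by blast
qed

text \<open>One of the two factors of \<open>Lm2 = Lm Lm\<close> moves to the other side of the
  inner product. Crossing \<open>X\<close> costs the commutator of \<open>Lm\<close> with
  \<open>X\<close>, bounded because \<open>nn\<close> is Lipschitz.\<close>

lemma P_form: "\<exists>C\<ge>0. \<forall>x\<in>H2. \<bar>Re (cip (P x) x) - Re (cip (X (Lm x)) (Lm x))\<bar> \<le> C * (norm (Lm x) * norm x + (norm x)\<^sup>2)"
proof -
  obtain C where C: "C \<ge> 0" "\<And>x. x \<in> H2 \<Longrightarrow> norm (P x - X (Lm2 x)) \<le> C * (norm (Lm x) + norm x)"
    using P_principal_part by blast
  obtain K where K: "K \<ge> 0" "\<And>x. x \<in> mdom nn \<Longrightarrow> X x \<in> mdom nn \<and> norm (Lm (X x) - X (Lm x)) \<le> K * norm x"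
    using X_commutator nn_lipschitz by (metis mult.right_neutral mult_1 zero_le_one)
  have "\<bar>Re (cip (P x) x) - Re (cip (X (Lm x)) (Lm x))\<bar> \<le> (C + K) * (norm (Lm x) * norm x + (norm x)\<^sup>2)"
    if x: "x \<in> H2" for x
  proof -
    note xn = H2_nn[OF x]
    have "cip (X (Lm2 x)) x = cip (Lm x) (Lm (X x))"
      unfolding X_selfadjoint H2_Lm(2)[OF x, symmetric] using K(2)[OF xn] H2_Lm(1)[OF x] by (intro mlt_symmetric) auto
    hence "cip (P x) x - cip (X (Lm x)) (Lm x) = cip (P x - X (Lm2 x)) x + cip (Lm x) (Lm (X x) - X (Lm x))"
      by (simp add: cip_diff_left cip_diff_right X_selfadjoint)
    hence "\<bar>Re (cip (P x) x) - Re (cip (X (Lm x)) (Lm x))\<bar> \<le> cmod (cip (P x - X (Lm2 x)) x + cip (Lm x) (Lm (X x) - X (Lm x)))"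
      by (metis abs_Re_le_cmod minus_complex.sel(1))
    also have "\<dots> \<le> cmod (cip (P x - X (Lm2 x)) x) + cmod (cip (Lm x) (Lm (X x) - X (Lm x)))"
      by (rule norm_triangle_ineq)
    also have "\<dots> \<le> norm (P x - X (Lm2 x)) * norm x + norm (Lm x) * norm (Lm (X x) - X (Lm x))"
      by (intro add_mono cmod_cip_le)
    also have "\<dots> \<le> (C * (norm (Lm x) + norm x)) * norm x + norm (Lm x) * (K * norm x)"
      using C(2)[OF x] K(2)[OF xn] by (intro add_mono mult_right_mono mult_left_mono) auto
    also have "\<dots> \<le> (C + K) * (norm (Lm x) * norm x + (norm x)\<^sup>2)"
      using K(1) by (simp add: algebra_simps power2_eq_square)
    finally show ?thesis .
  qed
  thus ?thesis using C(1) K(1) by (intro exI[of _ "C + K"]) auto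
qed

text \<open>The shift is by \<open>t X\<close> rather than by \<open>t\<close> because
  \<open>X (Lm2 + t)\<close> has the explicit inverse \<open>J X'\<close>. The remainder of
  \<open>P\<close> is of first order and becomes a small perturbation after \<open>J\<close> for
  large \<open>t\<close>, so a contraction argument solves the equation.\<close>

lemma P_shift_surjective: "\<exists>t\<ge>1. \<forall>f. \<exists>x\<in>H2. P x + scaleR t (X x) = f"
proof -
  obtain C where C: "C \<ge> 0" "\<And>x. x \<in> H2 \<Longrightarrow> norm (P x - X (Lm2 x)) \<le> C * (norm (Lm x) + norm x)"
    using P_principal_part by blast
  obtain K where K: "K > 0" "\<And>x. norm (X' x) \<le> norm x * K"
    using X'.pos_bounded by blast
  \<comment> \<open>Chosen so that the contraction factor \<open>2 * C * K / s\<close> found below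
    is at most 1/2: both \<open>J\<close> and \<open>Lm J\<close> have norm at most
    \<open>1 / s\<close>.\<close>
  define s where "s = 1 + 4 * C * K"
  define t where "t = s\<^sup>2"
  have s1: "s \<ge> 1" using C(1) K(1) by (simp add: s_def)
  have t1: "t \<ge> 1" unfolding t_def using s1 by simp
  define J where "J = mlt (\<lambda>n. 1 / ((nn n)\<^sup>2 + t))"
  have jb: "\<bar>1 / ((nn n)\<^sup>2 + t)\<bar> \<le> 1 / s" for n
  proof -
    have "s \<le> s\<^sup>2" using s1 by (simp add: power2_eq_square)
    hence "s \<le> (nn n)\<^sup>2 + t" using t_def by (smt (verit) zero_le_power2)
    thus ?thesis using s1 by (auto simp: field_simps)
  qed
  have Jdom: "x \<in> mdom (\<lambda>n. 1 / ((nn n)\<^sup>2 + t))" for x by (rule mdom_bounded[OF jb])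
  have b2: "\<bar>(nn n)\<^sup>2 * (1 / ((nn n)\<^sup>2 + t))\<bar> \<le> 1" for n
  proof -
    have "(nn n)\<^sup>2 + t > 0" using t1 by (intro add_nonneg_pos) auto
    thus ?thesis using t1 by (auto simp: divide_le_eq)
  qed
  have b1: "\<bar>nn n * (1 / ((nn n)\<^sup>2 + t))\<bar> \<le> 1 / s" for n
  proof -
    have "0 \<le> s * nn n" using s1 by simp
    moreover have "2 * (s * nn n) \<le> (nn n)\<^sup>2 + t"
      using zero_le_power2[of "nn n - s"] unfolding t_def power2_diff by (simp add: mult_ac)
    ultimately have "s * nn n \<le> (nn n)\<^sup>2 + t" by linarith
    moreover have "(nn n)\<^sup>2 + t > 0" using t1 by (intro add_nonneg_pos) auto
    ultimately have "nn n * (1 / ((nn n)\<^sup>2 + t)) \<le> 1 / s" using s1 by (simp add: field_simps)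
    moreover have "0 \<le> nn n * (1 / ((nn n)\<^sup>2 + t))" using t1 by simp
    ultimately show ?thesis by (simp only: abs_of_nonneg)
  qed
  have JH2: "J x \<in> H2" and Lm2J: "Lm2 (J x) = mlt (\<lambda>n. (nn n)\<^sup>2 * (1 / ((nn n)\<^sup>2 + t))) x" for x
    using mlt_mlt[OF Jdom mdom_bounded[OF b2], of x] unfolding J_def H2_def by auto
  have LmJ: "Lm (J x) = mlt (\<lambda>n. nn n * (1 / ((nn n)\<^sup>2 + t))) x" for x
    using mlt_mlt[OF Jdom mdom_bounded[OF b1], of x] unfolding J_def by auto
  have nJ: "norm (J x) \<le> 1 / s * norm x" for x unfolding J_def by (rule mlt_norm_le[OF jb])
  have nLJ: "norm (Lm (J x)) \<le> 1 / s * norm x" for x unfolding LmJ by (rule mlt_norm_le[OF b1])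
  have inv: "Lm2 (J w) + scaleR t (J w) = w" for w
  proof (rule hil_eqI)
    fix n :: "nat \<Rightarrow> int"
    have "(nn n)\<^sup>2 + t \<noteq> 0" using t1 by (smt (verit) zero_le_power2)
    hence "(nn n)\<^sup>2 * (1 / ((nn n)\<^sup>2 + t)) + t * (1 / ((nn n)\<^sup>2 + t)) = 1"
      by (simp add: add_divide_distrib[symmetric])
    hence "complex_of_real ((nn n)\<^sup>2 * (1 / ((nn n)\<^sup>2 + t)) + t * (1 / ((nn n)\<^sup>2 + t))) = 1"
      by (simp only: of_real_1)
    hence "(complex_of_real ((nn n)\<^sup>2 * (1 / ((nn n)\<^sup>2 + t))) + complex_of_real t * complex_of_real (1 / ((nn n)\<^sup>2 + t))) * co w n = co w n"
      by (simp only: of_real_add of_real_mult mult_1_left)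
    thus "co (Lm2 (J w) + scaleR t (J w)) n = co w n"
      unfolding Lm2J co_add co_scaleR
      unfolding J_def co_mlt[OF mdom_bounded[OF b2]] co_mlt[OF Jdom]
      by (simp only: distrib_right mult.assoc)
  qed
  have "\<exists>x\<in>H2. P x + scaleR t (X x) = f" for f
  proof -
    \<comment> \<open>With \<open>x = J w\<close> the equation reads
      \<open>X w + (P (J w) - X (Lm2 (J w))) = f\<close>; applying \<open>X'\<close> puts it in
      fixed point form.\<close>
    define Q where "Q w = X' (f - (P (J w) - X (Lm2 (J w))))" for w
    have "\<exists>!w. Q w = w"
    proof (rule banach_fix_type[where c = "1/2"], simp, simp, intro allI)
      fix w z
      have Jd: "J w - J z = J (w - z)" unfolding J_def by (rule mlt_diff[OF Jdom Jdom, symmetric])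
      have Ld: "Lm2 (J w) - Lm2 (J z) = Lm2 (J (w - z))"
        unfolding Jd[symmetric] using JH2 by (intro mlt_diff[symmetric]) (auto simp: H2_def)
      have Pd: "P (J (w - z)) = P (J w) - P (J z)"
        unfolding Jd[symmetric] by (rule P_linear(2)[OF JH2 JH2])
      have "Q w - Q z = - X' (P (J (w - z)) - X (Lm2 (J (w - z))))"
        unfolding Q_def Pd Ld[symmetric] by (simp add: X'.diff X.diff)
      hence "dist (Q w) (Q z) = norm (X' (P (J (w - z)) - X (Lm2 (J (w - z)))))" by (simp add: dist_norm)
      also have "\<dots> \<le> norm (P (J (w - z)) - X (Lm2 (J (w - z)))) * K" by (rule K(2))
      also have "\<dots> \<le> (C * (norm (Lm (J (w - z))) + norm (J (w - z)))) * K"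
        using K(1) by (intro mult_right_mono C(2) JH2) auto
      also have "\<dots> \<le> (C * (1 / s * norm (w - z) + 1 / s * norm (w - z))) * K"
        using C(1) K(1) by (intro mult_right_mono mult_left_mono add_mono nJ nLJ) auto
      also have "\<dots> = (2 * C * K / s) * norm (w - z)" by (simp add: field_simps)
      also have "\<dots> \<le> 1/2 * norm (w - z)"
      proof (rule mult_right_mono)
        have "2 * C * K \<le> 1/2 * s" by (simp add: s_def)
        thus "2 * C * K / s \<le> 1/2" using s1 by (simp add: divide_le_eq)
      qed simp
      finally show "dist (Q w) (Q z) \<le> 1/2 * dist w z" by (simp add: dist_norm)
    qed
    then obtain w where w: "Q w = w" by auto
    have "X w = f - (P (J w) - X (Lm2 (J w)))"
      using arg_cong[OF w, of X] unfolding Q_def by simp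
    moreover have "X w = X (Lm2 (J w)) + scaleR t (X (J w))"
      using arg_cong[OF inv[of w], of X] by (simp add: X.add X.scaleR)
    ultimately have "P (J w) + scaleR t (X (J w)) = f" by (simp add: algebra_simps)
    thus ?thesis using JH2 by blast
  qed
  thus ?thesis using t1 by blast
qed

text \<open>Symmetry together with surjectivity of \<^term>\<open>\<lambda>x. P x + scaleR t (X x)\<close> makes every weak solution a
  strong one; this replaces elliptic regularity and yields self-adjointness on the domain \<^term>\<open>H2\<close>.\<close>

lemma weak_solution:
  assumes "\<And>w. w \<in> H2 \<Longrightarrow> cip \<xi> (P w) = cip \<eta> w"
  shows "\<xi> \<in> H2" "P \<xi> = \<eta>"
proof -
  obtain t where t: "\<And>f. \<exists>x\<in>H2. P x + scaleR t (X x) = f" using P_shift_surjective by blast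
  obtain z where z: "z \<in> H2" "P z + scaleR t (X z) = \<eta> + scaleR t (X \<xi>)" using t by blast
  have "cip (\<xi> - z) (P w + scaleR t (X w)) = 0" if w: "w \<in> H2" for w
  proof -
    have "cip z (P w + scaleR t (X w)) = cip (P z + scaleR t (X z)) w"
      by (simp add: cip_add_left cip_add_right cip_scaleR_left cip_scaleR_right P_symmetric[OF z(1) w] X_selfadjoint)
    also have "\<dots> = cip \<xi> (P w + scaleR t (X w))"
      unfolding z(2) using assms[OF w]
      by (simp add: cip_add_left cip_add_right cip_scaleR_left cip_scaleR_right X_selfadjoint)
    finally show ?thesis by (simp add: cip_diff_left)
  qed
  moreover obtain w where "w \<in> H2" "P w + scaleR t (X w) = \<xi> - z" using t by blast
  ultimately have "cip (\<xi> - z) (\<xi> - z) = 0" by metis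
  hence "\<xi> = z" by (simp add: cip_self_norm)
  thus "\<xi> \<in> H2" "P \<xi> = \<eta>" using z by auto
qed

end

section \<open>Smooth elements and the graph of the closure\<close>

lemma l1_H0:
  assumes "l1 f" "\<And>n. n \<notin> lat \<Longrightarrow> f n = 0"
  shows "f \<in> H0"
proof (rule H0_boundedI[OF assms(2)])
  fix F assume F: "finite F" "F \<subseteq> lat"
  let ?K = "infsum (\<lambda>n. cmod (f n)) lat"
  have "L2_set (\<lambda>n. cmod (f n)) F \<le> (\<Sum>n\<in>F. cmod (f n))" by (rule L2_set_le_sum) auto
  also have "\<dots> \<le> ?K" by (rule finite_sum_le_infsum[OF assms(1)]) (use F in auto)
  finally have "(L2_set (\<lambda>n. cmod (f n)) F)\<^sup>2 \<le> ?K\<^sup>2" by (intro power_mono) (auto simp: L2_set_nonneg)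
  thus "(\<Sum>n\<in>F. (cmod (f n))\<^sup>2) \<le> ?K\<^sup>2" unfolding L2_set_def by (simp add: sum_nonneg)
qed auto

lemma smooth_H0:
  assumes "a \<in> smooth"
  shows "a \<in> H0" "Hil a \<in> H2"
proof -
  note lw = smooth_lw[OF assms]
  have 0: "a n = 0" if "n \<notin> lat" for n using assms that by (auto simp: smooth_def)
  show *: "a \<in> H0" by (rule l1_H0[OF lw_l1[OF lw] 0])
  have "l1 (\<lambda>n. of_real ((nn n)\<^sup>2) * a n)"
  proof (rule lw_comparison[OF lw, where C = 1])
    fix m
    have "(nn m)\<^sup>2 \<le> (wt m)\<^sup>2" using nn_le_wt[of m] by (intro power_mono) auto
    thus "cmod (of_real ((nn m)\<^sup>2) * a m) \<le> 1 * ((wt m)\<^sup>2 * cmod (a m))"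
      by (auto simp: norm_mult norm_power intro!: mult_right_mono)
  qed
  from l1_H0[OF this] 0 show "Hil a \<in> H2" by (simp add: H2_def mdom_def Hil_inverse[OF *])
qed

lemma finite_support_smooth:
  assumes "\<And>n. n \<in> lat \<Longrightarrow> nn n > r \<Longrightarrow> co x n = 0"
  shows "co x \<in> smooth"
  unfolding smooth_def
proof (intro CollectI conjI allI impI)
  fix p :: nat
  let ?f = "\<lambda>m. (1 + real (\<Sum>i\<in>{1..4}. nat \<bar>m i\<bar>)) ^ p * cmod (co x m)"
  have fm: "?f m \<le> (\<Sum>m\<in>{n\<in>lat. nn n \<le> r}. ?f m)" if "m \<in> lat" for m
  proof (cases "nn m \<le> r")
    case True
    show ?thesis
    proof (rule member_le_sum[OF _ _ finite_nn_ball])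
      show "m \<in> {n \<in> lat. nn n \<le> r}" using True that by simp
    qed simp
  next
    case False
    have "co x m = 0" using assms[OF that] False by simp
    hence "?f m = 0" by (simp only: norm_zero mult_zero_right)
    also have "0 \<le> (\<Sum>m\<in>{n\<in>lat. nn n \<le> r}. ?f m)" by (intro sum_nonneg) auto
    finally show ?thesis .
  qed
  show "\<exists>C. \<forall>m\<in>lat. ?f m \<le> C" by (rule exI, rule ballI, erule fm)
qed (auto simp: co_off)

lemma l2dist2_co: "l2dist2 (co x) (co y) = (norm (x - y))\<^sup>2"
  by (simp add: l2dist2_def norm_sq_hil)

lemma norm_sq_tendsto_0: "(\<lambda>n. (norm (f n - l))\<^sup>2) \<longlonglongrightarrow> 0 \<longleftrightarrow> f \<longlonglongrightarrow> (l::hil)"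
proof
  assume "(\<lambda>n. (norm (f n - l))\<^sup>2) \<longlonglongrightarrow> 0"
  hence "(\<lambda>n. sqrt ((norm (f n - l))\<^sup>2)) \<longlonglongrightarrow> sqrt 0" by (rule tendsto_real_sqrt)
  hence "(\<lambda>n. norm (f n - l)) \<longlonglongrightarrow> 0" by simp
  thus "f \<longlonglongrightarrow> l" by (rule LIM_zero_cancel[OF tendsto_norm_zero_cancel])
next
  assume "f \<longlonglongrightarrow> l"
  hence "(\<lambda>n. (norm (f n - l))\<^sup>2) \<longlonglongrightarrow> (norm (l - l))\<^sup>2"
    by (rule tendsto_power[OF tendsto_norm[OF tendsto_diff[OF _ tendsto_const]]])
  thus "(\<lambda>n. (norm (f n - l))\<^sup>2) \<longlonglongrightarrow> 0" by simp
qed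

lemma mlt_trunc:
  assumes "x \<in> mdom g"
  shows "mlt g (trunc r x) = trunc r (mlt g x)"
proof (rule hil_eqI)
  fix n
  have "trunc r x \<in> mdom g" by (rule mdom_finite_support[where r = r]) (simp add: co_trunc)
  thus "co (mlt g (trunc r x)) n = co (trunc r (mlt g x)) n"
    by (simp add: co_mlt assms co_trunc)
qed

context nct begin

text \<open>Truncation commutes with multipliers, so truncations converge in the graph norm of
  \<open>Lm2\<close>, which controls that of \<open>P\<close> through the principal part. Hence the
  finitely supported vectors form a core.\<close>

lemma P_trunc_tendsto:
  assumes x: "x \<in> H2"
  shows "(\<lambda>k. P (trunc (real k) x)) \<longlonglongrightarrow> P x"
proof -
  obtain C where C: "C \<ge> 0" "\<And>x. x \<in> H2 \<Longrightarrow> norm (P x - X (Lm2 x)) \<le> C * (norm (Lm x) + norm x)"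
    using P_principal_part by blast
  have "(\<lambda>k. P (trunc (real k) x) - P x - X (Lm2 (trunc (real k) x - x))) \<longlonglongrightarrow> 0"
  proof (rule Lim_null_comparison[OF always_eventually])
    show "\<forall>k. norm (P (trunc (real k) x) - P x - X (Lm2 (trunc (real k) x - x)))
        \<le> C * (norm (trunc (real k) (Lm x) - Lm x) + norm (trunc (real k) x - x))"
    proof
      fix k :: nat
      have "Lm (trunc (real k) x - x) = trunc (real k) (Lm x) - Lm x"
        using H2_nn[OF x] H2_nn[OF trunc_H2] by (simp add: mlt_diff mlt_trunc)
      thus "norm (P (trunc (real k) x) - P x - X (Lm2 (trunc (real k) x - x)))
        \<le> C * (norm (trunc (real k) (Lm x) - Lm x) + norm (trunc (real k) x - x))"
        using C(2)[OF H2_diff[OF trunc_H2[of "real k" x] x]] by (simp add: P_linear(2)[OF trunc_H2 x])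
    qed
    have "(\<lambda>k. C * (norm (trunc (real k) (Lm x) - Lm x) + norm (trunc (real k) x - x))) \<longlonglongrightarrow>
       C * (norm (Lm x - Lm x) + norm (x - x))"
      by (intro tendsto_intros trunc_tendsto)
    thus "(\<lambda>k. C * (norm (trunc (real k) (Lm x) - Lm x) + norm (trunc (real k) x - x))) \<longlonglongrightarrow> 0"
      by simp
  qed
  moreover have "(\<lambda>k. X (Lm2 (trunc (real k) x - x))) \<longlonglongrightarrow> X (Lm2 x - Lm2 x)"
  proof -
    have "Lm2 (trunc (real k) x - x) = trunc (real k) (Lm2 x) - Lm2 x" for k
      using x trunc_H2[of k x] by (simp add: H2_def mlt_diff mlt_trunc)
    thus ?thesis by (simp only:) (intro X.tendsto tendsto_intros trunc_tendsto)
  qed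
  ultimately have "(\<lambda>k. (P (trunc (real k) x) - P x - X (Lm2 (trunc (real k) x - x))) + X (Lm2 (trunc (real k) x - x)))
     \<longlonglongrightarrow> 0 + X (Lm2 x - Lm2 x)" by (rule tendsto_add)
  hence "(\<lambda>k. P (trunc (real k) x) - P x) \<longlonglongrightarrow> 0" by (simp add: X.zero)
  thus ?thesis by (rule LIM_zero_cancel)
qed

text \<open>Limits of smooth graph points are weak solutions, since the symmetric \<open>P\<close>
  may be moved to the test vector, and weak solutions are strong. Conversely, truncations are smooth
  and converge in graph norm.\<close>

lemma lap_closure_graph: "(x, y) \<in> lap_closure \<theta> h \<longleftrightarrow> (\<exists>\<xi>\<in>H2. x = co \<xi> \<and> y = co (P \<xi>))"
proof
  assume "(x, y) \<in> lap_closure \<theta> h"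
  then obtain s where xy: "x \<in> H0" "y \<in> H0" and s: "\<And>n. s n \<in> smooth"
    and lim: "(\<lambda>n. l2dist2 (s n) x) \<longlonglongrightarrow> 0" "(\<lambda>n. l2dist2 (lap \<theta> h (s n)) y) \<longlonglongrightarrow> 0"
    by (auto simp: lap_closure_def)
  define S where "S n = Hil (s n)" for n
  have S: "S n \<in> H2" "co (S n) = s n" for n
    using smooth_H0[OF s[of n]] by (auto simp: S_def Hil_inverse)
  define \<xi> where "\<xi> = Hil x"
  define \<eta> where "\<eta> = Hil y"
  have co: "co \<xi> = x" "co \<eta> = y" using xy by (auto simp: \<xi>_def \<eta>_def Hil_inverse)
  have l: "S \<longlonglongrightarrow> \<xi>" "(\<lambda>n. P (S n)) \<longlonglongrightarrow> \<eta>"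
    using lim unfolding S(2)[symmetric] co[symmetric] lap_co[OF S(1)] l2dist2_co norm_sq_tendsto_0 by auto
  have "cip \<xi> (P w) = cip \<eta> w" if w: "w \<in> H2" for w
  proof (rule LIMSEQ_unique)
    show "(\<lambda>n. cip (S n) (P w)) \<longlonglongrightarrow> cip \<xi> (P w)"
      by (rule bounded_linear.tendsto[OF bounded_linear_cip_left l(1)])
    show "(\<lambda>n. cip (S n) (P w)) \<longlonglongrightarrow> cip \<eta> w"
      using bounded_linear.tendsto[OF bounded_linear_cip_left l(2), of w]
      by (simp add: P_symmetric S(1) w)
  qed
  from weak_solution[OF this] show "\<exists>\<xi>\<in>H2. x = co \<xi> \<and> y = co (P \<xi>)" using co by blast
next
  assume "\<exists>\<xi>\<in>H2. x = co \<xi> \<and> y = co (P \<xi>)"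
  then obtain \<xi> where \<xi>: "\<xi> \<in> H2" "x = co \<xi>" "y = co (P \<xi>)" by blast
  let ?s = "\<lambda>n::nat. co (trunc (real n) \<xi>)"
  have 1: "?s n \<in> smooth" for n by (rule finite_support_smooth[where r = "real n"]) (simp add: co_trunc)
  have 2: "(\<lambda>n. l2dist2 (?s n) x) \<longlonglongrightarrow> 0"
    unfolding \<xi>(2) l2dist2_co norm_sq_tendsto_0 by (rule trunc_tendsto)
  have 3: "(\<lambda>n. l2dist2 (lap \<theta> h (?s n)) y) \<longlonglongrightarrow> 0"
    unfolding \<xi>(3) lap_co[OF trunc_H2] l2dist2_co norm_sq_tendsto_0 by (rule P_trunc_tendsto[OF \<xi>(1)])
  have "x \<in> H0" "y \<in> H0" by (simp_all add: \<xi> co)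
  thus "(x, y) \<in> lap_closure \<theta> h"
    unfolding lap_closure_def mem_Collect_eq case_prod_conv
    by (intro conjI exI[of _ ?s] allI 1 2 3)
qed

end

section \<open>Spectral theory and functional calculus\<close>

text \<open>Supplies the finite-dimensional compactness behind total boundedness in
  \<open>rellich\<close>. Each coordinate adds a compact disc, and the larger box is a continuous
  image of a product.\<close>

lemma compact_finite_box: "finite F \<Longrightarrow> compact {\<Sum>n\<in>F. cs (c n) (bas n) |c. \<forall>n\<in>F. cmod (c n) \<le> b}"
proof (induction F rule: finite_induct)
  case empty
  have "{\<Sum>n\<in>{}. cs (c n) (bas n) |c. \<forall>n\<in>{}. cmod (c n) \<le> b} = {0}" by auto
  thus ?case by simp
next
  case (insert m F)
  let ?S = "\<lambda>F. {\<Sum>n\<in>F. cs (c n) (bas n) |c. \<forall>n\<in>F. cmod (c n) \<le> b}"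
  have bl: "bounded_linear (\<lambda>z. cs z (bas m))"
    by (rule bounded_linear_intro[where K = "norm (bas m)"])
       (auto simp: cs_add_left scaleR_cs scaleR_conv_of_real)
  have "?S (insert m F) \<subseteq> (\<lambda>(z, y). cs z (bas m) + y) ` (cball 0 b \<times> ?S F)"
  proof
    fix x assume "x \<in> ?S (insert m F)"
    then obtain c where c: "x = (\<Sum>n\<in>insert m F. cs (c n) (bas n))" "\<forall>n\<in>insert m F. cmod (c n) \<le> b" by blast
    have "x = (\<lambda>(z, y). cs z (bas m) + y) (c m, \<Sum>n\<in>F. cs (c n) (bas n))"
      using insert by (simp add: c(1))
    moreover have "(c m, \<Sum>n\<in>F. cs (c n) (bas n)) \<in> cball 0 b \<times> ?S F" using c(2) by auto
    ultimately show "x \<in> (\<lambda>(z, y). cs z (bas m) + y) ` (cball 0 b \<times> ?S F)" by blast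
  qed
  moreover have "(\<lambda>(z, y). cs z (bas m) + y) ` (cball 0 b \<times> ?S F) \<subseteq> ?S (insert m F)"
  proof clarsimp
    fix z c assume z: "cmod z \<le> b" and c: "\<forall>n\<in>F. cmod (c n) \<le> b"
    have "cs z (bas m) + (\<Sum>n\<in>F. cs (c n) (bas n)) = (\<Sum>n\<in>insert m F. cs ((c(m := z)) n) (bas n))"
      using insert by (auto intro!: sum.cong)
    moreover have "\<forall>n\<in>insert m F. cmod ((c(m := z)) n) \<le> b" using z c by auto
    ultimately show "\<exists>ca. cs z (bas m) + (\<Sum>n\<in>F. cs (c n) (bas n)) = (\<Sum>n\<in>insert m F. cs (ca n) (bas n)) \<and>
       cmod (ca m) \<le> b \<and> (\<forall>n\<in>F. cmod (ca n) \<le> b)" by blast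
  qed
  ultimately have "?S (insert m F) = (\<lambda>(z, y). cs z (bas m) + y) ` (cball 0 b \<times> ?S F)" by blast
  moreover have "continuous_on (cball 0 b \<times> ?S F) (\<lambda>(z, y). cs z (bas m) + y)"
    unfolding case_prod_unfold
    by (rule continuous_on_add[OF bounded_linear.continuous_on[OF bl continuous_on_fst[OF continuous_on_id]]
          continuous_on_snd[OF continuous_on_id]])
  ultimately show ?case
    using insert.IH by (simp add: compact_continuous_image compact_Times)
qed

text \<open>Vectors with both norms bounded lie in a closed ellipsoid whose axes shrink with
  \<open>nn\<close>. High frequencies are uniformly small and low ones are finite-dimensional, so it
  is totally bounded, hence compact.\<close>

lemma rellich:
  assumes "\<And>k::nat. x k \<in> mdom nn" "\<And>k. norm (x k) \<le> B" "\<And>k. norm (Lm (x k)) \<le> B"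
  shows "\<exists>l r. strict_mono r \<and> (\<lambda>k. x (r k)) \<longlonglongrightarrow> (l::hil)"
proof -
  define K where "K = {y. \<forall>F. finite F \<longrightarrow> F \<subseteq> lat \<longrightarrow> (\<Sum>n\<in>F. (1 + (nn n)\<^sup>2) * (cmod (co y n))\<^sup>2) \<le> 2 * B\<^sup>2}"
  have B: "B \<ge> 0" using norm_ge_zero[of "x 0"] assms(2)[of 0] by linarith
  have xK: "x k \<in> K" for k
    unfolding K_def
  proof (intro CollectI allI impI)
    fix F :: "(nat \<Rightarrow> int) set" assume F: "finite F" "F \<subseteq> lat"
    have "(\<Sum>n\<in>F. (1 + (nn n)\<^sup>2) * (cmod (co (x k) n))\<^sup>2) =
       (\<Sum>n\<in>F. (cmod (co (x k) n))\<^sup>2) + (\<Sum>n\<in>F. (cmod (co (Lm (x k)) n))\<^sup>2)"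
      unfolding sum.distrib[symmetric]
      by (intro sum.cong) (simp_all add: co_mlt[OF assms(1)] norm_mult power_mult_distrib algebra_simps)
    also have "\<dots> \<le> (norm (x k))\<^sup>2 + (norm (Lm (x k)))\<^sup>2"
      by (intro add_mono finite_sum_le_norm F)
    also have "\<dots> \<le> B\<^sup>2 + B\<^sup>2" by (intro add_mono power_mono assms) auto
    finally show "(\<Sum>n\<in>F. (1 + (nn n)\<^sup>2) * (cmod (co (x k) n))\<^sup>2) \<le> 2 * B\<^sup>2" by simp
  qed
  have "closed K"
  proof -
    have "K = (\<Inter>F\<in>{F. finite F \<and> F \<subseteq> lat}. {y. (\<Sum>n\<in>F. (1 + (nn n)\<^sup>2) * (cmod (co y n))\<^sup>2) \<le> 2 * B\<^sup>2})"
      unfolding K_def by auto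
    moreover have "continuous_on UNIV (\<lambda>y. co y n)" for n by (rule linear_continuous_on[OF bounded_linear_co])
    ultimately show ?thesis
      by (simp only:) (intro closed_INT ballI closed_Collect_le continuous_on_sum continuous_on_mult
        continuous_on_const continuous_on_power continuous_on_norm)
  qed
  have "compact K"
    unfolding compact_eq_totally_bounded
  proof (intro conjI allI impI)
    show "complete K" using \<open>closed K\<close> by (simp add: complete_eq_closed)
    fix e :: real assume e: "e > 0"
    \<comment> \<open>With this radius the tail bound \<open>2 * B / r\<close> falls strictly below
      \<open>e / 2\<close>; the summand 1 keeps \<open>r\<close> positive and the inequality
      strict.\<close>
    define r where "r = 1 + 4 * B / e"
    have r: "r \<ge> 1" using B e by (simp add: r_def)
    let ?F = "{n \<in> lat. nn n \<le> r}"
    let ?S = "{\<Sum>n\<in>?F. cs (c n) (bas n) |c. \<forall>n\<in>?F. cmod (c n) \<le> 2 * B}"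
    have cS: "compact ?S" by (rule compact_finite_box[OF finite_nn_ball])
    have e2: "0 < e / 2" using e by simp
    obtain k where k: "finite k" "?S \<subseteq> (\<Union>x\<in>k. ball x (e/2))"
      using compact_eq_totally_bounded[THEN iffD1, OF cS, THEN conjunct2, rule_format, OF e2] by (elim exE conjE)
    have "K \<subseteq> (\<Union>x\<in>k. ball x e)"
    proof
      fix y assume y: "y \<in> K"
      have c: "cmod (co y n) \<le> 2 * B" if n: "n \<in> lat" for n
      proof -
        have "(1 + (nn n)\<^sup>2) * (cmod (co y n))\<^sup>2 \<le> 2 * B\<^sup>2"
          using y n unfolding K_def by (auto dest: spec[of _ "{n}"])
        moreover have "1 * (cmod (co y n))\<^sup>2 \<le> (1 + (nn n)\<^sup>2) * (cmod (co y n))\<^sup>2"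
          by (intro mult_right_mono) auto
        moreover have "2 * B\<^sup>2 \<le> (2 * B)\<^sup>2" by (simp add: power_mult_distrib)
        ultimately have "(cmod (co y n))\<^sup>2 \<le> (2 * B)\<^sup>2" by linarith
        thus ?thesis by (rule power2_le_imp_le) (use B in simp)
      qed
      have "trunc r y \<in> ?S" unfolding trunc_sum using c by blast
      then obtain z where z: "z \<in> k" "dist z (trunc r y) < e / 2" using k by auto
      have "norm (y - trunc r y) \<le> 2 * B / r"
      proof (rule norm_boundI)
        fix F :: "(nat \<Rightarrow> int) set" assume F: "finite F" "F \<subseteq> lat"
        have "r\<^sup>2 * (\<Sum>n\<in>F. (cmod (co (y - trunc r y) n))\<^sup>2) \<le> (\<Sum>n\<in>F. (1 + (nn n)\<^sup>2) * (cmod (co y n))\<^sup>2)"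
          unfolding sum_distrib_left
        proof (rule sum_mono)
          fix n
          show "r\<^sup>2 * (cmod (co (y - trunc r y) n))\<^sup>2 \<le> (1 + (nn n)\<^sup>2) * (cmod (co y n))\<^sup>2"
          proof (cases "nn n \<le> r")
            case False
            hence "r\<^sup>2 \<le> (nn n)\<^sup>2" using r by (intro power_mono) auto
            thus ?thesis using False by (auto simp: co_trunc intro!: mult_right_mono)
          qed (simp add: co_trunc)
        qed
        also have "\<dots> \<le> 2 * B\<^sup>2" using y F unfolding K_def by auto
        also have "\<dots> \<le> (2 * B)\<^sup>2" by (simp add: power_mult_distrib)
        finally show "(\<Sum>n\<in>F. (cmod (co (y - trunc r y) n))\<^sup>2) \<le> (2 * B / r)\<^sup>2"
          using r by (simp add: power_divide field_simps)
      qed (use B r in auto)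
      also have "\<dots> < e / 2" using r e B by (simp add: r_def field_simps)
      finally have "dist (trunc r y) y < e / 2" by (simp add: dist_norm norm_minus_commute)
      hence "dist z y < e" using z(2) dist_triangle_half_r[of "trunc r y" z e y] by (simp add: dist_commute)
      thus "y \<in> (\<Union>x\<in>k. ball x e)" using z(1) by auto
    qed
    thus "\<exists>k. finite k \<and> K \<subseteq> (\<Union>x\<in>k. ball x e)" using k(1) by blast
  qed
  hence sc: "seq_compact K" by (rule compact_imp_seq_compact)
  obtain l r where "strict_mono r" "(x \<circ> r) \<longlonglongrightarrow> l"
    by (rule seq_compactE[OF sc]) (auto intro: xK)
  thus ?thesis unfolding o_def by (intro exI conjI)
qed

text \<open>The value \<open>z = - cnj b / c\<close> minimises the quadratic. The formulation by
  scalars fits a form that is nonnegative on a subspace only.\<close>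

lemma form_cauchy_schwarz:
  fixes a c :: real and b :: complex
  assumes "\<And>z. 0 \<le> a + 2 * Re (z * b) + (cmod z)\<^sup>2 * c" "c > 0"
  shows "(cmod b)\<^sup>2 \<le> a * c"
proof -
  have "0 \<le> a + 2 * Re (- cnj b / of_real c * b) + (cmod (- cnj b / of_real c))\<^sup>2 * c" by (rule assms)
  also have "- cnj b / of_real c * b = of_real (- ((cmod b)\<^sup>2) / c)"
    using complex_norm_square[of b] by (simp add: mult.commute)
  finally have "0 \<le> a - (cmod b)\<^sup>2 / c"
    using assms(2) by (simp add: norm_divide power_divide power2_eq_square field_simps)
  thus ?thesis using assms(2) by (simp add: field_simps)
qed

definition ons :: "hil set \<Rightarrow> bool" where
  "ons O' \<longleftrightarrow> (\<forall>\<psi>\<in>O'. \<forall>\<phi>\<in>O'. cip \<psi> \<phi> = (if \<psi> = \<phi> then 1 else 0))"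

lemma ons_projection:
  assumes "finite O'" "ons O'" "\<phi> \<in> O'"
  shows "cip (x - (\<Sum>\<psi>\<in>O'. cs (cip x \<psi>) \<psi>)) \<phi> = 0"
proof -
  have "(\<Sum>\<psi>\<in>O'. cip x \<psi> * cip \<psi> \<phi>) = (\<Sum>\<psi>\<in>O'. if \<psi> = \<phi> then cip x \<psi> else 0)"
    using assms by (intro sum.cong) (auto simp: ons_def)
  thus ?thesis using assms by (simp add: cip_diff_left cip_sum_left cip_cs_left sum.delta)
qed

context nct begin

text \<open>Garding inequality: completing a square absorbs the mixed first order term into half of
  the positive leading term.\<close>

lemma P_coercive: "\<exists>a C. a > 0 \<and> C \<ge> 0 \<and> (\<forall>x\<in>H2. a * (norm (Lm x))\<^sup>2 \<le> Re (cip (P x) x) + C * (norm x)\<^sup>2)"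
proof -
  obtain C where C: "C \<ge> 0" "\<And>x. x \<in> H2 \<Longrightarrow> \<bar>Re (cip (P x) x) - Re (cip (X (Lm x)) (Lm x))\<bar> \<le> C * (norm (Lm x) * norm x + (norm x)\<^sup>2)"
    using P_form by blast
  obtain a b where a: "a > 0" "\<And>x. a * (norm x)\<^sup>2 \<le> Re (cip (X x) x)" using X_bounds by blast
  have "a / 2 * (norm (Lm x))\<^sup>2 \<le> Re (cip (P x) x) + (C + C\<^sup>2 / (2 * a)) * (norm x)\<^sup>2" if x: "x \<in> H2" for x
  proof -
    let ?u = "norm (Lm x)" and ?w = "norm x"
    have "0 \<le> (a * ?u - C * ?w)\<^sup>2 / (2 * a)" using a by auto
    also have "\<dots> = a / 2 * ?u\<^sup>2 - C * (?u * ?w) + C\<^sup>2 / (2 * a) * ?w\<^sup>2"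
      using a by (simp add: power2_diff power_mult_distrib field_simps power2_eq_square)
    finally show ?thesis
      using C(2)[OF x, unfolded distrib_left] a(2)[of "Lm x"] unfolding distrib_right by linarith
  qed
  moreover have "0 \<le> C + C\<^sup>2 / (2 * a)" using a C by simp
  ultimately show ?thesis using a(1) half_gt_zero by blast
qed

text \<open>The Rayleigh quotient is minimised on the orthogonal complement of \<open>O'\<close>.
  Coercivity and \<open>rellich\<close> make a minimising sequence converge, and its limit is first
  shown to solve the eigenvalue equation weakly; \<open>weak_solution\<close> then puts it into
  \<open>H2\<close>. Thus no semicontinuity of the form is required.\<close>

lemma eigenvector_below:
  assumes O: "finite O'" "ons O'" "\<And>\<psi>. \<psi> \<in> O' \<Longrightarrow> \<psi> \<in> H2 \<and> P \<psi> = cs (of_real (\<mu> \<psi>)) \<psi>"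
    and x0: "x0 \<in> H2" "\<And>\<psi>. \<psi> \<in> O' \<Longrightarrow> cip x0 \<psi> = 0" "Re (cip (P x0) x0) < lam * (norm x0)\<^sup>2"
  shows "\<exists>x\<in>H2. norm x = 1 \<and> (\<forall>\<psi>\<in>O'. cip x \<psi> = 0) \<and> (\<exists>m<lam. P x = cs (of_real m) x)"
proof -
  obtain a C where aC: "a > 0" "C \<ge> 0" "\<And>x. x \<in> H2 \<Longrightarrow> a * (norm (Lm x))\<^sup>2 \<le> Re (cip (P x) x) + C * (norm x)\<^sup>2"
    using P_coercive by blast
  define W where "W = {x\<in>H2. norm x = 1 \<and> (\<forall>\<psi>\<in>O'. cip x \<psi> = 0)}"
  define q where "q x = Re (cip (P x) x)" for x
  define x1 where "x1 = cs (of_real (1 / norm x0)) x0"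
  have n0: "norm x0 > 0" using x0(3) by auto
  have x1: "x1 \<in> W" using x0 n0 by (auto simp: W_def x1_def H2_cs cip_cs_left norm_divide)
  have "q x1 = q x0 / (norm x0)\<^sup>2"
    using x0(1) by (simp add: q_def x1_def P_cs cip_cs_left cip_cs_right power2_eq_square del: of_real_divide)
  moreover have "q x0 / (norm x0)\<^sup>2 < lam" using x0(3) n0 by (simp add: q_def pos_divide_less_eq)
  ultimately have q1: "q x1 < lam" by simp
  have bdd: "bdd_below (q ` W)"
  proof (rule bdd_belowI2)
    fix x assume "x \<in> W"
    hence "a * (norm (Lm x))\<^sup>2 \<le> q x + C" using aC(3)[of x] by (simp add: W_def q_def)
    moreover have "0 \<le> a * (norm (Lm x))\<^sup>2" using aC(1) by simp
    ultimately show "- C \<le> q x" by linarith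
  qed
  define m where "m = (INF x\<in>W. q x)"
  have m_le: "m \<le> q x" if "x \<in> W" for x unfolding m_def by (rule cINF_lower[OF bdd that])
  have m_lam: "m < lam" using m_le[OF x1] q1 by linarith
  have "\<exists>x\<in>W. q x < m + 1 / Suc n" for n
    using cINF_less_iff[OF _ bdd, of "m + 1 / Suc n"] x1 unfolding m_def[symmetric] by auto
  then obtain y where y: "\<And>n. y n \<in> W" "\<And>n. q (y n) < m + 1 / Suc n" by metis
  define B where "B = 1 + sqrt ((\<bar>m\<bar> + 1 + C) / a)"
  have LB: "norm (Lm (y n)) \<le> B" for n
  proof -
    have "1 / real (Suc n) \<le> 1" by simp
    moreover have "a * (norm (Lm (y n)))\<^sup>2 \<le> q (y n) + C"
      using aC(3)[of "y n"] y(1)[of n] by (simp add: W_def q_def)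
    ultimately have "a * (norm (Lm (y n)))\<^sup>2 \<le> \<bar>m\<bar> + 1 + C"
      using y(2)[of n] by linarith
    hence "(norm (Lm (y n)))\<^sup>2 \<le> (\<bar>m\<bar> + 1 + C) / a" using aC(1) by (simp add: field_simps)
    hence "norm (Lm (y n)) \<le> sqrt ((\<bar>m\<bar> + 1 + C) / a)" by (rule real_le_rsqrt)
    thus ?thesis by (simp add: B_def)
  qed
  have "0 \<le> (\<bar>m\<bar> + 1 + C) / a" using aC by simp
  hence B1: "B \<ge> 1" by (simp add: B_def)
  obtain x r where r: "strict_mono r" and lim: "(\<lambda>k. y (r k)) \<longlonglongrightarrow> x"
    using rellich[of y B] LB B1 y(1) H2_nn by (auto simp: W_def)
  have nx: "norm x = 1"
  proof (rule LIMSEQ_unique)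
    show "(\<lambda>k. norm (y (r k))) \<longlonglongrightarrow> norm x" by (intro tendsto_intros lim)
    show "(\<lambda>k. norm (y (r k))) \<longlonglongrightarrow> 1" using y(1) by (simp add: W_def)
  qed
  have xO: "cip x \<psi> = 0" if "\<psi> \<in> O'" for \<psi>
  proof (rule LIMSEQ_unique)
    show "(\<lambda>k. cip (y (r k)) \<psi>) \<longlonglongrightarrow> cip x \<psi>" by (rule bounded_linear.tendsto[OF bounded_linear_cip_left lim])
    show "(\<lambda>k. cip (y (r k)) \<psi>) \<longlonglongrightarrow> 0" using y(1) that by (simp add: W_def)
  qed
  have pos: "m * (norm u)\<^sup>2 \<le> q u" if u: "u \<in> H2" "\<And>\<psi>. \<psi> \<in> O' \<Longrightarrow> cip u \<psi> = 0" for u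
  proof (cases "u = 0")
    case False
    have "cs (of_real (1 / norm u)) u \<in> W" using u False by (auto simp: W_def H2_cs cip_cs_left norm_divide)
    hence "m \<le> q (cs (of_real (1 / norm u)) u)" by (rule m_le)
    also have "\<dots> = q u / (norm u)\<^sup>2"
      using u(1) by (simp add: q_def P_cs cip_cs_left cip_cs_right power2_eq_square del: of_real_divide)
    finally show ?thesis using False by (simp add: field_simps)
  qed (use P_cs[of 0 0] in \<open>simp add: q_def\<close>)
  \<comment> \<open>Cauchy-Schwarz for the form of \<open>P - m\<close>, nonnegative on the
    complement of \<open>O'\<close>: its value at \<open>y n\<close> tends to 0, hence so does its
    pairing with any fixed \<open>s\<close>, and the pairing passes to the limit in norm.\<close>
  have key: "cip (P s - cs (of_real m) s) x = 0" if s: "s \<in> H2" "\<And>\<psi>. \<psi> \<in> O' \<Longrightarrow> cip s \<psi> = 0" for s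
  proof -
    define b where "b n = cip (P s - cs (of_real m) s) (y n)" for n
    \<comment> \<open>The summand 1 makes \<open>c\<close> positive even when the form vanishes at
      \<open>s\<close>, as \<open>form_cauchy_schwarz\<close> demands.\<close>
    define c where "c = q s - m * (norm s)\<^sup>2 + 1"
    have c: "c > 0" using pos[OF s] by (simp add: c_def)
    have bn: "(cmod (b n))\<^sup>2 \<le> (1 / Suc n) * c" for n
    proof -
      have yn: "y n \<in> H2" "norm (y n) = 1" "\<And>\<psi>. \<psi> \<in> O' \<Longrightarrow> cip (y n) \<psi> = 0" using y(1)[of n] by (auto simp: W_def)
      have "(cmod (b n))\<^sup>2 \<le> (q (y n) - m) * c"
      proof (rule form_cauchy_schwarz[OF _ c])
        fix z
        let ?u = "y n + cs z s"
        have "m * (norm ?u)\<^sup>2 \<le> q ?u"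
          by (rule pos) (auto simp: H2_add H2_cs yn s cip_add_left cip_cs_left)
        moreover have "q ?u = q (y n) + 2 * Re (z * cip (P s) (y n)) + (cmod z)\<^sup>2 * q s"
        proof -
          have "cip (P ?u) ?u = cip (P (y n)) (y n) + z * cip (P s) (y n) + (cnj z * cip (P (y n)) s + z * cnj z * cip (P s) s)"
            by (simp add: P_linear(1)[OF yn(1) H2_cs[OF s(1)]] P_cs[OF s(1)] cip_add_left cip_add_right cip_cs_left cip_cs_right algebra_simps)
          moreover have "cnj z * cip (P (y n)) s = cnj (z * cip (P s) (y n))"
            by (simp add: cip_cnj P_symmetric[OF yn(1) s(1)])
          moreover have "z * cnj z = of_real ((cmod z)\<^sup>2)" by (rule complex_norm_square[symmetric])
          ultimately show ?thesis by (simp add: q_def)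
        qed
        moreover have "(norm ?u)\<^sup>2 = 1 + 2 * Re (z * cip s (y n)) + (cmod z)\<^sup>2 * (norm s)\<^sup>2"
        proof -
          have "cip ?u ?u = cip (y n) (y n) + z * cip s (y n) + (cnj (z * cip s (y n)) + z * cnj z * cip s s)"
            by (simp add: cip_add_left cip_add_right cip_cs_left cip_cs_right algebra_simps cip_cnj)
          moreover have "z * cnj z = of_real ((cmod z)\<^sup>2)" by (rule complex_norm_square[symmetric])
          ultimately have "complex_of_real ((norm ?u)\<^sup>2) = 1 + z * cip s (y n) + (cnj (z * cip s (y n)) + of_real ((cmod z)\<^sup>2) * of_real ((norm s)\<^sup>2))"
            by (simp only: cip_self_norm yn) simp
          hence "Re (complex_of_real ((norm ?u)\<^sup>2)) = Re (1 + z * cip s (y n) + (cnj (z * cip s (y n)) + of_real ((cmod z)\<^sup>2) * of_real ((norm s)\<^sup>2)))"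
            by (rule arg_cong)
          thus ?thesis by (simp del: of_real_power)
        qed
        moreover have "Re (z * b n) = Re (z * cip (P s) (y n)) - m * Re (z * cip s (y n))"
          by (simp add: b_def cip_diff_left cip_cs_left algebra_simps)
        ultimately have "0 \<le> (q (y n) - m) + 2 * Re (z * b n) + (cmod z)\<^sup>2 * (c - 1)"
          unfolding c_def by (simp add: algebra_simps)
        also have "\<dots> \<le> (q (y n) - m) + 2 * Re (z * b n) + (cmod z)\<^sup>2 * c"
          by (intro add_mono mult_left_mono) auto
        finally show "0 \<le> q (y n) - m + 2 * Re (z * b n) + (cmod z)\<^sup>2 * c" .
      qed
      also have "\<dots> \<le> (1 / Suc n) * c" using c y(2)[of n] by (intro mult_right_mono) auto
      finally show ?thesis .
    qed
    have "(\<lambda>n. (cmod (b n))\<^sup>2) \<longlonglongrightarrow> 0"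
    proof (rule tendsto_sandwich[OF always_eventually always_eventually tendsto_const])
      have "(\<lambda>n. 1 / real (Suc n) * c) \<longlonglongrightarrow> 0 * c"
        by (intro tendsto_mult tendsto_const lim_1_over_n[THEN LIMSEQ_Suc])
      thus "(\<lambda>n. 1 / real (Suc n) * c) \<longlonglongrightarrow> 0" by simp
    qed (use bn in auto)
    hence "(\<lambda>n. sqrt ((cmod (b n))\<^sup>2)) \<longlonglongrightarrow> sqrt 0" by (rule tendsto_real_sqrt)
    hence "b \<longlonglongrightarrow> 0" by (simp add: tendsto_norm_zero_iff)
    hence "(\<lambda>k. b (r k)) \<longlonglongrightarrow> 0" using LIMSEQ_subseq_LIMSEQ[OF _ r, of b 0] by (simp add: o_def)
    moreover have "(\<lambda>k. b (r k)) \<longlonglongrightarrow> cip (P s - cs (of_real m) s) x"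
      unfolding b_def by (rule bounded_linear.tendsto[OF bounded_linear_cip_right lim])
    ultimately show ?thesis using LIMSEQ_unique by blast
  qed
  have weak: "cip x (P s) = cip (cs (of_real m) x) s" if s: "s \<in> H2" for s
  proof -
    \<comment> \<open>A general test vector is split along \<open>O'\<close>. Its part
      \<open>p\<close> in the span stays in the span under \<open>P\<close> and so remains
      orthogonal to \<open>x\<close>; the rest is covered by \<open>key\<close>.\<close>
    define p where "p = (\<Sum>\<psi>\<in>O'. cs (cip s \<psi>) \<psi>)"
    have p: "p \<in> H2" unfolding p_def using O(3) by (intro H2_sum H2_cs) auto
    have Pp: "cip (P p - cs (of_real m) p) x = 0"
    proof -
      have px: "cip p x = 0" unfolding p_def cip_sum_left
        by (intro sum.neutral ballI) (metis cip_cs_left cip_cnj xO complex_cnj_zero mult_zero_right)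
      have "P p = (\<Sum>\<psi>\<in>O'. P (cs (cip s \<psi>) \<psi>))" unfolding p_def
      proof (use O(1) O(3) in \<open>induction O' rule: finite_induct\<close>)
        case empty
        show ?case using P_cs[of 0 0] by (simp add: H2_def)
      next
        case (insert \<psi> F)
        have "(\<Sum>\<psi>\<in>F. cs (cip s \<psi>) \<psi>) \<in> H2" using insert by (intro H2_sum H2_cs) auto
        thus ?case using insert by (simp add: P_linear(1) H2_cs)
      qed
      hence "cip (P p) x = (\<Sum>\<psi>\<in>O'. cip (P (cs (cip s \<psi>) \<psi>)) x)" by (simp add: cip_sum_left)
      also have "\<dots> = 0"
      proof (intro sum.neutral ballI)
        fix \<psi> assume \<psi>: "\<psi> \<in> O'"
        have "cip \<psi> x = 0" using xO[OF \<psi>] by (metis cip_cnj complex_cnj_zero)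
        thus "cip (P (cs (cip s \<psi>) \<psi>)) x = 0" using O(3)[OF \<psi>] by (simp add: P_cs cip_cs_left)
      qed
      finally show ?thesis by (simp add: cip_diff_left cip_cs_left px)
    qed
    have "cip (P (s - p) - cs (of_real m) (s - p)) x = 0"
    proof (rule key)
      show "s - p \<in> H2" by (rule H2_diff[OF s p])
      show "cip (s - p) \<psi> = 0" if "\<psi> \<in> O'" for \<psi>
        unfolding p_def by (rule ons_projection[OF O(1,2) that])
    qed
    moreover have "P (s - p) - cs (of_real m) (s - p) = (P s - cs (of_real m) s) - (P p - cs (of_real m) p)"
      by (simp add: P_linear(2)[OF s p] cs_diff)
    ultimately have "cip (P s - cs (of_real m) s) x = 0"
      using Pp by (simp only: cip_diff_left[of "P s - cs (of_real m) s" "P p - cs (of_real m) p"] diff_zero)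
    hence "cip (P s) x = of_real m * cip s x" by (simp add: cip_diff_left cip_cs_left)
    hence "cnj (cip (P s) x) = cnj (of_real m * cip s x)" by simp
    thus ?thesis by (simp add: cip_cnj cip_cs_left)
  qed
  from weak_solution[OF weak] show ?thesis using nx xO m_lam by blast
qed

end

section \<open>Polynomial functional calculus of \<open>X\<close>\<close>

lemma poly_map_of_real: "poly (map_poly complex_of_real p) (of_real s) = of_real (poly p s)"
  by (induction p) (simp_all add: map_poly_pCons)

lemma cip_R:
  assumes "n \<in> lat"
  shows "cip (R \<theta> n x) (R \<theta> n y) = cip x y"
proof -
  have "cip (R \<theta> n x) (R \<theta> n y) = infsum (\<lambda>m. co x (m - n) * cnj (co y (m - n))) lat"
    unfolding cip_def
  proof (rule infsum_cong)
    fix m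
    have "co (R \<theta> n x) m * cnj (co (R \<theta> n y) m) =
        (phase \<theta> (m - n) n * cnj (phase \<theta> (m - n) n)) * (co x (m - n) * cnj (co y (m - n)))"
      by (simp only: co_R[OF assms] complex_cnj_mult mult_ac)
    thus "co (R \<theta> n x) m * cnj (co (R \<theta> n y) m) = co x (m - n) * cnj (co y (m - n))" by simp
  qed
  also have "\<dots> = cip x y"
    unfolding cip_def by (rule infsum_reindex_bij_betw[OF bij_lat_shift[OF assms]])
  finally show ?thesis .
qed

context nct begin

text \<open>Horner evaluation of a polynomial at \<open>X\<close>. The complex version exists in
  order to split polynomials into linear factors; \<open>rpop\<close> is the selfadjoint version
  used in the estimates.\<close>

definition pop :: "complex poly \<Rightarrow> hil \<Rightarrow> hil" where
  "pop p = fold_coeffs (\<lambda>c f x. cs c x + X (f x)) p (\<lambda>_. 0)"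

definition rpop :: "real poly \<Rightarrow> hil \<Rightarrow> hil" where
  "rpop p = fold_coeffs (\<lambda>c f x. scaleR c x + X (f x)) p (\<lambda>_. 0)"

lemma pop_0 [simp]: "pop 0 x = 0" by (simp add: pop_def X.zero)
lemma rpop_0 [simp]: "rpop 0 x = 0" by (simp add: rpop_def)
lemma pop_pCons [simp]: "pop (pCons c p) x = cs c x + X (pop p x)"
  by (cases "c = 0 \<and> p = 0") (auto simp: pop_def X.zero fold_coeffs_pCons_coeff_not_0_eq fold_coeffs_pCons_not_0_0_eq)
lemma rpop_pCons [simp]: "rpop (pCons c p) x = scaleR c x + X (rpop p x)"
  by (cases "c = 0 \<and> p = 0") (auto simp: rpop_def X.zero fold_coeffs_pCons_coeff_not_0_eq fold_coeffs_pCons_not_0_0_eq)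

lemma pop_of_real: "pop (map_poly of_real p) x = rpop p x"
  by (induction p) (simp_all add: map_poly_pCons scaleR_cs)

lemma pop_add: "pop (p + q) x = pop p x + pop q x"
  by (induction p q rule: poly_induct2) (simp_all add: cs_add_left X.add)
lemma pop_smult: "pop (smult c p) x = cs c (pop p x)"
  by (induction p) (simp_all add: cs_add X_cs)
lemma pop_X: "pop p (X x) = X (pop p x)"
  by (induction p) (simp_all add: X.add X.zero X_cs)
lemma pop_mult: "pop (p * q) x = pop p (pop q x)"
  by (induction p) (simp_all add: pop_add pop_smult)

lemma rpop_add: "rpop (p + q) x = rpop p x + rpop q x"
  by (induction p q rule: poly_induct2) (simp_all add: scaleR_add_left X.add)
lemma rpop_smult: "rpop (smult c p) x = scaleR c (rpop p x)"
  by (induction p) (simp_all add: scaleR_add_right X.scaleR)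
lemma rpop_diff: "rpop (p - q) x = rpop p x - rpop q x"
  using rpop_add[of p "smult (-1) q" x] unfolding rpop_smult by simp
lemma rpop_mult: "rpop (p * q) x = rpop p (rpop q x)"
  by (induction p) (simp_all add: rpop_add rpop_smult)
lemma rpop_sum: "rpop (\<Sum>i\<in>I. f i) x = (\<Sum>i\<in>I. rpop (f i) x)"
  by (induction I rule: infinite_finite_induct) (simp_all add: rpop_add)
lemma rpop_add_right: "rpop p (x + y) = rpop p x + rpop p y"
  by (induction p) (simp_all add: X.add scaleR_add_right)
lemma rpop_cs: "rpop p (cs c x) = cs c (rpop p x)"
  by (induction p) (simp_all add: X_cs cs_add scaleR_cs mult.commute)
lemma rpop_R: "n \<in> lat \<Longrightarrow> rpop p (R \<theta> n x) = R \<theta> n (rpop p x)"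
proof (induction p)
  case 0
  thus ?case using linear_0[OF bounded_linear.linear[OF bl_R]] by simp
next
  case (pCons c p)
  interpret R: bounded_linear "R \<theta> n" by (rule bl_R[OF pCons.prems])
  show ?case by (simp add: pCons X_R R.add R.scaleR)
qed
lemma rpop_selfadjoint: "cip (rpop p x) y = cip x (rpop p y)"
proof (induction p arbitrary: x y)
  case (pCons c p)
  have "rpop p (X y) = X (rpop p y)" for y
    using pop_X[of "map_poly of_real p" y] by (simp add: pop_of_real)
  thus ?case
    by (simp add: cip_add_left cip_add_right cip_scaleR_left cip_scaleR_right X_selfadjoint pCons.IH)
qed simp
lemma rpop_bounded: "\<exists>B>0. \<forall>x. norm (rpop p x) \<le> B * norm x"
proof (induction p)
  case 0
  show ?case by (intro exI[of _ 1]) simp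
next
  case (pCons c p)
  then obtain B where B: "B > 0" "\<And>x. norm (rpop p x) \<le> B * norm x" by blast
  obtain K where K: "K > 0" "\<And>x. norm (X x) \<le> norm x * K" using X.pos_bounded by blast
  have "norm (rpop (pCons c p) x) \<le> (\<bar>c\<bar> + B * K) * norm x" for x
  proof -
    have "norm (rpop (pCons c p) x) \<le> norm (scaleR c x) + norm (X (rpop p x))"
      unfolding rpop_pCons by (rule norm_triangle_ineq)
    also have "norm (X (rpop p x)) \<le> norm (rpop p x) * K" by (rule K(2))
    also have "norm (rpop p x) * K \<le> B * norm x * K"
      by (rule mult_right_mono[OF B(2)]) (use K in simp)
    finally show ?thesis by (simp add: algebra_simps)
  qed
  moreover have "\<bar>c\<bar> + B * K > 0" using B K by (simp add: add_nonneg_pos)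
  ultimately show ?case by blast
qed

text \<open>Leibniz rule along the Horner scheme. The multiplier is required to be defined
  everywhere because it also meets all intermediate vectors; the cutoffs are bounded, so this
  suffices.\<close>

lemma rpop_commutator: "\<exists>K\<ge>0. \<forall>g l x. (\<forall>m\<in>lat. \<forall>n\<in>lat. \<bar>g n - g m\<bar> \<le> l * nn (n - m)) \<longrightarrow> l \<ge> 0 \<longrightarrow>
   (\<forall>x. x \<in> mdom g) \<longrightarrow> norm (mlt g (rpop p x) - rpop p (mlt g x)) \<le> K * l * norm x"
proof (induction p)
  case 0
  have "mlt g 0 = 0" for g by (rule hil_eqI) (simp add: co_mlt)
  thus ?case by (intro exI[of _ 0]) simp
next
  case (pCons c p)
  then obtain K where K: "K \<ge> 0" "\<And>g l x. \<forall>m\<in>lat. \<forall>n\<in>lat. \<bar>g n - g m\<bar> \<le> l * nn (n - m) \<Longrightarrow> l \<ge> 0 \<Longrightarrow>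
     \<forall>x. x \<in> mdom g \<Longrightarrow> norm (mlt g (rpop p x) - rpop p (mlt g x)) \<le> K * l * norm x" by blast
  obtain B where B: "B > 0" "\<And>x. norm (rpop p x) \<le> B * norm x" using rpop_bounded by blast
  obtain b where b: "b > 0" "\<And>x. norm (X x) \<le> norm x * b" using X.pos_bounded by blast
  obtain KX where KX: "KX \<ge> 0" "\<And>g l x. \<forall>m\<in>lat. \<forall>n\<in>lat. \<bar>g n - g m\<bar> \<le> l * nn (n - m) \<Longrightarrow> l \<ge> 0 \<Longrightarrow>
     x \<in> mdom g \<Longrightarrow> norm (mlt g (X x) - X (mlt g x)) \<le> KX * l * norm x" using X_commutator by blast
  have "norm (mlt g (rpop (pCons c p) x) - rpop (pCons c p) (mlt g x)) \<le> (KX * B + K * b) * l * norm x"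
    if g: "\<forall>m\<in>lat. \<forall>n\<in>lat. \<bar>g n - g m\<bar> \<le> l * nn (n - m)" and l: "l \<ge> 0" and d: "\<forall>x. x \<in> mdom g" for g l x
  proof -
    have "mlt g (rpop (pCons c p) x) - rpop (pCons c p) (mlt g x) =
       (mlt g (X (rpop p x)) - X (mlt g (rpop p x))) + X (mlt g (rpop p x) - rpop p (mlt g x))"
      using d by (simp add: mlt_add scaleR_cs mlt_cs X.diff)
    also have "norm \<dots> \<le> KX * l * norm (rpop p x) + norm (mlt g (rpop p x) - rpop p (mlt g x)) * b"
      using KX(2)[OF g l, of "rpop p x"] b(2) d by (intro order_trans[OF norm_triangle_ineq] add_mono) auto
    also have "\<dots> \<le> KX * l * (B * norm x) + K * l * norm x * b"
      using B b KX(1) l K(2)[OF g l d] by (intro add_mono mult_left_mono mult_right_mono) auto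
    finally show ?thesis by (simp add: algebra_simps)
  qed
  moreover have "KX * B + K * b \<ge> 0" using KX(1) B(1) K(1) b(1) by simp
  ultimately show ?case by blast
qed

text \<open>Spectral bounds for \<open>X\<close>; the choices are justified by \<open>X_bounds\<close>.\<close>

definition lo :: real where "lo = (SOME a. \<exists>b. 0 < a \<and> a \<le> b \<and> (\<forall>x. a * (norm x)\<^sup>2 \<le> Re (cip (X x) x) \<and> norm (X x) \<le> b * norm x))"
definition hi :: real where "hi = (SOME b. 0 < lo \<and> lo \<le> b \<and> (\<forall>x. lo * (norm x)\<^sup>2 \<le> Re (cip (X x) x) \<and> norm (X x) \<le> b * norm x))"

lemma lo_hi: "0 < lo" "lo \<le> hi" "lo * (norm x)\<^sup>2 \<le> Re (cip (X x) x)" "norm (X x) \<le> hi * norm x"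
proof -
  have "\<exists>b. 0 < lo \<and> lo \<le> b \<and> (\<forall>x. lo * (norm x)\<^sup>2 \<le> Re (cip (X x) x) \<and> norm (X x) \<le> b * norm x)"
    unfolding lo_def by (rule someI_ex[OF X_bounds])
  from someI_ex[OF this, folded hi_def]
  show "0 < lo" "lo \<le> hi" "lo * (norm x)\<^sup>2 \<le> Re (cip (X x) x)" "norm (X x) \<le> hi * norm x" by auto
qed

lemma X_form_le: "Re (cip (X x) x) \<le> hi * (norm x)\<^sup>2"
proof -
  have "Re (cip (X x) x) \<le> norm (X x) * norm x"
    using cmod_cip_le[of "X x" x] complex_Re_le_cmod[of "cip (X x) x"] by linarith
  also have "\<dots> \<le> hi * norm x * norm x" by (intro mult_right_mono lo_hi) auto
  finally show ?thesis by (simp add: power2_eq_square mult.assoc)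
qed

lemma cip_real_selfadjoint:
  assumes "\<And>x y. cip (Y x) y = cip x (Y y)"
  shows "cip (Y x) x = of_real (Re (cip (Y x) x))"
proof -
  have "cnj (cip (Y x) x) = cip (Y x) x" by (simp add: cip_cnj assms)
  thus ?thesis by (simp add: complex_eq_iff)
qed

text \<open>The numerical range of the selfadjoint \<open>X\<close> lies in \<open>{lo..hi}\<close>,
  so pairing \<open>X y - cs z y\<close> with \<open>y\<close> already sees the distance of
  \<open>z\<close> from that interval.\<close>

lemma X_minus_bounded_below:
  assumes "z \<notin> of_real ` {lo..hi}"
  shows "\<exists>d>0. \<forall>y. d * norm y \<le> norm (X y - cs z y)"
proof -
  let ?S = "complex_of_real ` {lo..hi}"
  have S: "closed ?S"
    by (intro compact_imp_closed compact_continuous_image continuous_intros) auto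
  have "?S \<noteq> {}" using lo_hi(2) by auto
  hence d: "infdist z ?S > 0"
    using assms S infdist_pos_not_in_closed by blast
  have "infdist z ?S * norm y \<le> norm (X y - cs z y)" for y
  proof (cases "y = 0")
    case False
    define t where "t = Re (cip (X y) y) / (norm y)\<^sup>2"
    have t: "t \<in> {lo..hi}"
      using False lo_hi(3)[of y] X_form_le[of y] by (simp add: t_def field_simps)
    have "cip (X y) y = of_real (t * (norm y)\<^sup>2)"
      using cip_real_selfadjoint[of X y] X_selfadjoint False by (simp add: t_def)
    hence "cip (X y - cs z y) y = (of_real t - z) * of_real ((norm y)\<^sup>2)"
      by (simp add: cip_diff_left cip_cs_left cip_self_norm algebra_simps)
    hence "cmod (cip (X y - cs z y) y) = dist z (of_real t) * (norm y)\<^sup>2"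
      by (simp add: norm_mult dist_norm norm_minus_commute norm_power)
    moreover have "infdist z ?S \<le> dist z (of_real t)" by (rule infdist_le) (use t in auto)
    ultimately have "infdist z ?S * (norm y)\<^sup>2 \<le> cmod (cip (X y - cs z y) y)"
      by (simp add: mult_right_mono)
    also have "\<dots> \<le> norm (X y - cs z y) * norm y" by (rule cmod_cip_le)
    finally show ?thesis using False by (simp add: power2_eq_square)
  qed simp
  thus ?thesis using d by blast
qed

text \<open>Half of the spectral mapping theorem: by the fundamental theorem of algebra
  \<open>q\<close> splits into linear factors with zeros off \<open>{lo..hi}\<close>, each bounded
  below.\<close>

lemma pop_bounded_below:
  assumes "\<And>s. s \<in> {lo..hi} \<Longrightarrow> poly q (of_real s) \<noteq> 0"
  shows "\<exists>d>0. \<forall>y. d * norm y \<le> norm (pop q y)"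
  using assms
proof (induction "degree q" arbitrary: q)
  case 0
  then obtain c where c: "q = [:c:]" by (metis degree_eq_zeroE)
  have "c \<noteq> 0" using "0.prems"[of lo] lo_hi(2) c by auto
  thus ?case by (intro exI[of _ "cmod c"]) (simp add: c X.zero)
next
  case (Suc k)
  hence "\<not> constant (poly q)" by (simp add: constant_degree)
  then obtain z where "poly q z = 0" using fundamental_theorem_of_algebra by blast
  hence "[:- z, 1:] dvd q" by (simp only: poly_eq_0_iff_dvd)
  then obtain r where r: "q = [:- z, 1:] * r" by (rule dvdE)
  have r0: "r \<noteq> 0" using Suc.hyps(2) r by auto
  have "degree q = Suc (degree r)" unfolding r using r0 by (subst degree_mult_eq) auto
  hence "k = degree r" using Suc.hyps(2) by simp
  moreover have "poly r (of_real s) \<noteq> 0" if "s \<in> {lo..hi}" for s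
    using Suc.prems[OF that] by (auto simp: r)
  ultimately obtain d where d: "d > 0" "\<And>y. d * norm y \<le> norm (pop r y)"
    using Suc.hyps(1)[of r] by blast
  have "z \<notin> of_real ` {lo..hi}"
  proof
    assume "z \<in> of_real ` {lo..hi}"
    then obtain s where s: "s \<in> {lo..hi}" "z = of_real s" by blast
    hence "poly q (of_real s) = 0" by (simp add: r)
    thus False using Suc.prems[OF s(1)] by simp
  qed
  then obtain e where e: "e > 0" "\<And>y. e * norm y \<le> norm (X y - cs z y)" using X_minus_bounded_below by blast
  have "e * d * norm y \<le> norm (pop q y)" for y
  proof -
    have "e * (d * norm y) \<le> e * norm (pop r y)" using d e by (intro mult_left_mono) auto
    also have "\<dots> \<le> norm (X (pop r y) - cs z (pop r y))" by (rule e)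
    also have "X (pop r y) - cs z (pop r y) = pop q y"
      unfolding r pop_mult by (rule hil_eqI) (simp add: X.zero)
    finally show ?thesis by (simp add: mult.assoc)
  qed
  thus ?case using d e by (intro exI[of _ "e * d"]) auto
qed

text \<open>If the form had a negative infimum \<open>m\<close> on the unit sphere, then
  \<open>p - m\<close> would be positive on \<open>{lo..hi}\<close> and \<open>Z = p(X) - m\<close>
  bounded below. For a nonnegative bounded \<open>Z\<close> this pushes the infimum strictly above
  \<open>m\<close>, a contradiction.\<close>

lemma rpop_nonneg:
  assumes p: "\<And>s. s \<in> {lo..hi} \<Longrightarrow> poly p s \<ge> 0"
  shows "0 \<le> Re (cip (rpop p x) x)"
proof (rule ccontr)
  assume neg: "\<not> 0 \<le> Re (cip (rpop p x) x)"
  define q where "q x = Re (cip (rpop p x) x)" for x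
  define S where "S = {x::hil. norm x = 1}"
  obtain B where B: "B > 0" "\<And>x. norm (rpop p x) \<le> B * norm x" using rpop_bounded by blast
  have qb: "\<bar>q x\<bar> \<le> B * (norm x)\<^sup>2" for x
  proof -
    have "\<bar>q x\<bar> \<le> norm (rpop p x) * norm x"
      unfolding q_def using cmod_cip_le[of "rpop p x" x] abs_Re_le_cmod[of "cip (rpop p x) x"] by linarith
    also have "\<dots> \<le> B * norm x * norm x" by (intro mult_right_mono B) auto
    finally show ?thesis by (simp add: power2_eq_square mult.assoc)
  qed
  have bdd: "bdd_below (q ` S)"
  proof (rule bdd_belowI2)
    show "- B \<le> q x" if "x \<in> S" for x using qb[of x] that by (simp add: S_def)
  qed
  define m where "m = (INF x\<in>S. q x)"
  have scale: "m * (norm u)\<^sup>2 \<le> q u" for u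
  proof (cases "u = 0")
    case False
    have "cs (of_real (1 / norm u)) u \<in> S" using False by (simp add: S_def norm_divide)
    hence "m \<le> q (cs (of_real (1 / norm u)) u)" unfolding m_def by (rule cINF_lower[OF bdd])
    also have "\<dots> = q u / (norm u)\<^sup>2"
      by (simp add: q_def rpop_cs cip_cs_left cip_cs_right power2_eq_square del: of_real_divide)
    finally show ?thesis using False by (simp add: field_simps)
  qed (use rpop_cs[of p 0 0] in \<open>simp add: q_def\<close>)
  have "m < 0"
  proof (rule ccontr)
    assume "\<not> m < 0"
    hence "0 \<le> m * (norm x)\<^sup>2" by simp
    thus False using scale[of x] neg by (simp add: q_def)
  qed
  define Z where "Z = rpop (p - [:m:])"
  have Zx: "Z x = rpop p x - scaleR m x" for x by (simp add: Z_def rpop_diff X.zero)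
  have Zsa: "cip (Z x) y = cip x (Z y)" for x y unfolding Z_def by (rule rpop_selfadjoint)
  have Zq: "Re (cip (Z x) x) = q x - m * (norm x)\<^sup>2" for x
    by (simp add: Zx q_def cip_diff_left cip_scaleR_left cip_self_norm del: of_real_power)
  have Zpos: "0 \<le> Re (cip (Z x) x)" for x using scale[of x] by (simp add: Zq)
  define K where "K = B - m"
  have K: "K > 0" using B \<open>m < 0\<close> by (simp add: K_def)
  have ZK: "Re (cip (Z x) x) \<le> K * (norm x)\<^sup>2" for x
    using qb[of x] by (simp add: Zq K_def algebra_simps abs_le_iff)
  have "poly (map_poly complex_of_real (p - [:m:])) (of_real s) \<noteq> 0" if s: "s \<in> {lo..hi}" for s
  proof -
    have "poly (map_poly complex_of_real (p - [:m:])) (of_real s) = of_real (poly (p - [:m:]) s)"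
      by (rule poly_map_of_real)
    moreover have "poly (p - [:m:]) s \<noteq> 0" using p[OF s] \<open>m < 0\<close> by simp
    ultimately show ?thesis by simp
  qed
  from pop_bounded_below[OF this] obtain d where d: "d > 0" "\<And>y. d * norm y \<le> norm (Z y)"
    by (auto simp: Z_def pop_of_real)
  \<comment> \<open>Cauchy-Schwarz for the nonnegative form of \<open>Z\<close>, tested against
    \<open>Z y\<close>. It turns the lower bound on the norm of \<open>Z y\<close> into one on the
    form itself.\<close>
  have ZZ: "(norm (Z y))\<^sup>2 \<le> K * Re (cip (Z y) y)" for y
  proof (cases "Z y = 0")
    case False
    have "(cmod (cip (Z (Z y)) y))\<^sup>2 \<le> Re (cip (Z y) y) * (K * (norm (Z y))\<^sup>2)"
    proof (rule form_cauchy_schwarz)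
      show "0 < K * (norm (Z y))\<^sup>2" using K False by simp
      fix z
      let ?s = "Z y" let ?u = "y + cs z ?s"
      have "0 \<le> Re (cip (Z ?u) ?u)" by (rule Zpos)
      also have "cip (Z ?u) ?u = cip (Z y) y + z * cip (Z ?s) y + (cnj (z * cip (Z ?s) y) + (z * cnj z) * cip (Z ?s) ?s)"
      proof -
        have "Z ?u = Z y + cs z (Z ?s)" unfolding Z_def by (simp only: rpop_add_right rpop_cs)
        moreover have "cnj z * cip (Z y) ?s = cnj (z * cip (Z ?s) y)" by (simp add: cip_cnj Zsa)
        ultimately show ?thesis by (simp add: cip_add_left cip_add_right cip_cs_left cip_cs_right algebra_simps)
      qed
      also have "z * cnj z = of_real ((cmod z)\<^sup>2)" by (rule complex_norm_square[symmetric])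
      also have "Re (cip (Z y) y + z * cip (Z ?s) y + (cnj (z * cip (Z ?s) y) + of_real ((cmod z)\<^sup>2) * cip (Z ?s) ?s)) =
         Re (cip (Z y) y) + 2 * Re (z * cip (Z ?s) y) + (cmod z)\<^sup>2 * Re (cip (Z ?s) ?s)"
        by (simp del: of_real_power)
      also have "\<dots> \<le> Re (cip (Z y) y) + 2 * Re (z * cip (Z ?s) y) + (cmod z)\<^sup>2 * (K * (norm (Z y))\<^sup>2)"
        by (intro add_mono mult_left_mono ZK) auto
      finally show "0 \<le> Re (cip (Z y) y) + 2 * Re (z * cip (Z ?s) y) + (cmod z)\<^sup>2 * (K * (norm (Z y))\<^sup>2)" .
    qed
    moreover have "cmod (cip (Z (Z y)) y) = (norm (Z y))\<^sup>2"
      by (simp add: Zsa cip_self_norm norm_power)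
    ultimately have "(norm (Z y))\<^sup>2 * (norm (Z y))\<^sup>2 \<le> (K * Re (cip (Z y) y)) * (norm (Z y))\<^sup>2"
      by (simp add: power2_eq_square mult_ac)
    moreover have "(norm (Z y))\<^sup>2 > 0" using False by simp
    ultimately show ?thesis by (rule mult_right_le_imp_le)
  qed (use Zpos K in simp)
  have "m + d\<^sup>2 / K \<le> q y" if "y \<in> S" for y
  proof -
    have "d\<^sup>2 \<le> (norm (Z y))\<^sup>2" using d(2)[of y] d(1) that by (intro power_mono) (auto simp: S_def)
    also have "\<dots> \<le> K * (q y - m)" using ZZ[of y] that by (simp add: Zq S_def)
    finally show ?thesis using K by (simp add: field_simps)
  qed
  moreover have "S \<noteq> {}" using norm_bas[OF lat_zero] unfolding S_def by blast
  ultimately have "m + d\<^sup>2 / K \<le> m" unfolding m_def by (intro cINF_greatest) auto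
  thus False using d K by (simp add: field_simps)
qed

text \<open>Positivity of \<open>1 - p^2\<close> on the spectral interval, read as a norm
  inequality.\<close>

lemma rpop_contraction:
  assumes "\<And>s. s \<in> {lo..hi} \<Longrightarrow> \<bar>poly p s\<bar> \<le> 1"
  shows "norm (rpop p x) \<le> norm x"
proof -
  have "0 \<le> Re (cip (rpop (1 - p * p) x) x)"
  proof (rule rpop_nonneg)
    fix s assume "s \<in> {lo..hi}"
    hence "(poly p s)\<^sup>2 \<le> 1" by (simp only: abs_square_le_1 assms)
    thus "0 \<le> poly (1 - p * p) s" by (simp add: power2_eq_square)
  qed
  also have "rpop (1 - p * p) x = x - rpop p (rpop p x)"
    by (simp add: rpop_diff rpop_mult one_pCons X.zero)
  also have "Re (cip (x - rpop p (rpop p x)) x) = (norm x)\<^sup>2 - (norm (rpop p x))\<^sup>2"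
    by (simp add: cip_diff_left rpop_selfadjoint[of p "rpop p x" x] cip_self_norm del: of_real_power)
  finally have "(norm (rpop p x))\<^sup>2 \<le> (norm x)\<^sup>2" by simp
  thus ?thesis by (rule power2_le_imp_le) simp
qed

text \<open>Since \<open>X v = bas 0\<close>, the vacuum expectation of \<open>rpop p\<close> is the expectation of
  \<open>X\<^sup>2 (rpop p)\<close> in the vector \<open>v\<close>.\<close>

lemma vacuum_le:
  assumes "\<And>s. s \<in> {lo..hi} \<Longrightarrow> s\<^sup>2 * poly p s \<le> c"
  shows "Re (cip (rpop p (bas 0)) (bas 0)) \<le> c * (norm v)\<^sup>2"
proof -
  have "0 \<le> Re (cip (rpop ([:c:] - [:0, 1:] * p * [:0, 1:]) v) v)"
    by (rule rpop_nonneg) (use assms in \<open>simp add: power2_eq_square mult_ac\<close>)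
  also have "rpop ([:c:] - [:0, 1:] * p * [:0, 1:]) v = scaleR c v - X (rpop p (bas 0))"
    using X_v by (simp only: rpop_diff rpop_mult) (simp add: X.zero)
  also have "Re (cip (scaleR c v - X (rpop p (bas 0))) v) = c * (norm v)\<^sup>2 - Re (cip (rpop p (bas 0)) (bas 0))"
    by (simp add: cip_diff_left cip_scaleR_left cip_self_norm X_selfadjoint X_v del: of_real_power)
  finally show ?thesis by simp
qed

lemma vacuum_ge:
  assumes "\<And>s. s \<in> {lo..hi} \<Longrightarrow> c \<le> s\<^sup>2 * poly p s"
  shows "c * (norm v)\<^sup>2 \<le> Re (cip (rpop p (bas 0)) (bas 0))"
proof -
  have "Re (cip (rpop (- p) (bas 0)) (bas 0)) \<le> (- c) * (norm v)\<^sup>2"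
    by (rule vacuum_le) (use assms in simp)
  thus ?thesis using rpop_diff[of 0 p "bas 0"] by (simp add: cip_minus_left)
qed

text \<open>Right translations are isometric, commute with \<open>X\<close> and carry
  \<open>bas 0\<close> to \<open>bas n\<close>. This is the trace property of \<open>phi0\<close> in
  the form used for counting.\<close>

lemma rpop_bas_norm: "n \<in> lat \<Longrightarrow> norm (rpop p (bas n)) = norm (rpop p (bas 0))"
  by (metis R_bas rpop_R norm_R)

end

section \<open>Counting lattice points\<close>

definition Nlat :: "real \<Rightarrow> nat" where "Nlat r = card {n \<in> lat. nn n \<le> r}"

text \<open>Half-open unit cubes with the lattice point as lower corner, so that they are disjoint
  and \<open>floor\<close> recovers the point. Lattice counts become volumes of unions.\<close>

definition cube :: "(nat \<Rightarrow> int) \<Rightarrow> (nat \<Rightarrow> real) set" where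
  "cube n = PiE {1..4} (\<lambda>i. {of_int (n i)..<of_int (n i) + 1})"

abbreviation "leb4 \<equiv> (Pi\<^sub>M {1..4::nat} (\<lambda>_. lborel)) :: (nat \<Rightarrow> real) measure"

lemma cube_measure: "cube n \<in> sets leb4" "emeasure leb4 (cube n) = 1"
proof -
  interpret product_sigma_finite "\<lambda>_::nat. lborel :: real measure" by standard
  show "cube n \<in> sets leb4" unfolding cube_def by (rule sets_PiM_I_finite) auto
  have "emeasure leb4 (cube n) = (\<Prod>i\<in>{1..4::nat}. emeasure lborel {real_of_int (n i)..<of_int (n i) + 1})"
    unfolding cube_def by (rule emeasure_PiM) auto
  thus "emeasure leb4 (cube n) = 1" by simp
qed

lemma cube_disjoint:
  assumes "m \<in> lat" "n \<in> lat" "x \<in> cube m" "x \<in> cube n"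
  shows "m = n"
proof
  fix i
  show "m i = n i"
  proof (cases "i \<in> {1..4}")
    case True
    have "\<lfloor>x i\<rfloor> = m i" "\<lfloor>x i\<rfloor> = n i"
      using PiE_mem[OF assms(3)[unfolded cube_def] True] PiE_mem[OF assms(4)[unfolded cube_def] True]
      by (auto simp: floor_eq_iff)
    thus ?thesis by simp
  next
    case False
    thus ?thesis using assms(1,2) unfolding lat_def by simp
  qed
qed

lemma cube_union_measure:
  assumes "finite S" "S \<subseteq> lat"
  shows "(\<Union>n\<in>S. cube n) \<in> sets leb4" "emeasure leb4 (\<Union>n\<in>S. cube n) = of_nat (card S)"
proof -
  show "(\<Union>n\<in>S. cube n) \<in> sets leb4" using assms(1) by (intro sets.finite_UN cube_measure) auto
  have "disjoint_family_on cube S"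
    unfolding disjoint_family_on_def using cube_disjoint assms(2) by blast
  hence "(\<Sum>n\<in>S. emeasure leb4 (cube n)) = emeasure leb4 (\<Union>n\<in>S. cube n)"
    using assms(1) cube_measure(1) by (intro sum_emeasure) blast+
  thus "emeasure leb4 (\<Union>n\<in>S. cube n) = of_nat (card S)"
    unfolding cube_measure(2) by (simp only: sum_constant mult_1_right)
qed

lemma cube_ball_measure: "emeasure leb4 (\<Union>n\<in>{n \<in> lat. nn n \<le> r}. cube n) = ennreal (real (Nlat r))"
  unfolding Nlat_def
  by (subst cube_union_measure(2)[OF finite_nn_ball]) (auto simp: ennreal_of_nat_eq_real_of_nat)

text \<open>The 2 is the diagonal \<open>sqrt 4\<close> of the unit cube in dimension 4.\<close>

lemma cube_norm:
  assumes "x \<in> cube n"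
  shows "\<bar>L2_set x {1..4} - nn n\<bar> \<le> 2"
proof -
  have d: "L2_set (\<lambda>i. x i - of_int (n i)) {1..4::nat} \<le> 2"
  proof -
    have "(\<Sum>i\<in>{1..4::nat}. (x i - of_int (n i))\<^sup>2) \<le> (\<Sum>i\<in>{1..4::nat}. 1)"
    proof (rule sum_mono)
      fix i :: nat assume i: "i \<in> {1..4}"
      have "x i \<in> {of_int (n i)..<of_int (n i) + 1}" using PiE_mem[OF assms[unfolded cube_def] i] .
      hence "0 \<le> x i - of_int (n i)" "x i - of_int (n i) \<le> 1" by auto
      thus "(x i - of_int (n i))\<^sup>2 \<le> 1" by (rule power_le_one)
    qed
    hence "(\<Sum>i\<in>{1..4::nat}. (x i - of_int (n i))\<^sup>2) \<le> 2\<^sup>2" by simp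
    thus ?thesis unfolding L2_set_def by (intro real_le_lsqrt) (auto intro: sum_nonneg)
  qed
  have "L2_set x {1..4::nat} \<le> nn n + L2_set (\<lambda>i. x i - of_int (n i)) {1..4}"
    unfolding nn_def using L2_set_triangle_ineq[of "\<lambda>i. of_int (n i)" "\<lambda>i. x i - of_int (n i)" "{1..4::nat}"] by simp
  moreover have "nn n \<le> L2_set x {1..4} + L2_set (\<lambda>i. of_int (n i) - x i) {1..4::nat}"
    unfolding nn_def using L2_set_triangle_ineq[of x "\<lambda>i. of_int (n i) - x i" "{1..4::nat}"] by simp
  moreover have "L2_set (\<lambda>i. of_int (n i) - x i) {1..4::nat} = L2_set (\<lambda>i. x i - of_int (n i)) {1..4}"
    unfolding L2_set_def by (simp add: power2_commute)
  ultimately show ?thesis using d by linarith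
qed

text \<open>The intersection with \<open>space leb4\<close> fixes the coordinates off
  \<open>{1..4}\<close> to \<open>undefined\<close>, as points of the product measure
  require.\<close>

definition ball4 :: "real \<Rightarrow> (nat \<Rightarrow> real) set" where
  "ball4 r = {f. sqrt (\<Sum>i\<in>{1..4::nat}. (f i)\<^sup>2) \<le> r} \<inter> space leb4"

lemma ball4_measure: "r > 0 \<Longrightarrow> emeasure leb4 (ball4 r) = ennreal (pi\<^sup>2 / 2 * r ^ 4)"
  unfolding ball4_def using emeasure_cball_aux[of "{1..4::nat}" r]
  by (simp add: eval_unit_ball_vol)

lemma ball4_sets: "ball4 r \<in> sets leb4"
  unfolding ball4_def by measurable

lemma Nlat_upper: "r \<ge> 0 \<Longrightarrow> real (Nlat r) \<le> pi\<^sup>2 / 2 * (r + 2) ^ 4"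
proof -
  assume r: "r \<ge> 0"
  let ?S = "{n \<in> lat. nn n \<le> r}"
  have "(\<Union>n\<in>?S. cube n) \<subseteq> ball4 (r + 2)"
  proof
    fix x assume "x \<in> (\<Union>n\<in>?S. cube n)"
    then obtain n where n: "nn n \<le> r" "x \<in> cube n" by auto
    have "L2_set x {1..4} \<le> r + 2" using cube_norm[OF n(2)] n(1) by linarith
    moreover have "x \<in> space leb4" using n(2) sets.sets_into_space[OF cube_measure(1)] by blast
    ultimately show "x \<in> ball4 (r + 2)" by (simp add: ball4_def L2_set_def)
  qed
  hence "emeasure leb4 (\<Union>n\<in>?S. cube n) \<le> emeasure leb4 (ball4 (r + 2))"
    by (rule emeasure_mono[OF _ ball4_sets])
  moreover have "r + 2 > 0" using r by simp
  ultimately have "ennreal (real (Nlat r)) \<le> ennreal (pi\<^sup>2 / 2 * (r + 2) ^ 4)"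
    by (simp only: cube_ball_measure ball4_measure)
  thus ?thesis using r by (subst (asm) ennreal_le_iff) auto
qed

lemma Nlat_lower: "r > 2 \<Longrightarrow> pi\<^sup>2 / 2 * (r - 2) ^ 4 \<le> real (Nlat r)"
proof -
  assume r: "r > 2"
  let ?S = "{n \<in> lat. nn n \<le> r}"
  have "ball4 (r - 2) \<subseteq> (\<Union>n\<in>?S. cube n)"
  proof
    fix x assume x: "x \<in> ball4 (r - 2)"
    define n where "n i = (if i \<in> {1..4::nat} then \<lfloor>x i\<rfloor> else 0)" for i
    have nl: "n \<in> lat" unfolding lat_def n_def by simp
    have ext: "x \<in> extensional {1..4}" using x by (auto simp: ball4_def space_PiM PiE_def)
    have xc: "x \<in> cube n"
      unfolding cube_def
    proof (rule PiE_I)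
      fix i :: nat assume "i \<in> {1..4}"
      hence "n i = \<lfloor>x i\<rfloor>" unfolding n_def by (simp only: if_True)
      thus "x i \<in> {real_of_int (n i)..<real_of_int (n i) + 1}" by simp
    next
      fix i :: nat assume "i \<notin> {1..4}"
      thus "x i = undefined" using ext unfolding extensional_def by blast
    qed
    have "L2_set x {1..4} \<le> r - 2" using x by (simp add: ball4_def L2_set_def)
    hence "nn n \<le> r" using cube_norm[OF xc] by linarith
    thus "x \<in> (\<Union>n\<in>?S. cube n)" using nl xc by blast
  qed
  hence "emeasure leb4 (ball4 (r - 2)) \<le> emeasure leb4 (\<Union>n\<in>?S. cube n)"
    by (rule emeasure_mono) (intro cube_union_measure finite_nn_ball, auto)
  moreover have "r - 2 > 0" using r by simp
  ultimately have "ennreal (pi\<^sup>2 / 2 * (r - 2) ^ 4) \<le> ennreal (real (Nlat r))"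
    by (simp only: cube_ball_measure ball4_measure)
  thus ?thesis by (subst (asm) ennreal_le_iff) auto
qed

lemma Nlat_mono: "r \<le> s \<Longrightarrow> Nlat r \<le> Nlat s"
  unfolding Nlat_def by (rule card_mono[OF finite_nn_ball]) auto

lemma Nlat_bound: "r \<ge> 1 \<Longrightarrow> real (Nlat r) \<le> pi\<^sup>2 / 2 * 81 * r ^ 4"
proof -
  assume r: "r \<ge> 1"
  have "real (Nlat r) \<le> pi\<^sup>2 / 2 * (r + 2) ^ 4" using r by (intro Nlat_upper) auto
  also have "\<dots> \<le> pi\<^sup>2 / 2 * (3 * r) ^ 4" using r by (intro mult_left_mono power_mono) auto
  finally show ?thesis by (simp add: power_mult_distrib)
qed

text \<open>The additive constant makes the estimate valid from \<open>u = 0\<close> on, which is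
  what integration over \<open>{0..\<rho>}\<close> needs; an asymptotic statement alone would leave
  the small \<open>u\<close> open.\<close>

lemma Nlat_sqrt_approx:
  assumes "\<eta> > 0"
  shows "\<exists>C. \<forall>u\<ge>0. \<bar>real (Nlat (sqrt u)) - pi\<^sup>2 / 2 * u\<^sup>2\<bar> \<le> \<eta> * u\<^sup>2 + C"
proof -
  have lim: "((\<lambda>u::real. pi\<^sup>2 / 2 * (sqrt u + c) ^ 4 / u\<^sup>2) \<longlongrightarrow> pi\<^sup>2 / 2) at_top" for c :: real
  proof (rule Lim_transform_eventually)
    have "((\<lambda>u::real. c / sqrt u) \<longlongrightarrow> 0) at_top"
      by (rule tendsto_divide_0[OF tendsto_const filterlim_at_top_imp_at_infinity[OF sqrt_at_top]])
    hence "((\<lambda>u::real. pi\<^sup>2 / 2 * (1 + c / sqrt u) ^ 4) \<longlongrightarrow> pi\<^sup>2 / 2 * (1 + 0) ^ 4) at_top"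
      by (intro tendsto_mult tendsto_power tendsto_add tendsto_const)
    thus "((\<lambda>u::real. pi\<^sup>2 / 2 * (1 + c / sqrt u) ^ 4) \<longlongrightarrow> pi\<^sup>2 / 2) at_top" by simp
    show "\<forall>\<^sub>F u in at_top. pi\<^sup>2 / 2 * (1 + c / sqrt u) ^ 4 = pi\<^sup>2 / 2 * (sqrt u + c) ^ 4 / u\<^sup>2"
    proof (rule eventually_mono[OF eventually_gt_at_top[of "0::real"]])
      fix u :: real assume u: "0 < u"
      have "u\<^sup>2 = sqrt u ^ 4" using u by (simp add: power4_eq_xxxx power2_eq_square)
      moreover have "1 + c / sqrt u = (sqrt u + c) / sqrt u" using u by (simp add: add_divide_distrib)
      ultimately show "pi\<^sup>2 / 2 * (1 + c / sqrt u) ^ 4 = pi\<^sup>2 / 2 * (sqrt u + c) ^ 4 / u\<^sup>2"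
        by (simp only: power_divide times_divide_eq_right)
    qed
  qed
  have "((\<lambda>u::real. pi\<^sup>2 / 2 * (sqrt u + 2) ^ 4 / u\<^sup>2) \<longlongrightarrow> pi\<^sup>2 / 2) at_top"
    "((\<lambda>u::real. pi\<^sup>2 / 2 * (sqrt u - 2) ^ 4 / u\<^sup>2) \<longlongrightarrow> pi\<^sup>2 / 2) at_top"
    using lim[of 2] lim[of "-2"] by simp_all
  hence "eventually (\<lambda>u::real. pi\<^sup>2 / 2 * (sqrt u + 2) ^ 4 / u\<^sup>2 < pi\<^sup>2 / 2 + \<eta>) at_top"
    "eventually (\<lambda>u::real. pi\<^sup>2 / 2 * (sqrt u - 2) ^ 4 / u\<^sup>2 > pi\<^sup>2 / 2 - \<eta>) at_top"
    using assms by (auto dest: order_tendstoD(2)[where a = "pi\<^sup>2 / 2 + \<eta>"] order_tendstoD(1)[where a = "pi\<^sup>2 / 2 - \<eta>"])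
  hence "eventually (\<lambda>u::real. pi\<^sup>2 / 2 * (sqrt u + 2) ^ 4 / u\<^sup>2 < pi\<^sup>2 / 2 + \<eta> \<and>
     pi\<^sup>2 / 2 * (sqrt u - 2) ^ 4 / u\<^sup>2 > pi\<^sup>2 / 2 - \<eta> \<and> u > 4) at_top"
    by (intro eventually_conj eventually_gt_at_top)
  then obtain u0 where u0: "\<And>u. u \<ge> u0 \<Longrightarrow> pi\<^sup>2 / 2 * (sqrt u + 2) ^ 4 / u\<^sup>2 < pi\<^sup>2 / 2 + \<eta> \<and>
     pi\<^sup>2 / 2 * (sqrt u - 2) ^ 4 / u\<^sup>2 > pi\<^sup>2 / 2 - \<eta> \<and> u > 4"
    unfolding eventually_at_top_linorder by blast
  \<comment> \<open>Below the threshold both quantities are increasing in \<open>u\<close>, so their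
    values at \<open>u0\<close> bound the difference.\<close>
  define C where "C = real (Nlat (sqrt u0)) + pi\<^sup>2 / 2 * u0\<^sup>2"
  have u04: "u0 > 4" using u0[of u0] by simp
  have "\<bar>real (Nlat (sqrt u)) - pi\<^sup>2 / 2 * u\<^sup>2\<bar> \<le> \<eta> * u\<^sup>2 + C" if u: "u \<ge> 0" for u
  proof (cases "u \<ge> u0")
    case True
    have u4: "u > 4" using u0[OF True] by simp
    have s2: "sqrt u > 2" using u4 real_less_rsqrt[of 2 u] by simp
    have up: "u\<^sup>2 > 0" using u4 by simp
    have "pi\<^sup>2 / 2 * (sqrt u + 2) ^ 4 \<le> (pi\<^sup>2 / 2 + \<eta>) * u\<^sup>2"
      using u0[OF True] by (simp only: pos_divide_less_eq[OF up] less_imp_le)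
    moreover have "(pi\<^sup>2 / 2 - \<eta>) * u\<^sup>2 \<le> pi\<^sup>2 / 2 * (sqrt u - 2) ^ 4"
      using u0[OF True] by (simp only: pos_less_divide_eq[OF up] less_imp_le)
    moreover have "real (Nlat (sqrt u)) \<le> pi\<^sup>2 / 2 * (sqrt u + 2) ^ 4" by (rule Nlat_upper) (use u in simp)
    moreover have "pi\<^sup>2 / 2 * (sqrt u - 2) ^ 4 \<le> real (Nlat (sqrt u))" by (rule Nlat_lower[OF s2])
    moreover have "C \<ge> 0" by (simp add: C_def)
    ultimately show ?thesis unfolding distrib_right left_diff_distrib by linarith
  next
    case False
    have "real (Nlat (sqrt u)) \<le> real (Nlat (sqrt u0))" using False by (simp add: Nlat_mono)
    moreover have "pi\<^sup>2 / 2 * u\<^sup>2 \<le> pi\<^sup>2 / 2 * u0\<^sup>2" using False u by (intro mult_left_mono power_mono) auto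
    moreover have "0 \<le> \<eta> * u\<^sup>2" "0 \<le> pi\<^sup>2 / 2 * u\<^sup>2" using assms by auto
    ultimately show ?thesis unfolding C_def abs_le_iff using of_nat_0_le_iff[of "Nlat (sqrt u)"] of_nat_0_le_iff[of "Nlat (sqrt u0)"]
      by linarith
  qed
  thus ?thesis by blast
qed

text \<open>The first Riesz mean of the flat Laplacian, with eigenvalues
  \<open>(nn n)\<^sup>2\<close>, divided by \<open>\<rho>\<close>.\<close>

definition Phi :: "real \<Rightarrow> real" where
  "Phi \<rho> = (\<Sum>n\<in>{n \<in> lat. nn n \<le> sqrt \<rho>}. 1 - (nn n)\<^sup>2 / \<rho>)"

text \<open>Layer-cake formula: \<open>\<rho> - (nn n)\<^sup>2\<close> is the length of the set of
  levels \<open>u\<close> up to \<open>\<rho>\<close> whose ball contains \<open>n\<close>.\<close>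

lemma Phi_integral:
  assumes "\<rho> > 0"
  shows "((\<lambda>u. real (Nlat (sqrt u))) has_integral \<rho> * Phi \<rho>) {0..\<rho>}"
proof -
  let ?S = "{n \<in> lat. nn n \<le> sqrt \<rho>}"
  have le: "(nn n)\<^sup>2 \<le> u \<longleftrightarrow> nn n \<le> sqrt u" if "u \<ge> 0" for n u
    using that by (metis nn_ge0 real_le_rsqrt real_sqrt_le_iff real_sqrt_unique)
  have one: "((\<lambda>u. if u \<in> {(nn n)\<^sup>2..\<rho>} then 1 else 0) has_integral (\<rho> - (nn n)\<^sup>2)) {0..\<rho>}"
    if "n \<in> ?S" for n
  proof (rule has_integral_restrict[THEN iffD2])
    show "{(nn n)\<^sup>2..\<rho>} \<subseteq> {0..\<rho>}" by auto
    have "(nn n)\<^sup>2 \<le> \<rho>" using that assms le[of \<rho> n] by simp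
    thus "((\<lambda>u. 1) has_integral \<rho> - (nn n)\<^sup>2) {(nn n)\<^sup>2..\<rho>}"
      using has_integral_const_real[of "1::real" "(nn n)\<^sup>2" \<rho>] by simp
  qed
  have "((\<lambda>u. \<Sum>n\<in>?S. if u \<in> {(nn n)\<^sup>2..\<rho>} then 1 else 0) has_integral (\<Sum>n\<in>?S. \<rho> - (nn n)\<^sup>2)) {0..\<rho>}"
    by (rule has_integral_sum[OF finite_nn_ball one])
  moreover have "(\<Sum>n\<in>?S. \<rho> - (nn n)\<^sup>2) = \<rho> * Phi \<rho>"
    unfolding Phi_def sum_distrib_left using assms by (intro sum.cong) (auto simp: field_simps)
  moreover have "(\<Sum>n\<in>?S. if u \<in> {(nn n)\<^sup>2..\<rho>} then 1 else 0) = real (Nlat (sqrt u))" if u: "u \<in> {0..\<rho>}" for u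
  proof -
    have "sqrt u \<le> sqrt \<rho>" using u by simp
    hence "{n \<in> lat. nn n \<le> sqrt u} = {n\<in>?S. u \<in> {(nn n)\<^sup>2..\<rho>}}"
      using u le[of u] by (auto intro: order_trans[OF _ \<open>sqrt u \<le> sqrt \<rho>\<close>])
    hence "real (Nlat (sqrt u)) = (\<Sum>n\<in>{n\<in>?S. u \<in> {(nn n)\<^sup>2..\<rho>}}. 1)" by (simp add: Nlat_def)
    also have "\<dots> = (\<Sum>n\<in>?S. if u \<in> {(nn n)\<^sup>2..\<rho>} then 1 else 0)"
      by (rule sum.inter_filter[OF finite_nn_ball])
    finally show ?thesis by simp
  qed
  ultimately show ?thesis by (metis (no_types, lifting) has_integral_eq)
qed

text \<open>Integrating the lattice count \<open>pi^2/2 u^2\<close> up to \<open>\<rho>\<close>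
  gives \<open>pi^2/6 \<rho>^3\<close>, and \<open>Phi\<close> carries one factor
  \<open>\<rho>\<close> less.\<close>

lemma Phi_asymp:
  assumes "\<eta> > 0"
  shows "\<exists>\<rho>0>0. \<forall>\<rho>\<ge>\<rho>0. \<bar>Phi \<rho> - pi\<^sup>2 / 6 * \<rho>\<^sup>2\<bar> \<le> \<eta> * \<rho>\<^sup>2"
proof -
  obtain C where C: "\<And>u. u \<ge> 0 \<Longrightarrow> \<bar>real (Nlat (sqrt u)) - pi\<^sup>2 / 2 * u\<^sup>2\<bar> \<le> \<eta> * u\<^sup>2 + C"
    using Nlat_sqrt_approx[OF assms] by blast
  \<comment> \<open>Beyond \<open>\<rho>0\<close> the integrated constant is at most
    \<open>\<eta> \<rho>^3 / 2\<close>; together with \<open>\<eta> \<rho>^3 / 3\<close> from the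
    quadratic error this stays below \<open>\<eta> \<rho>^3\<close>.\<close>
  define \<rho>0 where "\<rho>0 = 1 + 2 * \<bar>C\<bar> / \<eta>"
  have \<rho>01: "\<rho>0 \<ge> 1" using assms by (simp add: \<rho>0_def)
  have "\<bar>Phi \<rho> - pi\<^sup>2 / 6 * \<rho>\<^sup>2\<bar> \<le> \<eta> * \<rho>\<^sup>2" if \<rho>: "\<rho> \<ge> \<rho>0" for \<rho>
  proof -
    have r1: "\<rho> \<ge> 1" using \<rho> \<rho>01 by linarith
    have poly: "((\<lambda>u. c * u\<^sup>2 + d) has_integral (c * \<rho> ^ 3 / 3 + d * \<rho>)) {0..\<rho>}" for c d
    proof -
      have "((\<lambda>u. c * u\<^sup>2 + d) has_integral ((c * \<rho> ^ 3 / 3 + d * \<rho>) - (c * 0 ^ 3 / 3 + d * 0))) {0..\<rho>}"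
        by (rule fundamental_theorem_of_calculus)
           (use r1 in \<open>auto intro!: derivative_eq_intros simp flip: has_real_derivative_iff_has_vector_derivative\<close>)
      thus ?thesis by simp
    qed
    have I: "((\<lambda>u. real (Nlat (sqrt u))) has_integral \<rho> * Phi \<rho>) {0..\<rho>}"
      using r1 by (intro Phi_integral) auto
    have up: "\<rho> * Phi \<rho> \<le> (pi\<^sup>2 / 2 + \<eta>) * \<rho> ^ 3 / 3 + \<bar>C\<bar> * \<rho>"
    proof (rule has_integral_le[OF I poly])
      fix u assume "u \<in> {0..\<rho>}"
      thus "real (Nlat (sqrt u)) \<le> (pi\<^sup>2 / 2 + \<eta>) * u\<^sup>2 + \<bar>C\<bar>"
        using C[of u] unfolding distrib_right by auto
    qed
    have low: "(pi\<^sup>2 / 2 - \<eta>) * \<rho> ^ 3 / 3 + (- \<bar>C\<bar>) * \<rho> \<le> \<rho> * Phi \<rho>"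
    proof (rule has_integral_le[OF poly I])
      fix u assume "u \<in> {0..\<rho>}"
      thus "(pi\<^sup>2 / 2 - \<eta>) * u\<^sup>2 + (- \<bar>C\<bar>) \<le> real (Nlat (sqrt u))"
        using C[of u] unfolding left_diff_distrib by auto
    qed
    have "2 * \<bar>C\<bar> / \<eta> \<le> \<rho>" using \<rho> by (simp add: \<rho>0_def)
    hence "2 * \<bar>C\<bar> \<le> \<eta> * \<rho>" using assms by (simp add: divide_le_eq mult.commute)
    also have "\<dots> \<le> \<eta> * \<rho>\<^sup>2" using r1 assms by (intro mult_left_mono) (auto simp: power2_eq_square)
    finally have Cb: "\<bar>C\<bar> * \<rho> \<le> (\<eta> * \<rho>\<^sup>2 / 2) * \<rho>" using r1 by (intro mult_right_mono) auto
    have cub: "\<rho> ^ 3 = \<rho>\<^sup>2 * \<rho>" by (simp add: power2_eq_square power3_eq_cube)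
    have "Phi \<rho> * \<rho> \<le> (pi\<^sup>2 / 6 * \<rho>\<^sup>2 + \<eta> * \<rho>\<^sup>2) * \<rho>"
    proof -
      have "0 \<le> \<eta> * \<rho>\<^sup>2 * \<rho>" using assms r1 by simp
      moreover have "(pi\<^sup>2 / 2 + \<eta>) * \<rho> ^ 3 / 3 = pi\<^sup>2 / 6 * \<rho>\<^sup>2 * \<rho> + \<eta> * \<rho>\<^sup>2 * \<rho> / 3"
        unfolding cub by (simp add: field_simps)
      moreover have "\<eta> * \<rho>\<^sup>2 / 2 * \<rho> = \<eta> * \<rho>\<^sup>2 * \<rho> / 2" by simp
      ultimately show ?thesis using up Cb unfolding distrib_right mult.commute[of \<rho> "Phi \<rho>"] by linarith
    qed
    hence 1: "Phi \<rho> \<le> pi\<^sup>2 / 6 * \<rho>\<^sup>2 + \<eta> * \<rho>\<^sup>2" using r1 by simp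
    have "(pi\<^sup>2 / 6 * \<rho>\<^sup>2 - \<eta> * \<rho>\<^sup>2) * \<rho> \<le> Phi \<rho> * \<rho>"
    proof -
      have "0 \<le> \<eta> * \<rho>\<^sup>2 * \<rho>" using assms r1 by simp
      moreover have "(pi\<^sup>2 / 2 - \<eta>) * \<rho> ^ 3 / 3 = pi\<^sup>2 / 6 * \<rho>\<^sup>2 * \<rho> - \<eta> * \<rho>\<^sup>2 * \<rho> / 3"
        unfolding cub by (simp add: field_simps)
      moreover have "\<eta> * \<rho>\<^sup>2 / 2 * \<rho> = \<eta> * \<rho>\<^sup>2 * \<rho> / 2" by simp
      moreover have "(- \<bar>C\<bar>) * \<rho> = - (\<bar>C\<bar> * \<rho>)" by simp
      ultimately show ?thesis using low Cb unfolding left_diff_distrib mult.commute[of \<rho> "Phi \<rho>"] by linarith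
    qed
    hence 2: "pi\<^sup>2 / 6 * \<rho>\<^sup>2 - \<eta> * \<rho>\<^sup>2 \<le> Phi \<rho>" using r1 by simp
    show ?thesis using 1 2 by linarith
  qed
  thus ?thesis using \<rho>01 by (intro exI[of _ \<rho>0]) auto
qed

section \<open>Riesz means\<close>

lemma cos_lipschitz: "\<bar>cos x - cos y\<bar> \<le> \<bar>x - y\<bar>" for x y :: real
proof -
  have "\<bar>cos x - cos y\<bar> = 2 * (\<bar>sin ((x + y) / 2)\<bar> * \<bar>sin ((y - x) / 2)\<bar>)"
    unfolding cos_diff_cos by (simp add: abs_mult)
  also have "\<dots> \<le> 2 * (1 * \<bar>(y - x) / 2\<bar>)"
    by (intro mult_left_mono mult_mono abs_sin_x_le_abs_x) auto
  finally show ?thesis by simp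
qed

text \<open>A quadratic partition of unity: \<open>chi J e j\<close> lives on \<open>\<bar>r - j e\<bar> \<le> e\<close> for \<open>j < J\<close>,
  and \<open>chi J e J\<close> on \<open>r \<ge> (J - 1) e\<close>.\<close>

definition chi :: "nat \<Rightarrow> real \<Rightarrow> nat \<Rightarrow> real \<Rightarrow> real" where
  "chi J e j r = (if j < J then cos (pi / 2 * min 1 \<bar>r / e - real j\<bar>)
                  else cos (pi / 2 * max 0 (min 1 (real J - r / e))))"

lemma chi_abs: "\<bar>chi J e j r\<bar> \<le> 1"
  unfolding chi_def by auto

lemma chi_lipschitz:
  assumes "e > 0"
  shows "\<bar>chi J e j r - chi J e j s\<bar> \<le> pi / (2 * e) * \<bar>r - s\<bar>"
proof -
  have c: "\<bar>cos (pi / 2 * a) - cos (pi / 2 * b)\<bar> \<le> pi / 2 * d" if "\<bar>a - b\<bar> \<le> d" for a b d :: real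
  proof -
    have "\<bar>cos (pi / 2 * a) - cos (pi / 2 * b)\<bar> \<le> \<bar>pi / 2 * (a - b)\<bar>"
      using cos_lipschitz[of "pi / 2 * a" "pi / 2 * b"] unfolding right_diff_distrib .
    also have "\<dots> = pi / 2 * \<bar>a - b\<bar>" by (simp add: abs_mult)
    also have "\<dots> \<le> pi / 2 * d" using that by (intro mult_left_mono) auto
    finally show ?thesis .
  qed
  have d: "\<bar>r / e - s / e\<bar> = \<bar>r - s\<bar> / e" using assms by (simp add: diff_divide_distrib[symmetric])
  have "\<bar>chi J e j r - chi J e j s\<bar> \<le> pi / 2 * \<bar>r / e - s / e\<bar>"
  proof (cases "j < J")
    case True
    thus ?thesis unfolding chi_def by (simp only: if_True) (rule c, linarith)
  next
    case False
    thus ?thesis unfolding chi_def by (simp only: if_False) (rule c, linarith)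
  qed
  thus ?thesis unfolding d by simp
qed

lemma chi_support:
  assumes "e > 0" "j < J" "chi J e j r \<noteq> 0"
  shows "\<bar>r - real j * e\<bar> < e"
proof -
  have "\<bar>r / e - real j\<bar> < 1"
  proof (rule ccontr)
    assume "\<not> \<bar>r / e - real j\<bar> < 1"
    hence "min 1 \<bar>r / e - real j\<bar> = 1" by simp
    thus False using assms(2,3) by (simp add: chi_def)
  qed
  moreover have "r / e - real j = (r - real j * e) / e" using assms(1) by (simp add: diff_divide_distrib)
  ultimately show ?thesis using assms(1) by (simp add: divide_less_eq)
qed

lemma chi_top_support:
  assumes "e > 0" "chi J e J r \<noteq> 0"
  shows "(real J - 1) * e < r"
proof -
  have "real J - r / e < 1"
  proof (rule ccontr)
    assume "\<not> real J - r / e < 1"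
    hence "max 0 (min 1 (real J - r / e)) = 1" by simp
    thus False using assms(2) by (simp add: chi_def)
  qed
  hence "real J - 1 < r / e" by linarith
  thus ?thesis using assms(1) by (simp add: less_divide_eq)
qed

text \<open>The sum telescopes: raising \<open>J\<close> by one splits the outer cutoff into a new
  shell and a smaller outer cutoff. On the overlap the two are cosine and sine of the same
  angle.\<close>

lemma chi_sum:
  assumes "e > 0" "r \<ge> 0"
  shows "(\<Sum>j\<le>J. (chi J e j r)\<^sup>2) = 1"
proof -
  define x where "x = r / e"
  define p where "p j = cos (pi / 2 * min 1 \<bar>x - real j\<bar>)" for j
  define q where "q J = cos (pi / 2 * max 0 (min 1 (real J - x)))" for J
  have x0: "x \<ge> 0" using assms by (simp add: x_def)
  have step: "(p J)\<^sup>2 + (q (Suc J))\<^sup>2 = (q J)\<^sup>2" for J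
  proof -
    consider "x \<le> real J - 1" | "real J - 1 \<le> x" "x \<le> real J" | "real J \<le> x" "x \<le> real J + 1" | "real J + 1 \<le> x" by linarith
    thus ?thesis
    proof cases
      case 1
      hence "min 1 \<bar>x - real J\<bar> = 1" "max 0 (min 1 (real (Suc J) - x)) = 1" "max 0 (min 1 (real J - x)) = 1" by auto
      thus ?thesis unfolding p_def q_def by (simp only:) simp
    next
      case 2
      hence "min 1 \<bar>x - real J\<bar> = real J - x" "max 0 (min 1 (real (Suc J) - x)) = 1" "max 0 (min 1 (real J - x)) = real J - x" by auto
      thus ?thesis unfolding p_def q_def by (simp only:) simp
    next
      case 3
      hence e: "min 1 \<bar>x - real J\<bar> = x - real J" "max 0 (min 1 (real (Suc J) - x)) = 1 - (x - real J)" "max 0 (min 1 (real J - x)) = 0" by auto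
      have "cos (pi / 2 * (1 - (x - real J))) = sin (pi / 2 * (x - real J))"
        using sin_cos_eq[of "pi / 2 * (x - real J)"] by (simp add: right_diff_distrib)
      thus ?thesis unfolding p_def q_def e by (simp only: mult_zero_right cos_zero) simp
    next
      case 4
      hence "min 1 \<bar>x - real J\<bar> = 1" "max 0 (min 1 (real (Suc J) - x)) = 0" "max 0 (min 1 (real J - x)) = 0" by auto
      thus ?thesis unfolding p_def q_def by (simp only:) simp
    qed
  qed
  have "(\<Sum>j<J. (p j)\<^sup>2) + (q J)\<^sup>2 = 1" for J
  proof (induction J)
    case 0
    have "max 0 (min 1 (real 0 - x)) = 0" using x0 by simp
    thus ?case by (simp add: q_def)
  next
    case (Suc J)
    thus ?case using step[of J] by simp
  qed
  moreover have "(\<Sum>j<J. (chi J e j r)\<^sup>2) = (\<Sum>j<J. (p j)\<^sup>2)"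
    by (intro sum.cong) (auto simp: chi_def p_def x_def)
  moreover have "chi J e J r = q J" by (simp add: chi_def q_def x_def)
  ultimately show ?thesis by (simp add: lessThan_Suc_atMost[symmetric])
qed

section \<open>Polynomial approximation and orthonormal families\<close>

lemma poly_approx:
  fixes f :: "real \<Rightarrow> real"
  assumes "continuous_on {a..b} f" "e > 0"
  shows "\<exists>p. \<forall>s\<in>{a..b}. \<bar>poly p s - f s\<bar> < e"
proof -
  obtain g where g: "real_polynomial_function g" "\<And>x. x \<in> {a..b} \<Longrightarrow> \<bar>f x - g x\<bar> < e"
    using Stone_Weierstrass_real_polynomial_function[OF compact_Icc assms] by blast
  then obtain c n where c: "g = (\<lambda>x. \<Sum>i\<le>n. c i * x ^ i)"
    unfolding real_polynomial_function_iff_sum by blast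
  have "poly (\<Sum>i\<le>n. monom (c i) i) s = g s" for s by (simp add: c poly_sum poly_monom)
  thus ?thesis using g(2) by (intro exI[of _ "\<Sum>i\<le>n. monom (c i) i"]) (simp add: abs_minus_commute)
qed

text \<open>The square root is approximated and then squared. Having an exact square turns the form
  of the operator into a squared norm, to which a Hilbert-Schmidt argument applies.\<close>

lemma poly_square_approx:
  fixes f :: "real \<Rightarrow> real"
  assumes f: "continuous_on {a..b} f" "\<And>s. s \<in> {a..b} \<Longrightarrow> 0 \<le> f s" and e: "e > 0"
  shows "\<exists>g. \<forall>s\<in>{a..b}. \<bar>(poly g s)\<^sup>2 - f s\<bar> \<le> e"
proof -
  have "bounded (f ` {a..b})" by (intro compact_imp_bounded compact_continuous_image f compact_Icc)
  then obtain G where G: "G > 0" "\<And>s. s \<in> {a..b} \<Longrightarrow> \<bar>f s\<bar> \<le> G" by (auto simp: bounded_pos)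
  \<comment> \<open>The difference of squares factors; with error at most 1 in the root, the sum
    factor is at most \<open>2 * sqrt G + 1\<close>.\<close>
  define d where "d = min 1 (e / (2 * sqrt G + 1))"
  have sG: "2 * sqrt G + 1 > 0" using G(1) by (intro add_nonneg_pos) auto
  have d: "d > 0" "d \<le> 1" "d * (2 * sqrt G + 1) \<le> e"
  proof -
    show "d > 0" "d \<le> 1" using e sG by (auto simp: d_def)
    have "d \<le> e / (2 * sqrt G + 1)" by (simp add: d_def)
    thus "d * (2 * sqrt G + 1) \<le> e" using sG by (simp only: pos_le_divide_eq)
  qed
  obtain g where g: "\<And>s. s \<in> {a..b} \<Longrightarrow> \<bar>poly g s - sqrt (f s)\<bar> < d"
    using poly_approx[OF continuous_on_real_sqrt[OF f(1)] d(1)] by blast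
  have "\<bar>(poly g s)\<^sup>2 - f s\<bar> \<le> e" if s: "s \<in> {a..b}" for s
  proof -
    have sf: "0 \<le> sqrt (f s)" "sqrt (f s) \<le> sqrt G" using f(2)[OF s] G(2)[OF s] by auto
    have "(poly g s)\<^sup>2 - f s = (poly g s - sqrt (f s)) * (poly g s + sqrt (f s))"
    proof -
      have "(poly g s - sqrt (f s)) * (poly g s + sqrt (f s)) = (poly g s)\<^sup>2 - (sqrt (f s))\<^sup>2"
        by (simp add: power2_eq_square algebra_simps)
      thus ?thesis using f(2)[OF s] by simp
    qed
    hence "\<bar>(poly g s)\<^sup>2 - f s\<bar> = \<bar>poly g s - sqrt (f s)\<bar> * \<bar>poly g s + sqrt (f s)\<bar>" by (simp only: abs_mult)
    also have "\<dots> \<le> d * (2 * sqrt G + 1)"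
    proof (rule mult_mono)
      show "\<bar>poly g s - sqrt (f s)\<bar> \<le> d" using g[OF s] by simp
      show "\<bar>poly g s + sqrt (f s)\<bar> \<le> 2 * sqrt G + 1" using g[OF s] sf d by linarith
    qed (use d in auto)
    finally show ?thesis using d(3) by linarith
  qed
  thus ?thesis by blast
qed

lemma ons_pythagoras:
  assumes "finite O'" "ons O'"
  defines "p \<equiv> \<lambda>u. \<Sum>\<psi>\<in>O'. cs (cip u \<psi>) \<psi>"
  shows "(norm u)\<^sup>2 = (norm (u - p u))\<^sup>2 + (\<Sum>\<psi>\<in>O'. (cmod (cip u \<psi>))\<^sup>2)"
proof -
  have 0: "cip (u - p u) (p u) = 0"
  proof -
    have "cip (u - p u) (cs (cip u \<psi>) \<psi>) = 0" if "\<psi> \<in> O'" for \<psi>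
      unfolding p_def cip_cs_right ons_projection[OF assms(1,2) that] by simp
    thus ?thesis using cip_sum_right[of "u - p u" "\<lambda>\<psi>. cs (cip u \<psi>) \<psi>" O'] by (simp add: p_def)
  qed
  have "cip u u = cip (u - p u) (u - p u) + cip (u - p u) (p u) + cip (p u) u"
    by (simp add: cip_diff_left cip_diff_right)
  also have "cip (p u) u = (\<Sum>\<psi>\<in>O'. of_real ((cmod (cip u \<psi>))\<^sup>2))"
    unfolding p_def cip_sum_left cip_cs_left complex_norm_square by (simp add: cip_cnj)
  finally have "complex_of_real ((norm u)\<^sup>2) = of_real ((norm (u - p u))\<^sup>2 + (\<Sum>\<psi>\<in>O'. (cmod (cip u \<psi>))\<^sup>2))"
    using 0 by (simp add: cip_self_norm)
  thus ?thesis by (simp only: of_real_eq_iff)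
qed

lemma bessel: "finite O' \<Longrightarrow> ons O' \<Longrightarrow> (\<Sum>\<psi>\<in>O'. (cmod (cip u \<psi>))\<^sup>2) \<le> (norm u)\<^sup>2"
  using ons_pythagoras[of O' u] zero_le_power2 by (metis add.commute le_add_same_cancel1)

section \<open>Localisation to frequency shells\<close>

abbreviation cm :: "nat \<Rightarrow> real \<Rightarrow> real \<Rightarrow> nat \<Rightarrow> (nat \<Rightarrow> int) \<Rightarrow> real" where
  "cm J e t j \<equiv> \<lambda>n. chi J e j (nn n / t)"
abbreviation ch :: "nat \<Rightarrow> real \<Rightarrow> real \<Rightarrow> nat \<Rightarrow> hil \<Rightarrow> hil" where
  "ch J e t j \<equiv> mlt (cm J e t j)"

lemma cm_mdom [simp]: "x \<in> mdom (cm J e t j)"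
  by (rule mdom_bounded[OF chi_abs])
lemma ch_norm: "norm (ch J e t j x) \<le> norm x"
  using mlt_norm_le[of "cm J e t j" 1 x] chi_abs by simp
lemma cm_lipschitz:
  assumes "e > 0" "t > 0"
  shows "\<bar>cm J e t j n - cm J e t j m\<bar> \<le> pi / (2 * e * t) * nn (n - m)"
proof -
  have "\<bar>cm J e t j n - cm J e t j m\<bar> \<le> pi / (2 * e) * \<bar>nn n / t - nn m / t\<bar>" by (rule chi_lipschitz[OF assms(1)])
  also have "\<bar>nn n / t - nn m / t\<bar> = \<bar>nn n - nn m\<bar> / t" using assms by (simp add: diff_divide_distrib[symmetric])
  also have "pi / (2 * e) * (\<bar>nn n - nn m\<bar> / t) \<le> pi / (2 * e) * (nn (n - m) / t)"
    using assms by (intro mult_left_mono divide_right_mono nn_lipschitz) auto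
  finally show ?thesis by simp
qed

lemma ch_square_sum:
  assumes "e > 0" "t > 0"
  shows "(\<Sum>j\<le>J. ch J e t j (ch J e t j x)) = x"
proof (rule hil_eqI)
  fix n
  have "co (\<Sum>j\<le>J. ch J e t j (ch J e t j x)) n = of_real (\<Sum>j\<le>J. (cm J e t j n)\<^sup>2) * co x n"
    by (simp add: co_sum co_mlt sum_distrib_right power2_eq_square mult.assoc)
  also have "(\<Sum>j\<le>J. (cm J e t j n)\<^sup>2) = 1" by (rule chi_sum) (use assms in auto)
  finally show "co (\<Sum>j\<le>J. ch J e t j (ch J e t j x)) n = co x n" by simp
qed

lemma ch_norm_sum:
  assumes "e > 0" "t > 0"
  shows "(\<Sum>j\<le>J. (norm (ch J e t j x))\<^sup>2) = (norm x)\<^sup>2"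
proof -
  have "cip x x = cip (\<Sum>j\<le>J. ch J e t j (ch J e t j x)) x" by (simp only: ch_square_sum[OF assms])
  also have "\<dots> = (\<Sum>j\<le>J. of_real ((norm (ch J e t j x))\<^sup>2))"
    unfolding cip_sum_left cip_self_norm[symmetric] by (intro sum.cong refl mlt_symmetric cm_mdom)
  finally have "complex_of_real ((norm x)\<^sup>2) = of_real (\<Sum>j\<le>J. (norm (ch J e t j x))\<^sup>2)"
    by (simp add: cip_self_norm)
  thus ?thesis by (simp only: of_real_eq_iff)
qed

text \<open>A cut-off vector has finitely many frequencies, all with \<open>nn n\<close> within
  \<open>e * t\<close> of \<open>real j * e * t\<close>. Hence it lies in \<open>H2\<close>, and
  \<open>Lm\<close> acts on it almost as a scalar.\<close>

lemma ch_shell: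
  assumes "e > 0" "t > 0" "j < J"
  shows "ch J e t j x \<in> H2"
    "norm (Lm (ch J e t j x) - scaleR (real j * e * t) (ch J e t j x)) \<le> e * t * norm (ch J e t j x)"
    "norm (Lm (ch J e t j x)) \<le> real J * e * t * norm (ch J e t j x)"
proof -
  let ?y = "ch J e t j x"
  have sup: "\<bar>nn n - real j * e * t\<bar> \<le> e * t" if "co ?y n \<noteq> 0" for n
  proof -
    have "cm J e t j n \<noteq> 0" using that by (auto simp: co_mlt)
    hence "\<bar>nn n / t - real j * e\<bar> < e" by (rule chi_support[OF assms(1,3)])
    moreover have "nn n / t - real j * e = (nn n - real j * e * t) / t" using assms(2) by (simp add: diff_divide_distrib)
    ultimately show ?thesis using assms(2) by (simp add: divide_less_eq)
  qed
  have jJ: "real j * e * t + e * t \<le> real J * e * t"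
  proof -
    have "(real j + 1) * (e * t) \<le> real J * (e * t)" using assms by (intro mult_right_mono) auto
    thus ?thesis by (simp add: algebra_simps)
  qed
  have supJ: "nn n \<le> real J * e * t" if "co ?y n \<noteq> 0" for n using sup[OF that] jJ by linarith
  show H2: "?y \<in> H2" unfolding H2_def
    by (rule mdom_finite_support[where r = "real J * e * t"]) (use supJ in force)
  have Lc: "co (Lm ?y) n = of_real (nn n) * co ?y n" for n by (rule co_mlt[OF H2_nn[OF H2]])
  show "norm (Lm ?y - scaleR (real j * e * t) ?y) \<le> e * t * norm ?y"
  proof (rule norm_comparison)
    fix n
    have "co (Lm ?y - scaleR (real j * e * t) ?y) n = of_real (nn n - real j * e * t) * co ?y n"
      unfolding co_diff co_scaleR Lc by (simp add: algebra_simps)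
    moreover have "\<bar>nn n - real j * e * t\<bar> * cmod (co ?y n) \<le> e * t * cmod (co ?y n)"
      using sup[of n] by (cases "co ?y n = 0") (auto intro: mult_right_mono)
    ultimately show "cmod (co (Lm ?y - scaleR (real j * e * t) ?y) n) \<le> e * t * cmod (co ?y n)"
      by (simp only: norm_mult norm_of_real)
  qed (use assms in auto)
  show "norm (Lm ?y) \<le> real J * e * t * norm ?y"
  proof (rule norm_comparison)
    fix n
    have "nn n * cmod (co ?y n) \<le> real J * e * t * cmod (co ?y n)"
      using supJ[of n] by (cases "co ?y n = 0") (auto intro: mult_right_mono)
    thus "cmod (co (Lm ?y) n) \<le> real J * e * t * cmod (co ?y n)"
      by (simp only: Lc norm_mult norm_of_real abs_of_nonneg[OF nn_ge0])
  qed (use assms in auto)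
qed

lemma ch_Lm:
  assumes "x \<in> mdom nn"
  shows "ch J e t j x \<in> mdom nn" "Lm (ch J e t j x) = ch J e t j (Lm x)"
proof -
  have "of_real (nn n) * co (ch J e t j x) n = co (ch J e t j (Lm x)) n" for n
    by (simp add: co_mlt assms)
  from mdomI[of nn, OF this] show "ch J e t j x \<in> mdom nn" "Lm (ch J e t j x) = ch J e t j (Lm x)" by auto
qed

context nct begin

text \<open>A Hilbert-Schmidt estimate: Bessel's inequality replaces the orthonormal family by the
  standard basis, and the resulting double sum depends on the basis vector only through
  \<open>c\<close>, since all columns of \<open>rpop g\<close> have the norm of the column at
  \<open>bas 0\<close>.\<close>

lemma trace_bound:
  assumes O: "finite O'" "ons O'" and F: "finite F" "F \<subseteq> lat"
    and c: "\<And>n. \<bar>c n\<bar> \<le> 1" "\<And>n. n \<in> lat \<Longrightarrow> n \<notin> F \<Longrightarrow> c n = 0"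
  shows "(\<Sum>\<psi>\<in>O'. (norm (rpop g (mlt c \<psi>)))\<^sup>2) \<le> (\<Sum>m\<in>F. (c m)\<^sup>2) * (norm (rpop g (bas 0)))\<^sup>2"
proof -
  have dom: "x \<in> mdom c" for x by (rule mdom_bounded[OF c(1)])
  have "((\<lambda>n. \<Sum>\<psi>\<in>O'. (cmod (co (rpop g (mlt c \<psi>)) n))\<^sup>2) has_sum (\<Sum>\<psi>\<in>O'. (norm (rpop g (mlt c \<psi>)))\<^sup>2)) lat"
    by (intro has_sum_finite_sum norm_sq_has_sum)
  thus ?thesis
  proof (rule has_sum_le_finite_sums)
    fix G assume G: "finite G" "G \<subseteq> lat"
    have "(\<Sum>n\<in>G. \<Sum>\<psi>\<in>O'. (cmod (co (rpop g (mlt c \<psi>)) n))\<^sup>2) \<le> (\<Sum>n\<in>G. (norm (mlt c (rpop g (bas n))))\<^sup>2)"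
    proof (rule sum_mono)
      fix n assume n: "n \<in> G"
      have "cmod (co (rpop g (mlt c \<psi>)) n) = cmod (cip (mlt c (rpop g (bas n))) \<psi>)" for \<psi>
      proof -
        have "co (rpop g (mlt c \<psi>)) n = cip (rpop g (mlt c \<psi>)) (bas n)" using n G by (simp add: cip_bas subset_iff)
        also have "\<dots> = cip \<psi> (mlt c (rpop g (bas n)))"
          by (simp add: rpop_selfadjoint mlt_symmetric[OF dom dom])
        also have "cmod \<dots> = cmod (cip (mlt c (rpop g (bas n))) \<psi>)" by (metis cip_cnj complex_mod_cnj)
        finally show ?thesis .
      qed
      thus "(\<Sum>\<psi>\<in>O'. (cmod (co (rpop g (mlt c \<psi>)) n))\<^sup>2) \<le> (norm (mlt c (rpop g (bas n))))\<^sup>2"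
        using bessel[OF O, of "mlt c (rpop g (bas n))"] by simp
    qed
    also have "\<dots> \<le> (\<Sum>n\<in>G. \<Sum>m\<in>F. (c m)\<^sup>2 * (cmod (co (rpop g (bas m)) n))\<^sup>2)"
    proof (rule sum_mono)
      fix n assume n: "n \<in> G"
      \<comment> \<open>The matrix of \<open>rpop g\<close> is Hermitian, so rows may be exchanged
        for columns, whose norms are known.\<close>
      have sym: "cmod (co (rpop g (bas n)) m) = cmod (co (rpop g (bas m)) n)" if "m \<in> F" for m
      proof -
        have mn: "m \<in> lat" "n \<in> lat" using that n F G by auto
        have "co (rpop g (bas n)) m = cip (bas n) (rpop g (bas m))" using mn by (simp add: cip_bas[symmetric] rpop_selfadjoint)
        also have "cmod \<dots> = cmod (cip (rpop g (bas m)) (bas n))" by (metis cip_cnj complex_mod_cnj)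
        finally show ?thesis using mn by (simp add: cip_bas)
      qed
      have "((\<lambda>m. (cmod (co (mlt c (rpop g (bas n))) m))\<^sup>2) has_sum (norm (mlt c (rpop g (bas n))))\<^sup>2) lat"
        by (rule norm_sq_has_sum)
      moreover have "((\<lambda>m. (cmod (co (mlt c (rpop g (bas n))) m))\<^sup>2) has_sum (\<Sum>m\<in>F. (cmod (co (mlt c (rpop g (bas n))) m))\<^sup>2)) lat"
        by (rule has_sum_finite_neutralI[OF F]) (auto simp: co_mlt[OF dom] c(2))
      ultimately have "(norm (mlt c (rpop g (bas n))))\<^sup>2 = (\<Sum>m\<in>F. (cmod (co (mlt c (rpop g (bas n))) m))\<^sup>2)"
        by (rule has_sum_unique)
      also have "\<dots> = (\<Sum>m\<in>F. (c m)\<^sup>2 * (cmod (co (rpop g (bas m)) n))\<^sup>2)"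
        by (intro sum.cong refl) (simp add: co_mlt[OF dom] norm_mult power_mult_distrib sym)
      finally show "(norm (mlt c (rpop g (bas n))))\<^sup>2 \<le> (\<Sum>m\<in>F. (c m)\<^sup>2 * (cmod (co (rpop g (bas m)) n))\<^sup>2)" by simp
    qed
    also have "\<dots> = (\<Sum>m\<in>F. (c m)\<^sup>2 * (\<Sum>n\<in>G. (cmod (co (rpop g (bas m)) n))\<^sup>2))"
      by (subst sum.swap) (simp add: sum_distrib_left)
    also have "\<dots> \<le> (\<Sum>m\<in>F. (c m)\<^sup>2 * (norm (rpop g (bas 0)))\<^sup>2)"
    proof (intro sum_mono mult_left_mono)
      fix m assume "m \<in> F"
      hence "norm (rpop g (bas m)) = norm (rpop g (bas 0))" using F by (intro rpop_bas_norm) auto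
      thus "(\<Sum>n\<in>G. (cmod (co (rpop g (bas m)) n))\<^sup>2) \<le> (norm (rpop g (bas 0)))\<^sup>2"
        using finite_sum_le_norm[OF G(1), of "rpop g (bas m)"] by simp
    qed auto
    finally show "(\<Sum>n\<in>G. \<Sum>\<psi>\<in>O'. (cmod (co (rpop g (mlt c \<psi>)) n))\<^sup>2) \<le> (\<Sum>m\<in>F. (c m)\<^sup>2) * (norm (rpop g (bas 0)))\<^sup>2"
      by (simp add: sum_distrib_right)
  qed
qed

text \<open>Each cutoff is moved once across \<open>X\<close>, after which the doubled cutoffs sum
  to the identity. One commutator costs \<open>1 / (e * t)\<close>, so for a fixed number of shells
  the loss vanishes as \<open>t\<close> grows.\<close>

lemma localization: "\<exists>K\<ge>0. \<forall>J e t z. e > 0 \<longrightarrow> t > 0 \<longrightarrow>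
   (\<Sum>j\<le>J. Re (cip (X (ch J e t j z)) (ch J e t j z))) \<le> Re (cip (X z) z) + real (Suc J) * (K * (pi / (2 * e * t))) * (norm z)\<^sup>2"
proof -
  obtain K where K: "K \<ge> 0" "\<And>g l x. \<forall>m\<in>lat. \<forall>n\<in>lat. \<bar>g n - g m\<bar> \<le> l * nn (n - m) \<Longrightarrow> l \<ge> 0 \<Longrightarrow>
     x \<in> mdom g \<Longrightarrow> norm (mlt g (X x) - X (mlt g x)) \<le> K * l * norm x" using X_commutator by blast
  have "(\<Sum>j\<le>J. Re (cip (X (ch J e t j z)) (ch J e t j z))) \<le> Re (cip (X z) z) + real (Suc J) * (K * (pi / (2 * e * t))) * (norm z)\<^sup>2"
    if et: "e > 0" "t > 0" for J e t z
  proof -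
    let ?l = "pi / (2 * e * t)"
    have "Re (cip (X (ch J e t j z)) (ch J e t j z)) \<le> Re (cip (ch J e t j (ch J e t j (X z))) z) + K * ?l * (norm z)\<^sup>2" for j
    proof -
      let ?d = "ch J e t j (X z) - X (ch J e t j z)"
      have nd: "norm ?d \<le> K * ?l * norm z"
        by (rule K(2)) (use et cm_lipschitz[OF et] in auto)
      have "cip (ch J e t j (ch J e t j (X z))) z = cip (ch J e t j (X z)) (ch J e t j z)"
        by (rule mlt_symmetric) auto
      hence "cip (X (ch J e t j z)) (ch J e t j z) = cip (ch J e t j (ch J e t j (X z))) z - cip ?d (ch J e t j z)"
        by (simp add: cip_diff_left)
      moreover have "\<bar>Re (cip ?d (ch J e t j z))\<bar> \<le> K * ?l * (norm z)\<^sup>2"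
      proof -
        have "\<bar>Re (cip ?d (ch J e t j z))\<bar> \<le> norm ?d * norm (ch J e t j z)"
          using abs_Re_le_cmod[of "cip ?d (ch J e t j z)"] cmod_cip_le[of ?d "ch J e t j z"] by linarith
        also have "\<dots> \<le> (K * ?l * norm z) * norm z"
          using et K(1) by (intro mult_mono nd ch_norm) auto
        finally show ?thesis by (simp add: power2_eq_square mult.assoc)
      qed
      ultimately show ?thesis by simp
    qed
    hence "(\<Sum>j\<le>J. Re (cip (X (ch J e t j z)) (ch J e t j z))) \<le>
       (\<Sum>j\<le>J. Re (cip (ch J e t j (ch J e t j (X z))) z) + K * ?l * (norm z)\<^sup>2)" by (intro sum_mono)
    also have "\<dots> = Re (cip (\<Sum>j\<le>J. ch J e t j (ch J e t j (X z))) z) + real (Suc J) * (K * ?l) * (norm z)\<^sup>2"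
      by (simp only: sum.distrib Re_sum cip_sum_left sum_constant card_atMost mult.assoc)
    also have "(\<Sum>j\<le>J. ch J e t j (ch J e t j (X z))) = X z" by (rule ch_square_sum[OF et])
    finally show ?thesis .
  qed
  thus ?thesis using K(1) by blast
qed

lemma X_form_perturb:
  assumes "norm d \<le> r * norm y" "r \<ge> 0" "s \<ge> 0"
  shows "\<bar>Re (cip (X (scaleR s y + d)) (scaleR s y + d)) - s\<^sup>2 * Re (cip (X y) y)\<bar> \<le> hi * (2 * s * r + r\<^sup>2) * (norm y)\<^sup>2"
proof -
  have sym: "Re (cip (X d) y) = Re (cip (X y) d)"
    by (metis X_selfadjoint cip_cnj cnj.sel(1))
  have e: "Re (cip (X (scaleR s y + d)) (scaleR s y + d)) - s\<^sup>2 * Re (cip (X y) y) = 2 * s * Re (cip (X y) d) + Re (cip (X d) d)"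
    by (simp add: X.add X.scaleR cip_add_left cip_add_right cip_scaleR_left cip_scaleR_right sym power2_eq_square algebra_simps)
  have h0: "hi \<ge> 0" using lo_hi(1,2) by linarith
  have 1: "\<bar>Re (cip (X a) b)\<bar> \<le> hi * (norm a * norm b)" for a b
  proof -
    have "\<bar>Re (cip (X a) b)\<bar> \<le> norm (X a) * norm b"
      using abs_Re_le_cmod[of "cip (X a) b"] cmod_cip_le[of "X a" b] by linarith
    also have "\<dots> \<le> hi * norm a * norm b" by (intro mult_right_mono lo_hi(4)) auto
    finally show ?thesis by (simp add: mult.assoc)
  qed
  have "\<bar>2 * s * Re (cip (X y) d) + Re (cip (X d) d)\<bar> \<le> 2 * s * \<bar>Re (cip (X y) d)\<bar> + \<bar>Re (cip (X d) d)\<bar>"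
    using assms(3) by (intro order_trans[OF abs_triangle_ineq]) (simp add: abs_mult)
  also have "\<dots> \<le> 2 * s * (hi * (norm y * (r * norm y))) + hi * ((r * norm y) * (r * norm y))"
    using assms h0
    by (intro add_mono mult_left_mono order_trans[OF 1] mult_mono) auto
  finally show ?thesis unfolding e by (simp add: power2_eq_square algebra_simps)
qed

text \<open>The constant 8 makes the contribution to \<open>P\<close> of the region beyond \<open>MM * sqrt lam\<close>, covered by
  the last partition function, larger than \<open>lam\<close> with room for all error terms.\<close>

definition MM :: real where "MM = sqrt (8 / lo)"
lemma MM: "MM > 0" "lo * MM\<^sup>2 = 8" using lo_hi(1) by (auto simp: MM_def)

text \<open>On shell \<open>j\<close> the operator \<open>Lm\<close> is nearly the scalar
  \<open>real j * e * t\<close>, so the form of \<open>P\<close> nearly becomes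
  \<open>lam (j e)^2\<close> times that of \<open>X\<close>. All relative errors are measured by
  \<open>d = 1 / J\<close>: the shell width for fixed \<open>J\<close>, and the lower order terms
  once \<open>lam\<close> is large compared with \<open>J\<close>.\<close>

lemma upper_form:
  assumes J: "J \<ge> 4"
  defines "e \<equiv> MM / real J"
  shows "\<exists>l0\<ge>1. \<forall>lam\<ge>l0. \<forall>x\<in>H2. lam * (norm x)\<^sup>2 - Re (cip (P x) x) \<le>
    lam * (\<Sum>j<J. (1 + (1 + 6 * hi * MM\<^sup>2) / real J) * (norm (ch J e (sqrt lam) j x))\<^sup>2
       - (real j * e)\<^sup>2 * Re (cip (X (ch J e (sqrt lam) j x)) (ch J e (sqrt lam) j x)))"
proof -
  obtain C where C: "C \<ge> 0" "\<And>x. x \<in> H2 \<Longrightarrow> \<bar>Re (cip (P x) x) - Re (cip (X (Lm x)) (Lm x))\<bar> \<le> C * (norm (Lm x) * norm x + (norm x)\<^sup>2)"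
    using P_form by blast
  obtain K where K: "K \<ge> 0" "\<And>J e t z. e > 0 \<Longrightarrow> t > 0 \<Longrightarrow>
   (\<Sum>j\<le>J. Re (cip (X (ch J e t j z)) (ch J e t j z))) \<le> Re (cip (X z) z) + real (Suc J) * (K * (pi / (2 * e * t))) * (norm z)\<^sup>2"
    using localization by blast
  define d where "d = 1 / real J"
  have J0: "real J \<ge> 4" using J by simp
  have d: "d > 0" "d \<le> 1/4" using J0 by (auto simp: d_def field_simps)
  have e: "e > 0" "e = MM * d" "real J * e = MM" using MM(1) J0 by (auto simp: e_def d_def)
  have h0: "hi > 0" using lo_hi(1,2) by linarith
  \<comment> \<open>Result of trading the mixed term \<open>C * norm (Lm x) * norm x\<close> for a
    fraction \<open>d\<close> of the leading form plus a multiple of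
    \<open>(norm x)\<^sup>2\<close>.\<close>
  define C1 where "C1 = C + C\<^sup>2 / (4 * d * lo)"
  \<comment> \<open>The localisation loss is \<open>\<tau> / t\<close> relative to the form of
    \<open>X\<close>. The next definition makes \<open>lam\<close> large enough for both
    \<open>C1 \<le> d * lam\<close> and \<open>\<tau> / t \<le> d\<close>.\<close>
  define \<tau> where "\<tau> = real (Suc J) * K * pi / (2 * e * lo)"
  define l0 where "l0 = 1 + C1 / d + (\<tau> / d)\<^sup>2"
  have C10: "C1 \<ge> 0" using C d lo_hi(1) by (simp add: C1_def)
  have l01: "l0 \<ge> 1" using C10 d by (simp add: l0_def)
  have \<tau>0: "\<tau> \<ge> 0" using K(1) e lo_hi(1) by (simp add: \<tau>_def)
  have main: "lam * (norm x)\<^sup>2 - Re (cip (P x) x) \<le>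
    lam * (\<Sum>j<J. (1 + (1 + 6 * hi * MM\<^sup>2) * d) * (norm (ch J e (sqrt lam) j x))\<^sup>2
       - (real j * e)\<^sup>2 * Re (cip (X (ch J e (sqrt lam) j x)) (ch J e (sqrt lam) j x)))"
    if lam: "lam \<ge> l0" and x: "x \<in> H2" for lam x
  proof -
    define t where "t = sqrt lam"
    have lam1: "lam \<ge> 1" using lam l01 by linarith
    have t: "t > 0" "t\<^sup>2 = lam" using lam1 by (auto simp: t_def)
    define z where "z = Lm x"
    define Y where "Y j = ch J e t j x" for j
    have LY: "Lm (Y j) = ch J e t j z" "Y j \<in> mdom nn" for j
      using ch_Lm[OF H2_nn[OF x]] by (auto simp: Y_def z_def)
    define q where "q y = Re (cip (X y) y)" for y
    have qz: "lo * (norm y)\<^sup>2 \<le> q y" for y unfolding q_def by (rule lo_hi(3))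
    have qpos: "q y \<ge> 0" for y
      using qz[of y] lo_hi(1) by (smt (verit) mult_nonneg_nonneg zero_le_power2)
    have qhi: "q y \<le> hi * (norm y)\<^sup>2" for y unfolding q_def by (rule X_form_le)
    have s1: "Re (cip (P x) x) \<ge> (1 - d) * q z - C1 * (norm x)\<^sup>2"
    proof -
      let ?u = "norm z" and ?w = "norm x"
      have dl: "d * lo > 0" using d lo_hi(1) by simp
      have "0 \<le> (2 * (d * lo) * ?u - C * ?w)\<^sup>2 / (4 * (d * lo))" using dl by auto
      also have "\<dots> = d * lo * ?u\<^sup>2 - C * (?u * ?w) + C\<^sup>2 / (4 * (d * lo)) * ?w\<^sup>2"
      proof -
        have id: "(2 * a * u - c * w)\<^sup>2 / (4 * a) = a * u\<^sup>2 - c * (u * w) + c\<^sup>2 / (4 * a) * w\<^sup>2" if "a > 0" for a u c w :: real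
          using that by (simp add: power2_eq_square field_simps)
        show ?thesis by (rule id[OF dl])
      qed
      finally have "C * (?u * ?w) \<le> d * lo * ?u\<^sup>2 + C\<^sup>2 / (4 * d * lo) * ?w\<^sup>2" by (simp add: mult.assoc)
      also have "d * lo * ?u\<^sup>2 \<le> d * q z" unfolding mult.assoc using qz[of z] d by (intro mult_left_mono) auto
      finally have "C * (?u * ?w) \<le> d * q z + C\<^sup>2 / (4 * d * lo) * ?w\<^sup>2" by simp
      thus ?thesis using C(2)[OF x] unfolding C1_def q_def z_def[symmetric] distrib_left distrib_right left_diff_distrib
        by linarith
    qed
    define S where "S = (\<Sum>j\<le>J. q (Lm (Y j)))"
    have S0: "S \<ge> 0" unfolding S_def by (intro sum_nonneg qpos)
    have s2: "(1 - d) * S \<le> q z"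
    proof -
      have "S \<le> q z + real (Suc J) * (K * (pi / (2 * e * t))) * (norm z)\<^sup>2"
        unfolding S_def q_def LY using K(2)[OF e(1) t(1), of J z] by simp
      also have "real (Suc J) * (K * (pi / (2 * e * t))) * (norm z)\<^sup>2 = \<tau> / t * (lo * (norm z)\<^sup>2)"
        using lo_hi(1) t e by (simp add: \<tau>_def)
      also have "\<dots> \<le> \<tau> / t * q z" using \<tau>0 t by (intro mult_left_mono qz) auto
      also have "\<dots> \<le> d * q z"
      proof (rule mult_right_mono[OF _ qpos])
        have "(\<tau> / d)\<^sup>2 \<le> t\<^sup>2" using lam C10 d unfolding t(2) l0_def by (smt (verit) divide_nonneg_pos)
        hence "\<tau> / d \<le> t" using t(1) power2_le_imp_le[of "\<tau> / d" t] by simp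
        thus "\<tau> / t \<le> d" using d t by (simp add: field_simps)
      qed
      finally have "S \<le> (1 + d) * q z" by (simp add: algebra_simps)
      hence "(1 - d) * S \<le> (1 - d) * ((1 + d) * q z)" using d by (intro mult_left_mono) auto
      also have "\<dots> = (1 - d * d) * q z" by (simp add: algebra_simps)
      also have "\<dots> \<le> 1 * q z" by (intro mult_right_mono qpos) simp
      finally show ?thesis by simp
    qed
    have s3: "Re (cip (P x) x) \<ge> (1 - 2 * d) * S - C1 * (norm x)\<^sup>2"
    proof -
      have "(1 - d) * ((1 - d) * S) \<le> (1 - d) * q z" using s2 d by (intro mult_left_mono) auto
      moreover have "(1 - 2 * d) * S \<le> (1 - d) * ((1 - d) * S)"
      proof -
        have "(1 - d) * ((1 - d) * S) = (1 - 2 * d) * S + d * d * S" by (simp add: algebra_simps)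
        thus ?thesis using S0 d by simp
      qed
      ultimately show ?thesis using s1 by linarith
    qed
    have nsum: "(norm x)\<^sup>2 = (\<Sum>j\<le>J. (norm (Y j))\<^sup>2)" unfolding Y_def by (rule ch_norm_sum[OF e(1) t(1), symmetric])
    have C1l: "C1 \<le> d * lam"
    proof -
      have "C1 / d \<le> lam" using lam unfolding l0_def by (smt (verit) zero_le_power2)
      thus ?thesis using d by (simp add: field_simps)
    qed
    have shell: "q (Lm (Y j)) \<ge> lam * ((real j * e)\<^sup>2 * q (Y j) - 2 * hi * MM\<^sup>2 * d * (norm (Y j))\<^sup>2 - hi * MM\<^sup>2 * d * (norm (Y j))\<^sup>2) " if j: "j < J" for j
    proof -
      define D where "D = Lm (Y j) - scaleR (real j * e * t) (Y j)"
      have nD: "norm D \<le> (e * t) * norm (Y j)"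
        unfolding D_def Y_def by (rule ch_shell(2)[OF e(1) t(1) j])
      have LYD: "Lm (Y j) = scaleR (real j * e * t) (Y j) + D" by (simp add: D_def)
      have "\<bar>q (Lm (Y j)) - (real j * e * t)\<^sup>2 * q (Y j)\<bar> \<le> hi * (2 * (real j * e * t) * (e * t) + (e * t)\<^sup>2) * (norm (Y j))\<^sup>2"
        unfolding q_def LYD by (rule X_form_perturb[OF nD]) (use e t in auto)
      also have "hi * (2 * (real j * e * t) * (e * t) + (e * t)\<^sup>2) = lam * (hi * (2 * (real j * e) * e + e * e))"
        unfolding t(2)[symmetric] by (simp add: power2_eq_square algebra_simps)
      also have "\<dots> * (norm (Y j))\<^sup>2 \<le> lam * (hi * (2 * MM * e + MM * e)) * (norm (Y j))\<^sup>2"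
      proof (intro mult_right_mono mult_left_mono add_mono)
        show "real j * e \<le> MM" unfolding e(3)[symmetric] using j e(1) by (intro mult_right_mono) auto
        show "e \<le> MM" using e(2) d MM(1) by simp
      qed (use e h0 lam1 in auto)
      finally have "(real j * e * t)\<^sup>2 * q (Y j) - lam * (hi * (2 * MM * e + MM * e)) * (norm (Y j))\<^sup>2 \<le> q (Lm (Y j))" by linarith
      moreover have "(real j * e * t)\<^sup>2 * q (Y j) - lam * (hi * (2 * MM * e + MM * e)) * (norm (Y j))\<^sup>2 =
         lam * ((real j * e)\<^sup>2 * q (Y j) - 2 * hi * MM\<^sup>2 * d * (norm (Y j))\<^sup>2 - hi * MM\<^sup>2 * d * (norm (Y j))\<^sup>2)"
        unfolding t(2)[symmetric] e(2) by (simp add: power2_eq_square algebra_simps)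
      ultimately show ?thesis by simp
    qed
    \<comment> \<open>With \<open>d \<le> 1/4\<close> the last cutoff lives on
      \<open>nn n > 3/4 MM t\<close>, where the form is at least
      \<open>lo (9/16) MM^2 lam = 9/2 lam\<close> times the squared norm; 4 leaves room.\<close>
    have top: "q (Lm (Y J)) \<ge> 4 * lam * (norm (Y J))\<^sup>2"
    proof -
      have "norm (Y J) \<le> (4 / (3 * MM * t)) * norm (Lm (Y J))"
      proof (rule norm_comparison)
        fix n
        show "cmod (co (Y J) n) \<le> 4 / (3 * MM * t) * cmod (co (Lm (Y J)) n)"
        proof (cases "cm J e t J n = 0")
          case True
          thus ?thesis using MM(1) t by (simp add: Y_def co_mlt)
        next
          case False
          have "(real J - 1) * e < nn n / t" by (rule chi_top_support[OF e(1) False])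
          moreover have "3 / 4 * MM \<le> (real J - 1) * e"
          proof -
            have "(real J - 1) * e = MM - e" using e(3) by (simp add: algebra_simps)
            moreover have "e \<le> MM / 4" using e(2) d MM(1) by (simp add: mult.commute)
            ultimately show ?thesis by simp
          qed
          ultimately have "3 / 4 * MM < nn n / t" by linarith
          hence "3 / 4 * MM * t < nn n" using t(1) by (simp add: less_divide_eq)
          hence "1 \<le> 4 / (3 * MM * t) * nn n" using MM(1) t(1) by (simp add: field_simps)
          hence "1 * cmod (co (Y J) n) \<le> 4 / (3 * MM * t) * nn n * cmod (co (Y J) n)" by (intro mult_right_mono) auto
          thus ?thesis by (simp add: co_mlt[OF LY(2)] norm_mult)
        qed
      qed (use MM(1) t in auto)
      hence "(norm (Y J))\<^sup>2 \<le> ((4 / (3 * MM * t)) * norm (Lm (Y J)))\<^sup>2" by (intro power_mono) auto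
      also have "\<dots> = 16 / (9 * MM\<^sup>2 * lam) * (norm (Lm (Y J)))\<^sup>2"
        unfolding t(2)[symmetric] by (simp add: power_mult_distrib power_divide)
      finally have "9 * MM\<^sup>2 * lam * (norm (Y J))\<^sup>2 \<le> 16 * (norm (Lm (Y J)))\<^sup>2"
        using MM(1) lam1 by (simp add: field_simps)
      hence "lo * (9 * MM\<^sup>2 * lam * (norm (Y J))\<^sup>2) \<le> lo * (16 * (norm (Lm (Y J)))\<^sup>2)"
        using lo_hi(1) by (intro mult_left_mono) auto
      moreover have "lo * (9 * MM\<^sup>2 * lam * (norm (Y J))\<^sup>2) = (lo * MM\<^sup>2) * (9 * (lam * (norm (Y J))\<^sup>2))"
        by (simp only: mult_ac)
      ultimately have "72 * (lam * (norm (Y J))\<^sup>2) \<le> 16 * (lo * (norm (Lm (Y J)))\<^sup>2)" unfolding MM(2) by simp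
      moreover have "0 \<le> lam * (norm (Y J))\<^sup>2" using lam1 by simp
      ultimately show ?thesis using qz[of "Lm (Y J)"] by linarith
    qed
    let ?B = "\<lambda>j. (1 + (1 + 6 * hi * MM\<^sup>2) * d) * (norm (Y j))\<^sup>2 - (real j * e)\<^sup>2 * q (Y j)"
    have termj: "(lam + C1) * (norm (Y j))\<^sup>2 - (1 - 2 * d) * q (Lm (Y j)) \<le> lam * ?B j" if j: "j < J" for j
    proof -
      let ?N = "(norm (Y j))\<^sup>2" and ?r = "(real j * e)\<^sup>2"
      have rM: "?r \<le> MM\<^sup>2"
      proof (rule power_mono)
        show "real j * e \<le> MM" unfolding e(3)[symmetric] using j e by (intro mult_right_mono) auto
      qed (use e in auto)
      have rq: "?r * q (Y j) \<le> MM\<^sup>2 * (hi * ?N)" by (intro mult_mono rM qhi qpos) auto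
      have "(1 - 2 * d) * q (Lm (Y j)) \<ge> (1 - 2 * d) * (lam * (?r * q (Y j) - 2 * hi * MM\<^sup>2 * d * ?N - hi * MM\<^sup>2 * d * ?N))"
        using shell[OF j] d by (intro mult_left_mono) auto
      moreover have "(1 - 2 * d) * (lam * (?r * q (Y j) - 2 * hi * MM\<^sup>2 * d * ?N - hi * MM\<^sup>2 * d * ?N)) =
         lam * (?r * q (Y j)) - lam * (2 * d * (?r * q (Y j))) - (1 - 2 * d) * (lam * (3 * (hi * MM\<^sup>2 * d * ?N)))"
        by (simp add: algebra_simps)
      moreover have "lam * (2 * d * (?r * q (Y j))) \<le> lam * (2 * d * (MM\<^sup>2 * (hi * ?N)))"
        using lam1 d rq by (intro mult_left_mono) auto
      moreover have "(1 - 2 * d) * (lam * (3 * (hi * MM\<^sup>2 * d * ?N))) \<le> 1 * (lam * (3 * (hi * MM\<^sup>2 * d * ?N)))"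
        using lam1 d h0 by (intro mult_right_mono) auto
      moreover have "C1 * ?N \<le> d * lam * ?N" using C1l by (intro mult_right_mono) auto
      moreover have "0 \<le> lam * (hi * MM\<^sup>2 * d * ?N)" using lam1 d h0 by simp
      \<comment> \<open>The coefficient 6 of \<open>hi * MM\<^sup>2 * d\<close> collects 2 from the
        factor \<open>1 - 2 * d\<close>, 3 from replacing \<open>Lm\<close> by a scalar, and 1 as
        slack; the lone \<open>d\<close> comes from \<open>C1\<close>.\<close>
      ultimately have "(lam + C1) * ?N - (1 - 2 * d) * q (Lm (Y j)) \<le>
         lam * ?N + d * lam * ?N - lam * (?r * q (Y j)) + lam * (2 * d * (MM\<^sup>2 * (hi * ?N))) + lam * (3 * (hi * MM\<^sup>2 * d * ?N)) + lam * (hi * MM\<^sup>2 * d * ?N)"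
        unfolding distrib_right by linarith
      also have "\<dots> = lam * ?B j" by (simp add: algebra_simps)
      finally show ?thesis .
    qed
    have topj: "(lam + C1) * (norm (Y J))\<^sup>2 - (1 - 2 * d) * q (Lm (Y J)) \<le> 0"
    proof -
      have N: "0 \<le> lam * (norm (Y J))\<^sup>2" using lam1 by simp
      have "C1 * (norm (Y J))\<^sup>2 \<le> d * lam * (norm (Y J))\<^sup>2" using C1l by (intro mult_right_mono) auto
      also have "\<dots> \<le> 1 * (lam * (norm (Y J))\<^sup>2)" unfolding mult.assoc using d N by (intro mult_right_mono) auto
      finally have 1: "C1 * (norm (Y J))\<^sup>2 \<le> lam * (norm (Y J))\<^sup>2" by simp
      have "1/2 * (4 * lam * (norm (Y J))\<^sup>2) \<le> (1 - 2 * d) * q (Lm (Y J))"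
        using top d N by (intro mult_mono) auto
      thus ?thesis using 1 unfolding distrib_right by linarith
    qed
    have "lam * (norm x)\<^sup>2 - Re (cip (P x) x) \<le> (lam + C1) * (norm x)\<^sup>2 - (1 - 2 * d) * S"
      using s3 unfolding distrib_right by linarith
    also have "\<dots> = (\<Sum>j\<le>J. (lam + C1) * (norm (Y j))\<^sup>2 - (1 - 2 * d) * q (Lm (Y j)))"
      unfolding nsum S_def by (simp only: sum_subtractf sum_distrib_left)
    also have "\<dots> = (\<Sum>j<J. (lam + C1) * (norm (Y j))\<^sup>2 - (1 - 2 * d) * q (Lm (Y j))) + ((lam + C1) * (norm (Y J))\<^sup>2 - (1 - 2 * d) * q (Lm (Y J)))"
      by (simp only: lessThan_Suc_atMost[symmetric] sum.lessThan_Suc)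
    also have "\<dots> \<le> (\<Sum>j<J. lam * ?B j) + 0"
      by (intro add_mono sum_mono termj topj) auto
    finally show ?thesis by (simp add: sum_distrib_left Y_def q_def t_def)
  qed
  show ?thesis
  proof (intro exI[of _ l0] conjI l01 allI impI ballI)
    fix lam x assume "l0 \<le> lam" "x \<in> H2"
    from main[OF this] show "lam * (norm x)\<^sup>2 - Re (cip (P x) x) \<le>
      lam * (\<Sum>j<J. (1 + (1 + 6 * hi * MM\<^sup>2) / real J) * (norm (ch J e (sqrt lam) j x))\<^sup>2
       - (real j * e)\<^sup>2 * Re (cip (X (ch J e (sqrt lam) j x)) (ch J e (sqrt lam) j x)))"
      by (simp add: d_def)
  qed
qed

definition Fs :: "real \<Rightarrow> (nat \<Rightarrow> int) set" where "Fs lam = {n \<in> lat. nn n \<le> MM * sqrt lam}"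

lemma Fs: "finite (Fs lam)" "Fs lam \<subseteq> lat"
  unfolding Fs_def by (auto intro: finite_nn_ball)

lemma Fs_card:
  assumes "lam \<ge> 1" "MM * sqrt lam \<ge> 1"
  shows "real (card (Fs lam)) \<le> pi\<^sup>2 / 2 * 81 * MM ^ 4 * lam\<^sup>2"
proof -
  have "real (card (Fs lam)) \<le> pi\<^sup>2 / 2 * 81 * (MM * sqrt lam) ^ 4"
    using Nlat_bound[OF assms(2)] by (simp add: Nlat_def Fs_def)
  also have "sqrt lam ^ 4 = lam\<^sup>2" using assms(1) by (simp add: power4_eq_xxxx power2_eq_square)
  hence "(MM * sqrt lam) ^ 4 = MM ^ 4 * lam\<^sup>2" by (simp add: power_mult_distrib)
  finally show ?thesis by simp
qed

text \<open>As \<open>lo * MM\<^sup>2 = 8\<close> is larger than 1, \<open>Fs lam\<close> contains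
  every lattice point with nonzero positive part, for all \<open>s\<close> in the spectral interval
  at once.\<close>

lemma Fs_Phi:
  assumes "lam > 0" "s \<in> {lo..hi}"
  shows "(\<Sum>n\<in>Fs lam. max 0 (1 - (nn n / sqrt lam)\<^sup>2 * s)) = Phi (lam / s)"
proof -
  have s: "s > 0" using assms(2) lo_hi(1) by auto
  have e: "(nn n / sqrt lam)\<^sup>2 * s = (nn n)\<^sup>2 / (lam / s)" for n
    using assms(1) s by (simp add: power_divide)
  have "lam / s \<le> MM\<^sup>2 * lam"
  proof -
    have "1 / s \<le> 1 / lo" using assms(2) lo_hi(1) by (auto simp: frac_le)
    also have "1 / lo \<le> MM\<^sup>2" using MM(2) lo_hi(1) by (simp add: field_simps)
    finally have "1 / s * lam \<le> MM\<^sup>2 * lam" using assms(1) by (intro mult_right_mono) auto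
    thus ?thesis by simp
  qed
  hence "sqrt (lam / s) \<le> sqrt (MM\<^sup>2 * lam)" by (rule real_sqrt_le_mono)
  hence sub: "sqrt (lam / s) \<le> MM * sqrt lam" using MM(1) by (simp add: real_sqrt_mult)
  have "(\<Sum>n\<in>Fs lam. max 0 (1 - (nn n / sqrt lam)\<^sup>2 * s)) = (\<Sum>n\<in>{n\<in>lat. nn n \<le> sqrt (lam / s)}. max 0 (1 - (nn n)\<^sup>2 / (lam / s)))"
    unfolding e
  proof (rule sum.mono_neutral_right[OF Fs(1)])
    show "{n \<in> lat. nn n \<le> sqrt (lam / s)} \<subseteq> Fs lam" using sub by (auto simp: Fs_def)
    show "\<forall>n\<in>Fs lam - {n \<in> lat. nn n \<le> sqrt (lam / s)}. max 0 (1 - (nn n)\<^sup>2 / (lam / s)) = 0"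
    proof
      fix n assume "n \<in> Fs lam - {n \<in> lat. nn n \<le> sqrt (lam / s)}"
      hence "sqrt (lam / s) < nn n" by (auto simp: Fs_def)
      hence "sqrt (lam / s) \<le> nn n" by simp
      hence "lam / s \<le> (nn n)\<^sup>2" by (rule sqrt_le_D)
      hence "1 \<le> (nn n)\<^sup>2 / (lam / s)" using assms(1) s by (subst le_divide_eq_1_pos) auto
      thus "max 0 (1 - (nn n)\<^sup>2 / (lam / s)) = 0" by simp
    qed
  qed
  also have "\<dots> = Phi (lam / s)" unfolding Phi_def
  proof (rule sum.cong[OF refl])
    fix n assume "n \<in> {n \<in> lat. nn n \<le> sqrt (lam / s)}"
    hence "(nn n)\<^sup>2 \<le> (sqrt (lam / s))\<^sup>2" by (intro power_mono) auto
    hence "(nn n)\<^sup>2 \<le> lam / s" using assms(1) s by simp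
    hence "(nn n)\<^sup>2 / (lam / s) \<le> 1" using assms(1) s by (subst divide_le_eq_1_pos) auto
    thus "max 0 (1 - (nn n)\<^sup>2 / (lam / s)) = 1 - (nn n)\<^sup>2 / (lam / s)" by simp
  qed
  finally show ?thesis .
qed

text \<open>The smoothed number of lattice points in shell \<open>j\<close>, that is, the trace of
  the squared cutoff restricted to \<open>Fs lam\<close>.\<close>

definition Wj :: "nat \<Rightarrow> real \<Rightarrow> nat \<Rightarrow> real" where
  "Wj J lam j = (\<Sum>m\<in>Fs lam. (cm J (MM / real J) (sqrt lam) j m)\<^sup>2)"

text \<open>Passes from shell radii back to lattice points. On the support of a shell,
  \<open>r j\<close> and \<open>nn m / t\<close> differ by less than \<open>MM / J\<close>, which
  changes the positive part by at most \<open>2 * MM\<^sup>2 * hi / J\<close>; the squared cutoffs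
  then sum to 1 except in the outer region.\<close>

lemma shell_sums:
  assumes J: "J \<ge> 4" and lam: "lam > 0" and s: "s \<in> {lo..hi}" and \<alpha>: "\<alpha> \<ge> 0"
  defines "r \<equiv> \<lambda>j. real j * (MM / real J)"
  shows "(\<And>j. j < J \<Longrightarrow> B j \<le> max 0 (1 - (r j)\<^sup>2 * s) + \<alpha>) \<Longrightarrow>
      (\<Sum>j<J. Wj J lam j * B j) \<le> Phi (lam / s) + (\<alpha> + 2 * MM\<^sup>2 * hi / real J) * real (card (Fs lam))"
    "(\<And>j. j < J \<Longrightarrow> max 0 (1 - (r j)\<^sup>2 * s) - \<alpha> \<le> B j) \<Longrightarrow>
      Phi (lam / s) - (\<alpha> + 2 * MM\<^sup>2 * hi / real J) * real (card (Fs lam)) \<le> (\<Sum>j<J. Wj J lam j * B j)"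
proof -
  define e where "e = MM / real J"
  define t where "t = sqrt lam"
  define \<beta> where "\<beta> = \<alpha> + 2 * MM\<^sup>2 * hi / real J"
  define T where "T m = max 0 (1 - (nn m / t)\<^sup>2 * s)" for m
  have J0: "real J > 0" using J by simp
  have e: "e > 0" "real J * e = MM" using MM(1) J0 by (auto simp: e_def)
  have t: "t > 0" using lam by (simp add: t_def)
  have s0: "0 \<le> s" "s \<le> hi" "lo \<le> s" using s lo_hi(1) by auto
  have h0: "hi > 0" using lo_hi(1,2) by linarith
  have \<beta>0: "\<beta> \<ge> 0" using \<alpha> h0 by (simp add: \<beta>_def)
  have diff: "\<bar>max 0 (1 - (r j)\<^sup>2 * s) - T m\<bar> \<le> 2 * MM\<^sup>2 * hi / real J"
    if j: "j < J" and m: "m \<in> Fs lam" and nz: "cm J e t j m \<noteq> 0" for j m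
  proof -
    define \<rho> where "\<rho> = nn m / t"
    have \<rho>: "0 \<le> \<rho>" "\<rho> \<le> MM" using m t by (auto simp: \<rho>_def Fs_def t_def divide_le_eq)
    have rj: "0 \<le> r j" "r j \<le> MM"
    proof -
      show "0 \<le> r j" using e(1) by (simp add: r_def e_def[symmetric])
      have "real j * e \<le> real J * e" using j e(1) by (intro mult_right_mono) auto
      thus "r j \<le> MM" unfolding e(2) by (simp add: r_def e_def)
    qed
    have "\<bar>\<rho> - r j\<bar> < e" using chi_support[OF e(1) j nz] by (simp add: \<rho>_def r_def e_def)
    have "\<bar>(r j)\<^sup>2 - \<rho>\<^sup>2\<bar> = \<bar>\<rho> - r j\<bar> * (\<rho> + r j)"
    proof -
      have "(r j)\<^sup>2 - \<rho>\<^sup>2 = - ((\<rho> - r j) * (\<rho> + r j))" by (simp add: power2_eq_square algebra_simps)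
      thus ?thesis using \<rho> rj by (simp add: abs_mult)
    qed
    also have "\<dots> \<le> e * (2 * MM)" using \<open>\<bar>\<rho> - r j\<bar> < e\<close> \<rho> rj e by (intro mult_mono) auto
    finally have *: "\<bar>(r j)\<^sup>2 - \<rho>\<^sup>2\<bar> \<le> e * (2 * MM)" .
    have "\<bar>max 0 (1 - (r j)\<^sup>2 * s) - T m\<bar> \<le> \<bar>(1 - (r j)\<^sup>2 * s) - (1 - \<rho>\<^sup>2 * s)\<bar>"
      unfolding T_def \<rho>_def[symmetric] by linarith
    also have "(1 - (r j)\<^sup>2 * s) - (1 - \<rho>\<^sup>2 * s) = - (((r j)\<^sup>2 - \<rho>\<^sup>2) * s)" by (simp add: algebra_simps)
    also have "\<bar>- (((r j)\<^sup>2 - \<rho>\<^sup>2) * s)\<bar> = \<bar>(r j)\<^sup>2 - \<rho>\<^sup>2\<bar> * s" using s0 by (simp add: abs_mult)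
    also have "\<dots> \<le> e * (2 * MM) * hi" using * s0 e MM(1) by (intro mult_mono) auto
    finally show ?thesis by (simp add: e_def power2_eq_square mult_ac)
  qed
  have part: "(\<Sum>j<J. (cm J e t j m)\<^sup>2) + (cm J e t J m)\<^sup>2 = 1" for m
  proof -
    have "(\<Sum>j\<le>J. (cm J e t j m)\<^sup>2) = 1" by (rule chi_sum) (use e t in auto)
    thus ?thesis by (simp only: lessThan_Suc_atMost[symmetric] sum.lessThan_Suc)
  qed
  have le1: "(\<Sum>j<J. (cm J e t j m)\<^sup>2) \<le> 1" for m
    using part[of m] zero_le_power2[of "cm J e t J m"] by linarith
  have swap: "(\<Sum>j<J. Wj J lam j * B j) = (\<Sum>m\<in>Fs lam. \<Sum>j<J. (cm J e t j m)\<^sup>2 * B j)"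
    unfolding Wj_def sum_distrib_right e_def[symmetric] t_def[symmetric] by (rule sum.swap)
  have Phi: "(\<Sum>m\<in>Fs lam. T m) = Phi (lam / s)" unfolding T_def t_def by (rule Fs_Phi[OF lam s])
  have T0: "T m \<ge> 0" for m by (simp add: T_def)
  show "(\<Sum>j<J. Wj J lam j * B j) \<le> Phi (lam / s) + (\<alpha> + 2 * MM\<^sup>2 * hi / real J) * real (card (Fs lam))"
    if B: "\<And>j. j < J \<Longrightarrow> B j \<le> max 0 (1 - (r j)\<^sup>2 * s) + \<alpha>"
  proof -
    have "(\<Sum>m\<in>Fs lam. \<Sum>j<J. (cm J e t j m)\<^sup>2 * B j) \<le> (\<Sum>m\<in>Fs lam. T m + \<beta>)"
    proof (rule sum_mono)
      fix m assume m: "m \<in> Fs lam"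
      have "(\<Sum>j<J. (cm J e t j m)\<^sup>2 * B j) \<le> (\<Sum>j<J. (cm J e t j m)\<^sup>2 * (T m + \<beta>))"
      proof (rule sum_mono)
        fix j assume j: "j \<in> {..<J}"
        show "(cm J e t j m)\<^sup>2 * B j \<le> (cm J e t j m)\<^sup>2 * (T m + \<beta>)"
        proof (cases "cm J e t j m = 0")
          case False
          have "B j \<le> T m + \<beta>" using B[of j] diff[OF _ m False] j unfolding \<beta>_def by auto
          thus ?thesis by (intro mult_left_mono) auto
        qed simp
      qed
      also have "\<dots> = (\<Sum>j<J. (cm J e t j m)\<^sup>2) * (T m + \<beta>)" by (simp add: sum_distrib_right)
      also have "\<dots> \<le> 1 * (T m + \<beta>)" using le1 T0 \<beta>0 by (intro mult_right_mono) (auto intro: add_nonneg_nonneg)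
      finally show "(\<Sum>j<J. (cm J e t j m)\<^sup>2 * B j) \<le> T m + \<beta>" by simp
    qed
    also have "\<dots> = Phi (lam / s) + \<beta> * real (card (Fs lam))" by (simp add: sum.distrib Phi)
    finally show ?thesis unfolding swap \<beta>_def .
  qed
  show "Phi (lam / s) - (\<alpha> + 2 * MM\<^sup>2 * hi / real J) * real (card (Fs lam)) \<le> (\<Sum>j<J. Wj J lam j * B j)"
    if B: "\<And>j. j < J \<Longrightarrow> max 0 (1 - (r j)\<^sup>2 * s) - \<alpha> \<le> B j"
  proof -
    have "Phi (lam / s) - \<beta> * real (card (Fs lam)) = (\<Sum>m\<in>Fs lam. T m - \<beta>)" by (simp add: sum_subtractf Phi)
    also have "\<dots> \<le> (\<Sum>m\<in>Fs lam. \<Sum>j<J. (cm J e t j m)\<^sup>2 * B j)"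
    proof (rule sum_mono)
      fix m assume m: "m \<in> Fs lam"
      \<comment> \<open>The shells below \<open>J\<close> miss only the part of the last cutoff,
        supported beyond \<open>MM / 2\<close>. There \<open>(MM / 2)\<^sup>2 * lo = 2\<close>
        already exceeds 1, so the positive part is zero.\<close>
      have top: "T m = 0" if "cm J e t J m \<noteq> 0"
      proof -
        have "(real J - 1) * e < nn m / t" by (rule chi_top_support[OF e(1) that])
        moreover have "MM / 2 \<le> (real J - 1) * e"
        proof -
          have "4 * e \<le> real J * e" using J e(1) by (intro mult_right_mono) auto
          hence "4 * e \<le> MM" by (simp only: e(2))
          hence "MM / 2 \<le> MM - e" using MM(1) by linarith
          moreover have "(real J - 1) * e = MM - e" by (simp only: left_diff_distrib e(2) mult_1_left)
          ultimately show ?thesis by (simp only:)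
        qed
        ultimately have "MM / 2 \<le> nn m / t" by linarith
        hence "(MM / 2)\<^sup>2 \<le> (nn m / t)\<^sup>2" using MM(1) by (intro power_mono) auto
        hence "(MM / 2)\<^sup>2 * lo \<le> (nn m / t)\<^sup>2 * s" using s0 lo_hi(1) by (intro mult_mono) auto
        moreover have "(MM / 2)\<^sup>2 * lo = 2" using MM(2) by (simp add: power_divide mult.commute)
        ultimately show ?thesis by (simp add: T_def)
      qed
      have "T m - \<beta> \<le> (\<Sum>j<J. (cm J e t j m)\<^sup>2) * (T m - \<beta>)"
      proof (cases "cm J e t J m = 0")
        case True
        thus ?thesis using part[of m] by simp
      next
        case False
        have "(\<Sum>j<J. (cm J e t j m)\<^sup>2) * \<beta> \<le> 1 * \<beta>" by (rule mult_right_mono[OF le1 \<beta>0])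
        thus ?thesis unfolding top[OF False] by simp
      qed
      also have "\<dots> = (\<Sum>j<J. (cm J e t j m)\<^sup>2 * (T m - \<beta>))" by (simp add: sum_distrib_right)
      also have "\<dots> \<le> (\<Sum>j<J. (cm J e t j m)\<^sup>2 * B j)"
      proof (rule sum_mono)
        fix j assume j: "j \<in> {..<J}"
        show "(cm J e t j m)\<^sup>2 * (T m - \<beta>) \<le> (cm J e t j m)\<^sup>2 * B j"
        proof (cases "cm J e t j m = 0")
          case False
          have "T m - \<beta> \<le> B j" using B[of j] diff[OF _ m False] j unfolding \<beta>_def by auto
          thus ?thesis by (intro mult_left_mono) auto
        qed simp
      qed
      finally show "T m - \<beta> \<le> (\<Sum>j<J. (cm J e t j m)\<^sup>2 * B j)" .
    qed
    finally show ?thesis unfolding swap \<beta>_def .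
  qed
qed

lemma cm_zero_outside:
  assumes "lam > 0" "J > 0" "j < J" "n \<in> lat" "n \<notin> Fs lam"
  shows "cm J (MM / real J) (sqrt lam) j n = 0"
proof (rule ccontr)
  assume nz: "cm J (MM / real J) (sqrt lam) j n \<noteq> 0"
  have e: "MM / real J > 0" using MM(1) assms(2) by simp
  have "nn n / sqrt lam < real j * (MM / real J) + MM / real J"
    using chi_support[OF e assms(3) nz] by linarith
  also have "\<dots> = (real j + 1) * (MM / real J)" by (simp only: distrib_right mult_1_left)
  also have "\<dots> \<le> real J * (MM / real J)" using assms(3) e by (intro mult_right_mono) auto
  also have "\<dots> = MM" using assms(2) by simp
  finally have "nn n \<le> MM * sqrt lam" using assms(1) by (simp add: divide_less_eq)
  thus False using assms(4,5) by (simp add: Fs_def)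
qed

section \<open>Upper bound for the Riesz mean\<close>

lemma shells_exist: "\<exists>J::nat. J \<ge> 4 \<and> c / real J \<le> \<eta>" if "\<eta> > 0" for c \<eta> :: real
proof -
  define J where "J = max 4 (nat \<lceil>c / \<eta>\<rceil>)"
  have "c / \<eta> \<le> real J" unfolding J_def by linarith
  moreover have "real J > 0" by (simp add: J_def)
  ultimately have "c / real J \<le> \<eta>" using that by (simp add: field_simps)
  thus ?thesis by (intro exI[of _ J]) (simp add: J_def)
qed

text \<open>The size of \<open>Fs lam\<close> in units of \<open>lam^2\<close>; 81 is
  \<open>3^4\<close>, from \<open>r + 2 \<le> 3 * r\<close> for \<open>r \<ge> 1\<close>.\<close>

definition C5 :: real where "C5 = pi\<^sup>2 / 2 * 81 * MM ^ 4"

lemma C5_pos: "C5 > 0" unfolding C5_def using MM(1) by simp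

text \<open>The family is any orthonormal one, not only eigenvectors of the level
  \<open>lam\<close>. This freedom allows the eigenvectors below \<open>lam\<close> to be inserted
  at the shifted levels \<open>(1 \<plusminus> d) lam\<close> later.\<close>

lemma upper_riesz:
  assumes \<eta>: "\<eta> > 0"
  shows "\<exists>l0\<ge>1. \<forall>lam\<ge>l0. \<forall>O'. finite O' \<longrightarrow> ons O' \<longrightarrow> O' \<subseteq> H2 \<longrightarrow>
    (\<Sum>\<psi>\<in>O'. lam - Re (cip (P \<psi>) \<psi>)) \<le> (pi\<^sup>2 / 6 + \<eta>) * (norm v)\<^sup>2 * lam ^ 3"
proof -
  obtain \<rho>0 where \<rho>0: "\<rho>0 > 0" "\<And>\<rho>. \<rho> \<ge> \<rho>0 \<Longrightarrow> \<bar>Phi \<rho> - pi\<^sup>2 / 6 * \<rho>\<^sup>2\<bar> \<le> \<eta> / 2 * \<rho>\<^sup>2"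
    using Phi_asymp[of "\<eta> / 2"] \<eta> by auto
  have h0: "hi > 0" using lo_hi(1,2) by linarith
  define c3 where "c3 = 1 + 6 * hi * MM\<^sup>2"
  \<comment> \<open>All errors of order \<open>1 / J\<close>: \<open>c3\<close> from the form, 2
    from the polynomial approximation, the rest from the width of the shells.\<close>
  define c4 where "c4 = c3 + 2 + 2 * MM\<^sup>2 * hi"
  have c3: "c3 \<ge> 0" using h0 by (simp add: c3_def)
  obtain J :: nat where J: "J \<ge> 4" "hi\<^sup>2 * C5 * c4 / real J \<le> \<eta> / 2"
    using shells_exist[of "\<eta>/2" "hi\<^sup>2 * C5 * c4"] \<eta> by auto
  have J0: "real J > 0" using J by simp
  define e where "e = MM / real J"
  have e: "e > 0" using MM(1) J0 by (simp add: e_def)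
  obtain l1 where l1: "l1 \<ge> 1" "\<And>lam x. lam \<ge> l1 \<Longrightarrow> x \<in> H2 \<Longrightarrow> lam * (norm x)\<^sup>2 - Re (cip (P x) x) \<le>
    lam * (\<Sum>j<J. (1 + c3 / real J) * (norm (ch J e (sqrt lam) j x))\<^sup>2
       - (real j * e)\<^sup>2 * Re (cip (X (ch J e (sqrt lam) j x)) (ch J e (sqrt lam) j x)))"
    using upper_form[OF J(1)] unfolding e_def c3_def by blast
  \<comment> \<open>The extra \<open>1 / J\<close> equals the approximation error, so the squared
    polynomial lies above the wanted positive part and not just near it.\<close>
  define Fj where "Fj j s = max 0 (1 + c3 / real J - (real j * e)\<^sup>2 * s) + 1 / real J" for j s
  have "\<exists>g. \<forall>s\<in>{lo..hi}. \<bar>(poly g s)\<^sup>2 - Fj j s\<bar> \<le> 1 / real J" for j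
    by (rule poly_square_approx) (use J0 in \<open>auto simp: Fj_def intro!: continuous_intros add_nonneg_nonneg\<close>)
  then obtain g where g: "\<And>j s. s \<in> {lo..hi} \<Longrightarrow> \<bar>(poly (g j) s)\<^sup>2 - Fj j s\<bar> \<le> 1 / real J" by metis
  define l0 where "l0 = l1 + hi * \<rho>0 + 1 / MM\<^sup>2"
  have l0: "l0 \<ge> l1" "l0 \<ge> hi * \<rho>0" "l0 \<ge> 1 / MM\<^sup>2" "l0 \<ge> 1"
  proof -
    have "0 \<le> hi * \<rho>0" "0 \<le> 1 / MM\<^sup>2" using h0 \<rho>0(1) by auto
    thus "l0 \<ge> l1" "l0 \<ge> hi * \<rho>0" "l0 \<ge> 1 / MM\<^sup>2" "l0 \<ge> 1" using l1(1) unfolding l0_def by linarith+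
  qed
  have "(\<Sum>\<psi>\<in>O'. lam - Re (cip (P \<psi>) \<psi>)) \<le> (pi\<^sup>2 / 6 + \<eta>) * (norm v)\<^sup>2 * lam ^ 3"
    if lam: "lam \<ge> l0" and O: "finite O'" "ons O'" "O' \<subseteq> H2" for lam O'
  proof -
    have lam1: "lam \<ge> 1" using lam l0 by linarith
    define t where "t = sqrt lam"
    \<comment> \<open>The shells are merged into one polynomial before the vacuum expectation is
      taken. For a fixed scalar \<open>s\<close> the shell sum is a lattice sum at radius
      \<open>sqrt (lam / s)\<close>, and the \<open>s\<^sup>2\<close> of \<open>vacuum_le\<close>
      cancels its \<open>s^-2\<close>.\<close>
    define Q where "Q = (\<Sum>j<J. smult (Wj J lam j) (g j * g j))"
    have n1: "(norm \<psi>)\<^sup>2 = 1" if "\<psi> \<in> O'" for \<psi>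
    proof -
      have "cip \<psi> \<psi> = 1" using O(2) that by (simp add: ons_def)
      hence "complex_of_real ((norm \<psi>)\<^sup>2) = of_real 1" by (simp add: cip_self_norm)
      thus ?thesis by (simp only: of_real_eq_iff)
    qed
    have pt: "(1 + c3 / real J) * (norm y)\<^sup>2 - (real j * e)\<^sup>2 * Re (cip (X y) y) \<le> (norm (rpop (g j) y))\<^sup>2" for j y
    proof -
      have "0 \<le> Re (cip (rpop (g j * g j - ([:1 + c3 / real J:] - smult ((real j * e)\<^sup>2) [:0, 1:])) y) y)"
      proof (rule rpop_nonneg)
        fix s assume "s \<in> {lo..hi}"
        from g[OF this, of j] have "1 + c3 / real J - (real j * e)\<^sup>2 * s \<le> (poly (g j) s)\<^sup>2"
          unfolding Fj_def by linarith
        thus "0 \<le> poly (g j * g j - ([:1 + c3 / real J:] - smult ((real j * e)\<^sup>2) [:0, 1:])) s" by (simp add: power2_eq_square mult_ac)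
      qed
      also have "rpop (g j * g j - ([:1 + c3 / real J:] - smult ((real j * e)\<^sup>2) [:0, 1:])) y =
         rpop (g j) (rpop (g j) y) - (scaleR (1 + c3 / real J) y - scaleR ((real j * e)\<^sup>2) (X y))"
        by (simp only: rpop_diff rpop_mult rpop_smult) (simp add: X.zero)
      also have "Re (cip \<dots> y) = (norm (rpop (g j) y))\<^sup>2 - ((1 + c3 / real J) * (norm y)\<^sup>2 - (real j * e)\<^sup>2 * Re (cip (X y) y))"
        by (simp add: cip_diff_left cip_scaleR_left rpop_selfadjoint[of "g j" "rpop (g j) y" y] cip_self_norm del: of_real_power of_real_add)
      finally show ?thesis by simp
    qed
    have "(\<Sum>\<psi>\<in>O'. lam - Re (cip (P \<psi>) \<psi>)) \<le> (\<Sum>\<psi>\<in>O'. lam * (\<Sum>j<J. (norm (rpop (g j) (ch J e t j \<psi>)))\<^sup>2))"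
    proof (rule sum_mono)
      fix \<psi> assume \<psi>: "\<psi> \<in> O'"
      have "lam - Re (cip (P \<psi>) \<psi>) \<le> lam * (\<Sum>j<J. (1 + c3 / real J) * (norm (ch J e t j \<psi>))\<^sup>2
       - (real j * e)\<^sup>2 * Re (cip (X (ch J e t j \<psi>)) (ch J e t j \<psi>)))"
        using l1(2)[of lam \<psi>] lam l0(1) O(3) \<psi> n1[OF \<psi>] by (auto simp: t_def)
      also have "\<dots> \<le> lam * (\<Sum>j<J. (norm (rpop (g j) (ch J e t j \<psi>)))\<^sup>2)"
        using lam1 by (intro mult_left_mono sum_mono pt) auto
      finally show "lam - Re (cip (P \<psi>) \<psi>) \<le> \<dots>" .
    qed
    also have "\<dots> = lam * (\<Sum>j<J. \<Sum>\<psi>\<in>O'. (norm (rpop (g j) (ch J e t j \<psi>)))\<^sup>2)"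
      by (subst sum.swap) (simp add: sum_distrib_left)
    also have "\<dots> \<le> lam * (\<Sum>j<J. Wj J lam j * (norm (rpop (g j) (bas 0)))\<^sup>2)"
    proof (intro mult_left_mono sum_mono)
      fix j assume "j \<in> {..<J}"
      hence j: "j < J" by simp
      show "(\<Sum>\<psi>\<in>O'. (norm (rpop (g j) (ch J e t j \<psi>)))\<^sup>2) \<le> Wj J lam j * (norm (rpop (g j) (bas 0)))\<^sup>2"
        unfolding Wj_def e_def t_def
        by (rule trace_bound[OF O(1,2) Fs]) (use chi_abs cm_zero_outside[OF _ _ j] lam1 J in auto)
    qed (use lam1 in auto)
    also have "(\<Sum>j<J. Wj J lam j * (norm (rpop (g j) (bas 0)))\<^sup>2) = Re (cip (rpop Q (bas 0)) (bas 0))"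
      unfolding Q_def rpop_sum cip_sum_left Re_sum
      by (intro sum.cong refl)
         (simp add: rpop_smult rpop_mult cip_scaleR_left rpop_selfadjoint[of "g _" "rpop (g _) _"] cip_self_norm del: of_real_power)
    also have "Re (cip (rpop Q (bas 0)) (bas 0)) \<le> ((pi\<^sup>2 / 6 + \<eta>) * lam\<^sup>2) * (norm v)\<^sup>2"
    proof (rule vacuum_le)
      fix s assume s: "s \<in> {lo..hi}"
      have s0: "0 < s" "s \<le> hi" using s lo_hi(1) by auto
      have "poly Q s = (\<Sum>j<J. Wj J lam j * (poly (g j) s)\<^sup>2)"
        by (simp add: Q_def poly_sum power2_eq_square)
      also have "\<dots> \<le> Phi (lam / s) + ((c3 + 2) / real J + 2 * MM\<^sup>2 * hi / real J) * real (card (Fs lam))"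
      proof (rule shell_sums(1)[OF J(1) _ s])
        fix j assume "j < J"
        have "(poly (g j) s)\<^sup>2 \<le> Fj j s + 1 / real J" using g[OF s, of j] by linarith
        also have "Fj j s \<le> max 0 (1 - (real j * e)\<^sup>2 * s) + c3 / real J + 1 / real J"
          unfolding Fj_def using c3 J0 divide_nonneg_pos[OF c3 J0] by linarith
        finally show "(poly (g j) s)\<^sup>2 \<le> max 0 (1 - (real j * (MM / real J))\<^sup>2 * s) + (c3 + 2) / real J"
          by (simp add: e_def add_divide_distrib)
      qed (use lam1 c3 in auto)
      also have "(c3 + 2) / real J + 2 * MM\<^sup>2 * hi / real J = c4 / real J" by (simp add: c4_def add_divide_distrib)
      also have "Phi (lam / s) \<le> (pi\<^sup>2 / 6 + \<eta> / 2) * (lam / s)\<^sup>2"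
      proof -
        have "s * \<rho>0 \<le> lam" using s0 \<rho>0(1) l0(2) lam mult_right_mono[of s hi \<rho>0] by linarith
        hence "\<rho>0 \<le> lam / s" using s0 by (simp add: le_divide_eq mult.commute)
        from \<rho>0(2)[OF this] show ?thesis unfolding distrib_right by linarith
      qed
      also have "c4 / real J * real (card (Fs lam)) \<le> c4 / real J * (C5 * lam\<^sup>2)"
      proof (rule mult_left_mono)
        have "1 / MM\<^sup>2 \<le> lam" using lam l0(3) by linarith
        hence "1 \<le> MM\<^sup>2 * lam" using MM(1) by (simp add: divide_le_eq mult.commute)
        hence "sqrt 1 \<le> sqrt (MM\<^sup>2 * lam)" by (rule real_sqrt_le_mono)
        hence "1 \<le> MM * sqrt lam" using MM(1) by (simp add: real_sqrt_mult)
        from Fs_card[OF lam1 this] show "real (card (Fs lam)) \<le> C5 * lam\<^sup>2" by (simp add: C5_def)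
      qed (use c3 h0 in \<open>auto simp: c4_def\<close>)
      finally have "poly Q s \<le> (pi\<^sup>2 / 6 + \<eta> / 2) * (lam / s)\<^sup>2 + c4 / real J * (C5 * lam\<^sup>2)" by simp
      hence "s\<^sup>2 * poly Q s \<le> s\<^sup>2 * ((pi\<^sup>2 / 6 + \<eta> / 2) * (lam / s)\<^sup>2 + c4 / real J * (C5 * lam\<^sup>2))"
        by (intro mult_left_mono) auto
      also have "\<dots> = (pi\<^sup>2 / 6 + \<eta> / 2) * lam\<^sup>2 + s\<^sup>2 * (c4 / real J * (C5 * lam\<^sup>2))"
        using s0 by (simp add: distrib_left power_divide)
      also have "s\<^sup>2 * (c4 / real J * (C5 * lam\<^sup>2)) \<le> hi\<^sup>2 * (c4 / real J * (C5 * lam\<^sup>2))"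
        using s0 c3 h0 C5_pos by (intro mult_right_mono power_mono mult_nonneg_nonneg divide_nonneg_nonneg) (auto simp: c4_def)
      also have "\<dots> = (hi\<^sup>2 * C5 * c4 / real J) * lam\<^sup>2" by simp
      also have "\<dots> \<le> \<eta> / 2 * lam\<^sup>2" by (intro mult_right_mono J(2)) auto
      finally show "s\<^sup>2 * poly Q s \<le> (pi\<^sup>2 / 6 + \<eta>) * lam\<^sup>2" by (simp add: algebra_simps)
    qed
    finally have "(\<Sum>\<psi>\<in>O'. lam - Re (cip (P \<psi>) \<psi>)) \<le> lam * (((pi\<^sup>2 / 6 + \<eta>) * lam\<^sup>2) * (norm v)\<^sup>2)"
      using lam1 by (simp add: mult_left_mono)
    also have "\<dots> = (pi\<^sup>2 / 6 + \<eta>) * (norm v)\<^sup>2 * lam ^ 3" by (simp add: power2_eq_square power3_eq_cube mult_ac)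
    finally show ?thesis .
  qed
  thus ?thesis using l0(4) by blast
qed

end

text \<open>The trial polynomial must resemble the indicator of \<open>r\<^sup>2 * s < 1\<close> and
  must stay below 1 in modulus, so that it yields trial operators below the identity. A ramp of
  width \<open>d\<close> serves as the indicator, because the function it multiplies is of order
  \<open>d\<close> there.\<close>

lemma lower_polynomial:
  fixes lo hi r M d c :: real
  assumes s: "0 < lo" "lo \<le> hi" and r: "0 \<le> r" "r \<le> M" and d: "0 < d" "d \<le> 1" and c: "c \<ge> 0"
  shows "\<exists>b. \<forall>s\<in>{lo..hi}. \<bar>poly b s\<bar> \<le> 1 \<and>
    max 0 (1 - r\<^sup>2 * s) - ((1 + c) + 4 * (1 + M\<^sup>2 * hi + c)) * d \<le> (poly b s)\<^sup>2 * (1 - c * d - r\<^sup>2 * s)"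
proof -
  \<comment> \<open>The ramp is 1 where \<open>1 - r\<^sup>2 * s \<ge> d\<close> and 0 where this
    quantity is negative. Shrinking it by \<open>1 - d\<close> before approximating leaves room for
    an error \<open>d\<close> under the bound 1.\<close>
  define \<beta> where "\<beta> s = min 1 (max 0 (1 - r\<^sup>2 * s) / d)" for s
  have "continuous_on {lo..hi} (\<lambda>s. (1 - d) * \<beta> s)"
    unfolding \<beta>_def using d by (auto intro!: continuous_intros)
  then obtain b where b: "\<And>s. s \<in> {lo..hi} \<Longrightarrow> \<bar>poly b s - (1 - d) * \<beta> s\<bar> < d"
    using poly_approx d by blast
  have "\<bar>poly b s\<bar> \<le> 1 \<and> max 0 (1 - r\<^sup>2 * s) - ((1 + c) + 4 * (1 + M\<^sup>2 * hi + c)) * d \<le> (poly b s)\<^sup>2 * (1 - c * d - r\<^sup>2 * s)"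
    if s: "s \<in> {lo..hi}" for s
  proof
    define f where "f = 1 - r\<^sup>2 * s"
    define g where "g = f - c * d"
    have be: "0 \<le> \<beta> s" "\<beta> s \<le> 1" using d by (auto simp: \<beta>_def)
    have bb: "\<bar>poly b s - \<beta> s\<bar> \<le> 2 * d"
    proof -
      have "d * \<beta> s \<le> d * 1" using be d by (intro mult_left_mono) auto
      moreover have "0 \<le> d * \<beta> s" using be d by simp
      moreover have "(1 - d) * \<beta> s = \<beta> s - d * \<beta> s" by (simp add: algebra_simps)
      ultimately show ?thesis using b[OF s] by linarith
    qed
    define \<gamma> where "\<gamma> = (1 - d) * \<beta> s"
    have "0 \<le> \<gamma>" unfolding \<gamma>_def using be d by simp
    moreover have "\<gamma> \<le> 1 - d" unfolding \<gamma>_def using be d by (simp add: mult_left_le)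
    moreover have "\<bar>poly b s - \<gamma>\<bar> < d" unfolding \<gamma>_def by (rule b[OF s])
    ultimately show b1: "\<bar>poly b s\<bar> \<le> 1" by linarith
    have "\<bar>(poly b s)\<^sup>2 - (\<beta> s)\<^sup>2\<bar> = \<bar>poly b s - \<beta> s\<bar> * \<bar>poly b s + \<beta> s\<bar>"
      unfolding abs_mult[symmetric] by (simp add: power2_eq_square algebra_simps)
    also have "\<dots> \<le> (2 * d) * 2" using bb b1 be by (intro mult_mono) auto
    finally have sq: "\<bar>(poly b s)\<^sup>2 - (\<beta> s)\<^sup>2\<bar> \<le> 4 * d" by simp
    have cd: "0 \<le> c * d" "c * d \<le> c" using c d by (auto simp: mult_left_le)
    have rs: "0 \<le> r\<^sup>2 * s" "r\<^sup>2 * s \<le> M\<^sup>2 * hi"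
    proof -
      have "r\<^sup>2 \<le> M\<^sup>2" using r by (intro power_mono) auto
      thus "0 \<le> r\<^sup>2 * s" "r\<^sup>2 * s \<le> M\<^sup>2 * hi" using s assms(1) by (auto intro!: mult_mono)
    qed
    have G: "\<bar>g\<bar> \<le> 1 + M\<^sup>2 * hi + c" unfolding g_def f_def using rs cd by linarith
    have "\<bar>((poly b s)\<^sup>2 - (\<beta> s)\<^sup>2) * g\<bar> \<le> (4 * d) * (1 + M\<^sup>2 * hi + c)"
      unfolding abs_mult using sq G d by (intro mult_mono) auto
    moreover have "(poly b s)\<^sup>2 * g = (\<beta> s)\<^sup>2 * g + ((poly b s)\<^sup>2 - (\<beta> s)\<^sup>2) * g" by (simp add: algebra_simps)
    \<comment> \<open>On the ramp itself the positive part is below \<open>d\<close>, so losing it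
      entirely costs no more than the allowed error.\<close>
    moreover have "max 0 f - (1 + c) * d \<le> (\<beta> s)\<^sup>2 * g"
    proof -
      consider "f \<le> 0" | "0 < f" "f < d" | "d \<le> f" by linarith
      thus ?thesis
      proof cases
        case 1
        hence "\<beta> s = 0" using d by (simp add: \<beta>_def f_def[symmetric])
        thus ?thesis using 1 c d by simp
      next
        case 2
        have "(\<beta> s)\<^sup>2 \<le> 1" using be by (simp add: power_le_one)
        hence "(\<beta> s)\<^sup>2 * (c * d) \<le> 1 * (c * d)" using cd by (intro mult_right_mono) auto
        moreover have "0 \<le> (\<beta> s)\<^sup>2 * f" using 2 by simp
        moreover have "(\<beta> s)\<^sup>2 * g = (\<beta> s)\<^sup>2 * f - (\<beta> s)\<^sup>2 * (c * d)" by (simp add: g_def right_diff_distrib)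
        moreover have "(1 + c) * d = d + c * d" by (simp add: distrib_right)
        ultimately show ?thesis using 2 by linarith
      next
        case 3
        have "max 0 f / d \<ge> 1" using 3 d by (simp add: le_divide_eq)
        hence "\<beta> s = 1" by (simp add: \<beta>_def f_def[symmetric])
        moreover have "(1 + c) * d = d + c * d" by (simp add: distrib_right)
        ultimately show ?thesis using 3 d by (simp add: g_def)
      qed
    qed
    moreover have "(1 + c + 4 * (1 + M\<^sup>2 * hi + c)) * d = (1 + c) * d + (4 * d) * (1 + M\<^sup>2 * hi + c)"
      by (simp add: algebra_simps)
    ultimately have "max 0 f - (1 + c + 4 * (1 + M\<^sup>2 * hi + c)) * d \<le> (poly b s)\<^sup>2 * g" by linarith
    thus "max 0 (1 - r\<^sup>2 * s) - ((1 + c) + 4 * (1 + M\<^sup>2 * hi + c)) * d \<le> (poly b s)\<^sup>2 * (1 - c * d - r\<^sup>2 * s)"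
      unfolding f_def g_def by (simp add: algebra_simps)
  qed
  thus ?thesis by blast
qed

context nct begin

text \<open>The variational lower bound: no completeness of the eigenvectors is needed, only that
  \<open>P \<ge> lam\<close> on their orthogonal complement.\<close>

lemma form_le_projection:
  assumes O: "finite O'" "ons O'" "\<And>\<psi>. \<psi> \<in> O' \<Longrightarrow> \<psi> \<in> H2 \<and> P \<psi> = cs (of_real (\<mu> \<psi>)) \<psi>"
    and low: "\<And>x. x \<in> H2 \<Longrightarrow> (\<And>\<psi>. \<psi> \<in> O' \<Longrightarrow> cip x \<psi> = 0) \<Longrightarrow> lam * (norm x)\<^sup>2 \<le> Re (cip (P x) x)"
    and u: "u \<in> H2"
  shows "lam * (norm u)\<^sup>2 - Re (cip (P u) u) \<le> (\<Sum>\<psi>\<in>O'. (lam - \<mu> \<psi>) * (cmod (cip u \<psi>))\<^sup>2)"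
proof -
  define p where "p = (\<Sum>\<psi>\<in>O'. cs (cip u \<psi>) \<psi>)"
  define w where "w = u - p"
  have p: "p \<in> H2" unfolding p_def using O(3) by (intro H2_sum H2_cs) auto
  have w: "w \<in> H2" unfolding w_def by (rule H2_diff[OF u p])
  have wO: "cip w \<psi> = 0" if "\<psi> \<in> O'" for \<psi> unfolding w_def p_def by (rule ons_projection[OF O(1,2) that])
  have Pp: "P p = (\<Sum>\<psi>\<in>O'. cs (cip u \<psi> * of_real (\<mu> \<psi>)) \<psi>)" unfolding p_def
  proof (use O(1) O(3) in \<open>induction O' rule: finite_induct\<close>)
    case empty
    show ?case using P_cs[of 0 0] by (simp add: H2_def)
  next
    case (insert \<psi> F)
    have "(\<Sum>\<psi>\<in>F. cs (cip u \<psi>) \<psi>) \<in> H2" using insert by (intro H2_sum H2_cs) auto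
    thus ?case using insert by (simp add: P_linear(1) H2_cs P_cs)
  qed
  have wp: "cip w (P p) = 0"
  proof -
    have "cip w (cs (cip u \<psi> * of_real (\<mu> \<psi>)) \<psi>) = 0" if "\<psi> \<in> O'" for \<psi>
      by (simp only: cip_cs_right wO[OF that] mult_zero_right)
    thus ?thesis unfolding Pp cip_sum_right by (rule sum.neutral[OF ballI])
  qed
  have pw: "cip (P p) w = 0" using wp by (metis cip_cnj complex_cnj_zero)
  have Pu: "cip (P u) u = cip (P w) w + cip (P p) u"
  proof -
    have uw: "u = w + p" by (simp add: w_def)
    have "cip (P u) u = cip (P w) u + cip (P p) u"
      by (subst uw, subst P_linear(1)[OF w p]) (simp add: cip_add_left uw[symmetric])
    also have "cip (P w) u = cip w (P u)" by (rule P_symmetric[OF w u])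
    also have "\<dots> = cip w (P w) + cip w (P p)"
      by (subst uw, subst P_linear(1)[OF w p]) (simp add: cip_add_right)
    finally show ?thesis by (simp add: wp P_symmetric[OF w w])
  qed
  have "cip (P p) u = (\<Sum>\<psi>\<in>O'. of_real (\<mu> \<psi> * (cmod (cip u \<psi>))\<^sup>2))"
    unfolding Pp cip_sum_left cip_cs_left
  proof (rule sum.cong[OF refl])
    fix \<psi>
    have "cip \<psi> u = cnj (cip u \<psi>)" by (simp add: cip_cnj)
    thus "cip u \<psi> * complex_of_real (\<mu> \<psi>) * cip \<psi> u = of_real (\<mu> \<psi> * (cmod (cip u \<psi>))\<^sup>2)"
      unfolding of_real_mult complex_norm_square by (simp add: mult_ac)
  qed
  hence "Re (cip (P u) u) = Re (cip (P w) w) + (\<Sum>\<psi>\<in>O'. \<mu> \<psi> * (cmod (cip u \<psi>))\<^sup>2)"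
    unfolding Pu by (simp del: of_real_mult of_real_power)
  moreover have "lam * (norm w)\<^sup>2 \<le> Re (cip (P w) w)" by (rule low[OF w wO])
  moreover have "(norm u)\<^sup>2 = (norm w)\<^sup>2 + (\<Sum>\<psi>\<in>O'. (cmod (cip u \<psi>))\<^sup>2)"
    unfolding w_def p_def by (rule ons_pythagoras[OF O(1,2)])
  ultimately show ?thesis
    by (simp add: left_diff_distrib sum_subtractf sum_distrib_left distrib_left)
qed

lemma X_cip_le: "\<bar>Re (cip (X a) b)\<bar> \<le> hi * (norm a * norm b)"
proof -
  have "\<bar>Re (cip (X a) b)\<bar> \<le> norm (X a) * norm b"
    using abs_Re_le_cmod[of "cip (X a) b"] cmod_cip_le[of "X a" b] by linarith
  also have "\<dots> \<le> hi * norm a * norm b" by (intro mult_right_mono lo_hi(4)) auto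
  finally show ?thesis by (simp add: mult.assoc)
qed

text \<open>Used to exchange a cutoff with a polynomial in \<open>X\<close>: the two orders give
  vectors at distance \<open>O(1 / t)\<close> and of norm at most 1, hence nearly equal
  forms.\<close>

lemma form_lipschitz:
  assumes "norm u \<le> 1" "norm w \<le> 1" "\<bar>\<sigma>\<bar> \<le> G" "0 \<le> r" "r \<le> M"
  shows "\<bar>(\<sigma> * (norm u)\<^sup>2 - r\<^sup>2 * Re (cip (X u) u)) - (\<sigma> * (norm w)\<^sup>2 - r\<^sup>2 * Re (cip (X w) w))\<bar> \<le> 2 * (G + M\<^sup>2 * hi) * norm (u - w)"
proof -
  have h0: "hi > 0" using lo_hi(1,2) by linarith
  have 1: "\<bar>(norm u)\<^sup>2 - (norm w)\<^sup>2\<bar> \<le> 2 * norm (u - w)"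
  proof -
    have "\<bar>(norm u)\<^sup>2 - (norm w)\<^sup>2\<bar> = \<bar>norm u - norm w\<bar> * \<bar>norm u + norm w\<bar>"
      unfolding abs_mult[symmetric] by (simp add: power2_eq_square algebra_simps)
    also have "\<dots> \<le> norm (u - w) * 2"
      using assms(1,2) by (intro mult_mono norm_triangle_ineq3) auto
    finally show ?thesis by simp
  qed
  have 2: "\<bar>Re (cip (X u) u) - Re (cip (X w) w)\<bar> \<le> 2 * hi * norm (u - w)"
  proof -
    have "cip (X u) u - cip (X w) w = cip (X (u - w)) u + cip (X w) (u - w)"
      by (simp add: X.diff cip_diff_left cip_diff_right)
    hence "Re (cip (X u) u) - Re (cip (X w) w) = Re (cip (X (u - w)) u) + Re (cip (X w) (u - w))"
      by (metis minus_complex.sel(1) plus_complex.sel(1))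
    hence "\<bar>Re (cip (X u) u) - Re (cip (X w) w)\<bar> \<le> hi * (norm (u - w) * norm u) + hi * (norm w * norm (u - w))"
      using X_cip_le[of "u - w" u] X_cip_le[of w "u - w"] by linarith
    also have "\<dots> \<le> hi * (norm (u - w) * 1) + hi * (1 * norm (u - w))"
      using assms h0 by (intro add_mono mult_left_mono mult_right_mono) auto
    finally show ?thesis by simp
  qed
  have "\<bar>\<sigma> * ((norm u)\<^sup>2 - (norm w)\<^sup>2)\<bar> \<le> G * (2 * norm (u - w))"
    unfolding abs_mult using assms 1 by (intro mult_mono) auto
  moreover have "\<bar>r\<^sup>2 * (Re (cip (X u) u) - Re (cip (X w) w))\<bar> \<le> M\<^sup>2 * (2 * hi * norm (u - w))"
    unfolding abs_mult using assms 2 h0 by (intro mult_mono) (auto intro: power_mono)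
  moreover have "(\<sigma> * (norm u)\<^sup>2 - r\<^sup>2 * Re (cip (X u) u)) - (\<sigma> * (norm w)\<^sup>2 - r\<^sup>2 * Re (cip (X w) w)) =
     \<sigma> * ((norm u)\<^sup>2 - (norm w)\<^sup>2) - r\<^sup>2 * (Re (cip (X u) u) - Re (cip (X w) w))" by (simp add: algebra_simps)
  moreover have "2 * (G + M\<^sup>2 * hi) * norm (u - w) = G * (2 * norm (u - w)) + M\<^sup>2 * (2 * hi * norm (u - w))"
    by (simp add: algebra_simps)
  ultimately show ?thesis by linarith
qed

lemma rpop_bas_form: "n \<in> lat \<Longrightarrow> cip (X (rpop b (bas n))) (rpop b (bas n)) = cip (X (rpop b (bas 0))) (rpop b (bas 0))"
  by (simp add: R_bas[of n \<theta>, symmetric] rpop_R X_R cip_R)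

text \<open>The trial operator is a sum of rank one terms over the vectors \<open>u j n\<close>; it
  lies below the identity because the \<open>b j\<close> are contractions and the squared cutoffs
  sum to 1. Its pairing with \<open>lam - P\<close> thus cannot exceed the Riesz mean, and on each
  shell it is computed from the vacuum.\<close>

lemma lower_riesz:
  assumes \<eta>: "\<eta> > 0"
  shows "\<exists>l0\<ge>1. \<forall>lam\<ge>l0. \<forall>O' \<mu>. finite O' \<longrightarrow> ons O' \<longrightarrow>
    (\<forall>\<psi>\<in>O'. \<psi> \<in> H2 \<and> P \<psi> = cs (of_real (\<mu> \<psi>)) \<psi> \<and> \<mu> \<psi> \<le> lam) \<longrightarrow>
    (\<forall>x\<in>H2. (\<forall>\<psi>\<in>O'. cip x \<psi> = 0) \<longrightarrow> lam * (norm x)\<^sup>2 \<le> Re (cip (P x) x)) \<longrightarrow>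
    (pi\<^sup>2 / 6 - \<eta>) * (norm v)\<^sup>2 * lam ^ 3 \<le> (\<Sum>\<psi>\<in>O'. lam - \<mu> \<psi>)"
proof -
  \<comment> \<open>The tolerance is split in three: the lattice asymptotics, the errors of order
    \<open>1 / J\<close>, and the lower order terms in \<open>lam\<close>.\<close>
  obtain \<rho>0 where \<rho>0: "\<rho>0 > 0" "\<And>\<rho>. \<rho> \<ge> \<rho>0 \<Longrightarrow> \<bar>Phi \<rho> - pi\<^sup>2 / 6 * \<rho>\<^sup>2\<bar> \<le> \<eta> / 3 * \<rho>\<^sup>2"
    using Phi_asymp[of "\<eta> / 3"] \<eta> by auto
  obtain C where C: "C \<ge> 0" "\<And>x. x \<in> H2 \<Longrightarrow> \<bar>Re (cip (P x) x) - Re (cip (X (Lm x)) (Lm x))\<bar> \<le> C * (norm (Lm x) * norm x + (norm x)\<^sup>2)"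
    using P_form by blast
  have h0: "hi > 0" using lo_hi(1,2) by linarith
  define c5 where "c5 = 3 * hi * MM\<^sup>2"
  define c6 where "c6 = (1 + c5) + 4 * (1 + MM\<^sup>2 * hi + c5)"
  define c7 where "c7 = c6 + 2 * MM\<^sup>2 * hi"
  have c5: "c5 \<ge> 0" using h0 by (simp add: c5_def)
  have c6: "c6 \<ge> 0" using c5 h0 by (simp add: c6_def)
  obtain J :: nat where J: "J \<ge> 4" "hi\<^sup>2 * C5 * c7 / real J \<le> \<eta> / 3"
    using shells_exist[of "\<eta>/3" "hi\<^sup>2 * C5 * c7"] \<eta> by auto
  have J0: "real J > 0" using J by simp
  define d where "d = 1 / real J"
  define e where "e = MM / real J"
  have d: "0 < d" "d \<le> 1" using J by (auto simp: d_def)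
  have e: "e > 0" "e = MM * d" "real J * e = MM" using MM(1) J0 by (auto simp: e_def d_def)
  have rj: "0 \<le> real j * e" "real j * e \<le> MM" if "j < J" for j
  proof -
    show "0 \<le> real j * e" using e by simp
    have "real j * e \<le> real J * e" using that e(1) by (intro mult_right_mono) auto
    thus "real j * e \<le> MM" unfolding e(3) .
  qed
  have "\<exists>b. \<forall>s\<in>{lo..hi}. \<bar>poly b s\<bar> \<le> 1 \<and>
    max 0 (1 - (real j * e)\<^sup>2 * s) - c6 * d \<le> (poly b s)\<^sup>2 * (1 - c5 * d - (real j * e)\<^sup>2 * s)" if "j < J" for j
    unfolding c6_def by (rule lower_polynomial[OF lo_hi(1,2) rj[OF that] d c5])
  then obtain b where b: "\<And>j s. j < J \<Longrightarrow> s \<in> {lo..hi} \<Longrightarrow> \<bar>poly (b j) s\<bar> \<le> 1 \<and>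
    max 0 (1 - (real j * e)\<^sup>2 * s) - c6 * d \<le> (poly (b j) s)\<^sup>2 * (1 - c5 * d - (real j * e)\<^sup>2 * s)" by metis
  have bc: "norm (rpop (b j) x) \<le> norm x" if "j < J" for j x
    by (rule rpop_contraction) (use b[OF that] in blast)
  have "\<exists>K\<ge>0. \<forall>g l x. (\<forall>m\<in>lat. \<forall>n\<in>lat. \<bar>g n - g m\<bar> \<le> l * nn (n - m)) \<longrightarrow> l \<ge> 0 \<longrightarrow>
   (\<forall>x. x \<in> mdom g) \<longrightarrow> norm (mlt g (rpop (b j) x) - rpop (b j) (mlt g x)) \<le> K * l * norm x" for j
    by (rule rpop_commutator)
  then obtain K where K: "\<And>j. K j \<ge> 0" "\<And>j g l x. \<forall>m\<in>lat. \<forall>n\<in>lat. \<bar>g n - g m\<bar> \<le> l * nn (n - m) \<Longrightarrow> l \<ge> 0 \<Longrightarrow>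
   \<forall>x. x \<in> mdom g \<Longrightarrow> norm (mlt g (rpop (b j) x) - rpop (b j) (mlt g x)) \<le> K j * l * norm x" by metis
  define Km where "Km = (\<Sum>j<J. K j)"
  have Km: "K j \<le> Km" if "j < J" for j unfolding Km_def by (rule member_le_sum) (use that K(1) in auto)
  have Km0: "Km \<ge> 0" unfolding Km_def by (intro sum_nonneg K)
  define G where "G = 1 + c5 + MM\<^sup>2 * hi"
  have G0: "G \<ge> 0" using c5 h0 by (simp add: G_def)
  \<comment> \<open>Lower order loss per trial vector in units of \<open>lam / t = t\<close>: the
    interchange of cutoff and polynomial, and the first order part of \<open>P\<close>. Summed over
    all vectors it is of order \<open>lam^(5/2)\<close>, and \<open>t0\<close> below makes it at
    most a third of the tolerance.\<close>
  define \<kappa> where "\<kappa> = 2 * G * (Km * (pi / (2 * e))) + C * MM + C"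
  have \<kappa>0: "\<kappa> \<ge> 0" using G0 Km0 e C MM(1) by (simp add: \<kappa>_def)
  define t0 where "t0 = C5 * real J * \<kappa> / (\<eta> / 3 * (norm v)\<^sup>2)"
  have v0: "(norm v)\<^sup>2 > 0" using v_pos by simp
  have t00: "t0 \<ge> 0" using C5_pos \<kappa>0 \<eta> by (simp add: t0_def)
  define l0 where "l0 = 1 + hi * \<rho>0 + 1 / MM\<^sup>2 + t0\<^sup>2"
  have l0: "l0 \<ge> 1" "l0 \<ge> hi * \<rho>0" "l0 \<ge> 1 / MM\<^sup>2" "l0 \<ge> t0\<^sup>2"
  proof -
    have "0 \<le> hi * \<rho>0" "0 \<le> 1 / MM\<^sup>2" "0 \<le> t0\<^sup>2" using h0 \<rho>0(1) by auto
    thus "l0 \<ge> 1" "l0 \<ge> hi * \<rho>0" "l0 \<ge> 1 / MM\<^sup>2" "l0 \<ge> t0\<^sup>2" unfolding l0_def by linarith+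
  qed
  have "(pi\<^sup>2 / 6 - \<eta>) * (norm v)\<^sup>2 * lam ^ 3 \<le> (\<Sum>\<psi>\<in>O'. lam - \<mu> \<psi>)"
    if lam: "lam \<ge> l0" and O: "finite O'" "ons O'" and ev: "\<forall>\<psi>\<in>O'. \<psi> \<in> H2 \<and> P \<psi> = cs (of_real (\<mu> \<psi>)) \<psi> \<and> \<mu> \<psi> \<le> lam"
      and low: "\<forall>x\<in>H2. (\<forall>\<psi>\<in>O'. cip x \<psi> = 0) \<longrightarrow> lam * (norm x)\<^sup>2 \<le> Re (cip (P x) x)" for lam O' \<mu>
  proof -
    have lam1: "lam \<ge> 1" using lam l0 by linarith
    define t where "t = sqrt lam"
    have t: "t \<ge> 1" "t\<^sup>2 = lam" "t > 0" using lam1 by (auto simp: t_def)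
    define F where "F = Fs lam"
    \<comment> \<open>The cutoff acts last so that \<open>u j n\<close> lies in \<open>H2\<close>
      and in one shell. The opposite order is easier to evaluate, since a cutoff only scales
      \<open>bas n\<close>.\<close>
    define u where "u j n = ch J e t j (rpop (b j) (bas n))" for j n
    define w where "w j = rpop (b j) (bas 0)" for j
    define B where "B j y = (1 - c5 * d) * (norm y)\<^sup>2 - (real j * e)\<^sup>2 * Re (cip (X y) y)" for j y
    define T where "T y = lam * (norm y)\<^sup>2 - Re (cip (P y) y)" for y
    have F: "finite F" "F \<subseteq> lat" unfolding F_def by (rule Fs)+
    have uH2: "u j n \<in> H2" if "j < J" for j n unfolding u_def by (rule ch_shell(1)[OF e(1) t(3) that])
    have nu: "norm (u j n) \<le> 1" if "j < J" "n \<in> F" for j n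
    proof -
      have "norm (u j n) \<le> norm (rpop (b j) (bas n))" unfolding u_def by (rule ch_norm)
      also have "\<dots> \<le> norm (bas n)" by (rule bc[OF that(1)])
      also have "\<dots> = 1" using that F by auto
      finally show ?thesis .
    qed
    \<comment> \<open>Each eigenvector receives total weight at most 1 from the trial vectors, and
      the factors \<open>lam - \<mu> \<psi>\<close> are nonnegative.\<close>
    have upper: "(\<Sum>j<J. \<Sum>n\<in>F. T (u j n)) \<le> (\<Sum>\<psi>\<in>O'. lam - \<mu> \<psi>)"
    proof -
      have "(\<Sum>j<J. \<Sum>n\<in>F. T (u j n)) \<le> (\<Sum>j<J. \<Sum>n\<in>F. \<Sum>\<psi>\<in>O'. (lam - \<mu> \<psi>) * (cmod (cip (u j n) \<psi>))\<^sup>2)"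
        unfolding T_def
      proof (intro sum_mono)
        fix j n assume j: "j \<in> {..<J}" "n \<in> F"
        show "lam * (norm (u j n))\<^sup>2 - Re (cip (P (u j n)) (u j n)) \<le> (\<Sum>\<psi>\<in>O'. (lam - \<mu> \<psi>) * (cmod (cip (u j n) \<psi>))\<^sup>2)"
          by (rule form_le_projection[OF O]) (use ev low uH2 j in auto)
      qed
      also have "\<dots> = (\<Sum>j<J. \<Sum>\<psi>\<in>O'. (lam - \<mu> \<psi>) * (\<Sum>n\<in>F. (cmod (cip (u j n) \<psi>))\<^sup>2))"
        by (subst sum.swap) (simp add: sum_distrib_left)
      also have "\<dots> = (\<Sum>\<psi>\<in>O'. (lam - \<mu> \<psi>) * (\<Sum>j<J. \<Sum>n\<in>F. (cmod (cip (u j n) \<psi>))\<^sup>2))"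
        by (subst sum.swap) (simp add: sum_distrib_left)
      also have "\<dots> \<le> (\<Sum>\<psi>\<in>O'. (lam - \<mu> \<psi>) * 1)"
      proof (intro sum_mono mult_left_mono)
        fix \<psi> assume \<psi>: "\<psi> \<in> O'"
        have "(\<Sum>j<J. \<Sum>n\<in>F. (cmod (cip (u j n) \<psi>))\<^sup>2) \<le> (\<Sum>j<J. (norm (ch J e t j \<psi>))\<^sup>2)"
        proof (rule sum_mono)
          fix j assume j: "j \<in> {..<J}"
          have "cmod (cip (u j n) \<psi>) = cmod (co (rpop (b j) (ch J e t j \<psi>)) n)" if n: "n \<in> F" for n
          proof -
            have "cip (u j n) \<psi> = cip (bas n) (rpop (b j) (ch J e t j \<psi>))"
              unfolding u_def by (simp add: mlt_symmetric[OF cm_mdom cm_mdom] rpop_selfadjoint)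
            also have "\<dots> = cnj (cip (rpop (b j) (ch J e t j \<psi>)) (bas n))" by (simp add: cip_cnj)
            finally show ?thesis using n F by (auto simp: cip_bas)
          qed
          hence "(\<Sum>n\<in>F. (cmod (cip (u j n) \<psi>))\<^sup>2) \<le> (norm (rpop (b j) (ch J e t j \<psi>)))\<^sup>2"
            using finite_sum_le_norm[OF F(1), of "rpop (b j) (ch J e t j \<psi>)"] by simp
          also have "\<dots> \<le> (norm (ch J e t j \<psi>))\<^sup>2" by (intro power_mono bc) (use j in auto)
          finally show "(\<Sum>n\<in>F. (cmod (cip (u j n) \<psi>))\<^sup>2) \<le> (norm (ch J e t j \<psi>))\<^sup>2" .
        qed
        also have "\<dots> \<le> (\<Sum>j\<le>J. (norm (ch J e t j \<psi>))\<^sup>2)" by (intro sum_mono2) auto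
        also have "\<dots> = (norm \<psi>)\<^sup>2" by (rule ch_norm_sum[OF e(1) t(3)])
        also have "\<dots> = 1"
        proof -
          have "cip \<psi> \<psi> = 1" using O(2) \<psi> by (simp add: ons_def)
          hence "complex_of_real ((norm \<psi>)\<^sup>2) = of_real 1" by (simp add: cip_self_norm)
          thus ?thesis by (simp only: of_real_eq_iff)
        qed
        finally show "(\<Sum>j<J. \<Sum>n\<in>F. (cmod (cip (u j n) \<psi>))\<^sup>2) \<le> 1" .
      qed (use ev in auto)
      finally show ?thesis by simp
    qed
    have Tlow: "lam * ((cm J e t j n)\<^sup>2 * B j (w j)) - lam * \<kappa> / t \<le> T (u j n)" if j: "j < J" and n: "n \<in> F" for j n
    proof -
      have nl: "n \<in> lat" using n F by auto
      let ?y = "u j n" let ?r = "real j * e"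
      define w' where "w' = scaleR (cm J e t j n) (rpop (b j) (bas n))"
      define D where "D = Lm ?y - scaleR (?r * t) ?y"
      have nD: "norm D \<le> (e * t) * norm ?y" unfolding D_def u_def by (rule ch_shell(2)[OF e(1) t(3) j])
      have nL: "norm (Lm ?y) \<le> MM * t * norm ?y"
        using ch_shell(3)[OF e(1) t(3) j, of "rpop (b j) (bas n)"] unfolding u_def e(3) .
      have ny: "norm ?y \<le> 1" by (rule nu[OF j n])
      have ny2: "(norm ?y)\<^sup>2 \<le> 1" using ny by (simp add: power_le_one)
      have LyD: "Lm ?y = scaleR (?r * t) ?y + D" by (simp add: D_def)
      have "Re (cip (X (Lm ?y)) (Lm ?y)) \<le> (?r * t)\<^sup>2 * Re (cip (X ?y) ?y) + hi * (2 * (?r * t) * (e * t) + (e * t)\<^sup>2) * (norm ?y)\<^sup>2"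
        using X_form_perturb[OF nD, of "?r * t"] e t rj[OF j] unfolding LyD[symmetric] by auto
      also have "hi * (2 * (?r * t) * (e * t) + (e * t)\<^sup>2) = lam * (hi * (2 * ?r * e + e * e))"
        unfolding t(2)[symmetric] by (simp add: power2_eq_square algebra_simps)
      also have "\<dots> * (norm ?y)\<^sup>2 \<le> lam * (hi * (2 * MM * e + MM * e)) * (norm ?y)\<^sup>2"
      proof (intro mult_right_mono mult_left_mono add_mono)
        show "?r \<le> MM" by (rule rj[OF j])
        show "e \<le> MM" using e(2) d MM(1) by (simp add: mult_left_le)
      qed (use e h0 lam1 in auto)
      also have "lam * (hi * (2 * MM * e + MM * e)) = lam * (c5 * d)"
        unfolding e(2) c5_def by (simp add: power2_eq_square algebra_simps)
      finally have q: "Re (cip (X (Lm ?y)) (Lm ?y)) \<le> lam * (?r\<^sup>2 * Re (cip (X ?y) ?y)) + lam * (c5 * d) * (norm ?y)\<^sup>2"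
        unfolding power_mult_distrib[of "?r" t] t(2) by (simp add: mult_ac)
      have "Re (cip (P ?y) ?y) \<le> Re (cip (X (Lm ?y)) (Lm ?y)) + C * (norm (Lm ?y) * norm ?y + (norm ?y)\<^sup>2)"
        using C(2)[OF uH2[OF j, of n]] by linarith
      also have "C * (norm (Lm ?y) * norm ?y + (norm ?y)\<^sup>2) \<le> C * (MM * t + 1)"
      proof (intro mult_left_mono add_mono ny2 C(1))
        have "norm (Lm ?y) * norm ?y \<le> (MM * t * 1) * 1"
          using nL ny MM(1) t by (intro mult_mono order_trans[OF nL] mult_left_mono) auto
        thus "norm (Lm ?y) * norm ?y \<le> MM * t" by simp
      qed
      finally have "lam * (norm ?y)\<^sup>2 - (lam * (?r\<^sup>2 * Re (cip (X ?y) ?y)) + lam * (c5 * d) * (norm ?y)\<^sup>2) - C * (MM * t + 1) \<le> T ?y"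
        using q unfolding T_def by linarith
      moreover have "lam * (norm ?y)\<^sup>2 - (lam * (?r\<^sup>2 * Re (cip (X ?y) ?y)) + lam * (c5 * d) * (norm ?y)\<^sup>2) = lam * B j ?y"
        unfolding B_def by (simp add: algebra_simps)
      ultimately have 1: "lam * B j ?y - C * (MM * t + 1) \<le> T ?y" by simp
      have nw': "norm w' \<le> 1"
      proof -
        have "norm w' = \<bar>cm J e t j n\<bar> * norm (rpop (b j) (bas n))" by (simp add: w'_def)
        also have "\<dots> \<le> 1 * norm (bas n)" by (intro mult_mono chi_abs bc j) auto
        finally show ?thesis using nl by simp
      qed
      \<comment> \<open>The vector \<open>w'\<close> is the polynomial applied to the cut-off basis
        vector, so the difference is a commutator with a cutoff of Lipschitz constant
        \<open>pi / (2 * e * t)\<close>.\<close>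
      have dist: "norm (?y - w') \<le> Km * (pi / (2 * e * t))"
      proof -
        have "ch J e t j (bas n) = scaleR (cm J e t j n) (bas n)"
          by (rule hil_eqI) (simp add: co_mlt nl)
        hence "w' = rpop (b j) (ch J e t j (bas n))" by (simp add: w'_def scaleR_cs rpop_cs)
        hence "norm (?y - w') \<le> K j * (pi / (2 * e * t)) * norm (bas n)"
          unfolding u_def by (simp only:) (rule K(2), use cm_lipschitz[OF e(1) t(3)] e t in auto)
        also have "\<dots> \<le> Km * (pi / (2 * e * t)) * 1" using nl Km[OF j] e t by (intro mult_mono) (auto simp: Km0)
        finally show ?thesis by simp
      qed
      have "c5 * d \<le> c5" using c5 d by (simp add: mult_left_le)
      moreover have "0 \<le> c5 * d" using c5 d by simp
      ultimately have "\<bar>1 - c5 * d\<bar> \<le> 1 + c5" by linarith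
      from form_lipschitz[OF ny nw' this rj[OF j]]
      have "B j w' - B j ?y \<le> 2 * G * norm (?y - w')" unfolding B_def G_def by linarith
      also have "\<dots> \<le> 2 * G * (Km * (pi / (2 * e * t)))" using dist G0 by (intro mult_left_mono) auto
      finally have "lam * B j w' - lam * (2 * G * (Km * (pi / (2 * e * t)))) \<le> lam * B j ?y"
        using lam1 mult_left_mono[of "B j w' - 2 * G * (Km * (pi / (2 * e * t)))" "B j ?y" lam] by (simp add: right_diff_distrib)
      moreover have Bw: "B j w' = (cm J e t j n)\<^sup>2 * B j (w j)"
        unfolding B_def w'_def w_def
        by (simp add: X.scaleR cip_scaleR_left cip_scaleR_right rpop_bas_norm[OF nl] rpop_bas_form[OF nl] power_mult_distrib)
          (simp add: power2_eq_square algebra_simps)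
      moreover have "lam * (2 * G * (Km * (pi / (2 * e * t)))) + C * (MM * t + 1) \<le> lam * \<kappa> / t"
      proof -
        have lt: "lam / t = t" using t by (simp add: power2_eq_square[symmetric] divide_eq_eq)
        have "C * 1 \<le> C * t" using C t by (intro mult_left_mono) auto
        moreover have "lam * (2 * G * (Km * (pi / (2 * e * t)))) = 2 * G * (Km * (pi / (2 * e))) * (lam / t)" by simp
        moreover have "lam * \<kappa> / t = \<kappa> * (lam / t)" by simp
        ultimately show ?thesis unfolding lt \<kappa>_def by (simp add: algebra_simps)
      qed
      ultimately show ?thesis using 1 unfolding Bw[symmetric] by linarith
    qed
    \<comment> \<open>The factor \<open>b j\<close> stands on both sides so that its vacuum
      expectation is the form \<open>B j\<close> at \<open>w j\<close>, by selfadjointness.\<close>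
    define Q where "Q = (\<Sum>j<J. smult (Wj J lam j) (b j * ([:1 - c5 * d:] - smult ((real j * e)\<^sup>2) [:0, 1:]) * b j))"
    have Qv: "Re (cip (rpop Q (bas 0)) (bas 0)) = (\<Sum>j<J. Wj J lam j * B j (w j))"
    proof -
      have "cip (rpop (b j * ([:1 - c5 * d:] - smult ((real j * e)\<^sup>2) [:0, 1:]) * b j) (bas 0)) (bas 0) =
         cip (scaleR (1 - c5 * d) (w j) - scaleR ((real j * e)\<^sup>2) (X (w j))) (w j)" for j
        unfolding rpop_mult w_def rpop_selfadjoint[of "b j" _ "bas 0"]
        by (simp only: rpop_diff rpop_smult) (simp add: X.zero)
      thus ?thesis unfolding Q_def rpop_sum cip_sum_left Re_sum B_def
        by (simp add: rpop_smult cip_scaleR_left cip_diff_left cip_self_norm del: of_real_power of_real_diff of_real_mult)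
    qed
    have "((pi\<^sup>2 / 6 - 2 * (\<eta> / 3)) * lam\<^sup>2) * (norm v)\<^sup>2 \<le> Re (cip (rpop Q (bas 0)) (bas 0))"
    proof (rule vacuum_ge)
      fix s assume s: "s \<in> {lo..hi}"
      have s0: "0 < s" "s \<le> hi" using s lo_hi(1) by auto
      have "(pi\<^sup>2 / 6 - \<eta> / 3) * (lam / s)\<^sup>2 \<le> Phi (lam / s)"
      proof -
        have "s * \<rho>0 \<le> lam" using s0 \<rho>0(1) l0(2) lam mult_right_mono[of s hi \<rho>0] by linarith
        hence "\<rho>0 \<le> lam / s" using s0 by (simp add: le_divide_eq mult.commute)
        from \<rho>0(2)[OF this] show ?thesis unfolding left_diff_distrib by linarith
      qed
      moreover have "(c6 * d + 2 * MM\<^sup>2 * hi / real J) * real (card (Fs lam)) \<le> c7 / real J * (C5 * lam\<^sup>2)"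
      proof -
        have e1: "c6 * d + 2 * MM\<^sup>2 * hi / real J = c7 / real J" by (simp add: c7_def d_def add_divide_distrib)
        have "1 / MM\<^sup>2 \<le> lam" using lam l0(3) by linarith
        hence "1 \<le> MM\<^sup>2 * lam" using MM(1) by (simp add: divide_le_eq mult.commute)
        hence "sqrt 1 \<le> sqrt (MM\<^sup>2 * lam)" by (rule real_sqrt_le_mono)
        hence "1 \<le> MM * sqrt lam" using MM(1) by (simp add: real_sqrt_mult)
        from Fs_card[OF lam1 this] have "real (card (Fs lam)) \<le> C5 * lam\<^sup>2" by (simp add: C5_def)
        thus ?thesis unfolding e1 using c6 h0 by (intro mult_left_mono) (auto simp: c7_def)
      qed
      moreover have "Phi (lam / s) - (c6 * d + 2 * MM\<^sup>2 * hi / real J) * real (card (Fs lam)) \<le> poly Q s"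
      proof -
        have "poly Q s = (\<Sum>j<J. Wj J lam j * ((poly (b j) s)\<^sup>2 * (1 - c5 * d - (real j * e)\<^sup>2 * s)))"
          unfolding Q_def poly_sum by (intro sum.cong refl) (simp add: power2_eq_square algebra_simps)
        moreover have "Phi (lam / s) - (c6 * d + 2 * MM\<^sup>2 * hi / real J) * real (card (Fs lam)) \<le>
           (\<Sum>j<J. Wj J lam j * ((poly (b j) s)\<^sup>2 * (1 - c5 * d - (real j * e)\<^sup>2 * s)))"
        proof (rule shell_sums(2)[OF J(1) _ s])
          fix j assume "j < J"
          from b[OF this s] show "max 0 (1 - (real j * (MM / real J))\<^sup>2 * s) - c6 * d \<le> (poly (b j) s)\<^sup>2 * (1 - c5 * d - (real j * e)\<^sup>2 * s)"
            by (simp add: e_def)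
        qed (use lam1 c6 d in auto)
        ultimately show ?thesis by simp
      qed
      ultimately have "(pi\<^sup>2 / 6 - \<eta> / 3) * (lam / s)\<^sup>2 - c7 / real J * (C5 * lam\<^sup>2) \<le> poly Q s" by linarith
      hence "s\<^sup>2 * ((pi\<^sup>2 / 6 - \<eta> / 3) * (lam / s)\<^sup>2 - c7 / real J * (C5 * lam\<^sup>2)) \<le> s\<^sup>2 * poly Q s"
        by (intro mult_left_mono) auto
      moreover have "s\<^sup>2 * ((pi\<^sup>2 / 6 - \<eta> / 3) * (lam / s)\<^sup>2 - c7 / real J * (C5 * lam\<^sup>2)) =
         (pi\<^sup>2 / 6 - \<eta> / 3) * lam\<^sup>2 - s\<^sup>2 * (c7 / real J * (C5 * lam\<^sup>2))"
        using s0 by (simp add: right_diff_distrib power_divide)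
      moreover have "s\<^sup>2 * (c7 / real J * (C5 * lam\<^sup>2)) \<le> \<eta> / 3 * lam\<^sup>2"
      proof -
        have "s\<^sup>2 * (c7 / real J * (C5 * lam\<^sup>2)) \<le> hi\<^sup>2 * (c7 / real J * (C5 * lam\<^sup>2))"
          using s0 c6 h0 C5_pos by (intro mult_right_mono power_mono mult_nonneg_nonneg divide_nonneg_nonneg) (auto simp: c7_def)
        also have "\<dots> = (hi\<^sup>2 * C5 * c7 / real J) * lam\<^sup>2" by simp
        also have "\<dots> \<le> \<eta> / 3 * lam\<^sup>2" by (intro mult_right_mono J(2)) auto
        finally show ?thesis .
      qed
      moreover have "(pi\<^sup>2 / 6 - 2 * (\<eta> / 3)) * lam\<^sup>2 = (pi\<^sup>2 / 6 - \<eta> / 3) * lam\<^sup>2 - \<eta> / 3 * lam\<^sup>2" by (simp add: algebra_simps)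
      ultimately show "(pi\<^sup>2 / 6 - 2 * (\<eta> / 3)) * lam\<^sup>2 \<le> s\<^sup>2 * poly Q s" by linarith
    qed
    hence main: "lam * (((pi\<^sup>2 / 6 - 2 * (\<eta> / 3)) * lam\<^sup>2) * (norm v)\<^sup>2) \<le> lam * (\<Sum>j<J. Wj J lam j * B j (w j))"
      unfolding Qv using lam1 by (intro mult_left_mono) auto
    have sumW: "(\<Sum>j<J. \<Sum>n\<in>F. lam * ((cm J e t j n)\<^sup>2 * B j (w j))) = lam * (\<Sum>j<J. Wj J lam j * B j (w j))"
      unfolding Wj_def F_def e_def t_def by (simp add: sum_distrib_left sum_distrib_right)
    have "(\<Sum>j<J. \<Sum>n\<in>F. lam * ((cm J e t j n)\<^sup>2 * B j (w j)) - lam * \<kappa> / t) \<le> (\<Sum>j<J. \<Sum>n\<in>F. T (u j n))"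
      by (intro sum_mono Tlow) auto
    also have "(\<Sum>j<J. \<Sum>n\<in>F. lam * ((cm J e t j n)\<^sup>2 * B j (w j)) - lam * \<kappa> / t) =
       lam * (\<Sum>j<J. Wj J lam j * B j (w j)) - real J * (real (card F) * (lam * \<kappa> / t))"
      by (simp only: sum_subtractf sumW sum_constant card_lessThan)
    finally have step: "lam * (\<Sum>j<J. Wj J lam j * B j (w j)) - real J * (real (card F) * (lam * \<kappa> / t)) \<le> (\<Sum>\<psi>\<in>O'. lam - \<mu> \<psi>)"
      using upper by linarith
    have err: "real J * (real (card F) * (lam * \<kappa> / t)) \<le> \<eta> / 3 * (norm v)\<^sup>2 * lam ^ 3"
    proof -
      have "1 / MM\<^sup>2 \<le> lam" using lam l0(3) by linarith
      hence "1 \<le> MM\<^sup>2 * lam" using MM(1) by (simp add: divide_le_eq mult.commute)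
      hence "sqrt 1 \<le> sqrt (MM\<^sup>2 * lam)" by (rule real_sqrt_le_mono)
      hence "1 \<le> MM * sqrt lam" using MM(1) by (simp add: real_sqrt_mult)
      from Fs_card[OF lam1 this] have cF: "real (card F) \<le> C5 * lam\<^sup>2" by (simp add: C5_def F_def)
      have "t0\<^sup>2 \<le> t\<^sup>2" using lam l0(4) t(2) by linarith
      hence "t0 \<le> t" using t(3) power2_le_imp_le[of t0 t] by simp
      hence tk: "C5 * real J * \<kappa> / t \<le> \<eta> / 3 * (norm v)\<^sup>2"
        using t(3) \<eta> v0 unfolding t0_def by (simp add: divide_le_eq mult.commute)
      have "real J * (real (card F) * (lam * \<kappa> / t)) \<le> real J * ((C5 * lam\<^sup>2) * (lam * \<kappa> / t))"
        using lam1 \<kappa>0 t(3) by (intro mult_left_mono mult_right_mono cF) auto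
      also have "\<dots> = (C5 * real J * \<kappa> / t) * lam ^ 3" by (simp add: power2_eq_square power3_eq_cube)
      also have "\<dots> \<le> (\<eta> / 3 * (norm v)\<^sup>2) * lam ^ 3" using lam1 by (intro mult_right_mono tk) auto
      finally show ?thesis .
    qed
    have "(pi\<^sup>2 / 6 - \<eta>) * (norm v)\<^sup>2 * lam ^ 3 = lam * (((pi\<^sup>2 / 6 - 2 * (\<eta> / 3)) * lam\<^sup>2) * (norm v)\<^sup>2) - \<eta> / 3 * (norm v)\<^sup>2 * lam ^ 3"
      by (simp add: power2_eq_square power3_eq_cube algebra_simps)
    thus ?thesis using main step err by linarith
  qed
  thus ?thesis using l0(1) by (intro exI[of _ l0]) blast
qed

end

section \<open>The counting function\<close>

lemma fun_sum_apply: "(\<Sum>i\<in>A. f i) x = (\<Sum>i\<in>A. f i x)"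
  by (induction A rule: infinite_finite_induct) auto

lemma co_sum_cs: "co (\<Sum>\<psi>\<in>O'. cs (c \<psi>) \<psi>) = (\<Sum>\<psi>\<in>O'. (\<lambda>m. c \<psi> * co \<psi> m))"
  by (rule ext) (simp add: co_sum fun_sum_apply)

lemma ons_norm: "ons O' \<Longrightarrow> \<psi> \<in> O' \<Longrightarrow> norm \<psi> = 1"
proof -
  assume "ons O'" "\<psi> \<in> O'"
  hence "cip \<psi> \<psi> = 1" by (simp add: ons_def)
  hence "complex_of_real ((norm \<psi>)\<^sup>2) = of_real 1" by (simp add: cip_self_norm)
  hence "(norm \<psi>)\<^sup>2 = 1\<^sup>2" by (simp only: of_real_eq_iff one_power2)
  thus ?thesis by (simp only: power2_eq_iff_nonneg norm_ge_zero zero_le_one)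
qed

text \<open>\<open>E\<close> need not be a subspace: it will be a union of eigenspaces, and the
  dimension counts its span.\<close>

lemma dim_ons_span:
  assumes "finite O'" "ons O'" "O' \<subseteq> E" "\<And>x. x \<in> E \<Longrightarrow> x = (\<Sum>\<psi>\<in>O'. cs (cip x \<psi>) \<psi>)"
  shows "vector_space.dim (\<lambda>(c::complex) x. (\<lambda>m. c * x m)) (co ` E) = card O'"
proof -
  interpret vs: vector_space "\<lambda>(c::complex) (x::(nat \<Rightarrow> int) \<Rightarrow> complex). (\<lambda>m. c * x m)"
    by standard (simp_all add: fun_eq_iff algebra_simps)
  have inj: "inj_on co O'" by (rule inj_onI) (simp add: co_inject)
  have sub: "co ` E \<subseteq> vs.span (co ` O')"
  proof
    fix y assume "y \<in> co ` E"
    then obtain x where x: "x \<in> E" "y = co x" by blast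
    have "y = co (\<Sum>\<psi>\<in>O'. cs (cip x \<psi>) \<psi>)"
      unfolding x(2) by (rule arg_cong[OF assms(4)[OF x(1)]])
    also have "\<dots> = (\<Sum>\<psi>\<in>O'. (\<lambda>m. cip x \<psi> * co \<psi> m))" by (rule co_sum_cs)
    also have "\<dots> \<in> vs.span (co ` O')"
      by (rule vs.span_sum, rule vs.span_scale, rule vs.span_base, rule imageI)
    finally show "y \<in> vs.span (co ` O')" .
  qed
  have "vs.independent (co ` O')"
  proof
    assume "vs.dependent (co ` O')"
    hence "\<exists>u. (\<exists>w\<in>co ` O'. u w \<noteq> 0) \<and> (\<Sum>w\<in>co ` O'. (\<lambda>m. u w * w m)) = 0"
      by (simp only: vs.dependent_finite[OF finite_imageI[OF assms(1)]])
    then obtain u where u: "\<exists>w\<in>co ` O'. u w \<noteq> 0" "(\<Sum>w\<in>co ` O'. (\<lambda>m. u w * w m)) = 0"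
      by (elim exE conjE)
    have "(\<Sum>\<psi>\<in>O'. (\<lambda>m. u (co \<psi>) * co \<psi> m)) = 0"
      using u(2) unfolding sum.reindex[OF inj] o_def .
    moreover have "co 0 = (0 :: (nat \<Rightarrow> int) \<Rightarrow> complex)" by (rule ext) simp
    ultimately have "co (\<Sum>\<psi>\<in>O'. cs (u (co \<psi>)) \<psi>) = co 0" by (simp only: co_sum_cs)
    hence z: "(\<Sum>\<psi>\<in>O'. cs (u (co \<psi>)) \<psi>) = 0" by (simp only: co_inject)
    have "u (co \<phi>) = 0" if \<phi>: "\<phi> \<in> O'" for \<phi>
    proof -
      have "0 = cip (\<Sum>\<psi>\<in>O'. cs (u (co \<psi>)) \<psi>) \<phi>" by (simp add: z)
      also have "\<dots> = (\<Sum>\<psi>\<in>O'. if \<psi> = \<phi> then u (co \<psi>) else 0)"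
        unfolding cip_sum_left cip_cs_left using assms(2) \<phi> by (intro sum.cong) (auto simp: ons_def)
      also have "\<dots> = u (co \<phi>)" using assms(1) \<phi> by (simp add: sum.delta)
      finally show ?thesis by simp
    qed
    hence "\<forall>w\<in>co ` O'. u w = 0" by simp
    thus False using u(1) by simp
  qed
  moreover have "vs.span (co ` O') = vs.span (co ` E)"
  proof
    show "vs.span (co ` O') \<subseteq> vs.span (co ` E)" using assms(3) by (intro vs.span_mono) auto
    show "vs.span (co ` E) \<subseteq> vs.span (co ` O')" using vs.span_mono[OF sub] by (simp only: vs.span_span)
  qed
  ultimately have "vs.dim (co ` E) = card (co ` O')" by (intro vs.dim_eq_card)
  thus ?thesis by (simp add: card_image[OF inj])
qed

context nct begin

definition Ev :: "real \<Rightarrow> hil set" where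
  "Ev lam = {\<psi>\<in>H2. \<exists>\<mu>\<le>lam. P \<psi> = cs (of_real \<mu>) \<psi>}"

lemma eigvecs_le_Ev: "eigvecs_le \<theta> h lam = co ` Ev lam"
proof -
  have "(x, \<lambda>m. of_real \<mu> * x m) \<in> lap_closure \<theta> h \<longleftrightarrow> (\<exists>\<xi>\<in>H2. x = co \<xi> \<and> P \<xi> = cs (of_real \<mu>) \<xi>)" for x \<mu>
  proof -
    have "(\<lambda>m. of_real \<mu> * co \<xi> m) = co (P \<xi>) \<longleftrightarrow> P \<xi> = cs (of_real \<mu>) \<xi>" for \<xi>
    proof -
      have "(\<lambda>m. of_real \<mu> * co \<xi> m) = co (cs (of_real \<mu>) \<xi>)" by (simp add: fun_eq_iff)
      thus ?thesis by (auto simp: co_inject)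
    qed
    thus ?thesis unfolding lap_closure_graph by blast
  qed
  thus ?thesis unfolding eigvecs_le_def Ev_def by auto
qed

text \<open>The a priori bound on cardinalities provides a largest orthonormal family of
  eigenvectors. Maximality yields both completeness below \<open>lam\<close>, hence the eigenvalue
  count, and \<open>P \<ge> lam\<close> on the complement through
  \<open>eigenvector_below\<close>.\<close>

lemma eigenbasis:
  assumes bound: "\<And>O'. finite O' \<Longrightarrow> ons O' \<Longrightarrow> O' \<subseteq> Ev lam \<Longrightarrow> card O' \<le> b"
  shows "\<exists>O' \<mu>. finite O' \<and> ons O' \<and> (\<forall>\<psi>\<in>O'. \<psi> \<in> H2 \<and> P \<psi> = cs (of_real (\<mu> \<psi>)) \<psi> \<and> \<mu> \<psi> \<le> lam) \<and>
    (\<forall>x\<in>H2. (\<forall>\<psi>\<in>O'. cip x \<psi> = 0) \<longrightarrow> lam * (norm x)\<^sup>2 \<le> Re (cip (P x) x)) \<and> Ncount \<theta> h lam = card O'"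
proof -
  let ?G = "\<lambda>O'. finite O' \<and> ons O' \<and> O' \<subseteq> Ev lam"
  have "\<exists>O'. ?G O' \<and> (\<forall>O''. ?G O'' \<longrightarrow> card O'' \<le> card O')"
  proof (rule ex_has_greatest_nat)
    show "?G {}" by (simp add: ons_def)
    show "\<forall>O''. ?G O'' \<longrightarrow> card O'' < Suc b" using bound by (simp add: less_Suc_eq_le)
  qed
  then obtain O' where OM: "?G O' \<and> (\<forall>O''. ?G O'' \<longrightarrow> card O'' \<le> card O')" by (rule exE)
  note O = conjunct1[OF OM] and max' = conjunct2[OF OM]
  note max = max'[rule_format]
  have "\<forall>\<psi>\<in>O'. \<exists>m. \<psi> \<in> H2 \<and> P \<psi> = cs (of_real m) \<psi> \<and> m \<le> lam"
  proof
    fix \<psi> assume "\<psi> \<in> O'"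
    hence "\<psi> \<in> Ev lam" using O by auto
    thus "\<exists>m. \<psi> \<in> H2 \<and> P \<psi> = cs (of_real m) \<psi> \<and> m \<le> lam" unfolding Ev_def by auto
  qed
  from bchoice[OF this] obtain \<mu> where \<mu>': "\<forall>\<psi>\<in>O'. \<psi> \<in> H2 \<and> P \<psi> = cs (of_real (\<mu> \<psi>)) \<psi> \<and> \<mu> \<psi> \<le> lam"
    by (rule exE)
  note \<mu> = bspec[OF \<mu>']
  \<comment> \<open>A nonzero eigenvector orthogonal to \<open>O'\<close> could be normalised and
    added, against maximality.\<close>
  have zero: "x = 0" if x: "x \<in> Ev lam" "\<And>\<psi>. \<psi> \<in> O' \<Longrightarrow> cip x \<psi> = 0" for x
  proof (rule ccontr)
    assume x0: "x \<noteq> 0"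
    define y where "y = cs (of_real (1 / norm x)) x"
    obtain m where m: "x \<in> H2" "m \<le> lam" "P x = cs (of_real m) x" using x(1) by (auto simp: Ev_def)
    have "P y = cs (of_real m) y" unfolding y_def P_cs[OF m(1)] m(3) cs_cs by (simp only: mult.commute)
    hence yE: "y \<in> Ev lam" unfolding Ev_def using m(1,2) by (intro CollectI conjI exI[of _ m]) (simp_all add: y_def H2_cs)
    have "norm y = 1" using x0 by (simp add: y_def norm_divide)
    hence yy: "cip y y = 1" by (simp add: cip_self_norm)
    have yO: "cip y \<psi> = 0" "cip \<psi> y = 0" if "\<psi> \<in> O'" for \<psi>
    proof -
      show "cip y \<psi> = 0" by (simp add: y_def cip_cs_left x(2)[OF that])
      thus "cip \<psi> y = 0" by (metis cip_cnj complex_cnj_zero)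
    qed
    have nin: "y \<notin> O'" using yO(1)[of y] yy by auto
    have "ons (insert y O')" unfolding ons_def
    proof (intro ballI)
      fix a c assume a: "a \<in> insert y O'" and c: "c \<in> insert y O'"
      consider "a = y" "c = y" | "a = y" "c \<in> O'" | "a \<in> O'" "c = y" | "a \<in> O'" "c \<in> O'" using a c by auto
      thus "cip a c = (if a = c then 1 else 0)"
      proof cases
        case 1
        thus ?thesis by (simp add: yy)
      next
        case 2
        hence "a \<noteq> c" using nin by auto
        thus ?thesis using 2 by (simp add: yO)
      next
        case 3
        hence "a \<noteq> c" using nin by auto
        thus ?thesis using 3 by (simp add: yO)
      next
        case 4
        thus ?thesis using O unfolding ons_def by blast
      qed
    qed
    hence "card (insert y O') \<le> card O'" using O yE by (intro max) auto
    thus False using O nin by simp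
  qed
  have low: "lam * (norm x)\<^sup>2 \<le> Re (cip (P x) x)" if x: "x \<in> H2" "\<And>\<psi>. \<psi> \<in> O' \<Longrightarrow> cip x \<psi> = 0" for x
  proof (rule ccontr)
    assume "\<not> lam * (norm x)\<^sup>2 \<le> Re (cip (P x) x)"
    hence lt: "Re (cip (P x) x) < lam * (norm x)\<^sup>2" by simp
    have "\<exists>z\<in>H2. norm z = 1 \<and> (\<forall>\<psi>\<in>O'. cip z \<psi> = 0) \<and> (\<exists>m<lam. P z = cs (of_real m) z)"
      by (rule eigenvector_below[of O' \<mu>, OF _ _ _ x lt]) (use O \<mu> in simp_all)
    then obtain z m where z: "z \<in> H2" "norm z = 1" "\<forall>\<psi>\<in>O'. cip z \<psi> = 0" "m < lam" "P z = cs (of_real m) z"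
      by (elim bexE exE conjE)
    have "z \<in> Ev lam" unfolding Ev_def using z by (intro CollectI conjI exI[of _ m]) simp_all
    hence "z = 0" using z(3) by (intro zero) auto
    thus False using z(2) by simp
  qed
  \<comment> \<open>By symmetry \<open>x\<close> pairs nontrivially only with members of its own
    eigenvalue. Hence \<open>x - p\<close> is again an eigenvector for that value, orthogonal to
    \<open>O'\<close>, and so zero.\<close>
  have expand: "x = (\<Sum>\<psi>\<in>O'. cs (cip x \<psi>) \<psi>)" if x: "x \<in> Ev lam" for x
  proof -
    define p where "p = (\<Sum>\<psi>\<in>O'. cs (cip x \<psi>) \<psi>)"
    obtain m where m: "m \<le> lam" "P x = cs (of_real m) x" and xH: "x \<in> H2" using x by (auto simp: Ev_def)
    have pH: "p \<in> H2" unfolding p_def using \<mu> by (intro H2_sum H2_cs) auto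
    have each: "P (cs (cip x \<psi>) \<psi>) = cs (of_real m) (cs (cip x \<psi>) \<psi>)" if \<psi>: "\<psi> \<in> O'" for \<psi>
    proof (cases "cip x \<psi> = 0")
      case True
      thus ?thesis using P_cs[of 0 0] by (simp add: H2_def)
    next
      case False
      have "of_real m * cip x \<psi> = cip (P x) \<psi>" by (simp add: m cip_cs_left)
      also have "\<dots> = cip x (P \<psi>)" by (rule P_symmetric[OF xH]) (use \<mu>[OF \<psi>] in simp)
      also have "\<dots> = of_real (\<mu> \<psi>) * cip x \<psi>" using \<mu>[OF \<psi>] by (simp add: cip_cs_right)
      finally have "m = \<mu> \<psi>" using False by simp
      thus ?thesis using \<mu>[OF \<psi>] by (simp add: P_cs mult.commute)
    qed
    have "P p = cs (of_real m) p" unfolding p_def cs_sum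
    proof (use O \<mu> each in \<open>induction O' rule: infinite_finite_induct\<close>)
      case (insert \<psi> F)
      have "(\<Sum>\<psi>\<in>F. cs (cip x \<psi>) \<psi>) \<in> H2" using insert.prems(2) by (intro H2_sum H2_cs) auto
      moreover have "ons F" "F \<subseteq> Ev lam" using insert.prems(1) by (auto simp: ons_def)
      ultimately show ?case using insert by (simp add: P_linear(1) H2_cs)
    qed (use P_cs[of 0 0] in \<open>simp_all add: H2_def\<close>)
    hence "P (x - p) = cs (of_real m) (x - p)" by (simp add: P_linear(2)[OF xH pH] m(2) cs_diff)
    hence "x - p \<in> Ev lam" unfolding Ev_def using m(1) H2_diff[OF xH pH] by (intro CollectI conjI exI[of _ m])
    moreover have "cip (x - p) \<psi> = 0" if "\<psi> \<in> O'" for \<psi>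
      unfolding p_def using O by (intro ons_projection that) auto
    ultimately have "x - p = 0" by (rule zero)
    thus ?thesis by (simp add: p_def)
  qed
  have "Ncount \<theta> h lam = card O'"
    unfolding Ncount_def eigvecs_le_Ev by (rule dim_ons_span) (use O expand in auto)
  moreover have "\<forall>x\<in>H2. (\<forall>\<psi>\<in>O'. cip x \<psi> = 0) \<longrightarrow> lam * (norm x)\<^sup>2 \<le> Re (cip (P x) x)" using low by simp
  ultimately show ?thesis using O \<mu>' by (intro exI[of _ O'] exI[of _ \<mu>] conjI) simp_all
qed

text \<open>A Tauberian step by difference quotients. The family of eigenvectors up to
  \<open>lam\<close> is tested in the upper bound at \<open>(1 + a) * lam\<close>, where its sum is
  the Riesz mean at \<open>lam\<close> plus \<open>n * (a * lam)\<close>. The signs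
  \<open>a = d\<close> and \<open>a = - d\<close> bound \<open>n\<close> from above and below, with
  no knowledge of the spectrum between the levels.\<close>

lemma counting_bounds:
  assumes d: "0 < d" "d \<le> 1/2"
  shows "\<exists>l0\<ge>1. \<forall>lam\<ge>l0. \<bar>real (Ncount \<theta> h lam) - pi\<^sup>2 / 2 * (norm v)\<^sup>2 * lam\<^sup>2\<bar> \<le> (2 * pi\<^sup>2 / 3 + 9) * d * ((norm v)\<^sup>2 * lam\<^sup>2)"
proof -
  \<comment> \<open>The Riesz means are needed with accuracy \<open>d\<^sup>2\<close>: dividing by
    the increment \<open>d\<close> leaves an error of order \<open>d\<close>.\<close>
  have d2: "d\<^sup>2 > 0" using d by simp
  from upper_riesz[OF d2] obtain l1 where l1: "l1 \<ge> 1" "\<forall>lam\<ge>l1. \<forall>O'. finite O' \<longrightarrow> ons O' \<longrightarrow> O' \<subseteq> H2 \<longrightarrow>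
    (\<Sum>\<psi>\<in>O'. lam - Re (cip (P \<psi>) \<psi>)) \<le> (pi\<^sup>2 / 6 + d\<^sup>2) * (norm v)\<^sup>2 * lam ^ 3" by (elim exE conjE)
  from lower_riesz[OF d2] obtain l2 where l2: "l2 \<ge> 1" "\<forall>lam\<ge>l2. \<forall>O' \<mu>. finite O' \<longrightarrow> ons O' \<longrightarrow>
    (\<forall>\<psi>\<in>O'. \<psi> \<in> H2 \<and> P \<psi> = cs (of_real (\<mu> \<psi>)) \<psi> \<and> \<mu> \<psi> \<le> lam) \<longrightarrow>
    (\<forall>x\<in>H2. (\<forall>\<psi>\<in>O'. cip x \<psi> = 0) \<longrightarrow> lam * (norm x)\<^sup>2 \<le> Re (cip (P x) x)) \<longrightarrow>
    (pi\<^sup>2 / 6 - d\<^sup>2) * (norm v)\<^sup>2 * lam ^ 3 \<le> (\<Sum>\<psi>\<in>O'. lam - \<mu> \<psi>)" by (elim exE conjE)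
  note upper = l1(2)[THEN spec, THEN mp, THEN spec, THEN mp, THEN mp, THEN mp]
  note lower = l2(2)[THEN spec, THEN mp, THEN spec, THEN spec, THEN mp, THEN mp, THEN mp, THEN mp]
  have "\<bar>real (Ncount \<theta> h lam) - pi\<^sup>2 / 2 * (norm v)\<^sup>2 * lam\<^sup>2\<bar> \<le> (2 * pi\<^sup>2 / 3 + 9) * d * ((norm v)\<^sup>2 * lam\<^sup>2)"
    if lam: "lam \<ge> 2 * l1 + l2" for lam
  proof -
    have lamb: "lam \<ge> 1" "lam \<ge> l2" "lam \<ge> l1" "(1 - d) * lam \<ge> l1" "(1 + d) * lam \<ge> l1"
    proof -
      show "lam \<ge> 1" "lam \<ge> l2" "lam \<ge> l1" using lam l1(1) l2(1) by linarith+
      have "1/2 * (2 * l1) \<le> (1 - d) * lam" using lam l1(1) l2(1) d by (intro mult_mono) auto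
      thus "(1 - d) * lam \<ge> l1" by simp
      have "1 * l1 \<le> (1 + d) * lam" using lam l1(1) l2(1) d by (intro mult_mono) auto
      thus "(1 + d) * lam \<ge> l1" by simp
    qed
    have eig: "Re (cip (P \<psi>) \<psi>) = m" if "P \<psi> = cs (of_real m) \<psi>" "norm \<psi> = 1" for \<psi> m
      unfolding that(1) cip_cs_left cip_self_norm by (simp add: that(2))
    \<comment> \<open>Finiteness of the count: at the level \<open>(1 + d) * lam\<close> every
      eigenvector up to \<open>lam\<close> contributes at least \<open>d * lam\<close> to a sum that
      is already bounded.\<close>
    have card_bound: "card O' \<le> nat \<lfloor>(pi\<^sup>2 / 6 + d\<^sup>2) * (norm v)\<^sup>2 * ((1 + d) * lam) ^ 3 / (d * lam)\<rfloor>"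
      if O: "finite O'" "ons O'" "O' \<subseteq> Ev lam" for O'
    proof -
      have "real (card O') * (d * lam) = (\<Sum>\<psi>\<in>O'. d * lam)" by simp
      also have "\<dots> \<le> (\<Sum>\<psi>\<in>O'. (1 + d) * lam - Re (cip (P \<psi>) \<psi>))"
      proof (rule sum_mono)
        fix \<psi> assume \<psi>: "\<psi> \<in> O'"
        then obtain m where m: "m \<le> lam" "P \<psi> = cs (of_real m) \<psi>" using O(3) unfolding Ev_def by auto
        have "Re (cip (P \<psi>) \<psi>) = m" by (rule eig[OF m(2) ons_norm[OF O(2) \<psi>]])
        thus "d * lam \<le> (1 + d) * lam - Re (cip (P \<psi>) \<psi>)"
          using m(1) unfolding distrib_right by linarith
      qed
      also have "\<dots> \<le> (pi\<^sup>2 / 6 + d\<^sup>2) * (norm v)\<^sup>2 * ((1 + d) * lam) ^ 3"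
        by (rule upper[OF lamb(5) O(1,2)]) (use O(3) in \<open>auto simp: Ev_def\<close>)
      finally have "real (card O') \<le> (pi\<^sup>2 / 6 + d\<^sup>2) * (norm v)\<^sup>2 * ((1 + d) * lam) ^ 3 / (d * lam)"
        using d lamb(1) by (simp add: le_divide_eq)
      thus ?thesis by (rule le_nat_floor)
    qed
    have "\<exists>O' \<mu>. finite O' \<and> ons O' \<and> (\<forall>\<psi>\<in>O'. \<psi> \<in> H2 \<and> P \<psi> = cs (of_real (\<mu> \<psi>)) \<psi> \<and> \<mu> \<psi> \<le> lam) \<and>
      (\<forall>x\<in>H2. (\<forall>\<psi>\<in>O'. cip x \<psi> = 0) \<longrightarrow> lam * (norm x)\<^sup>2 \<le> Re (cip (P x) x)) \<and> Ncount \<theta> h lam = card O'"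
      by (rule eigenbasis, rule card_bound)
    then obtain O' \<mu> where O: "finite O'" "ons O'"
      and ev: "\<forall>\<psi>\<in>O'. \<psi> \<in> H2 \<and> P \<psi> = cs (of_real (\<mu> \<psi>)) \<psi> \<and> \<mu> \<psi> \<le> lam"
      and low: "\<forall>x\<in>H2. (\<forall>\<psi>\<in>O'. cip x \<psi> = 0) \<longrightarrow> lam * (norm x)\<^sup>2 \<le> Re (cip (P x) x)"
      and N: "Ncount \<theta> h lam = card O'" by (elim exE conjE)
    define n where "n = real (card O')"
    define c where "c = (norm v)\<^sup>2 * lam\<^sup>2"
    define S where "S = (\<Sum>\<psi>\<in>O'. lam - \<mu> \<psi>)"
    have c0: "c \<ge> 0" by (simp add: c_def)
    have shift: "(\<Sum>\<psi>\<in>O'. (lam + a) - Re (cip (P \<psi>) \<psi>)) = S + n * a" for a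
    proof -
      have "(\<Sum>\<psi>\<in>O'. (lam + a) - Re (cip (P \<psi>) \<psi>)) = (\<Sum>\<psi>\<in>O'. (lam - \<mu> \<psi>) + a)"
      proof (rule sum.cong[OF refl])
        fix \<psi> assume \<psi>: "\<psi> \<in> O'"
        have "Re (cip (P \<psi>) \<psi>) = \<mu> \<psi>"
          by (rule eig[OF _ ons_norm[OF O(2) \<psi>]]) (use bspec[OF ev \<psi>] in blast)
        thus "(lam + a) - Re (cip (P \<psi>) \<psi>) = (lam - \<mu> \<psi>) + a" by simp
      qed
      thus ?thesis by (simp add: sum.distrib S_def n_def)
    qed
    have Slow: "(pi\<^sup>2 / 6 - d\<^sup>2) * c * lam \<le> S"
      using lower[OF lamb(2) O ev low] unfolding S_def c_def by (simp add: power2_eq_square power3_eq_cube mult_ac)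
    have up: "S + n * (a * lam) \<le> (pi\<^sup>2 / 6 + d\<^sup>2) * (1 + a) ^ 3 * c * lam" if a: "(1 + a) * lam \<ge> l1" for a
    proof -
      have "S + n * (a * lam) = (\<Sum>\<psi>\<in>O'. (1 + a) * lam - Re (cip (P \<psi>) \<psi>))"
        using shift[of "a * lam"] by (simp add: distrib_right)
      also have "\<dots> \<le> (pi\<^sup>2 / 6 + d\<^sup>2) * (norm v)\<^sup>2 * ((1 + a) * lam) ^ 3"
        by (rule upper[OF a O]) (use ev in auto)
      also have "\<dots> = (pi\<^sup>2 / 6 + d\<^sup>2) * (1 + a) ^ 3 * c * lam"
        by (simp add: c_def power_mult_distrib) (simp add: power2_eq_square power3_eq_cube mult_ac)
      finally show ?thesis .
    qed
    have est: "n * a \<le> ((pi\<^sup>2 / 6 + d\<^sup>2) * (1 + a) ^ 3 - (pi\<^sup>2 / 6 - d\<^sup>2)) * c" if a: "(1 + a) * lam \<ge> l1" for a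
    proof -
      have "n * a * lam \<le> ((pi\<^sup>2 / 6 + d\<^sup>2) * (1 + a) ^ 3 - (pi\<^sup>2 / 6 - d\<^sup>2)) * c * lam"
        using up[OF a] Slow by (simp add: left_diff_distrib mult.assoc)
      thus ?thesis using lamb(1) by simp
    qed
    have pi0: "0 \<le> pi\<^sup>2" by simp
    have d1: "d\<^sup>2 = d * d" "d * d \<le> 1/2 * d" "0 \<le> d * d" "d ^ 3 = d * (d * d)" using d by (auto simp: power2_eq_square power3_eq_cube)
    have "n * d \<le> (pi\<^sup>2 / 2 + (2 * pi\<^sup>2 / 3 + 9) * d) * d * c"
    proof -
      have "n * d \<le> ((pi\<^sup>2 / 6 + d\<^sup>2) * (1 + d) ^ 3 - (pi\<^sup>2 / 6 - d\<^sup>2)) * c" by (rule est[OF lamb(5)])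
      also have "\<dots> \<le> (pi\<^sup>2 / 2 + (2 * pi\<^sup>2 / 3 + 9) * d) * d * c"
      proof (rule mult_right_mono[OF _ c0])
        \<comment> \<open>The derivative of the cube gives \<open>pi\<^sup>2 / 2\<close>. For the
          second order term, \<open>3 + d \<le> 4\<close> accounts for
          \<open>2 * pi\<^sup>2 / 3\<close>, and \<open>1 + (1 + d)^3 \<le> 9\<close> for the
          rest.\<close>
        have "(pi\<^sup>2 / 6 + d\<^sup>2) * (1 + d) ^ 3 - (pi\<^sup>2 / 6 - d\<^sup>2) = (pi\<^sup>2 / 2 + (pi\<^sup>2 / 6 * (3 + d) + 1 + (1 + d) ^ 3) * d) * d"
          by (simp add: power2_eq_square power3_eq_cube field_simps)
        also have "\<dots> \<le> (pi\<^sup>2 / 2 + (2 * pi\<^sup>2 / 3 + 9) * d) * d"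
        proof (intro mult_right_mono add_left_mono)
          have "pi\<^sup>2 / 6 * (3 + d) \<le> pi\<^sup>2 / 6 * 4" using d by (intro mult_left_mono) auto
          moreover have "(1 + d) ^ 3 \<le> 2 ^ 3" using d by (intro power_mono) auto
          ultimately have "pi\<^sup>2 / 6 * (3 + d) + 1 + (1 + d) ^ 3 \<le> pi\<^sup>2 / 6 * 4 + 1 + 2 ^ 3" by (intro add_mono) auto
          thus "pi\<^sup>2 / 6 * (3 + d) + 1 + (1 + d) ^ 3 \<le> 2 * pi\<^sup>2 / 3 + 9" by simp
        qed (use d in auto)
        finally show "(pi\<^sup>2 / 6 + d\<^sup>2) * (1 + d) ^ 3 - (pi\<^sup>2 / 6 - d\<^sup>2) \<le> (pi\<^sup>2 / 2 + (2 * pi\<^sup>2 / 3 + 9) * d) * d" .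
      qed
      finally show ?thesis .
    qed
    hence "n * d \<le> ((pi\<^sup>2 / 2 + (2 * pi\<^sup>2 / 3 + 9) * d) * c) * d" by (simp add: mult_ac)
    hence upper: "n \<le> (pi\<^sup>2 / 2 + (2 * pi\<^sup>2 / 3 + 9) * d) * c" using d by simp
    have "((pi\<^sup>2 / 2 - (2 * pi\<^sup>2 / 3 + 9) * d) * c) * d \<le> n * d"
    proof -
      have "n * (- d) \<le> ((pi\<^sup>2 / 6 + d\<^sup>2) * (1 + - d) ^ 3 - (pi\<^sup>2 / 6 - d\<^sup>2)) * c"
        by (rule est) (use lamb(4) in simp)
      also have "\<dots> \<le> (- ((pi\<^sup>2 / 2 - (2 * pi\<^sup>2 / 3 + 9) * d) * d)) * c"
      proof (rule mult_right_mono[OF _ c0])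
        have "(pi\<^sup>2 / 6 + d\<^sup>2) * (1 + - d) ^ 3 - (pi\<^sup>2 / 6 - d\<^sup>2) = - ((pi\<^sup>2 / 2 - (pi\<^sup>2 / 6 * (3 - d) + 1 + (1 - d) ^ 3) * d) * d)"
          by (simp add: power2_eq_square power3_eq_cube field_simps)
        also have "\<dots> \<le> - ((pi\<^sup>2 / 2 - (2 * pi\<^sup>2 / 3 + 9) * d) * d)"
        proof (intro le_imp_neg_le mult_right_mono diff_left_mono)
          have "pi\<^sup>2 / 6 * (3 - d) \<le> pi\<^sup>2 / 6 * 4" using d by (intro mult_left_mono) auto
          moreover have "(1 - d) ^ 3 \<le> 1 ^ 3" using d by (intro power_mono) auto
          ultimately have "pi\<^sup>2 / 6 * (3 - d) + 1 + (1 - d) ^ 3 \<le> pi\<^sup>2 / 6 * 4 + 1 + 1 ^ 3" by (intro add_mono) auto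
          thus "pi\<^sup>2 / 6 * (3 - d) + 1 + (1 - d) ^ 3 \<le> 2 * pi\<^sup>2 / 3 + 9" by simp
        qed (use d in auto)
        finally show "(pi\<^sup>2 / 6 + d\<^sup>2) * (1 + - d) ^ 3 - (pi\<^sup>2 / 6 - d\<^sup>2) \<le> - ((pi\<^sup>2 / 2 - (2 * pi\<^sup>2 / 3 + 9) * d) * d)" .
      qed
      finally show ?thesis by (simp add: mult_ac)
    qed
    hence lower: "(pi\<^sup>2 / 2 - (2 * pi\<^sup>2 / 3 + 9) * d) * c \<le> n" using d by simp
    have "\<bar>n - pi\<^sup>2 / 2 * c\<bar> \<le> (2 * pi\<^sup>2 / 3 + 9) * d * c"
      using upper lower unfolding abs_le_iff by (simp add: left_diff_distrib distrib_right)
    thus ?thesis unfolding n_def c_def N by (simp only: mult.assoc)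
  qed
  thus ?thesis using l1(1) l2(1) by (intro exI[of _ "2 * l1 + l2"]) auto
qed

lemma counting_asymptotics:
  "((\<lambda>lam. real (Ncount \<theta> h lam) / (pi\<^sup>2 / 2 * lam\<^sup>2 * (norm v)\<^sup>2)) \<longlongrightarrow> 1) at_top"
proof (rule tendstoI)
  fix \<epsilon> :: real assume \<epsilon>: "\<epsilon> > 0"
  define K where "K = 2 * pi\<^sup>2 / 3 + 9"
  have K: "K > 0" unfolding K_def by (intro add_nonneg_pos) auto
  define d where "d = min (1/2) (\<epsilon> * (pi\<^sup>2 / 2) / (2 * K))"
  have d: "0 < d" "d \<le> 1/2" using \<epsilon> K by (auto simp: d_def)
  have "d \<le> \<epsilon> * (pi\<^sup>2 / 2) / (2 * K)" by (simp add: d_def)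
  hence Kd: "K * d \<le> \<epsilon> * (pi\<^sup>2 / 2) / 2" using K by (simp add: field_simps)
  obtain l0 where l0: "l0 \<ge> 1" "\<And>lam. lam \<ge> l0 \<Longrightarrow> \<bar>real (Ncount \<theta> h lam) - pi\<^sup>2 / 2 * (norm v)\<^sup>2 * lam\<^sup>2\<bar> \<le> K * d * ((norm v)\<^sup>2 * lam\<^sup>2)"
    using counting_bounds[OF d] unfolding K_def by blast
  show "eventually (\<lambda>lam. dist (real (Ncount \<theta> h lam) / (pi\<^sup>2 / 2 * lam\<^sup>2 * (norm v)\<^sup>2)) 1 < \<epsilon>) at_top"
    unfolding eventually_at_top_linorder
  proof (intro exI[of _ l0] allI impI)
    fix lam assume lam: "lam \<ge> l0"
    define g where "g = pi\<^sup>2 / 2 * lam\<^sup>2 * (norm v)\<^sup>2"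
    have c: "(norm v)\<^sup>2 * lam\<^sup>2 > 0" using v_pos lam l0(1) by simp
    have geq: "g = pi\<^sup>2 / 2 * ((norm v)\<^sup>2 * lam\<^sup>2)" by (simp add: g_def)
    have g: "g > 0" unfolding geq using c by (intro mult_pos_pos) auto
    have "dist (real (Ncount \<theta> h lam) / g) 1 = \<bar>real (Ncount \<theta> h lam) - g\<bar> / g"
      using g by (simp add: dist_real_def diff_divide_distrib[symmetric] field_simps abs_divide)
    also have "\<dots> \<le> K * d * ((norm v)\<^sup>2 * lam\<^sup>2) / g"
      using l0(2)[OF lam] g by (intro divide_right_mono) (simp_all add: g_def mult_ac)
    also have "\<dots> \<le> \<epsilon> * (pi\<^sup>2 / 2) / 2 * ((norm v)\<^sup>2 * lam\<^sup>2) / g"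
      using Kd c g by (intro divide_right_mono mult_right_mono) auto
    also have "\<dots> = \<epsilon> / 2"
    proof -
      have "\<epsilon> * (pi\<^sup>2 / 2) / 2 * ((norm v)\<^sup>2 * lam\<^sup>2) = \<epsilon> / 2 * g" by (simp add: geq)
      thus ?thesis using g by (simp only:) simp
    qed
    also have "\<dots> < \<epsilon>" using \<epsilon> by simp
    finally show "dist (real (Ncount \<theta> h lam) / (pi\<^sup>2 / 2 * lam\<^sup>2 * (norm v)\<^sup>2)) 1 < \<epsilon>" unfolding g_def .
  qed
qed

end

theorem theorem4p1:
  fixes \<theta> :: "nat \<Rightarrow> nat \<Rightarrow> real" and h :: "(nat \<Rightarrow> int) \<Rightarrow> complex"
  assumes "skew4 \<theta>"
    and "h \<in> smooth"
    and "tstar \<theta> h = h"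
  shows "(\<lambda>lam. complex_of_real (real (Ncount \<theta> h lam))) \<sim>[at_top]
         (\<lambda>lam. complex_of_real (pi\<^sup>2 / 2 * lam\<^sup>2) * phi0 (texp \<theta> (\<lambda>m. - 2 * h m)))"
proof -
  interpret nct \<theta> h by standard (use assms in auto)
  have "((\<lambda>lam. complex_of_real (real (Ncount \<theta> h lam) / (pi\<^sup>2 / 2 * lam\<^sup>2 * (norm v)\<^sup>2))) \<longlongrightarrow> of_real 1) at_top"
    by (rule tendsto_of_real[OF counting_asymptotics])
  thus ?thesis
    unfolding norm_v by (intro asymp_equivI') simp
qed

end
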